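(* Let $0\le r\le n$ be integers. The set $$\{1\}\ \sqcup\ \bigsqcup_{F \text{ proper flat of } U_{r,n}} \mathcal B^{F}_{U_{r,n}}\ \sqcup\ \mathcal B^{\mathrm{IN}}_{U_{r,n}}$$ is a basis (over $\mathbb Q$) of the augmented singular cohomology ring $H_\bullet(K(\mathbb Q[\Sigma_{U_{r,n}}]))\cong H^\bullet(X_{\Sigma_{U_{r,n}}})$ of the uniform matroid $U_{r,n}$.
   Context: **Matroid.** $U_{r,n}$ is the uniform matroid of rank $r$ on $[n]=\{1,\dots,n\}$. Its bases are the $r$-subsets of $[n]$ (the set of bases is $\mathcal B(U_{r,n})$), its independent sets are the subsets of size $\le r$, its proper flats are the subsets $F\subseteq[n]$ with $|F|\le r-1$ (of rank $|F|$), and its hyperplanes (corank-1 flats) are the subsets of size $r-1$. **Augmented Bergman fan.** Let $N=\mathbb Z^n$ with basis $e_1,\dots,e_n$, and let $\ell_1,\dots,\ell_n$ be the dual basis of $N^\vee$. Write $e_S=\sum_{i\in S}e_i$. For a (possibly empty) flag (chain) $\mathcal F$ of proper flats and an independent set $I$ with $I\subseteq F$ for all $F\in\mathcal F$ (written $I\le\mathcal F$), put $\sigma_{I\le\mathcal F}=\operatorname{cone}(e_i)_{i\in I}+\operatorname{cone}(-e_{[n]\setminus F})_{F\in\mathcal F}$. The augmented Bergman fan $\Sigma_{U_{r,n}}$ is the unimodular fan in $N_{\mathbb R}=\mathbb R^n$ whose cones are all the $\sigma_{I\le\mathcal F}$ (a single point if $n=0$). $X_\Sigma$ denotes the smooth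 complex toric variety of a unimodular fan $\Sigma$. **Koszul homology.** For a unimodular fan $\Sigma$ in $N_{\mathbb R}$, with primitive ray generators $u_\rho$, the Stanley–Reisner ring is $\mathbb Q[\Sigma]=\mathbb Q[x_\rho:\rho\text{ a ray of }\Sigma]/(x_{\rho_1}\cdots x_{\rho_s}:\operatorname{cone}(\rho_1,\dots,\rho_s)\notin\Sigma)$. The Koszul complex is $K_i(\mathbb Q[\Sigma])_j=\mathbb Q[\Sigma]_{j-i}\otimes\bigwedge^iN^\vee_{\mathbb Q}$, with product $(x\otimes\xi)(y\otimes\zeta)=xy\otimes\xi\wedge\zeta$ and differential the graded derivation with $d(x)=0$ for $x\in\mathbb Q[\Sigma]$ and $d(m)=\sum_\rho\langle m,u_\rho\rangle x_\rho$ for $m\in N^\vee$. Its homology is isomorphic as a ring to $H^\bullet(X_\Sigma)$ (rational coefficients). For $\Sigma_{U_{r,n}}$, the variable of the ray $\operatorname{cone}(e_i)$ is denoted $y_i$ and the variable of the ray $\operatorname{cone}(-e_{[n]\setminus F})$ is denoted $x_F$. A set of elements of the Koszul complex is called a basis of the homology if its elements are cycles whose classes form a basis. **The sets $\mathcal B^F_{U_{r,n}}$.** Fix a proper flat $F$. The lattice of flats of the contraction $U_{r,n}/F$ is identified with the interval $[F,[n]]$ of the lattice of flats of $U_{r,n}$. Consider flags of proper flats $\mathcal F=\{F=F_0\subsetneq F_1\subsetneq\cdots\subsetneq F_s\}$, $s\ge0$, always containing $F$, and put $F_{s+1}=[n]$. ($F_k$ covers $F_{k-1}$ iff $|F_k\setminus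 F_{k-1}|=1$; a singleton is identified with its element.) - $\mathcal F$ is *retral* (in $U_{r,n}/F$) if for every $1\le k\le s$ such that $F_k$ covers $F_{k-1}$, one has $F_k\setminus F_{k-1}=\max(F_{k+1}\setminus F_{k-1})$. - $\mathcal F$ is *weakly retral* if $F_s$ is a hyperplane and for every $1\le k<s$ such that $F_k$ covers $F_{k-1}$, one has $F_k\setminus F_{k-1}=\max(F_{k+1}\setminus F_{k-1})$. - An *admissible wedge* to a weakly retral $\mathcal F$ is an element $\xi=(\ell_{u_1}-\ell_{v_1})\wedge\cdots\wedge(\ell_{u_i}-\ell_{v_i})$, $i\ge1$, where $\{u_1<\dots<u_i\}\subseteq[n]\setminus F_s$, each $v_k$ is the successor of $u_k$ in the ordered set $[n]\setminus F_s$, and, if $s\geq 1$ and $F_s$ covers $F_{s-1}$, then $u_1<F_s\setminus F_{s-1}$. Write $x_{\mathcal F}=\prod_{k=1}^sx_{F_k}$. The retral basis for $H^\bullet$ of the toric variety of the (non-augmented) Bergman fan of $U_{r,n}/F$ is the set of all $x_{\mathcal F}\,(=x_{\mathcal F}\otimes1)$ with $\mathcal F$ retral, together with all $x_{\mathcal F}\otimes\xi$ with $\mathcal F$ weakly retral and $\xi$ admissible to $\mathcal F$. Then $\mathcal B^F_{U_{r,n}}=\{x_F\cdot x_{\mathcal F}\otimes\xi: x_{\mathcal F}\otimes\xi\text{ in this retral basis}\}$, regarded in $K(\mathbb Q[\Sigma_{U_{r,n}}])$. **The set $\mathcal B^{\mathrm{IN}}_{U_{r,n}}$.** For $J=\{j_1<\dots<j_m\}\subseteq[n]$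 put $\ell_J=\ell_{j_1}\wedge\cdots\wedge\ell_{j_m}$. Then $\mathcal B^{\mathrm{IN}}_{U_{r,n}}=\{\prod_{j\in B}y_j\otimes\ell_J: B\in\mathcal B(U_{r,n}),\ J\subseteq[n],\ J\ne\varnothing,\ J\cap B=\varnothing,\ \min J<\min B\}$, where the condition $\min J<\min B$ is considered always satisfied if $r=0$. *)

theory Defs
  imports Complex_Main "HOL-Library.Poly_Mapping"
begin

section \<open>Cones and fans in \<open>N\<^sub>\<real> = \<real>\<^sup>n\<close>\<close>

text \<open>
  The dimension \<open>n\<close> is a term, so vectors are functions on \<open>nat\<close> that vanish outside
  \<open>[n] = {1..n}\<close>. A fan is the set of its cones.
\<close>

definition int_lattice :: "nat \<Rightarrow> (nat \<Rightarrow> int) set" where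
  "int_lattice n = {u. \<forall>i. i \<notin> {1..n} \<longrightarrow> u i = 0}"

definition rvec :: "(nat \<Rightarrow> int) \<Rightarrow> nat \<Rightarrow> real" where
  "rvec u = (\<lambda>i. real_of_int (u i))"

definition cone_hull :: "(nat \<Rightarrow> real) set \<Rightarrow> (nat \<Rightarrow> real) set" where
  "cone_hull V = {\<lambda>i. \<Sum>v\<in>T. c v * v i | T c. finite T \<and> T \<subseteq> V \<and> (\<forall>v\<in>T. 0 \<le> c v)}"

definition minkowski_sum :: "(nat \<Rightarrow> real) set \<Rightarrow> (nat \<Rightarrow> real) set \<Rightarrow> (nat \<Rightarrow> real) set" where
  "minkowski_sum A B = {\<lambda>i. a i + b i | a b. a \<in> A \<and> b \<in> B}"

definition fan_rays :: "nat \<Rightarrow> (nat \<Rightarrow> real) set set \<Rightarrow> (nat \<Rightarrow> real) set set" where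
  "fan_rays n \<Sigma> = {\<rho> \<in> \<Sigma>. \<exists>u \<in> int_lattice n. u \<noteq> (\<lambda>_. 0) \<and> \<rho> = cone_hull {rvec u}}"

text \<open>The primitive generator of a ray is the unique generator of the monoid \<open>\<rho> \<inter> N\<close>.\<close>

definition prim_gen :: "nat \<Rightarrow> (nat \<Rightarrow> real) set \<Rightarrow> nat \<Rightarrow> int" where
  "prim_gen n \<rho> = (THE u. u \<in> int_lattice n \<and>
     {w \<in> int_lattice n. rvec w \<in> \<rho>} = {\<lambda>i. int k * u i | k. True})"


section \<open>The Stanley--Reisner ring of a fan\<close>

text \<open>
  Polynomials over \<open>\<rat>\<close> whose variables are cones; \<open>poly_ring R\<close> is the subring of polynomials
  in the variables \<open>x\<^sub>\<rho>\<close>, \<open>\<rho> \<in> R\<close>. The ring \<open>\<rat>[\<Sigma>]\<close> is \<open>poly_ring (fan_rays n \<Sigma>)\<close> modulo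
  \<open>sr_ideal n \<Sigma>\<close>.
\<close>

type_synonym ray_poly = "((nat \<Rightarrow> real) set \<Rightarrow>\<^sub>0 nat) \<Rightarrow>\<^sub>0 rat"

definition ray_var :: "(nat \<Rightarrow> real) set \<Rightarrow> ray_poly" where
  "ray_var \<rho> = Poly_Mapping.single (Poly_Mapping.single \<rho> 1) 1"

definition const_poly :: "rat \<Rightarrow> ray_poly" where
  "const_poly c = Poly_Mapping.single 0 c"

definition poly_ring :: "(nat \<Rightarrow> real) set set \<Rightarrow> ray_poly set" where
  "poly_ring R = {p. \<forall>m \<in> Poly_Mapping.keys p. Poly_Mapping.keys m \<subseteq> R}"

definition sr_gens :: "nat \<Rightarrow> (nat \<Rightarrow> real) set set \<Rightarrow> ray_poly set" where
  "sr_gens n \<Sigma> = {\<Prod>\<rho>\<in>A. ray_var \<rho> | A.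
     finite A \<and> A \<subseteq> fan_rays n \<Sigma> \<and> cone_hull (\<Union>A) \<notin> \<Sigma>}"

definition sr_ideal :: "nat \<Rightarrow> (nat \<Rightarrow> real) set set \<Rightarrow> ray_poly set" where
  "sr_ideal n \<Sigma> = {\<Sum>g\<in>G. q g * g | G q.
     finite G \<and> G \<subseteq> sr_gens n \<Sigma> \<and> (\<forall>g\<in>G. q g \<in> poly_ring (fan_rays n \<Sigma>))}"


section \<open>The Koszul complex\<close>

text \<open>
  The exterior algebra of \<open>N\<^sup>\<or>\<close> has the basis \<open>\<ell>\<^sub>J\<close>, \<open>J \<subseteq> [n]\<close>. An element
  \<open>\<Sum>\<^sub>J p\<^sub>J \<otimes> \<ell>\<^sub>J\<close> with polynomial coefficients is the function \<open>J \<mapsto> p\<^sub>J\<close>. Elements of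
  \<open>K(\<rat>[\<Sigma>]) = \<rat>[\<Sigma>] \<otimes> \<And>N\<^sup>\<or>\<close> are represented by elements of \<open>koszul_lift n \<Sigma>\<close>; two of them
  represent the same element iff their difference is in \<open>koszul_null n \<Sigma>\<close>, that is, iff all
  their coefficients agree modulo \<open>sr_ideal n \<Sigma>\<close>.
\<close>

type_synonym koszul = "nat set \<Rightarrow> ray_poly"

definition koszul_lift :: "nat \<Rightarrow> (nat \<Rightarrow> real) set set \<Rightarrow> koszul set" where
  "koszul_lift n \<Sigma> = {\<kappa>. (\<forall>J. \<kappa> J \<in> poly_ring (fan_rays n \<Sigma>)) \<and> (\<forall>J. \<not> J \<subseteq> {1..n} \<longrightarrow> \<kappa> J = 0)}"

definition koszul_null :: "nat \<Rightarrow> (nat \<Rightarrow> real) set set \<Rightarrow> koszul set" where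
  "koszul_null n \<Sigma> = {\<kappa> \<in> koszul_lift n \<Sigma>. \<forall>J. \<kappa> J \<in> sr_ideal n \<Sigma>}"

definition tensor :: "ray_poly \<Rightarrow> koszul \<Rightarrow> koszul" where
  "tensor p \<xi> = (\<lambda>J. p * \<xi> J)"

definition koszul_one :: koszul where
  "koszul_one = (\<lambda>J. if J = {} then 1 else 0)"

definition ell :: "nat \<Rightarrow> koszul" where
  "ell j = (\<lambda>J. if J = {j} then 1 else 0)"

text \<open>For disjoint finite \<open>A\<close>, \<open>B\<close> one has \<open>\<ell>\<^sub>A \<and> \<ell>\<^sub>B = wedge_sign A B \<cdot> \<ell>\<^bsub>A \<union> B\<^esub>\<close>.\<close>

definition wedge_sign :: "nat set \<Rightarrow> nat set \<Rightarrow> ray_poly" where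
  "wedge_sign A B = (- 1) ^ card {(a, b). a \<in> A \<and> b \<in> B \<and> b < a}"

definition koszul_mult :: "koszul \<Rightarrow> koszul \<Rightarrow> koszul" where
  "koszul_mult \<kappa> \<eta> = (\<lambda>J. \<Sum>A\<in>Pow J. wedge_sign A (J - A) * (\<kappa> A * \<eta> (J - A)))"

lemma koszul_mult_tensor:
  "koszul_mult (tensor p \<xi>) (tensor q \<zeta>) = tensor (p * q) (koszul_mult \<xi> \<zeta>)"
  by (simp add: koszul_mult_def tensor_def sum_distrib_left algebra_simps)

definition wedge_list :: "koszul list \<Rightarrow> koszul" where
  "wedge_list ms = foldr koszul_mult ms koszul_one"

definition ell_set :: "nat set \<Rightarrow> koszul" where
  "ell_set J = wedge_list (map ell (sorted_list_of_set J))"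

definition koszul_theta :: "nat \<Rightarrow> (nat \<Rightarrow> real) set set \<Rightarrow> nat \<Rightarrow> ray_poly" where
  "koszul_theta n \<Sigma> j = (\<Sum>\<rho>\<in>fan_rays n \<Sigma>. of_int (prim_gen n \<rho> j) * ray_var \<rho>)"

text \<open>
  The differential, written in coordinates: the coefficient of \<open>\<ell>\<^sub>J\<close> in \<open>d(\<ell>\<^bsub>J \<union> {j}\<^esub>)\<close> is
  \<open>\<plusminus> d(\<ell>\<^sub>j)\<close>, the sign counting the elements of \<open>J\<close> smaller than \<open>j\<close>. The lemmas
  \<open>koszul_d_scalar\<close>, \<open>koszul_d_ell\<close> and \<open>koszul_d_leibniz\<close> below state that it is the graded
  derivation with \<open>d(x) = 0\<close> and \<open>d(\<ell>\<^sub>j) = \<Sum>\<^sub>\<rho> \<langle>\<ell>\<^sub>j, u\<^sub>\<rho>\<rangle> x\<^sub>\<rho>\<close>.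
\<close>

definition koszul_d :: "nat \<Rightarrow> (nat \<Rightarrow> real) set set \<Rightarrow> koszul \<Rightarrow> koszul" where
  "koszul_d n \<Sigma> \<kappa> =
     (\<lambda>J. \<Sum>j\<in>{1..n} - J. wedge_sign {j} J * (koszul_theta n \<Sigma> j * \<kappa> (insert j J)))"

lemma koszul_d_add:
  "koszul_d n \<Sigma> (\<lambda>J. \<kappa> J + \<eta> J) = (\<lambda>J. koszul_d n \<Sigma> \<kappa> J + koszul_d n \<Sigma> \<eta> J)"
  by (simp add: koszul_d_def algebra_simps sum.distrib)

lemma koszul_d_tensor: "koszul_d n \<Sigma> (tensor p \<xi>) = tensor p (koszul_d n \<Sigma> \<xi>)"
  by (simp add: koszul_d_def tensor_def sum_distrib_left algebra_simps)

lemma koszul_d_scalar: "koszul_d n \<Sigma> (tensor p koszul_one) = (\<lambda>_. 0)"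
  by (simp add: koszul_d_def tensor_def koszul_one_def)

lemma koszul_d_ell:
  assumes "j \<in> {1..n}"
  shows "koszul_d n \<Sigma> (ell j) = tensor (koszul_theta n \<Sigma> j) koszul_one"
proof
  fix J :: "nat set"
  show "koszul_d n \<Sigma> (ell j) J = tensor (koszul_theta n \<Sigma> j) koszul_one J"
  proof (cases "J = {}")
    case True
    have "koszul_d n \<Sigma> (ell j) J = (\<Sum>i\<in>{1..n}. if i = j then koszul_theta n \<Sigma> i else 0)"
      unfolding koszul_d_def True by (intro sum.cong) (auto simp: ell_def wedge_sign_def)
    also have "\<dots> = koszul_theta n \<Sigma> j"
      using assms by (subst sum.delta) auto
    finally show ?thesis using True by (simp add: tensor_def koszul_one_def)
  next
    case False
    have "ell j (insert i J) = 0" if "i \<notin> J" for i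
      using False that by (auto simp: ell_def)
    then show ?thesis using False by (simp add: koszul_d_def tensor_def koszul_one_def)
  qed
qed

lemma wedge_sign_square: "wedge_sign A B * wedge_sign A B = 1"
  by (simp add: wedge_sign_def flip: power_add mult_2 power_mult)

lemma wedge_sign_insert_left:
  assumes "finite A" "finite B" "j \<notin> A"
  shows "wedge_sign (insert j A) B = wedge_sign {j} B * wedge_sign A B"
proof -
  let ?P = "\<lambda>A. {(a, b). a \<in> A \<and> b \<in> B \<and> b < a}"
  have "?P (insert j A) = ?P {j} \<union> ?P A" "?P {j} \<inter> ?P A = {}"
    using assms by auto
  moreover have "finite (?P {j})" "finite (?P A)"
    by (rule finite_subset[of _ "{j} \<times> B"] finite_subset[of _ "A \<times> B"]; use assms in auto)+
  ultimately show ?thesis by (simp add: wedge_sign_def card_Un_disjoint power_add)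
qed

lemma wedge_sign_insert_right:
  assumes "finite A" "finite B" "j \<notin> B"
  shows "wedge_sign A (insert j B) = wedge_sign A {j} * wedge_sign A B"
proof -
  let ?P = "\<lambda>B. {(a, b). a \<in> A \<and> b \<in> B \<and> b < a}"
  have "?P (insert j B) = ?P {j} \<union> ?P B" "?P {j} \<inter> ?P B = {}"
    using assms by auto
  moreover have "finite (?P {j})" "finite (?P B)"
    by (rule finite_subset[of _ "A \<times> {j}"] finite_subset[of _ "A \<times> B"]; use assms in auto)+
  ultimately show ?thesis by (simp add: wedge_sign_def card_Un_disjoint power_add)
qed

lemma wedge_sign_swap:
  assumes "finite A" "j \<notin> A"
  shows "wedge_sign {j} A * wedge_sign A {j} = (- 1) ^ card A"
proof -
  have "{(a, b). a \<in> {j} \<and> b \<in> A \<and> b < a} = Pair j ` {b \<in> A. b < j}"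
       "{(a, b). a \<in> A \<and> b \<in> {j} \<and> b < a} = (\<lambda>a. (a, j)) ` {a \<in> A. j < a}" by auto
  then have "wedge_sign {j} A * wedge_sign A {j}
      = (- 1) ^ (card {b \<in> A. b < j} + card {a \<in> A. j < a})"
    unfolding wedge_sign_def by (simp add: card_image inj_on_def power_add)
  also have "card {b \<in> A. b < j} + card {a \<in> A. j < a} = card ({b \<in> A. b < j} \<union> {a \<in> A. j < a})"
    using assms by (intro card_Un_disjoint[symmetric]) auto
  also have "{b \<in> A. b < j} \<union> {a \<in> A. j < a} = A"
    using assms by (auto simp: not_less_iff_gr_or_eq)
  finally show ?thesis .
qed

lemma koszul_d_leibniz:
  assumes \<kappa>: "\<kappa> \<in> koszul_lift n \<Sigma>" "\<And>J. \<kappa> J \<noteq> 0 \<Longrightarrow> card J = i"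
    and \<eta>: "\<eta> \<in> koszul_lift n \<Sigma>"
  shows "koszul_d n \<Sigma> (koszul_mult \<kappa> \<eta>) =
    (\<lambda>J. koszul_mult (koszul_d n \<Sigma> \<kappa>) \<eta> J + (- 1) ^ i * koszul_mult \<kappa> (koszul_d n \<Sigma> \<eta>) J)"
proof
  fix J :: "nat set"
  let ?N = "{1..n}" and ?t = "koszul_theta n \<Sigma>" and ?w = wedge_sign
  have k0: "\<kappa> A = 0" "\<eta> A = 0" if "\<not> A \<subseteq> ?N" for A
    using that \<kappa>(1) \<eta> by (auto simp: koszul_lift_def)
  show "koszul_d n \<Sigma> (koszul_mult \<kappa> \<eta>) J =
    koszul_mult (koszul_d n \<Sigma> \<kappa>) \<eta> J + (- 1) ^ i * koszul_mult \<kappa> (koszul_d n \<Sigma> \<eta>) J"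
  proof (cases "J \<subseteq> ?N")
    case False
    have z: "\<kappa> A * \<eta> (insert j J - A) = 0" for A j
      using False k0(1)[of A] k0(2)[of "insert j J - A"] by fastforce
    have z1: "\<kappa> (insert j A) * \<eta> (J - A) = 0" for A j
      using False k0(1)[of "insert j A"] k0(2)[of "J - A"] by fastforce
    have z2: "\<kappa> A * \<eta> (insert j (J - A)) = 0" for A j
      using False k0(1)[of A] k0(2)[of "insert j (J - A)"] by fastforce
    have "koszul_d n \<Sigma> (koszul_mult \<kappa> \<eta>) J = 0"
      unfolding koszul_d_def koszul_mult_def by (simp add: z)
    moreover have "koszul_mult (koszul_d n \<Sigma> \<kappa>) \<eta> J = 0"
      unfolding koszul_d_def koszul_mult_def sum_distrib_right by (simp add: z1 mult.assoc)
    moreover have "koszul_mult \<kappa> (koszul_d n \<Sigma> \<eta>) J = 0"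
      unfolding koszul_d_def koszul_mult_def sum_distrib_left
      by (simp add: z2 mult.left_commute[of "\<kappa> _"])
    ultimately show ?thesis by simp
  next
    case True
    then have finJ: "finite J" by (rule finite_subset) simp
    define L where "L = (\<lambda>A j. ?w A (J - A) * ?w {j} A * (?t j * \<kappa> (insert j A) * \<eta> (J - A)))"
    define R where "R = (\<lambda>A j. (- 1) ^ i * (?w A (J - A) * ?w {j} (J - A)
                                * (?t j * \<kappa> A * \<eta> (insert j (J - A)))))"
    have fin: "finite A" "finite (J - A)" if "A \<subseteq> J" for A
      using that finJ finite_subset by auto
    have outer: "?w {j} J * (?t j * koszul_mult \<kappa> \<eta> (insert j J)) = (\<Sum>A\<in>Pow J. L A j + R A j)"
      if j: "j \<notin> J" for j
    proof -
      let ?f = "\<lambda>C. ?w C (insert j J - C) * (\<kappa> C * \<eta> (insert j J - C))"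
      have "koszul_mult \<kappa> \<eta> (insert j J) = sum ?f (Pow J) + sum ?f (insert j ` Pow J)"
        unfolding koszul_mult_def Pow_insert using finJ j by (intro sum.union_disjoint) auto
      also have "sum ?f (insert j ` Pow J) = (\<Sum>A\<in>Pow J. ?f (insert j A))"
        using j by (subst sum.reindex) (auto simp: inj_on_def)
      finally have *: "koszul_mult \<kappa> \<eta> (insert j J) = (\<Sum>A\<in>Pow J. ?f (insert j A) + ?f A)"
        by (simp add: sum.distrib)
      have "?w {j} J * (?t j * (?f (insert j A) + ?f A)) = L A j + R A j" if A: "A \<in> Pow J" for A
      proof -
        have jA: "j \<notin> A" "j \<notin> J - A" using A j by auto
        have s: "insert j J - insert j A = J - A" "insert j J - A = insert j (J - A)"
          using A j by auto
        have J: "?w {j} J = ?w {j} A * ?w {j} (J - A)"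
        proof -
          have "?w {j} (A \<union> B) = ?w {j} A * ?w {j} B" if "finite B" "A \<inter> B = {}" for B
            using that
          proof (induction B)
            case empty then show ?case by (simp add: wedge_sign_def)
          next
            case (insert b B)
            then show ?case using fin[of A] A
              wedge_sign_insert_right[of "{j}" "A \<union> B" b] wedge_sign_insert_right[of "{j}" B b]
              by (simp add: algebra_simps)
          qed
          from this[of "J - A"] show ?thesis using A fin by (auto simp: Un_absorb1)
        qed
        have w1: "?w (insert j A) (J - A) = ?w {j} (J - A) * ?w A (J - A)"
          using wedge_sign_insert_left[of A "J - A" j] fin[of A] A jA by auto
        have w2: "?w A (insert j (J - A)) = ?w A {j} * ?w A (J - A)"
          using wedge_sign_insert_right[of A "J - A" j] fin[of A] A jA by auto
        have "?w {j} J * ?w (insert j A) (J - A) = ?w {j} A * ?w A (J - A)"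
          unfolding J w1 using wedge_sign_square[of "{j}" "J - A"]
          by (metis (no_types, lifting) mult.assoc mult.commute mult.left_neutral)
        moreover have "?w {j} J * ?w A (insert j (J - A))
            = (- 1) ^ card A * (?w A (J - A) * ?w {j} (J - A))"
          unfolding J w2 using fin[of A] A jA
          by (simp add: wedge_sign_swap[symmetric] algebra_simps)
        moreover have "(- 1) ^ card A * \<kappa> A = (- 1) ^ i * \<kappa> A"
          using \<kappa>(2)[of A] by (cases "\<kappa> A = 0") auto
        ultimately show ?thesis
          unfolding s L_def R_def distrib_left
          by (smt (verit, ccfv_SIG) mult.assoc mult.left_commute)
      qed
      then show ?thesis unfolding * by (simp add: sum_distrib_left)
    qed
    have cancel: "(\<Sum>A\<in>Pow J. sum (L A) (J - A)) + (\<Sum>A\<in>Pow J. sum (R A) A) = 0"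
    proof -
      have "(\<Sum>A\<in>Pow J. sum (L A) (J - A)) = (\<Sum>(A, j)\<in>Sigma (Pow J) (\<lambda>A. J - A). L A j)"
        using finJ by (intro sum.Sigma) auto
      also have "\<dots> = (\<Sum>(A, j)\<in>Sigma (Pow J) (\<lambda>A. A). - R A j)"
      proof (rule sum.reindex_bij_witness[where
            i = "\<lambda>(A, j). (A - {j}, j)" and j = "\<lambda>(A, j). (insert j A, j)"])
        fix x assume "x \<in> Sigma (Pow J) (\<lambda>A. J - A)"
        then obtain A j where x: "x = (A, j)" "A \<subseteq> J" "j \<in> J" "j \<notin> A" by auto
        define B where "B = J - insert j A"
        have B: "J - A = insert j B" "j \<notin> B" "finite B" using x finJ by (auto simp: B_def)
        have fA: "finite A" using x fin by auto
        have "?w A (insert j B) * ?w {j} A = (- 1) ^ card A * ?w A B"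
          by (simp add: wedge_sign_insert_right[OF fA B(3,2)] algebra_simps
              flip: wedge_sign_swap[OF fA x(4)])
        moreover have "?w (insert j A) B * ?w {j} B = ?w A B"
          using wedge_sign_insert_left[OF fA B(3) x(4)] wedge_sign_square[of "{j}" B]
          by (metis (no_types, lifting) mult.assoc mult.commute mult.left_neutral)
        moreover have "(- 1) ^ card A * \<kappa> (insert j A) = - ((- 1) ^ i * \<kappa> (insert j A))"
          using \<kappa>(2)[of "insert j A"] fA x(4) by (cases "\<kappa> (insert j A) = 0") auto
        ultimately have "L A j = - R (insert j A) j"
          unfolding L_def R_def B_def[symmetric] B(1)
          by (smt (verit, ccfv_SIG) mult.assoc mult.left_commute mult_minus_left mult_minus_right)
        then show "(case case x of (A, j) \<Rightarrow> (insert j A, j) of (A, j) \<Rightarrow> - R A j)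
            = (case x of (A, j) \<Rightarrow> L A j)"
          by (simp add: x)
      qed auto
      also have "\<dots> = - (\<Sum>A\<in>Pow J. sum (R A) A)"
        using fin finJ by (subst sum.Sigma[symmetric]) (auto simp: sum_negf)
      finally show ?thesis by simp
    qed
    have "koszul_mult (koszul_d n \<Sigma> \<kappa>) \<eta> J = (\<Sum>A\<in>Pow J. sum (L A) (?N - A))"
      unfolding koszul_mult_def koszul_d_def L_def
      by (intro sum.cong) (simp_all add: sum_distrib_left sum_distrib_right algebra_simps)
    also have "\<dots> = (\<Sum>A\<in>Pow J. sum (L A) (?N - J) + sum (L A) (J - A))"
    proof (rule sum.cong)
      fix A assume "A \<in> Pow J"
      then have "?N - A = (?N - J) \<union> (J - A)" using True by auto
      then show "sum (L A) (?N - A) = sum (L A) (?N - J) + sum (L A) (J - A)"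
        using finJ by (simp only:) (rule sum.union_disjoint, auto)
    qed simp
    finally have 1: "koszul_mult (koszul_d n \<Sigma> \<kappa>) \<eta> J = \<dots>" .
    have "(- 1) ^ i * koszul_mult \<kappa> (koszul_d n \<Sigma> \<eta>) J = (\<Sum>A\<in>Pow J. sum (R A) (?N - (J - A)))"
      unfolding koszul_mult_def koszul_d_def R_def sum_distrib_left
      by (intro sum.cong refl) (simp_all add: algebra_simps)
    also have "\<dots> = (\<Sum>A\<in>Pow J. sum (R A) (?N - J) + sum (R A) A)"
    proof (rule sum.cong)
      fix A assume A: "A \<in> Pow J"
      then have "?N - (J - A) = (?N - J) \<union> A" using True by auto
      then show "sum (R A) (?N - (J - A)) = sum (R A) (?N - J) + sum (R A) A"
        using fin A by (simp only:) (rule sum.union_disjoint, auto)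
    qed simp
    finally have 2: "(- 1) ^ i * koszul_mult \<kappa> (koszul_d n \<Sigma> \<eta>) J = \<dots>" .
    have "koszul_d n \<Sigma> (koszul_mult \<kappa> \<eta>) J = (\<Sum>j\<in>?N - J. \<Sum>A\<in>Pow J. L A j + R A j)"
      unfolding koszul_d_def by (intro sum.cong refl outer) auto
    also have "\<dots> = (\<Sum>A\<in>Pow J. sum (L A) (?N - J) + sum (R A) (?N - J))"
      by (subst sum.swap) (simp add: sum.distrib)
    finally show ?thesis using cancel unfolding 1 2 by (simp add: sum.distrib algebra_simps)
  qed
qed


section \<open>Bases of the Koszul homology\<close>

text \<open>
  The homology of \<open>K(\<rat>[\<Sigma>])\<close> is \<open>koszul_cycles\<close> modulo \<open>koszul_boundaries\<close>; both are given by
  their preimages in \<open>koszul_lift\<close>. The grading plays no role, as \<open>H\<^sub>\<bullet>\<close> is the direct sum of its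
  graded pieces.
\<close>

definition koszul_cycles :: "nat \<Rightarrow> (nat \<Rightarrow> real) set set \<Rightarrow> koszul set" where
  "koszul_cycles n \<Sigma> = {\<kappa> \<in> koszul_lift n \<Sigma>. koszul_d n \<Sigma> \<kappa> \<in> koszul_null n \<Sigma>}"

definition koszul_boundaries :: "nat \<Rightarrow> (nat \<Rightarrow> real) set set \<Rightarrow> koszul set" where
  "koszul_boundaries n \<Sigma> = {\<kappa> \<in> koszul_lift n \<Sigma>.
     \<exists>\<eta> \<in> koszul_lift n \<Sigma>. (\<lambda>J. \<kappa> J - koszul_d n \<Sigma> \<eta> J) \<in> koszul_null n \<Sigma>}"

definition lin_comb :: "koszul set \<Rightarrow> (koszul \<Rightarrow> rat) \<Rightarrow> koszul" where
  "lin_comb T c = (\<lambda>J. \<Sum>\<kappa>\<in>T. const_poly (c \<kappa>) * \<kappa> J)"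

text \<open>
  The second condition, applied to \<open>\<kappa> - \<kappa>'\<close>, includes that different elements of \<open>S\<close> have
  different homology classes.
\<close>

definition homology_basis :: "nat \<Rightarrow> (nat \<Rightarrow> real) set set \<Rightarrow> koszul set \<Rightarrow> bool" where
  "homology_basis n \<Sigma> S \<longleftrightarrow>
     S \<subseteq> koszul_cycles n \<Sigma> \<and>
     (\<forall>T c. finite T \<and> T \<subseteq> S \<and> lin_comb T c \<in> koszul_boundaries n \<Sigma> \<longrightarrow> (\<forall>\<kappa>\<in>T. c \<kappa> = 0)) \<and>
     (\<forall>z \<in> koszul_cycles n \<Sigma>. \<exists>T c. finite T \<and> T \<subseteq> S \<and>
        (\<lambda>J. z J - lin_comb T c J) \<in> koszul_boundaries n \<Sigma>)"


section \<open>The uniform matroid and its augmented Bergman fan\<close>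

definition unif_indep :: "nat \<Rightarrow> nat \<Rightarrow> nat set \<Rightarrow> bool" where
  "unif_indep r n I \<longleftrightarrow> I \<subseteq> {1..n} \<and> card I \<le> r"

definition unif_basis :: "nat \<Rightarrow> nat \<Rightarrow> nat set \<Rightarrow> bool" where
  "unif_basis r n B \<longleftrightarrow> B \<subseteq> {1..n} \<and> card B = r"

text \<open>\<open>|F| \<le> r - 1\<close> and \<open>|H| = r - 1\<close> as integers: there are none if \<open>r = 0\<close>.\<close>

definition unif_proper_flat :: "nat \<Rightarrow> nat \<Rightarrow> nat set \<Rightarrow> bool" where
  "unif_proper_flat r n F \<longleftrightarrow> F \<subseteq> {1..n} \<and> card F + 1 \<le> r"

definition unif_hyperplane :: "nat \<Rightarrow> nat \<Rightarrow> nat set \<Rightarrow> bool" where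
  "unif_hyperplane r n H \<longleftrightarrow> H \<subseteq> {1..n} \<and> card H + 1 = r"

definition e_vec :: "nat set \<Rightarrow> nat \<Rightarrow> int" where
  "e_vec S = (\<lambda>i. if i \<in> S then 1 else 0)"

definition elem_vec :: "nat \<Rightarrow> nat \<Rightarrow> real" where
  "elem_vec i = rvec (e_vec {i})"

definition flat_vec :: "nat \<Rightarrow> nat set \<Rightarrow> nat \<Rightarrow> real" where
  "flat_vec n F = rvec (\<lambda>i. - e_vec ({1..n} - F) i)"

definition aug_cone :: "nat \<Rightarrow> nat set \<Rightarrow> nat set set \<Rightarrow> (nat \<Rightarrow> real) set" where
  "aug_cone n I \<F> = minkowski_sum (cone_hull (elem_vec ` I)) (cone_hull (flat_vec n ` \<F>))"

definition aug_bergman_fan :: "nat \<Rightarrow> nat \<Rightarrow> (nat \<Rightarrow> real) set set" where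
  "aug_bergman_fan r n = {aug_cone n I \<F> | I \<F>.
     unif_indep r n I \<and> (\<forall>F\<in>\<F>. unif_proper_flat r n F) \<and> chain\<^sub>\<subseteq> \<F> \<and> (\<forall>F\<in>\<F>. I \<subseteq> F)}"

definition y_var :: "nat \<Rightarrow> ray_poly" where
  "y_var i = ray_var (cone_hull {elem_vec i})"

definition x_var :: "nat \<Rightarrow> nat set \<Rightarrow> ray_poly" where
  "x_var n F = ray_var (cone_hull {flat_vec n F})"


section \<open>The sets \<open>\<B>\<^sup>F\<close> and \<open>\<B>\<^sup>I\<^sup>N\<close>\<close>

text \<open>
  A flag \<open>F = F\<^sub>0 \<subset> F\<^sub>1 \<subset> \<dots> \<subset> F\<^sub>s\<close> of proper flats is the list \<open>[F\<^sub>0, \<dots>, F\<^sub>s]\<close>, so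
  \<open>s = length Fs - 1\<close>. Appending \<open>[n]\<close> makes \<open>F\<^bsub>s+1\<^esub>\<close> available as an entry.
\<close>

definition flag_from :: "nat \<Rightarrow> nat \<Rightarrow> nat set \<Rightarrow> nat set list \<Rightarrow> bool" where
  "flag_from r n F Fs \<longleftrightarrow>
     Fs \<noteq> [] \<and> hd Fs = F \<and> sorted_wrt (\<subset>) Fs \<and> (\<forall>G \<in> set Fs. unif_proper_flat r n G)"

definition covers :: "nat set \<Rightarrow> nat set \<Rightarrow> bool" where
  "covers G F \<longleftrightarrow> F \<subseteq> G \<and> card (G - F) = 1"

definition retral_at :: "nat \<Rightarrow> nat set list \<Rightarrow> nat \<Rightarrow> bool" where
  "retral_at n Fs k \<longleftrightarrow> (let G = Fs @ [{1..n}] in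
     covers (G ! k) (G ! (k - 1)) \<longrightarrow> G ! k - G ! (k - 1) = {Max (G ! (k + 1) - G ! (k - 1))})"

definition retral :: "nat \<Rightarrow> nat set list \<Rightarrow> bool" where
  "retral n Fs \<longleftrightarrow> (\<forall>k. 1 \<le> k \<and> k \<le> length Fs - 1 \<longrightarrow> retral_at n Fs k)"

definition weakly_retral :: "nat \<Rightarrow> nat \<Rightarrow> nat set list \<Rightarrow> bool" where
  "weakly_retral r n Fs \<longleftrightarrow>
     unif_hyperplane r n (last Fs) \<and> (\<forall>k. 1 \<le> k \<and> k < length Fs - 1 \<longrightarrow> retral_at n Fs k)"

definition succ_in :: "nat set \<Rightarrow> nat \<Rightarrow> nat" where
  "succ_in E u = Min {v \<in> E. u < v}"

text \<open>
  The admissible wedge of \<open>Fs\<close> determined by \<open>U = {u\<^sub>1 < \<dots> < u\<^sub>i}\<close>, and the condition on \<open>U\<close>;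
  the second conjunct says that every element of \<open>U\<close> has a successor.
\<close>

definition admissible_set :: "nat \<Rightarrow> nat set list \<Rightarrow> nat set \<Rightarrow> bool" where
  "admissible_set n Fs U \<longleftrightarrow> (let E = {1..n} - last Fs; s = length Fs - 1 in
     U \<noteq> {} \<and> U \<subseteq> E \<and> (\<forall>u\<in>U. \<exists>v\<in>E. u < v) \<and>
     (1 \<le> s \<and> covers (Fs ! s) (Fs ! (s - 1)) \<longrightarrow> Min U < the_elem (Fs ! s - Fs ! (s - 1))))"

definition wedge_of :: "nat \<Rightarrow> nat set list \<Rightarrow> nat set \<Rightarrow> koszul" where
  "wedge_of n Fs U = wedge_list
     (map (\<lambda>u. (\<lambda>J. ell u J - ell (succ_in ({1..n} - last Fs) u) J)) (sorted_list_of_set U))"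

definition admissible_wedges :: "nat \<Rightarrow> nat set list \<Rightarrow> koszul set" where
  "admissible_wedges n Fs = {wedge_of n Fs U | U. admissible_set n Fs U}"

definition x_flag :: "nat \<Rightarrow> nat set list \<Rightarrow> ray_poly" where
  "x_flag n Fs = (\<Prod>k = 1..length Fs - 1. x_var n (Fs ! k))"

definition B_flat :: "nat \<Rightarrow> nat \<Rightarrow> nat set \<Rightarrow> koszul set" where
  "B_flat r n F =
     {tensor (x_var n F * x_flag n Fs) koszul_one | Fs. flag_from r n F Fs \<and> retral n Fs} \<union>
     {tensor (x_var n F * x_flag n Fs) \<xi> | Fs \<xi>.
        flag_from r n F Fs \<and> weakly_retral r n Fs \<and> \<xi> \<in> admissible_wedges n Fs}"

definition B_IN :: "nat \<Rightarrow> nat \<Rightarrow> koszul set" where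
  "B_IN r n = {tensor (\<Prod>j\<in>B. y_var j) (ell_set J) | B J.
     unif_basis r n B \<and> J \<subseteq> {1..n} \<and> J \<noteq> {} \<and> J \<inter> B = {} \<and> (r = 0 \<or> Min J < Min B)}"

end

theory Submission
  imports Defs "HOL-Library.Multiset" "HOL-Library.Function_Algebras"
begin

text \<open>
  A set \<open>X\<close> of monomials that is convex for divisibility spans a subquotient of a polynomial
  ring, and linear forms \<open>c j\<close>, \<open>j \<in> N\<close>, define a Koszul complex over it. Bases of the homology of
  such complexes are assembled from bases for smaller \<open>X\<close> and \<open>N\<close> in four ways. If one part of
  \<open>X\<close> spans a subcomplex, bases for the two parts combine, after basis elements of the quotient
  whose differential is a basis element of the subcomplex have been cancelled against it
  (\<open>hom_basis_extend\<close>). If \<open>X\<close> is a product, the forms of the second factor vanish on the variables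
  of the first factor and the first factor has a basis of monomials, the products of basis elements
  form a basis (\<open>hom_basis_tensor\<close>). A form that vanishes on \<open>X\<close> doubles a basis
  (\<open>hom_basis_adjoin_zero_form\<close>), and the forms may be changed linearly
  (\<open>hom_basis_subst_form\<close>).

  For the augmented fan, monomials without a variable \<open>x\<^sub>F\<close> form the quotient given by the faces of
  dimension at most \<open>r\<close> of the coordinate orthant; its basis consists of \<open>1\<close> and \<open>\<B>\<^sup>I\<^sup>N\<close>
  (\<open>hom_basis_skeleton\<close>). The others are sorted by the smallest \<open>F\<close> whose variable occurs. Such a
  monomial is an arbitrary monomial in the \<open>y\<^sub>i\<close> with \<open>i \<in> F\<close>, which contributes only the class \<open>1\<close>,
  times a positive power of \<open>x\<^sub>F\<close> and a chain of flats above \<open>F\<close>. The second factor is handled in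
  \<open>hom_basis_bergman\<close> and gives \<open>\<B>\<^sup>F\<close>. All these elements are cycles of the whole complex, so that
  nothing cancels (\<open>hom_basis_augmented\<close>).

  Let \<open>t\<close> be the largest element outside of \<open>F\<close>. After subtracting \<open>\<ell>\<^sub>t\<close> from the other forms these
  vanish on \<open>x\<^sub>F\<close>, and \<open>\<ell>\<^sub>t\<close> does not, which reduces the powers of \<open>x\<^sub>F\<close> to the first one. The chains
  above \<open>F\<close> are sorted by their smallest member \<open>G \<union> {t}\<close> that contains \<open>t\<close>. Above it one has the
  same problem with \<open>G \<union> {t}\<close> in place of \<open>F\<close>; below it the form with index \<open>j\<close> is the sum of the
  variables of the flats that contain \<open>j\<close>. Complexes of chains with the latter forms are treated in
  \<open>hom_basis_chains\<close>, sorting by the largest element \<open>v\<close> in the same way. There cancellation occurs: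
  the differential of \<open>\<ell>\<^sub>v\<close> times a flag with last member \<open>G\<close> is the sum of the flags extended by
  some \<open>G' \<union> {v}\<close> with \<open>G \<subseteq> G'\<close>, and it removes the flag whose last step is the cover
  \<open>G \<union> {v}\<close> of \<open>G\<close>. This is the origin of the retrality conditions: in a flag that meets \<open>v\<close>, the
  part before \<open>v\<close> cannot end with a covering step, and a covering step that adds \<open>v\<close> itself adds the
  maximum of whatever follows.

  Finally \<open>homology_basis_transfer\<close> identifies the Koszul complex of a fan with such a model, by
  reading off the coefficients of the monomials that are supported on cones.
\<close>

section \<open>Bases of the homology of a complex\<close>

definition coefs :: "'i set => ('i => 'f::zero) set" where
  "coefs I = {c. finite {i. c i \<noteq> 0} \<and> {i. c i \<noteq> 0} \<subseteq> I}"

lemma coefs_mono: "I \<subseteq> J ==> c \<in> coefs I ==> c \<in> coefs J"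
  by (auto simp: coefs_def)

lemma coefs_zero [simp]: "(\<lambda>_. 0) \<in> coefs I"
  by (simp add: coefs_def)

lemma coefs_outside: "c \<in> coefs I ==> i \<notin> I ==> c i = 0"
  by (auto simp: coefs_def)

lemma coefs_restrict:
  "c \<in> coefs J ==> J \<inter> P \<subseteq> I ==> (\<lambda>i. if i \<in> P then c i else 0) \<in> coefs I"
  unfolding coefs_def by (auto elim: rev_finite_subset)

lemma coefs_restrict_not:
  "c \<in> coefs J ==> J - P \<subseteq> I ==> (\<lambda>i. if i \<in> P then 0 else c i) \<in> coefs I"
  unfolding coefs_def by (auto elim: rev_finite_subset)

lemma coefs_add:
  fixes c c' :: "'i => 'f::ab_group_add"
  assumes "c \<in> coefs I" "c' \<in> coefs I"
  shows "(\<lambda>i. c i + c' i) \<in> coefs I"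
proof -
  have "{i. c i + c' i \<noteq> 0} \<subseteq> {i. c i \<noteq> 0} \<union> {i. c' i \<noteq> 0}" by auto
  moreover have "finite ({i. c i \<noteq> 0} \<union> {i. c' i \<noteq> 0})" using assms by (auto simp: coefs_def)
  ultimately show ?thesis using assms finite_subset unfolding coefs_def by blast
qed

lemma coefs_scale: "c \<in> coefs I ==> (\<lambda>i. a * c i) \<in> coefs I"
  for a :: "'f::field"
  unfolding coefs_def by (auto intro: finite_subset[of "{i. a \<noteq> 0 \<and> c i \<noteq> 0}" "{i. c i \<noteq> 0}"])

lemma coefs_sum:
  fixes f :: "'t => 'i => 'f::ab_group_add"
  shows "(\<And>t. t \<in> T ==> f t \<in> coefs I) ==> (\<lambda>i. \<Sum>t\<in>T. f t i) \<in> coefs I"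
  by (induction T rule: infinite_finite_induct) (auto intro: coefs_add)

lemma coefs_single: "i \<in> I ==> (\<lambda>j. if j = i then a else 0) \<in> coefs I"
  by (auto simp: coefs_def)

locale homology_space = vector_space scale
  for scale :: "'a::field => 'b::ab_group_add => 'b"  (infixr "*s" 75)
begin

definition lc :: "('i => 'b) => ('i => 'a) => 'b" where
  "lc s c = (\<Sum>i | c i \<noteq> 0. c i *s s i)"

lemma lc_superset:
  fixes c :: "'i => 'a"
  assumes "finite T" "{i. c i \<noteq> 0} \<subseteq> T"
  shows "lc s c = (\<Sum>i\<in>T. c i *s s i)"
  unfolding lc_def using assms by (intro sum.mono_neutral_left) auto

lemma lc_add:
  assumes "c \<in> coefs I" "c' \<in> coefs J"
  shows "lc s (\<lambda>i. c i + c' i) = lc s c + lc s c'"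
proof -
  define T where "T = {i. c i \<noteq> 0} \<union> {i. c' i \<noteq> 0}"
  have T: "finite T" using assms by (auto simp: coefs_def T_def)
  have "lc s (\<lambda>i. c i + c' i) = (\<Sum>i\<in>T. (c i + c' i) *s s i)"
    by (rule lc_superset[OF T]) (auto simp: T_def)
  also have "\<dots> = (\<Sum>i\<in>T. c i *s s i) + (\<Sum>i\<in>T. c' i *s s i)"
    by (simp add: scale_left_distrib sum.distrib)
  also have "\<dots> = lc s c + lc s c'"
    by (intro arg_cong2[where f="(+)"] lc_superset[symmetric] T) (auto simp: T_def)
  finally show ?thesis .
qed

lemma lc_scale:
  assumes "c \<in> coefs I" shows "lc s (\<lambda>i. a * c i) = a *s lc s c"
proof -
  have T: "finite {i. c i \<noteq> 0}" using assms by (auto simp: coefs_def)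
  have "lc s (\<lambda>i. a * c i) = (\<Sum>i | c i \<noteq> 0. (a * c i) *s s i)"
    by (rule lc_superset[OF T]) auto
  then show ?thesis by (simp add: lc_def scale_sum_right)
qed

lemma lc_zero [simp]: "lc s (\<lambda>_. 0) = 0"
  by (simp add: lc_def)

lemma lc_single [simp]: "lc s (\<lambda>j. if j = i then a else 0) = a *s s i"
  by (subst lc_superset[of "{i}"]) auto

lemma lc_cong: "(\<And>i. i \<in> I ==> s i = s' i) ==> c \<in> coefs I ==> lc s c = lc s' c"
  unfolding lc_def coefs_def by (intro sum.cong) auto

lemma lc_sum:
  assumes "\<And>t. t \<in> T ==> f t \<in> coefs I"
  shows "lc s (\<lambda>i. \<Sum>t\<in>T. f t i) = (\<Sum>t\<in>T. lc s (f t))"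
  using assms
proof (induction T rule: infinite_finite_induct)
  case (insert t T)
  have "lc s (\<lambda>i. f t i + (\<Sum>t\<in>T. f t i)) = lc s (f t) + lc s (\<lambda>i. \<Sum>t\<in>T. f t i)"
    by (rule lc_add[where I=I and J=I]) (use insert.prems in \<open>auto intro: coefs_sum\<close>)
  then show ?case using insert by simp
qed simp_all

lemma lc_split:
  assumes "c \<in> coefs I"
  shows "lc s c = lc s (\<lambda>i. if i \<in> P then c i else 0) + lc s (\<lambda>i. if i \<in> P then 0 else c i)"
proof -
  have 1: "(\<lambda>i. if i \<in> P then c i else 0) \<in> coefs I" "(\<lambda>i. if i \<in> - P then c i else 0) \<in> coefs I"
    by (rule coefs_restrict[OF assms], simp)+
  have "(\<lambda>i. if i \<in> P then 0 else c i) = (\<lambda>i. if i \<in> - P then c i else 0)" by auto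
  moreover have "lc s c = lc s (\<lambda>i. (if i \<in> P then c i else 0) + (if i \<in> - P then c i else 0))"
    by (rule arg_cong[where f="lc s"]) auto
  ultimately show ?thesis using lc_add[OF 1] by simp
qed

definition lin_op :: "('b => 'b) => bool" where
  "lin_op d \<longleftrightarrow> (\<forall>x y. d (x + y) = d x + d y) \<and> (\<forall>a x. d (a *s x) = a *s d x)"

lemma lin_opD:
  assumes "lin_op d"
  shows "d (x + y) = d x + d y" "d (a *s x) = a *s d x" "d 0 = 0" "d (- x) = - d x"
    "d (x - y) = d x - d y" "d (sum f T) = (\<Sum>t\<in>T. d (f t))"
proof -
  show 1: "d (x + y) = d x + d y" "d (a *s x) = a *s d x" for x y a
    using assms by (auto simp: lin_op_def)
  show 0: "d 0 = 0" using 1(2)[of 0 0] by simp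
  show 2: "d (- x) = - d x" for x using 1(2)[of "-1" x] by simp
  show "d (x - y) = d x - d y" using 1(1)[of x "- y"] 2 by simp
  show "d (sum f T) = (\<Sum>t\<in>T. d (f t))"
    by (induction T rule: infinite_finite_induct) (auto simp: 0 1)
qed

lemma lin_op_lc:
  assumes "lin_op d" shows "d (lc s c) = lc (\<lambda>i. d (s i)) c"
  by (simp add: lc_def lin_opD[OF assms])

lemma lin_op_comp: "lin_op d ==> lin_op d' ==> lin_op (\<lambda>x. d (d' x))"
  by (simp add: lin_op_def)

definition cpx :: "('b => 'b) => 'b set => bool" where
  "cpx d K \<longleftrightarrow> lin_op d \<and> subspace K \<and> d ` K \<subseteq> K \<and> (\<forall>x\<in>K. d (d x) = 0)"

lemma cpxD:
  assumes "cpx d K"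
  shows "lin_op d" "subspace K" "x \<in> K ==> d x \<in> K" "x \<in> K ==> d (d x) = 0"
  using assms by (auto simp: cpx_def)

lemma lc_in: "subspace K ==> (\<And>i. i \<in> I ==> s i \<in> K) ==> c \<in> coefs I ==> lc s c \<in> K"
  unfolding lc_def coefs_def by (intro subspace_sum subspace_scale) auto

text \<open>The classes of the cycles \<open>s i\<close>, \<open>i \<in> I\<close>, form a basis of the homology of \<open>(K, d)\<close>.\<close>

definition hbasis :: "('b => 'b) => 'b set => 'i set => ('i => 'b) => bool" where
  "hbasis d K I s \<longleftrightarrow> (\<forall>i\<in>I. s i \<in> K \<and> d (s i) = 0) \<and>
     (\<forall>c\<in>coefs I. \<forall>\<eta>\<in>K. lc s c = d \<eta> --> c = (\<lambda>_. 0)) \<and>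
     (\<forall>z\<in>K. d z = 0 --> (\<exists>c\<in>coefs I. \<exists>\<eta>\<in>K. z = d \<eta> + lc s c))"

lemma hbasisD:
  assumes "hbasis d K I s"
  shows "i \<in> I ==> s i \<in> K" "i \<in> I ==> d (s i) = 0"
    "c \<in> coefs I ==> \<eta> \<in> K ==> lc s c = d \<eta> ==> c i = 0"
    "z \<in> K ==> d z = 0 ==> \<exists>c\<in>coefs I. \<exists>\<eta>\<in>K. z = d \<eta> + lc s c"
  using assms by (auto simp: hbasis_def)

lemma hbasis_cong:
  assumes "hbasis d K I s" "\<And>i. i \<in> I ==> s i = s' i" "\<And>x. x \<in> K ==> d x = d' x"
  shows "hbasis d' K I s'"
proof -
  have "lc s c = lc s' c" if "c \<in> coefs I" for c using that assms(2) by (metis lc_cong)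
  then show ?thesis using assms(1) unfolding hbasis_def
    by (simp add: assms(2,3) cong: conj_cong)
qed

lemma hbasis_reindex:
  assumes "hbasis d K I s" and f: "bij_betw f I' I"
  shows "hbasis d K I' (\<lambda>i. s (f i))"
proof -
  define g where "g = the_inv_into I' f"
  have g: "bij_betw g I I'" "\<And>i. i \<in> I' ==> g (f i) = i" "\<And>i. i \<in> I ==> f (g i) = i"
    using f bij_betw_the_inv_into[OF f] unfolding g_def
    by (auto simp: bij_betw_def the_inv_into_f_f f_the_inv_into_f)
  define push where "push = (\<lambda>c i. if i \<in> I then c (g i) else (0::'a))"
  define pull where "pull = (\<lambda>c i. if i \<in> I' then c (f i) else (0::'a))"
  have bI: "f i \<in> I" if "i \<in> I'" for i using f that by (auto simp: bij_betw_def)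
  have bI': "g i \<in> I'" if "i \<in> I" for i using g(1) that by (auto simp: bij_betw_def)
  have supp: "{i. push c i \<noteq> 0} = f ` {i. c i \<noteq> 0}" if "c \<in> coefs I'" for c
  proof (intro set_eqI iffI)
    fix i assume "i \<in> {i. push c i \<noteq> 0}"
    then have "i \<in> I" "c (g i) \<noteq> 0" by (auto simp: push_def split: if_splits)
    then show "i \<in> f ` {i. c i \<noteq> 0}" using g(3)[of i] by (intro image_eqI[of _ _ "g i"]) auto
  next
    fix i assume "i \<in> f ` {i. c i \<noteq> 0}"
    then obtain j where "i = f j" "c j \<noteq> 0" by auto
    moreover from this have "j \<in> I'" using that by (auto simp: coefs_def)
    ultimately show "i \<in> {i. push c i \<noteq> 0}" using g(2)[of j] bI[of j] by (simp add: push_def)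
  qed
  have push: "push c \<in> coefs I" if "c \<in> coefs I'" for c
  proof -
    have "finite {i. c i \<noteq> 0}" using that by (simp add: coefs_def)
    then have "finite {i. push c i \<noteq> 0}" using supp[OF that] by simp
    then show ?thesis by (auto simp: coefs_def push_def)
  qed
  have supp2: "{i. pull c i \<noteq> 0} = g ` {i. c i \<noteq> 0}" if "c \<in> coefs I" for c
  proof (intro set_eqI iffI)
    fix i assume "i \<in> {i. pull c i \<noteq> 0}"
    then have "i \<in> I'" "c (f i) \<noteq> 0" by (auto simp: pull_def split: if_splits)
    then show "i \<in> g ` {i. c i \<noteq> 0}" using g(2)[of i] by (intro image_eqI[of _ _ "f i"]) auto
  next
    fix i assume "i \<in> g ` {i. c i \<noteq> 0}"
    then obtain j where "i = g j" "c j \<noteq> 0" by auto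
    moreover from this have "j \<in> I" using that by (auto simp: coefs_def)
    ultimately show "i \<in> {i. pull c i \<noteq> 0}" using g(3)[of j] bI'[of j] by (simp add: pull_def)
  qed
  have pull: "pull c \<in> coefs I'" if "c \<in> coefs I" for c
  proof -
    have "finite {i. c i \<noteq> 0}" using that by (simp add: coefs_def)
    then have "finite {i. pull c i \<noteq> 0}" using supp2[OF that] by simp
    then show ?thesis by (auto simp: coefs_def pull_def)
  qed
  have lcp: "lc (\<lambda>i. s (f i)) c = lc s (push c)" if "c \<in> coefs I'" for c
  proof -
    have inj: "inj_on f {i. c i \<noteq> 0}"
      using f that by (auto simp: bij_betw_def coefs_def intro: inj_on_subset)
    have "lc s (push c) = (\<Sum>i | c i \<noteq> 0. push c (f i) *s s (f i))"
      unfolding lc_def supp[OF that] using inj by (simp add: sum.reindex)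
    also have "\<dots> = (\<Sum>i | c i \<noteq> 0. c i *s s (f i))"
      using that g bI by (intro sum.cong) (auto simp: push_def coefs_def)
    finally show ?thesis by (simp add: lc_def)
  qed
  have pp: "push (pull c) = c" if "c \<in> coefs I" for c
    using that g bI' by (auto simp: push_def pull_def fun_eq_iff coefs_def)
  show ?thesis unfolding hbasis_def
  proof (intro conjI ballI impI)
    fix i assume "i \<in> I'"
    then show "s (f i) \<in> K" "d (s (f i)) = 0" using hbasisD[OF assms(1)] bI by auto
  next
    fix c \<eta> assume c: "c \<in> coefs I'" "\<eta> \<in> K" "lc (\<lambda>i. s (f i)) c = d \<eta>"
    then have 0: "push c i = 0" for i using hbasisD(3)[OF assms(1) push] lcp by metis
    show "c = (\<lambda>_. 0)"
    proof
      fix i show "c i = 0"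
      proof (cases "i \<in> I'")
        case True then show ?thesis using 0[of "f i"] bI g by (simp add: push_def)
      next
        case False then show ?thesis using c by (auto simp: coefs_def)
      qed
    qed
  next
    fix z assume "z \<in> K" "d z = 0"
    then obtain c \<eta> where "c \<in> coefs I" "\<eta> \<in> K" "z = d \<eta> + lc s c"
      using hbasisD(4)[OF assms(1)] by blast
    then show "\<exists>c\<in>coefs I'. \<exists>\<eta>\<in>K. z = d \<eta> + lc (\<lambda>i. s (f i)) c"
      using pull pp lcp by (intro bexI[of _ "pull c"] bexI[of _ \<eta>]) auto
  qed
qed

lemma hbasis_iso:
  assumes h: "hbasis d K I s"
    and lin: "lin_op \<Phi>" and bij: "\<Phi> ` K = K'" "\<And>x. x \<in> K ==> \<Phi> x = 0 ==> x = 0"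
    and sub: "subspace K" and dl: "lin_op d" "\<And>x. x \<in> K ==> d x \<in> K"
    and com: "\<And>x. x \<in> K ==> \<Phi> (d x) = d' (\<Phi> x)"
  shows "hbasis d' K' I (\<lambda>i. \<Phi> (s i))"
proof -
  note L = lin_opD[OF lin]
  have inj: "x = y" if "x \<in> K" "y \<in> K" "\<Phi> x = \<Phi> y" for x y
    using bij(2)[of "x - y"] that sub by (simp add: subspace_diff L)
  have lcK: "lc s c \<in> K" if "c \<in> coefs I" for c
    by (rule lc_in[OF sub _ that]) (rule hbasisD(1)[OF h])
  have lcP: "lc (\<lambda>i. \<Phi> (s i)) c = \<Phi> (lc s c)" for c by (simp add: lin_op_lc[OF lin])
  show ?thesis unfolding hbasis_def
  proof (intro conjI ballI impI)
    fix i assume i: "i \<in> I"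
    then show "\<Phi> (s i) \<in> K'" using bij hbasisD(1)[OF h] by auto
    show "d' (\<Phi> (s i)) = 0" using com[of "s i"] hbasisD(1,2)[OF h i] i L by simp
  next
    fix c \<eta> assume c: "c \<in> coefs I" "\<eta> \<in> K'" "lc (\<lambda>i. \<Phi> (s i)) c = d' \<eta>"
    obtain \<zeta> where z: "\<zeta> \<in> K" "\<eta> = \<Phi> \<zeta>" using c bij by auto
    have "\<Phi> (lc s c) = \<Phi> (d \<zeta>)" using c(3) lcP z com by simp
    then have "lc s c = d \<zeta>" using inj lcK c z dl by blast
    then show "c = (\<lambda>_. 0)" using h c z unfolding hbasis_def by blast
  next
    fix z assume "z \<in> K'" "d' z = 0"
    then obtain y where y: "y \<in> K" "z = \<Phi> y" using bij by auto
    then have "\<Phi> (d y) = 0" using com \<open>d' z = 0\<close> by simp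
    then have "d y = 0" using y dl bij by auto
    then obtain c \<eta> where "c \<in> coefs I" "\<eta> \<in> K" "y = d \<eta> + lc s c"
      using hbasisD(4)[OF h] y by blast
    then show "\<exists>c\<in>coefs I. \<exists>\<eta>\<in>K'. z = d' \<eta> + lc (\<lambda>i. \<Phi> (s i)) c"
      using y bij com L lcP by (intro bexI[of _ c] bexI[of _ "\<Phi> \<eta>"]) auto
  qed
qed

text \<open>
  Adding to some basis elements boundaries and combinations of the other ones is a unitriangular
  change of the basis of the homology.
\<close>

lemma hbasis_change:
  assumes h: "hbasis d K (A \<union> B) s" and cp: "cpx d K" and AB: "A \<inter> B = {}"
    and sB: "\<And>i. i \<in> B ==> s' i = s i"
    and sA: "\<And>i. i \<in> A ==> s' i = s i + d (\<eta> i) + lc s (g i)"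
    and eta: "\<And>i. i \<in> A ==> \<eta> i \<in> K" and g: "\<And>i. i \<in> A ==> g i \<in> coefs B"
  shows "hbasis d K (A \<union> B) s'"
proof -
  note d = cpxD[OF cp] and L = lin_opD[OF cpxD(1)[OF cp]]
  \<comment> \<open>The coefficients that a combination \<open>c\<close> of the new basis adds to the old one.\<close>
  define adj where "adj = (\<lambda>(c::'c=>'a) i. \<Sum>j | c j \<noteq> 0 \<and> j \<in> A. c j * g j i)"
  define H where "H = (\<lambda>c::'c=>'a. \<Sum>j | c j \<noteq> 0 \<and> j \<in> A. c j *s \<eta> j)"
  have adjB: "adj c \<in> coefs B" for c
    unfolding adj_def by (intro coefs_sum coefs_scale) (auto intro: g)
  have HK: "H c \<in> K" for c
    unfolding H_def by (intro subspace_sum subspace_scale d) (auto intro: eta)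
  have key: "lc s' c = lc s (\<lambda>i. c i + adj c i) + d (H c)" if c: "c \<in> coefs (A \<union> B)" for c
  proof -
    let ?S = "{j. c j \<noteq> 0}" and ?SA = "{j. c j \<noteq> 0 \<and> j \<in> A}"
    have fin: "finite ?S" using c by (simp add: coefs_def)
    have e: "c i *s s' i = c i *s s i + (if i \<in> A then c i *s (d (\<eta> i) + lc s (g i)) else 0)"
      if "i \<in> ?S" for i
    proof -
      have "i \<in> A \<or> i \<in> B" using that c by (auto simp: coefs_def)
      then show ?thesis using sB sA AB by (auto simp: algebra_simps scale_right_distrib)
    qed
    have "lc s' c = (\<Sum>i\<in>?S. c i *s s i + (if i \<in> A then c i *s (d (\<eta> i) + lc s (g i)) else 0))"
      using e by (subst lc_def) (intro sum.cong, auto)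
    also have "\<dots> = lc s c + (\<Sum>i\<in>?SA. c i *s (d (\<eta> i) + lc s (g i)))"
      using fin by (simp add: sum.distrib lc_def sum.If_cases Int_def)
    also have "\<dots> = lc s c + (d (H c) + (\<Sum>i\<in>?SA. c i *s lc s (g i)))"
      by (simp add: H_def L scale_right_distrib sum.distrib)
    also have "(\<Sum>i\<in>?SA. c i *s lc s (g i)) = (\<Sum>i\<in>?SA. lc s (\<lambda>j. c i * g i j))"
      by (intro sum.cong refl) (use lc_scale[OF g] in auto)
    also have "\<dots> = lc s (adj c)"
      unfolding adj_def by (rule lc_sum[symmetric]) (auto intro: coefs_scale g)
    finally show ?thesis using lc_add[OF c adjB] by simp
  qed
  have AadjA: "adj c i = 0" if "i \<in> A" for c i
    using coefs_outside[OF adjB] that AB by blast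
  have adj_cong: "adj c = adj c'" if "\<And>j. j \<in> A ==> c j = c' j" for c c'
    unfolding adj_def by (rule ext, rule sum.cong) (use that in auto)
  have adj2: "adj (\<lambda>i. c i - adj c i) = adj c" for c
    by (rule adj_cong) (simp add: AadjA)
  show ?thesis unfolding hbasis_def
  proof (intro conjI ballI impI)
    fix i assume i: "i \<in> A \<union> B"
    have K: "s i \<in> K" if "i \<in> A \<union> B" for i using hbasisD(1)[OF h] that by auto
    have gK: "lc s (g i) \<in> K" "d (lc s (g i)) = 0" if "i \<in> A" for i
    proof -
      show "lc s (g i) \<in> K" by (rule lc_in[OF d(2) _ g[OF that]]) (use K in auto)
      have "d (lc s (g i)) = lc (\<lambda>i. d (s i)) (g i)" by (rule lin_op_lc[OF d(1)])
      also have "\<dots> = lc (\<lambda>i. 0) (g i)"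
        by (rule lc_cong[OF _ g[OF that]]) (use hbasisD(2)[OF h] in auto)
      finally show "d (lc s (g i)) = 0" by (simp add: lc_def)
    qed
    show "s' i \<in> K"
    proof (cases "i \<in> A")
      case True then show ?thesis using sA eta gK K d(2,3) by (simp add: subspace_add)
    next
      case False then show ?thesis using i sB K by auto
    qed
    show "d (s' i) = 0"
    proof (cases "i \<in> A")
      case True then show ?thesis using sA eta gK hbasisD(2)[OF h] d(4) L by simp
    next
      case False then show ?thesis using i sB hbasisD(2)[OF h] by auto
    qed
  next
    fix c \<zeta> assume c: "c \<in> coefs (A \<union> B)" "\<zeta> \<in> K" "lc s' c = d \<zeta>"
    have "lc s (\<lambda>i. c i + adj c i) = d (\<zeta> - H c)" using key[OF c(1)] c(3) L by simp
    moreover have "(\<lambda>i. c i + adj c i) \<in> coefs (A \<union> B)"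
      by (rule coefs_add[OF c(1) coefs_mono[OF _ adjB]]) simp
    ultimately have 0: "c i + adj c i = 0" for i
      by (intro hbasisD(3)[OF h _ subspace_diff[OF d(2) c(2) HK]])
    then have "c i = 0" if "i \<in> A" for i using AadjA[OF that] by (metis add.right_neutral)
    then have "adj c = (\<lambda>_. 0)" unfolding adj_def by (intro ext sum.neutral) auto
    then show "c = (\<lambda>_. 0)" using 0 by auto
  next
    fix z assume "z \<in> K" "d z = 0"
    then obtain c \<zeta> where c: "c \<in> coefs (A \<union> B)" "\<zeta> \<in> K" "z = d \<zeta> + lc s c"
      using hbasisD(4)[OF h] by blast
    define c' where "c' = (\<lambda>i. c i - adj c i)"
    have "(\<lambda>i. (- 1) * adj c i) \<in> coefs (A \<union> B)"
      by (rule coefs_scale[OF coefs_mono[OF _ adjB]]) simp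
    from coefs_add[OF c(1) this] have c': "c' \<in> coefs (A \<union> B)" by (simp add: c'_def)
    have "lc s' c' = lc s c + d (H c')"
      using key[OF c'] adj2[of c] by (simp add: c'_def)
    then have "z = d (\<zeta> - H c') + lc s' c'" using c(3) L by simp
    then show "\<exists>c\<in>coefs (A \<union> B). \<exists>\<eta>\<in>K. z = d \<eta> + lc s' c"
      by (intro bexI[OF _ c'] bexI[OF _ subspace_diff[OF d(2) c(2) HK]])
  qed
qed

lemma lc_lin_const:
  assumes "\<And>i. i \<in> I ==> s i = 0" "c \<in> coefs I" shows "lc s c = 0"
  using assms unfolding lc_def coefs_def by (intro sum.neutral) auto

text \<open>
  A complex \<open>K\<close> with a subcomplex \<open>K1\<close> and a complement \<open>K2\<close>, which is a model of the quotient.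
  The basis elements \<open>t \<in> T\<close> of the quotient do not lift; they kill the elements \<open>d (s t)\<close> of the
  basis of the subcomplex.
\<close>

lemma hbasis_extend:
  assumes cp: "cpx d K" and K1: "subspace K1" "K1 \<subseteq> K" "\<And>x. x \<in> K1 ==> d x \<in> K1"
    and K2: "subspace K2" "K2 \<subseteq> K" and p: "lin_op p" "\<And>x. x \<in> K ==> p x \<in> K2"
      "\<And>x. x \<in> K ==> x - p x \<in> K1" "\<And>x. x \<in> K1 ==> p x = 0" "\<And>x. x \<in> K2 ==> p x = x"
    and h1: "hbasis d K1 (I1 \<union> \<rho> ` T) s" and h2: "hbasis (\<lambda>x. p (d x)) K2 (I2 \<union> T) s"
    and dis: "I1 \<inter> I2 = {}" "\<rho> ` T \<inter> I1 = {}" "I2 \<inter> T = {}"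
    and rho: "inj_on \<rho> T"
    and lift: "\<And>i. i \<in> I2 ==> d (s i) = 0" and T: "\<And>t. t \<in> T ==> d (s t) = s (\<rho> t)"
  shows "hbasis d K (I1 \<union> I2) s"
proof -
  note d = cpxD[OF cp] and L = lin_opD[OF cpxD(1)[OF cp]] and P = lin_opD[OF p(1)]
  have sK1: "s i \<in> K1" if "i \<in> I1 \<union> \<rho> ` T" for i using hbasisD(1)[OF h1 that] .
  have sK2: "s i \<in> K2" if "i \<in> I2 \<union> T" for i using hbasisD(1)[OF h2 that] .
  have lcK1: "lc s c \<in> K1" if "c \<in> coefs (I1 \<union> \<rho> ` T)" for c by (rule lc_in[OF K1(1) sK1 that])
  have lcK2: "lc s c \<in> K2" if "c \<in> coefs (I2 \<union> T)" for c by (rule lc_in[OF K2(1) sK2 that])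
  have dlc1: "d (lc s c) = 0" if "c \<in> coefs (I1 \<union> \<rho> ` T)" for c
    using lin_op_lc[OF d(1), of s c] lc_lin_const[OF _ that, of "\<lambda>i. d (s i)"] hbasisD(2)[OF h1] by simp
  have dlcI2: "d (lc s c) = 0" if "c \<in> coefs I2" for c
    using lin_op_lc[OF d(1), of s c] lc_lin_const[OF _ that, of "\<lambda>i. d (s i)"] lift by simp
  have K1I: "x \<in> K1" if "x \<in> K" "p x = 0" for x using p(3)[OF that(1)] that(2) by simp
  \<comment> \<open>The connecting map on coefficients: \<open>c t\<close> is moved to the index \<open>\<rho> t\<close>.\<close>
  define push where "push = (\<lambda>(c::'c=>'a) j. \<Sum>t | c t \<noteq> 0 \<and> t \<in> T. if j = \<rho> t then c t else 0)"
  have pushC: "push c \<in> coefs (\<rho> ` T)" for c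
    unfolding push_def by (intro coefs_sum coefs_single) auto
  have dlc: "d (lc s c) = lc s (push c)" if c: "c \<in> coefs (I2 \<union> T)" for c
  proof -
    have "lc s (push c) = (\<Sum>t | c t \<noteq> 0 \<and> t \<in> T. lc s (\<lambda>j. if j = \<rho> t then c t else 0))"
      unfolding push_def by (rule lc_sum[where I = "\<rho> ` T"]) (auto intro: coefs_single)
    also have "\<dots> = (\<Sum>t | c t \<noteq> 0 \<and> t \<in> T. c t *s d (s t))"
      by (intro sum.cong) (auto simp: T)
    also have "\<dots> = (\<Sum>t | c t \<noteq> 0. c t *s d (s t))"
      using c lift dis by (intro sum.mono_neutral_left) (auto simp: coefs_def)
    finally show ?thesis using lin_op_lc[OF d(1), of s c] by (simp add: lc_def)
  qed
  have push0: "c t = 0" if c: "c \<in> coefs (I2 \<union> T)" and "t \<in> T" "push c (\<rho> t) = 0" for c t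
  proof (rule ccontr)
    assume "c t \<noteq> 0"
    have fin: "finite {t. c t \<noteq> 0 \<and> t \<in> T}" using c by (auto simp: coefs_def elim: rev_finite_subset)
    have "push c (\<rho> t) = (\<Sum>u | c u \<noteq> 0 \<and> u \<in> T. if u = t then c t else 0)"
      unfolding push_def using rho that(2) by (intro sum.cong) (auto dest: inj_onD)
    also have "\<dots> = c t" using fin that(2) \<open>c t \<noteq> 0\<close> by simp
    finally show False using that(3) \<open>c t \<noteq> 0\<close> by simp
  qed
  have pd: "p (d (p x)) = p (d x)" if "x \<in> K" for x
  proof -
    have "p (d (x - p x)) = 0" using p(3)[OF that] K1(3) p(4) by blast
    then show ?thesis by (simp add: L P)
  qed
  show ?thesis unfolding hbasis_def
  proof (intro conjI ballI impI)
    fix i assume i: "i \<in> I1 \<union> I2"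
    then show "s i \<in> K" using sK1 sK2 K1(2) K2(2) by blast
    show "d (s i) = 0" using i lift hbasisD(2)[OF h1] by auto
  next
    fix c \<eta> assume c: "c \<in> coefs (I1 \<union> I2)" "\<eta> \<in> K" "lc s c = d \<eta>"
    define c1 c2 where "c1 = (\<lambda>i. if i \<in> I1 then c i else 0)" and "c2 = (\<lambda>i. if i \<in> I1 then 0 else c i)"
    have c1: "c1 \<in> coefs I1" unfolding c1_def by (rule coefs_restrict[OF c(1)]) auto
    have c2: "c2 \<in> coefs I2"
      unfolding c2_def by (rule coefs_restrict_not[OF c(1)]) auto
    have c1': "c1 \<in> coefs (I1 \<union> \<rho> ` T)" by (rule coefs_mono[OF _ c1]) simp
    have c2': "c2 \<in> coefs (I2 \<union> T)" by (rule coefs_mono[OF _ c2]) simp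
    have lcs: "lc s c = lc s c1 + lc s c2" unfolding c1_def c2_def by (rule lc_split[OF c(1)])
    have "p (lc s c) = lc s c2" using lcs P p(4)[OF lcK1[OF c1']] p(5)[OF lcK2[OF c2']] by simp
    then have "lc s c2 = p (d (p \<eta>))" using c pd by simp
    then have "c2 i = 0" for i using hbasisD(3)[OF h2 c2'] c p(2) by blast
    then have c2z: "c2 = (\<lambda>_. 0)" by auto
    then have e: "lc s c1 = d \<eta>" using lcs c by simp
    have "p (d (p \<eta>)) = 0" using pd[OF c(2)] e[symmetric] p(4)[OF lcK1[OF c1']] by simp
    then obtain e' \<eta>' where e': "e' \<in> coefs (I2 \<union> T)" "\<eta>' \<in> K2" "p \<eta> = p (d \<eta>') + lc s e'"
      using hbasisD(4)[OF h2 p(2)[OF c(2)]] by blast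
    define \<eta>1 where "\<eta>1 = \<eta> - d \<eta>' - lc s e'"
    have "\<eta>1 \<in> K" unfolding \<eta>1_def using c e' K2 d lcK2 by (auto intro!: subspace_diff)
    moreover have "p \<eta>1 = 0" unfolding \<eta>1_def using e' p(5)[OF lcK2[OF e'(1)]] by (simp add: P)
    ultimately have eK1: "\<eta>1 \<in> K1" by (rule K1I)
    have "d \<eta>1 = lc s c1 - lc s (push e')"
      unfolding \<eta>1_def using e' K2 d(4) e dlc by (auto simp: L)
    also have "\<dots> = lc s c1 + lc s (\<lambda>i. (-1) * push e' i)" by (subst lc_scale[OF pushC]) simp
    also have "\<dots> = lc s (\<lambda>i. c1 i + (-1) * push e' i)"
      by (rule lc_add[symmetric, OF c1 coefs_scale[OF pushC]])
    finally have E: "lc s (\<lambda>i. c1 i + (-1) * push e' i) = d \<eta>1" by simp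
    have C: "(\<lambda>i. c1 i + (-1) * push e' i) \<in> coefs (I1 \<union> \<rho> ` T)"
      by (rule coefs_add[OF c1' coefs_scale[OF coefs_mono[OF _ pushC]]]) auto
    have z: "c1 i + (-1) * push e' i = 0" for i
      using hbasisD(3)[OF h1 C eK1 E] .
    have "c1 i = 0" for i
    proof (cases "i \<in> I1")
      case True
      then have "i \<notin> \<rho> ` T" using dis by auto
      then have "push e' i = 0" by (rule coefs_outside[OF pushC])
      then show ?thesis using z[of i] by simp
    next
      case False then show ?thesis by (simp add: c1_def)
    qed
    then show "c = (\<lambda>_. 0)" using c2z unfolding c1_def c2_def fun_eq_iff by metis
  next
    fix z assume z: "z \<in> K" "d z = 0"
    have "p (d (p z)) = 0" using pd[OF z(1)] z P by simp
    then obtain c \<eta> where c: "c \<in> coefs (I2 \<union> T)" "\<eta> \<in> K2" "p z = p (d \<eta>) + lc s c"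
      using hbasisD(4)[OF h2 p(2)[OF z(1)]] by blast
    define z1 where "z1 = z - d \<eta> - lc s c"
    have "z1 \<in> K" unfolding z1_def using c z K2 d lcK2 by (auto intro!: subspace_diff)
    moreover have "p z1 = 0" unfolding z1_def using c p(5)[OF lcK2[OF c(1)]] by (simp add: P)
    ultimately have zK1: "z1 \<in> K1" by (rule K1I)
    have "d (- z1) = lc s (push c)" unfolding z1_def using c K2 d(4) z dlc by (auto simp: L)
    moreover have nz: "- z1 \<in> K1" using zK1 K1(1) by (simp add: subspace_neg)
    ultimately have "push c i = 0" for i
      by (intro hbasisD(3)[OF h1 coefs_mono[OF _ pushC] nz]) auto
    then have ct: "c t = 0" if "t \<in> T" for t using push0[OF c(1) that] by simp
    have c2: "c \<in> coefs I2" using c(1) ct by (auto simp: coefs_def)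
    have "d z1 = 0" unfolding z1_def using z c K2 d(4) dlcI2[OF c2] by (auto simp: L)
    then obtain c1 \<eta>1 where c1: "c1 \<in> coefs (I1 \<union> \<rho> ` T)" "\<eta>1 \<in> K1" "z1 = d \<eta>1 + lc s c1"
      using hbasisD(4)[OF h1 zK1] by blast
    define b1 b2 where "b1 = (\<lambda>i. if i \<in> I1 then c1 i else 0)" and "b2 = (\<lambda>i. if i \<in> I1 then 0 else c1 i)"
    have b1: "b1 \<in> coefs I1" unfolding b1_def by (rule coefs_restrict[OF c1(1)]) auto
    define e where "e = (\<lambda>t. if t \<in> T then b2 (\<rho> t) else 0)"
    have b2: "b2 \<in> coefs (\<rho> ` T)"
      unfolding b2_def by (rule coefs_restrict_not[OF c1(1)]) auto
    have "finite {i. b2 i \<noteq> 0}" using b2 by (simp add: coefs_def)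
    then have "finite (\<rho> ` {t \<in> T. b2 (\<rho> t) \<noteq> 0})" by (rule rev_finite_subset) auto
    then have "finite {t \<in> T. b2 (\<rho> t) \<noteq> 0}"
      by (rule finite_imageD) (auto intro: inj_on_subset[OF rho])
    then have eC: "e \<in> coefs T" unfolding e_def coefs_def by (auto elim: rev_finite_subset)
    have "push e = b2"
    proof
      fix j show "push e j = b2 j"
      proof (cases "j \<in> \<rho> ` T")
        case False
        then show ?thesis using coefs_outside[OF pushC] coefs_outside[OF b2] by metis
      next
        case True
        then obtain t where t: "t \<in> T" "j = \<rho> t" by auto
        have fin: "finite {u. e u \<noteq> 0 \<and> u \<in> T}" using eC by (auto simp: coefs_def elim: rev_finite_subset)
        have "push e j = (\<Sum>u | e u \<noteq> 0 \<and> u \<in> T. if u = t then e t else 0)"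
          unfolding push_def t(2) using rho t(1) by (intro sum.cong) (auto dest: inj_onD)
        also have "\<dots> = e t" using fin t(1) by auto
        finally show ?thesis using t by (simp add: e_def)
      qed
    qed
    then have b2d: "lc s b2 = d (lc s e)" using dlc[OF coefs_mono[OF _ eC]] by auto
    have "lc s c1 = lc s b1 + lc s b2" unfolding b1_def b2_def by (rule lc_split[OF c1(1)])
    then have "z = d (\<eta> + \<eta>1 + lc s e) + (lc s b1 + lc s c)"
      using c1(3) b2d by (simp add: z1_def L algebra_simps)
    also have "lc s b1 + lc s c = lc s (\<lambda>i. b1 i + c i)" by (rule lc_add[symmetric, OF b1 c(1)])
    finally have "z = d (\<eta> + \<eta>1 + lc s e) + lc s (\<lambda>i. b1 i + c i)" .
    moreover have "(\<lambda>i. b1 i + c i) \<in> coefs (I1 \<union> I2)"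
      by (rule coefs_add[OF coefs_mono[OF _ b1] coefs_mono[OF _ c2]]) simp_all
    moreover have "\<eta> \<in> K" "\<eta>1 \<in> K" "lc s e \<in> K"
      using c(2) c1(2) K1(2) K2(2) lcK2[OF coefs_mono[OF _ eC]] by auto
    then have "\<eta> + \<eta>1 + lc s e \<in> K" by (intro subspace_add d(2))
    ultimately show "\<exists>c\<in>coefs (I1 \<union> I2). \<exists>\<eta>\<in>K. z = d \<eta> + lc s c"
      by (intro bexI[of _ "\<lambda>i. b1 i + c i"] bexI[of _ "\<eta> + \<eta>1 + lc s e"])
  qed
qed

end

section \<open>Koszul complexes over convex sets of monomials\<close>

text \<open>
  An element of the complex is the function of its coefficients: the exterior monomial is given
  by its index set, the polynomial monomial by a multiset of variables.
\<close>

type_synonym 'v kos = "nat set => 'v multiset => rat"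

definition smul :: "rat => 'v kos => 'v kos" where
  "smul a \<nu> = (\<lambda>J M. a * \<nu> J M)"

interpretation kv: homology_space smul
  by unfold_locales (simp_all add: smul_def fun_eq_iff algebra_simps)

lemma smul_apply [simp]: "smul a \<nu> J M = a * \<nu> J M"
  by (simp add: smul_def)

lemma sum_kos_apply [simp]: "(\<Sum>t\<in>T. f t) J M = (\<Sum>t\<in>T. f t J M)" for f :: "'t => 'v kos"
  by (induction T rule: infinite_finite_induct) auto

lemma kos_minus_apply [simp]: "(\<nu> - \<eta>) J M = \<nu> J M - \<eta> J M" for \<nu> :: "'v kos"
  by (simp add: fun_diff_def)

lemma lc_apply: "kv.lc s c J M = (\<Sum>i | c i \<noteq> 0. c i * s i J M)"
  by (simp add: kv.lc_def)

definition kz :: "'v multiset set => nat set => 'v kos set" where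
  "kz X N = {\<nu>. finite {(J, M). \<nu> J M \<noteq> 0} \<and> (\<forall>J M. \<nu> J M \<noteq> 0 --> J \<subseteq> N \<and> M \<in> X)}"

lemma kzD: "\<nu> \<in> kz X N ==> \<nu> J M \<noteq> 0 ==> J \<subseteq> N" "\<nu> \<in> kz X N ==> \<nu> J M \<noteq> 0 ==> M \<in> X"
  "\<nu> \<in> kz X N ==> finite {(J, M). \<nu> J M \<noteq> 0}"
  by (auto simp: kz_def)

lemma kzI:
  assumes "finite S" "\<And>J M. \<nu> J M \<noteq> 0 ==> (J, M) \<in> S \<and> J \<subseteq> N \<and> M \<in> X"
  shows "\<nu> \<in> kz X N"
  unfolding kz_def using assms by (auto intro: finite_subset[OF _ assms(1)])

lemma kz_mono: "X \<subseteq> Y ==> N \<subseteq> N' ==> kz X N \<subseteq> kz Y N'"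
  unfolding kz_def by blast

lemma kz_subspace: "kv.subspace (kz X N)"
proof (rule kv.subspaceI)
  show "0 \<in> kz X N" by (auto simp: kz_def)
next
  fix \<nu> \<eta> assume *: "\<nu> \<in> kz X N" "\<eta> \<in> kz X N"
  show "\<nu> + \<eta> \<in> kz X N"
  proof (rule kzI[of "{(J, M). \<nu> J M \<noteq> 0} \<union> {(J, M). \<eta> J M \<noteq> 0}"])
    show "finite ({(J, M). \<nu> J M \<noteq> 0} \<union> {(J, M). \<eta> J M \<noteq> 0})" using * by (simp add: kzD)
    fix J M assume "(\<nu> + \<eta>) J M \<noteq> 0"
    then have "\<nu> J M \<noteq> 0 \<or> \<eta> J M \<noteq> 0" by auto
    then show "(J, M) \<in> {(J, M). \<nu> J M \<noteq> 0} \<union> {(J, M). \<eta> J M \<noteq> 0} \<and> J \<subseteq> N \<and> M \<in> X"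
      using * kzD by blast
  qed
next
  fix c and \<nu> :: "'a kos" assume *: "\<nu> \<in> kz X N"
  show "smul c \<nu> \<in> kz X N"
    by (rule kzI[OF kzD(3)[OF *]]) (use * in \<open>auto dest: kzD\<close>)
qed

text \<open>
  The sign for moving \<open>\<ell>\<^sub>j\<close> to its place in
  \<open>\<ell>\<^sub>J\<close>.
\<close>

definition sg :: "nat => nat set => rat" where
  "sg j J = (- 1) ^ card {i \<in> J. i < j}"

lemma sg_square [simp]: "sg j J * sg j J = 1"
  by (simp add: sg_def flip: power_add mult_2 power_mult)

lemma sg_square' [simp]: "sg j J * (sg j J * x) = x"
  by (simp flip: mult.assoc)

lemma sg_nonzero [simp]: "sg j J \<noteq> 0"
  by (simp add: sg_def)

lemma sg_insert:
  assumes "finite J" "i \<notin> J"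
  shows "sg j (insert i J) = (if i < j then - sg j J else sg j J)"
proof -
  have "{k \<in> insert i J. k < j} = (if i < j then insert i {k \<in> J. k < j} else {k \<in> J. k < j})" by auto
  then show ?thesis using assms by (simp add: sg_def)
qed

lemma sg_insert_self [simp]: "sg j (insert j J) = sg j J"
  by (simp add: sg_def) (metis less_irrefl)

lemma sg_remove_self [simp]: "sg j (J - {j}) = sg j J"
  unfolding sg_def by (rule arg_cong[where f = "\<lambda>S. (- 1) ^ card S"]) auto

lemma sg_insert_greater [simp]: "j < i ==> sg j (insert i J) = sg j J"
  unfolding sg_def by (rule arg_cong[where f = "\<lambda>S. (- 1) ^ card S"]) auto

lemma sg_remove_greater [simp]: "j < i ==> sg j (J - {i}) = sg j J"
  unfolding sg_def by (rule arg_cong[where f = "\<lambda>S. (- 1) ^ card S"]) auto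

text \<open>
  Multiplication by the linear form with coefficients \<open>f\<close>; next, the contraction
  with the \<open>j\<close>-th dual basis vector and the left multiplication by
  \<open>\<ell>\<^sub>j\<close>.
\<close>

definition fm :: "('v => rat) => 'v kos => 'v kos" where
  "fm f \<nu> = (\<lambda>J M. \<Sum>u\<in>set_mset M. f u * \<nu> J (M - {#u#}))"

definition iota :: "nat => 'v kos => 'v kos" where
  "iota j \<nu> = (\<lambda>J M. if j \<in> J then 0 else sg j J * \<nu> (insert j J) M)"

definition eps :: "nat => 'v kos => 'v kos" where
  "eps j \<nu> = (\<lambda>J M. if j \<in> J then sg j J * \<nu> (J - {j}) M else 0)"

definition rs :: "'v multiset set => 'v kos => 'v kos" where
  "rs X \<nu> = (\<lambda>J M. if M \<in> X then \<nu> J M else 0)"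

definition dd :: "(nat => 'v => rat) => nat set => 'v kos => 'v kos" where
  "dd c N \<nu> = (\<Sum>j\<in>N. fm (c j) (iota j \<nu>))"

text \<open>The Koszul differential, followed by the projection to the monomials of \<open>X\<close>.\<close>

definition dk :: "(nat => 'v => rat) => 'v multiset set => nat set => 'v kos => 'v kos" where
  "dk c X N \<nu> = rs X (dd c N \<nu>)"

lemma lin_fm: "kv.lin_op (fm f)"
  by (simp add: kv.lin_op_def fm_def fun_eq_iff algebra_simps sum.distrib sum_distrib_left)
lemma lin_iota: "kv.lin_op (iota j)"
  by (simp add: kv.lin_op_def iota_def fun_eq_iff algebra_simps)
lemma lin_eps: "kv.lin_op (eps j)"
  by (simp add: kv.lin_op_def eps_def fun_eq_iff algebra_simps)
lemma lin_rs: "kv.lin_op (rs X)"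
  by (simp add: kv.lin_op_def rs_def fun_eq_iff algebra_simps)

lemma lin_sum:
  assumes "\<And>t. t \<in> T ==> kv.lin_op (f t)" shows "kv.lin_op (\<lambda>x. \<Sum>t\<in>T. f t x)"
  using assms unfolding kv.lin_op_def
  by (induction T rule: infinite_finite_induct) (auto simp: algebra_simps kv.scale_right_distrib)

lemma lin_dd: "kv.lin_op (dd c N)"
proof -
  have "dd c N = (\<lambda>x. \<Sum>j\<in>N. fm (c j) (iota j x))" by (rule ext) (simp add: dd_def)
  then show ?thesis by (simp add: lin_sum kv.lin_op_comp[OF lin_fm lin_iota])
qed

lemma lin_dk: "kv.lin_op (dk c X N)"
  using kv.lin_op_comp[OF lin_rs lin_dd] unfolding dk_def .

lemmas fm_lin = kv.lin_opD[OF lin_fm]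
lemmas iota_lin = kv.lin_opD[OF lin_iota]
lemmas eps_lin = kv.lin_opD[OF lin_eps]
lemmas rs_lin = kv.lin_opD[OF lin_rs]
lemmas dd_lin = kv.lin_opD[OF lin_dd]
lemmas dk_lin = kv.lin_opD[OF lin_dk]

lemma dd_apply:
  assumes "finite N"
  shows "dd c N \<nu> J M = (\<Sum>j\<in>N - J. sg j J * (\<Sum>u\<in>set_mset M. c j u * \<nu> (insert j J) (M - {#u#})))"
proof -
  have "dd c N \<nu> J M = (\<Sum>j\<in>N. if j \<in> J then 0 else sg j J * (\<Sum>u\<in>set_mset M. c j u * \<nu> (insert j J) (M - {#u#})))"
    unfolding dd_def sum_kos_apply
    by (intro sum.cong refl) (auto simp: fm_def iota_def sum_distrib_left algebra_simps)
  also have "\<dots> = (\<Sum>j\<in>N - J. sg j J * (\<Sum>u\<in>set_mset M. c j u * \<nu> (insert j J) (M - {#u#})))"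
    using assms by (intro sum.mono_neutral_cong_right) auto
  finally show ?thesis .
qed

lemma dk_apply:
  assumes "finite N"
  shows "dk c X N \<nu> J M = (if M \<in> X then
    \<Sum>j\<in>N - J. sg j J * (\<Sum>u\<in>set_mset M. c j u * \<nu> (insert j J) (M - {#u#})) else 0)"
  by (simp add: dk_def rs_def dd_apply[OF assms])

lemma fm_commute: "fm f (fm g \<nu>) = fm g (fm f \<nu>)"
proof (intro ext)
  fix J and M :: "'a multiset"
  have *: "fm f (fm g \<nu>) J M = (\<Sum>(u, w)\<in>{(u, w). {#u, w#} \<subseteq># M}. f u * g w * \<nu> J (M - {#u, w#}))"
    for f g
  proof -
    have fin: "finite {(u, w). {#u, w#} \<subseteq># M}"
      by (rule finite_subset[of _ "set_mset M \<times> set_mset M"]) (auto dest: mset_subset_eqD)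
    have S: "Sigma (set_mset M) (\<lambda>u. set_mset (M - {#u#})) = {(u, w). {#u, w#} \<subseteq># M}"
      by (auto simp: insert_subset_eq_iff)
    have "fm f (fm g \<nu>) J M = (\<Sum>u\<in>set_mset M. \<Sum>w\<in>set_mset (M - {#u#}). f u * g w * \<nu> J (M - {#u, w#}))"
      by (simp add: fm_def sum_distrib_left mult.assoc add_mset_commute)
    also have "\<dots> = (\<Sum>(u, w)\<in>{(u, w). {#u, w#} \<subseteq># M}. f u * g w * \<nu> J (M - {#u, w#}))"
      by (subst sum.Sigma) (auto simp flip: S)
    finally show ?thesis .
  qed
  show "fm f (fm g \<nu>) J M = fm g (fm f \<nu>) J M"
    unfolding * by (rule sum.reindex_bij_witness[of _ prod.swap prod.swap])
      (auto simp: add_mset_commute mult_ac)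
qed

lemma fm_iota: "fm f (iota j \<nu>) = iota j (fm f \<nu>)"
  by (intro ext) (simp add: fm_def iota_def sum_distrib_left algebra_simps)

lemma fm_eps: "fm f (eps j \<nu>) = eps j (fm f \<nu>)"
  by (intro ext) (simp add: fm_def eps_def sum_distrib_left algebra_simps)

definition fj :: "'v kos => bool" where "fj \<nu> \<longleftrightarrow> (\<forall>J M. \<nu> J M \<noteq> 0 --> finite J)"

lemma iota_iota:
  assumes "fj \<nu>" "i \<noteq> j" shows "iota i (iota j \<nu>) = - iota j (iota i \<nu>)"
proof (intro ext)
  fix J M
  show "iota i (iota j \<nu>) J M = (- iota j (iota i \<nu>)) J M"
  proof (cases "finite J \<and> i \<notin> J \<and> j \<notin> J")
    case True
    then show ?thesis using assms(2) by (auto simp: iota_def sg_insert insert_commute)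
  next
    case False
    then have "\<nu> (insert j (insert i J)) M = 0" if "i \<notin> J" "j \<notin> J"
      using assms(1) that by (auto simp: fj_def)
    then show ?thesis using False by (auto simp: iota_def insert_commute)
  qed
qed

lemma iota_same: "iota j (iota j \<nu>) = 0"
  by (intro ext) (simp add: iota_def)

lemma fj_kz: "finite N ==> \<nu> \<in> kz X N ==> fj \<nu>"
  by (auto simp: fj_def kz_def intro: finite_subset)

lemma dd_dd: assumes "finite N" "fj \<nu>" shows "dd c N (dd c N \<nu>) = 0"
proof -
  let ?f = "\<lambda>i j. fm (c i) (fm (c j) (iota i (iota j \<nu>)))"
  have anti: "?f i j = - ?f j i" for i j
  proof (cases "i = j")
    case True then show ?thesis by (simp add: iota_same fm_lin)
  next
    case False
    have "?f i j = fm (c j) (fm (c i) (- iota j (iota i \<nu>)))"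
      by (subst fm_commute) (simp only: iota_iota[OF assms(2) False])
    then show ?thesis by (simp only: fm_lin)
  qed
  have "dd c N (dd c N \<nu>) = (\<Sum>i\<in>N. \<Sum>j\<in>N. ?f i j)"
    unfolding dd_def by (simp add: iota_lin fm_lin fm_iota)
  also have "\<dots> = (\<Sum>j\<in>N. \<Sum>i\<in>N. - ?f j i)"
    by (subst sum.swap) (intro sum.cong refl anti)
  also have "\<dots> = - (\<Sum>j\<in>N. \<Sum>i\<in>N. ?f j i)" by (simp add: sum_negf)
  finally have e: "(\<Sum>i\<in>N. \<Sum>j\<in>N. ?f i j) = - (\<Sum>i\<in>N. \<Sum>j\<in>N. ?f i j)"
    using \<open>dd c N (dd c N \<nu>) = (\<Sum>i\<in>N. \<Sum>j\<in>N. ?f i j)\<close> by simp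
  have "x = 0" if "x = - x" for x :: "'a kos"
  proof (intro ext)
    fix J M have "x J M = - x J M" by (subst that) simp
    then show "x J M = 0 J M" by simp
  qed
  from this[OF e] show ?thesis using \<open>dd c N (dd c N \<nu>) = (\<Sum>i\<in>N. \<Sum>j\<in>N. ?f i j)\<close> by simp
qed

text \<open>
  Convexity for divisibility makes the restriction of the differential to \<open>X\<close>
  square to zero: a monomial between two monomials of \<open>X\<close> is not lost on the way.
\<close>

definition okX :: "'v multiset set => bool" where
  "okX X \<longleftrightarrow> (\<exists>V. finite V \<and> (\<forall>M\<in>X. set_mset M \<subseteq> V)) \<and>
     (\<forall>A\<in>X. \<forall>C\<in>X. \<forall>B. A \<subseteq># B --> B \<subseteq># C --> B \<in> X)"

lemma okX_between: "okX X ==> A \<in> X ==> C \<in> X ==> A \<subseteq># B ==> B \<subseteq># C ==> B \<in> X"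
  unfolding okX_def by blast

lemma dd_nonzero:
  assumes "finite N" "dd c N \<nu> J M \<noteq> 0"
  obtains j u where "j \<in> N" "j \<notin> J" "u \<in># M" "c j u \<noteq> 0" "\<nu> (insert j J) (M - {#u#}) \<noteq> 0"
proof -
  from assms obtain j where j: "j \<in> N - J"
    "sg j J * (\<Sum>u\<in>set_mset M. c j u * \<nu> (insert j J) (M - {#u#})) \<noteq> 0"
    unfolding dd_apply[OF assms(1)] by (meson sum.neutral)
  then obtain u where "u \<in># M" "c j u * \<nu> (insert j J) (M - {#u#}) \<noteq> 0"
    by (metis (no_types, lifting) mult_zero_right sum.neutral)
  with j show thesis using that by auto
qed

lemma dk_kz:
  assumes "finite N" "okX X" "\<nu> \<in> kz X N" shows "dk c X N \<nu> \<in> kz X N"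
proof -
  obtain V where V: "finite V" "\<And>M. M \<in> X ==> set_mset M \<subseteq> V" using assms(2) by (auto simp: okX_def)
  let ?S = "{(J, M). \<nu> J M \<noteq> 0}"
  let ?T = "(\<lambda>(j, u, J, M). (J - {j}, add_mset u M)) ` (N \<times> V \<times> ?S)"
  show ?thesis
  proof (rule kzI[of ?T])
    show "finite ?T" using assms(1) V(1) kzD(3)[OF assms(3)] by blast
    fix J M assume "dk c X N \<nu> J M \<noteq> 0"
    then have M: "M \<in> X" "dd c N \<nu> J M \<noteq> 0" by (auto simp: dk_def rs_def split: if_splits)
    from dd_nonzero[OF assms(1) M(2)] obtain j u where
      ju: "j \<in> N" "j \<notin> J" "u \<in># M" "c j u \<noteq> 0" "\<nu> (insert j J) (M - {#u#}) \<noteq> 0" .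
    have "u \<in> V" using ju(3) V(2)[OF M(1)] by auto
    then have "(j, u, insert j J, M - {#u#}) \<in> N \<times> V \<times> ?S" using ju by auto
    moreover have "(J, M) = (\<lambda>(j, u, J, M). (J - {j}, add_mset u M)) (j, u, insert j J, M - {#u#})"
      using ju by simp
    ultimately have "(J, M) \<in> ?T" by (rule rev_image_eqI)
    moreover have "J \<subseteq> N" using kzD(1)[OF assms(3) ju(5)] by auto
    ultimately show "(J, M) \<in> ?T \<and> J \<subseteq> N \<and> M \<in> X" using M by blast
  qed
qed

lemma dk_dk:
  assumes "finite N" "okX X" "\<nu> \<in> kz X N" shows "dk c X N (dk c X N \<nu>) = 0"
proof (intro ext)
  fix J M
  show "dk c X N (dk c X N \<nu>) J M = 0 J M"
  proof (cases "M \<in> X")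
    case True
    have "(if M - {#u#} \<in> X then dd c N \<nu> (insert j J) (M - {#u#}) else 0) = dd c N \<nu> (insert j J) (M - {#u#})"
      if "u \<in># M" for j u
    proof (rule ccontr)
      assume "\<not> ?thesis"
      then have n: "M - {#u#} \<notin> X" "dd c N \<nu> (insert j J) (M - {#u#}) \<noteq> 0" by (auto split: if_splits)
      from dd_nonzero[OF assms(1) n(2)] obtain i w where
        "w \<in># M - {#u#}" "\<nu> (insert i (insert j J)) (M - {#u#} - {#w#}) \<noteq> 0" .
      then have "M - {#u#} - {#w#} \<in> X" using kzD(2)[OF assms(3)] by blast
      then have "M - {#u#} \<in> X"
        by (rule okX_between[OF assms(2) _ True]) (rule diff_subset_eq_self)+
      then show False using n by simp
    qed
    then have "dk c X N (dk c X N \<nu>) J M = dd c N (dd c N \<nu>) J M"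
      unfolding dk_apply[OF assms(1), of c X "dk c X N \<nu>"] unfolding dd_apply[OF assms(1), of c "dd c N \<nu>"]
      using True by (auto simp: dk_def rs_def intro!: sum.cong)
    then show ?thesis using dd_dd[OF assms(1) fj_kz[OF assms(1,3)]] by simp
  qed (simp add: dk_def rs_def)
qed

lemma cpx_dk: "finite N ==> okX X ==> kv.cpx (dk c X N) (kz X N)"
  unfolding kv.cpx_def using lin_dk kz_subspace dk_kz dk_dk by blast

lemma rs_kz: "\<nu> \<in> kz X N ==> rs Y \<nu> \<in> kz (X \<inter> Y) N"
  by (rule kzI[OF kzD(3)]) (auto simp: rs_def dest: kzD split: if_splits)

lemma dk_cong:
  assumes "finite N" "\<nu> \<in> kz X N"
    and "\<And>j u M. j \<in> N ==> u \<in># M ==> M \<in> X ==> M - {#u#} \<in> X ==> c j u = c' j u"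
  shows "dk c X N \<nu> = dk c' X N \<nu>"
proof (intro ext)
  fix J M
  have "c j u * \<nu> (insert j J) (M - {#u#}) = c' j u * \<nu> (insert j J) (M - {#u#})"
    if "j \<in> N - J" "u \<in># M" "M \<in> X" for j u
    using assms(3)[of j u M] that kzD(2)[OF assms(2), of "insert j J" "M - {#u#}"] by fastforce
  then show "dk c X N \<nu> J M = dk c' X N \<nu> J M"
    unfolding dk_apply[OF assms(1)] by (auto intro!: sum.cong)
qed

abbreviation hom_basis where
  "hom_basis c X N I s \<equiv> kv.hbasis (dk c X N) (kz X N) I s"

text \<open>
  A coefficient of a form matters only if its variable leads from a monomial of \<open>X\<close>
  to another one.
\<close>

lemma hom_basis_cong_forms:
  assumes "hom_basis c X N I s" "finite N"
    "\<And>j u M. j \<in> N ==> u \<in># M ==> M \<in> X ==> M - {#u#} \<in> X ==> c j u = c' j u"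
  shows "hom_basis c' X N I s"
  by (rule kv.hbasis_cong[OF assms(1) refl]) (rule dk_cong[OF assms(2) _ assms(3)])

lemma dk_upward_closed:
  assumes "finite N" "\<nu> \<in> kz X1 N" "X1 \<subseteq> X"
    and up: "\<And>M u. M \<in> X1 ==> add_mset u M \<in> X ==> add_mset u M \<in> X1"
  shows "dk c X N \<nu> = dk c X1 N \<nu>"
proof (intro ext)
  fix J M
  show "dk c X N \<nu> J M = dk c X1 N \<nu> J M"
  proof (cases "M \<in> X \<and> M \<notin> X1")
    case True
    have "dd c N \<nu> J M = 0"
    proof (rule ccontr)
      assume "\<not> ?thesis"
      from dd_nonzero[OF assms(1) this] obtain j u where
        ju: "u \<in># M" "\<nu> (insert j J) (M - {#u#}) \<noteq> 0" .
      then show False using up[of "M - {#u#}" u] kzD(2)[OF assms(2)] True by auto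
    qed
    then show ?thesis by (simp add: dk_def rs_def)
  qed (use assms(3) in \<open>auto simp: dk_def rs_def\<close>)
qed

text \<open>
  The part \<open>X1\<close> that is closed under multiplication spans the subcomplex, and
  \<open>X2\<close> the quotient.
\<close>

lemma hom_basis_extend:
  assumes fin: "finite N" and ok: "okX X" and X: "X = X1 \<union> X2" "X1 \<inter> X2 = {}"
    and up: "\<And>M u. M \<in> X1 ==> add_mset u M \<in> X ==> add_mset u M \<in> X1"
    and h1: "hom_basis c X1 N (I1 \<union> \<rho> ` T) s" and h2: "hom_basis c X2 N (I2 \<union> T) s"
    and dis: "I1 \<inter> I2 = {}" "\<rho> ` T \<inter> I1 = {}" "I2 \<inter> T = {}"
    and rho: "inj_on \<rho> T"
    and lift: "\<And>i. i \<in> I2 ==> dk c X N (s i) = 0" and T: "\<And>t. t \<in> T ==> dk c X N (s t) = s (\<rho> t)"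
  shows "hom_basis c X N (I1 \<union> I2) s"
proof (rule kv.hbasis_extend[where p = "rs X2" and ?K1.0 = "kz X1 N" and ?K2.0 = "kz X2 N" and T = T and \<rho> = \<rho>])
  show "kv.cpx (dk c X N) (kz X N)" by (rule cpx_dk[OF fin ok])
  show "kz X1 N \<subseteq> kz X N" "kz X2 N \<subseteq> kz X N" unfolding X(1) by (rule kz_mono; simp)+
  have ok1: "okX X1" unfolding okX_def
  proof (intro conjI ballI allI impI)
    obtain V where "finite V" "\<forall>M\<in>X. set_mset M \<subseteq> V" using ok by (auto simp: okX_def)
    then show "\<exists>V. finite V \<and> (\<forall>M\<in>X1. set_mset M \<subseteq> V)" using X by (intro exI[of _ V]) auto
    fix A C B assume AC: "A \<in> X1" "C \<in> X1" "A \<subseteq># B" "B \<subseteq># C"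
    have BX: "D \<in> X" if "A \<subseteq># D" "D \<subseteq># C" for D using okX_between[OF ok _ _ that] AC X by blast
    have "A + D \<in> X1" if "A + D \<subseteq># C" for D using that
    proof (induction D)
      case (add x D)
      have "A + D \<subseteq># C" using add.prems
        by (metis add_mset_add_single mset_subset_eq_add_left subset_mset.order_trans union_mset_add_mset_right)
      then show ?case using add up[of "A + D" x] BX[of "A + add_mset x D"] by auto
    qed (use AC in auto)
    then show "B \<in> X1" using AC by (metis subset_mset.add_diff_inverse)
  qed
  have e: "dk c X N \<nu> = dk c X1 N \<nu>" if "\<nu> \<in> kz X1 N" for \<nu>
    by (rule dk_upward_closed[OF fin that]) (use X up in auto)
  show "dk c X N x \<in> kz X1 N" if "x \<in> kz X1 N" for x
    using e[OF that] dk_kz[OF fin ok1 that] by simp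
  show "rs X2 x \<in> kz X2 N" if "x \<in> kz X N" for x using rs_kz[OF that, of X2] X by (simp add: Int_absorb1)
  show "x - rs X2 x \<in> kz X1 N" if "x \<in> kz X N" for x
  proof (rule kzI[OF kzD(3)[OF that]])
    fix J M assume "(x - rs X2 x) J M \<noteq> 0"
    then have "x J M \<noteq> 0" "M \<notin> X2" by (auto simp: rs_def split: if_splits)
    then show "(J, M) \<in> {(J, M). x J M \<noteq> 0} \<and> J \<subseteq> N \<and> M \<in> X1"
      using kzD(1,2)[OF that, of J M] X by blast
  qed
  show "rs X2 x = 0" if "x \<in> kz X1 N" for x
    using X kzD(2)[OF that] by (auto simp: rs_def fun_eq_iff)
  show "rs X2 x = x" if "x \<in> kz X2 N" for x
    using kzD(2)[OF that] by (auto simp: rs_def fun_eq_iff)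
  show "kv.hbasis (dk c X N) (kz X1 N) (I1 \<union> \<rho> ` T) s"
    by (rule kv.hbasis_cong[OF h1 refl]) (simp add: e)
  show "kv.hbasis (\<lambda>x. rs X2 (dk c X N x)) (kz X2 N) (I2 \<union> T) s"
    by (rule kv.hbasis_cong[OF h2 refl]) (use X in \<open>auto simp: dk_def rs_def fun_eq_iff\<close>)
qed (use dis rho lift T lin_rs kz_subspace in auto)

section \<open>Products of complexes\<close>

text \<open>
  The hypothesis \<open>ac\<close> says that the quotient by \<open>K0\<close> is acyclic.
\<close>

lemma (in homology_space) hbasis_quasi_iso:
  assumes cp: "cpx d K" and K0: "subspace K0" "K0 \<subseteq> K" "\<And>x. x \<in> K0 ==> d x \<in> K0"
    and ac: "\<And>z. z \<in> K ==> d z \<in> K0 ==> \<exists>\<eta>\<in>K. z - d \<eta> \<in> K0"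
    and h: "hbasis d K0 I s"
  shows "hbasis d K I s"
  unfolding hbasis_def
proof (intro conjI ballI impI)
  note d = cpxD[OF cp] and L = lin_opD[OF cpxD(1)[OF cp]]
  fix i assume i: "i \<in> I"
  show "s i \<in> K" "d (s i) = 0" using hbasisD(1,2)[OF h i] K0(2) by auto
next
  note d = cpxD[OF cp] and L = lin_opD[OF cpxD(1)[OF cp]]
  fix c \<eta> assume c: "c \<in> coefs I" "\<eta> \<in> K" "lc s c = d \<eta>"
  have "lc s c \<in> K0" by (rule lc_in[OF K0(1) hbasisD(1)[OF h] c(1)])
  then obtain \<eta>' where e: "\<eta>' \<in> K" "\<eta> - d \<eta>' \<in> K0" using ac[OF c(2)] c(3) by auto
  have "lc s c = d (\<eta> - d \<eta>')" using c d(4)[OF e(1)] by (simp add: L)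
  then have "c i = 0" for i using hbasisD(3)[OF h c(1) e(2)] by blast
  then show "c = (\<lambda>_. 0)" by auto
next
  note d = cpxD[OF cp] and L = lin_opD[OF cpxD(1)[OF cp]]
  fix z assume z: "z \<in> K" "d z = 0"
  then obtain \<eta> where e: "\<eta> \<in> K" "z - d \<eta> \<in> K0" using ac subspace_0[OF K0(1)] by force
  have "d (z - d \<eta>) = 0" using z d(4)[OF e(1)] by (simp add: L)
  then obtain c \<eta>' where c: "c \<in> coefs I" "\<eta>' \<in> K0" "z - d \<eta> = d \<eta>' + lc s c"
    using hbasisD(4)[OF h e(2)] by blast
  have "z = d (\<eta> + \<eta>') + lc s c" using c(3) by (simp add: L algebra_simps)
  moreover have "\<eta> + \<eta>' \<in> K" using e(1) c(2) K0(2) d(2) by (auto intro: subspace_add)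
  ultimately show "\<exists>c\<in>coefs I. \<exists>\<eta>\<in>K. z = d \<eta> + lc s c" using c(1) by (intro bexI)
qed

definition mon :: "'v multiset => 'v kos" where
  "mon \<alpha> = (\<lambda>J M. if J = {} \<and> M = \<alpha> then 1 else 0)"

lemma mon_expand:
  assumes "e \<in> kz T {}"
  shows "e {} \<in> coefs T" "e = kv.lc mon (e {})"
proof -
  have "{M. e {} M \<noteq> 0} = snd ` {(J, M). e J M \<noteq> 0}"
    using kzD(1)[OF assms] by force
  then have fin: "finite {M. e {} M \<noteq> 0}" using kzD(3)[OF assms] by simp
  then show "e {} \<in> coefs T" using kzD(2)[OF assms] by (auto simp: coefs_def)
  show "e = kv.lc mon (e {})"
  proof (intro ext)
    fix J M
    have "kv.lc mon (e {}) J M = (\<Sum>\<alpha> | e {} \<alpha> \<noteq> 0. if \<alpha> = M then (if J = {} then e {} M else 0) else 0)"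
      unfolding lc_apply by (intro sum.cong) (auto simp: mon_def)
    also have "\<dots> = (if J = {} then e {} M else 0)" using fin by simp
    also have "\<dots> = e J M" using kzD(1)[OF assms, of J M] by auto
    finally show "e J M = kv.lc mon (e {}) J M" by simp
  qed
qed

definition shift :: "'v multiset => 'v kos => 'v kos" where
  "shift \<alpha> \<nu> = (\<lambda>J M. if \<alpha> \<subseteq># M then \<nu> J (M - \<alpha>) else 0)"

lemma lin_shift: "kv.lin_op (shift \<alpha>)"
  by (simp add: kv.lin_op_def shift_def fun_eq_iff)

lemma shift_mon: "shift \<alpha> (mon \<beta>) = mon (\<alpha> + \<beta>)"
  by (intro ext) (auto simp: shift_def mon_def)

lemma filter_mset_none: "(\<And>v. v \<in># M ==> \<not> P v) ==> filter_mset P M = {#}"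
  by (induction M) auto

text \<open>
  The sign in \<open>\<ell>\<^sub>A \<and> \<ell>\<^sub>B = \<plusminus> \<ell>\<^bsub>A
  \<union> B\<^esub>\<close>.
\<close>

definition wsg :: "nat set => nat set => rat" where
  "wsg A B = (- 1) ^ card {(a, b). a \<in> A \<and> b \<in> B \<and> b < a}"

lemma wsg_square [simp]: "wsg A B * wsg A B = 1" "wsg A B * (wsg A B * x) = x"
  by (simp_all add: wsg_def flip: power_add mult_2 power_mult mult.assoc)

lemma wsg_nonzero [simp]: "wsg A B \<noteq> 0" by (simp add: wsg_def)

lemma wsg_insert:
  assumes "finite A" "finite B" "j \<notin> A"
  shows "wsg (insert j A) B = sg j B * wsg A B"
proof -
  let ?P = "\<lambda>A. {(a, b). a \<in> A \<and> b \<in> B \<and> b < a}"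
  have "?P (insert j A) = Pair j ` {b \<in> B. b < j} \<union> ?P A" "Pair j ` {b \<in> B. b < j} \<inter> ?P A = {}"
    using assms by auto
  moreover have "finite (Pair j ` {b \<in> B. b < j})" "finite (?P A)"
    using assms by (auto intro: finite_subset[of _ "A \<times> B"])
  ultimately show ?thesis
    by (simp add: wsg_def sg_def card_Un_disjoint power_add card_image inj_on_def)
qed

lemma sg_Un:
  assumes "finite A" "finite B" "A \<inter> B = {}"
  shows "sg j (A \<union> B) = sg j A * sg j B"
proof -
  have "{i \<in> A \<union> B. i < j} = {i \<in> A. i < j} \<union> {i \<in> B. i < j}" by auto
  then show ?thesis using assms by (simp add: sg_def card_Un_disjoint power_add disjoint_iff)
qed

text \<open>
  Monomials of \<open>X\<close> are products of a monomial of \<open>L\<close>, in the variables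
  \<open>VL\<close>, and one of \<open>U\<close>. The forms with index in \<open>NU\<close>
  involve no variable of \<open>VL\<close>, but those with index in \<open>NL\<close> may
  involve all variables, so that this is not a tensor product of complexes. The subcomplex
  \<open>K0\<close> is spanned by the basis monomials \<open>T\<close> of the first factor, and
  the quotient by it turns out to be acyclic.
\<close>

locale tensor_split =
  fixes c :: "nat => 'v => rat" and VL :: "'v set" and L U X :: "'v multiset set" and NL NU :: "nat set"
    and T :: "'v multiset set"
  assumes fin: "finite NL" "finite NU" and dis: "NL \<inter> NU = {}"
    and okX: "okX X" and okL: "okX L" and okU: "okX U"
    and L: "\<And>M. M \<in> L ==> set_mset M \<subseteq> VL" and U: "\<And>M. M \<in> U ==> set_mset M \<inter> VL = {}"
    and X: "X = {l + u | l u. l \<in> L \<and> u \<in> U}"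
    and zero: "\<And>j w. j \<in> NU ==> w \<in> VL ==> c j w = 0"
    and hL: "hom_basis c L NL T mon"
begin

abbreviation "N \<equiv> NL \<union> NU"
abbreviation "d \<equiv> dk c X N"
definition "pL = filter_mset (\<lambda>v. v \<in> VL)"
definition "pU = filter_mset (\<lambda>v. v \<notin> VL)"
definition "K0 = kz {M \<in> X. pL M \<in> T} NU"

lemma finN: "finite N" using fin by simp

lemma parts: "M = pL M + pU M"
  unfolding pL_def pU_def by (simp add: multiset_partition[symmetric])

lemma part_sum: assumes "l \<in> L" "u \<in> U" shows "pL (l + u) = l" "pU (l + u) = u"
proof -
  have "filter_mset (\<lambda>v. v \<in> VL) l = l" "filter_mset (\<lambda>v. v \<in> VL) u = {#}"
    "filter_mset (\<lambda>v. v \<notin> VL) l = {#}" "filter_mset (\<lambda>v. v \<notin> VL) u = u"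
    using L[OF assms(1)] U[OF assms(2)] by (auto simp: filter_mset_eq_conv intro!: filter_mset_none)
  then show "pL (l + u) = l" "pU (l + u) = u" by (simp_all add: pL_def pU_def)
qed

lemma X_iff: "M \<in> X \<longleftrightarrow> pL M \<in> L \<and> pU M \<in> U"
  using parts[of M] part_sum by (auto simp: X)

lemma sum_X: "l \<in> L ==> u \<in> U ==> l + u \<in> X" by (auto simp: X)

lemma pL_remove: "w \<notin> VL ==> pL (M - {#w#}) = pL M"
  by (simp add: pL_def)

lemma TL: "T \<subseteq> L"
proof
  fix \<alpha> assume "\<alpha> \<in> T"
  then have "mon \<alpha> \<in> kz L NL" by (rule kv.hbasisD(1)[OF hL])
  then show "\<alpha> \<in> L" using kzD(2)[of "mon \<alpha>" L NL "{}" \<alpha>] by (simp add: mon_def)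
qed

lemma K0_kz: "K0 \<subseteq> kz X N" unfolding K0_def by (rule kz_mono) auto

lemma K0_subspace: "kv.subspace K0" unfolding K0_def by (rule kz_subspace)

lemma K0_closed: assumes "\<nu> \<in> K0" shows "d \<nu> \<in> K0"
proof -
  have k: "\<nu> \<in> kz X N" using assms K0_kz by auto
  show ?thesis unfolding K0_def
  proof (rule kzI[OF kzD(3)[OF dk_kz[OF finN okX k]]])
    fix J M assume "d \<nu> J M \<noteq> 0"
    then have M: "M \<in> X" "dd c N \<nu> J M \<noteq> 0" by (auto simp: dk_def rs_def split: if_splits)
    from dd_nonzero[OF finN M(2)] obtain j u where
      ju: "j \<in> N" "j \<notin> J" "u \<in># M" "c j u \<noteq> 0" "\<nu> (insert j J) (M - {#u#}) \<noteq> 0" .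
    have *: "insert j J \<subseteq> NU" "pL (M - {#u#}) \<in> T"
      using kzD(1,2)[OF assms[unfolded K0_def] ju(5)] by auto
    then have "u \<notin> VL" using zero ju(4) by auto
    then show "(J, M) \<in> {(J, M). d \<nu> J M \<noteq> 0} \<and> J \<subseteq> NU \<and> M \<in> {M \<in> X. pL M \<in> T}"
      using * pL_remove \<open>d \<nu> J M \<noteq> 0\<close> M(1) by auto
  qed
qed

text \<open>
  The part of an element with second factor \<open>u \<otimes> \<ell>\<^sub>B\<close>, as an
  element of the complex of the first factor.
\<close>

definition slice :: "'v multiset => nat set => 'v kos => 'v kos" where
  "slice u B \<nu> = (\<lambda>J M. if J \<subseteq> NL \<and> M \<in> L then wsg J B * \<nu> (J \<union> B) (M + u) else 0)"

lemma lin_slice: "kv.lin_op (slice u B)"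
  by (simp add: kv.lin_op_def slice_def fun_eq_iff algebra_simps)

lemma slice_kz:
  assumes "\<nu> \<in> kz X N" "B \<subseteq> NU" shows "slice u B \<nu> \<in> kz L NL"
proof (rule kzI)
  show "finite ((\<lambda>(J, M). (J \<inter> NL, M - u)) ` {(J, M). \<nu> J M \<noteq> 0})" using kzD(3)[OF assms(1)] by simp
  fix J M assume "slice u B \<nu> J M \<noteq> 0"
  then have *: "J \<subseteq> NL" "M \<in> L" "\<nu> (J \<union> B) (M + u) \<noteq> 0" by (auto simp: slice_def split: if_splits)
  have "(J, M) = (\<lambda>(J, M). (J \<inter> NL, M - u)) (J \<union> B, M + u)" using *(1) assms(2) dis by auto
  then show "(J, M) \<in> (\<lambda>(J, M). (J \<inter> NL, M - u)) ` {(J, M). \<nu> J M \<noteq> 0} \<and> J \<subseteq> NL \<and> M \<in> L"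
    using * by (auto intro!: rev_image_eqI)
qed

text \<open>
  In the lowest occurring degree in the variables of the second factor only the differential of
  the first factor remains, since every other term raises this degree.
\<close>

lemma slice_dk:
  assumes k: "\<nu> \<in> kz X N" and B: "B \<subseteq> NU" and u: "u \<in> U"
    and low: "\<And>J M. \<nu> J M \<noteq> 0 ==> size u \<le> size (pU M)"
  shows "slice u B (d \<nu>) = dk c L NL (slice u B \<nu>)"
proof (intro ext)
  fix J M
  show "slice u B (d \<nu>) J M = dk c L NL (slice u B \<nu>) J M"
  proof (cases "J \<subseteq> NL \<and> M \<in> L")
    case False
    then have "slice u B \<nu> (insert j J) (M - {#w#}) = 0" if "M \<in> L" for j w
      using that by (simp add: slice_def)
    then show ?thesis using False by (simp add: dk_apply[OF fin(1)] slice_def[of u B "d \<nu>"])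
  next
    case True
    then have J: "J \<subseteq> NL" and M: "M \<in> L" by auto
    have fJ: "finite J" "finite B" using J B fin finite_subset by blast+
    have JB: "J \<inter> B = {}" using J B dis by auto
    have inner: "(\<Sum>w\<in>set_mset (M + u). c j w * \<nu> (insert j (J \<union> B)) (M + u - {#w#}))
        = (\<Sum>w\<in>set_mset M. c j w * \<nu> (insert j (J \<union> B)) (M - {#w#} + u))" for j
    proof -
      have *: "\<nu> K (M + u - {#w#}) = 0" if "w \<in># u" for w K
      proof (rule ccontr)
        assume "\<not> ?thesis"
        then have "size u \<le> size (pU (M + u - {#w#}))" by (rule low)
        also have "M + u - {#w#} = M + (u - {#w#})" using that by (rule diff_union_single_conv)
        also have "size (pU (M + (u - {#w#}))) \<le> size (u - {#w#})"
        proof -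
          have "pU M = {#}" using L[OF M] by (auto simp: pU_def intro!: filter_mset_none)
          then have "pU (M + (u - {#w#})) = pU (u - {#w#})" by (simp add: pU_def)
          moreover have "size (pU (u - {#w#})) \<le> size (u - {#w#})"
            unfolding pU_def by (rule size_filter_mset_lesseq)
          ultimately show ?thesis by simp
        qed
        finally show False using size_Suc_Diff1[OF that] by simp
      qed
      have Mu: "set_mset M \<inter> set_mset u = {}" using L[OF M] U[OF u] by blast
      have "(\<Sum>w\<in>set_mset (M + u). c j w * \<nu> (insert j (J \<union> B)) (M + u - {#w#}))
        = (\<Sum>w\<in>set_mset M. c j w * \<nu> (insert j (J \<union> B)) (M + u - {#w#}))"
        using Mu * by (intro sum.mono_neutral_right) auto
      also have "\<dots> = (\<Sum>w\<in>set_mset M. c j w * \<nu> (insert j (J \<union> B)) (M - {#w#} + u))"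
        by (intro sum.cong refl) (metis diff_union_single_conv add.commute)
      finally show ?thesis .
    qed
    have "slice u B (d \<nu>) J M = wsg J B * (\<Sum>j\<in>N - (J \<union> B). sg j (J \<union> B) *
        (\<Sum>w\<in>set_mset M. c j w * \<nu> (insert j (J \<union> B)) (M - {#w#} + u)))"
      using J M sum_X[OF M u] by (simp only: slice_def dk_apply[OF finN] inner if_True conj_absorb simp_thms)
    also have "(\<Sum>j\<in>N - (J \<union> B). sg j (J \<union> B) *
        (\<Sum>w\<in>set_mset M. c j w * \<nu> (insert j (J \<union> B)) (M - {#w#} + u)))
      = (\<Sum>j\<in>NL - J. sg j (J \<union> B) *
        (\<Sum>w\<in>set_mset M. c j w * \<nu> (insert j (J \<union> B)) (M - {#w#} + u)))"
      using L[OF M] zero dis B J finN by (intro sum.mono_neutral_right) (auto intro!: sum.neutral)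
    also have "wsg J B * \<dots> = (\<Sum>j\<in>NL - J. sg j J *
        (\<Sum>w\<in>set_mset M. c j w * slice u B \<nu> (insert j J) (M - {#w#})))"
      unfolding sum_distrib_left
    proof (intro sum.cong refl)
      fix j w assume j: "j \<in> NL - J" and w: "w \<in> set_mset M"
      have s: "slice u B \<nu> (insert j J) (M - {#w#})
          = wsg (insert j J) B * \<nu> (insert j (J \<union> B)) (M - {#w#} + u)"
      proof (cases "M - {#w#} \<in> L")
        case True then show ?thesis using j J by (simp add: slice_def)
      next
        case False
        have "\<nu> (insert j (J \<union> B)) (M - {#w#} + u) = 0"
        proof (rule ccontr)
          assume "\<not> ?thesis"
          then have "M - {#w#} + u \<in> X" by (rule kzD(2)[OF k])
          then have "pL (M - {#w#} + u) \<in> L" by (simp add: X_iff)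
          moreover have "pL (M - {#w#} + u) = M - {#w#}"
          proof -
            have "pL u = {#}" using U[OF u] by (auto simp: pL_def intro!: filter_mset_none)
            moreover have "pL (M - {#w#}) = M - {#w#}"
              using L[OF M] unfolding pL_def filter_mset_eq_conv by (auto dest: in_diffD)
            moreover have "pL (M - {#w#} + u) = pL (M - {#w#}) + pL u"
              unfolding pL_def by (rule filter_union_mset)
            ultimately show ?thesis by simp
          qed
          ultimately show False using False by simp
        qed
        then show ?thesis using False by (simp add: slice_def)
      qed
      have "wsg J B * sg j (J \<union> B) = sg j J * wsg (insert j J) B"
        using j fJ JB by (simp add: sg_Un wsg_insert)
      then show "wsg J B * (sg j (J \<union> B) * (c j w * \<nu> (insert j (J \<union> B)) (M - {#w#} + u))) =
          sg j J * (c j w * slice u B \<nu> (insert j J) (M - {#w#}))"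
        unfolding s by (simp add: algebra_simps)
    qed
    also have "\<dots> = dk c L NL (slice u B \<nu>) J M" using M by (simp add: dk_apply[OF fin(1)])
    finally show ?thesis .
  qed
qed

text \<open>
  The differential preserves the sum of the polynomial and the exterior degree, so that one may
  truncate by it.
\<close>

lemma deg_part_dk:
  fixes D b :: nat
  defines "deg_part \<equiv> \<lambda>(\<nu>::'v kos) J M. if size M + card J + b \<le> D then \<nu> J M else 0"
  assumes "\<nu> \<in> kz Y N'" "finite N'"
  shows "dk c Y N' (deg_part \<nu>) = deg_part (dk c Y N' \<nu>)"
proof (intro ext)
  fix J M
  have "deg_part \<nu> (insert j J) (M - {#u#}) = (if size M + card J + b \<le> D then \<nu> (insert j J) (M - {#u#}) else 0)"
    if "j \<notin> J" "u \<in># M" for j u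
  proof (cases "\<nu> (insert j J) (M - {#u#}) = 0")
    case False
    then have "insert j J \<subseteq> N'" by (rule kzD(1)[OF assms(2)])
    then have "finite J" using assms(3) finite_subset by auto
    then show ?thesis using that size_Suc_Diff1[OF that(2), symmetric] by (simp add: deg_part_def)
  qed (simp add: deg_part_def)
  then have "dk c Y N' (deg_part \<nu>) J M = (if size M + card J + b \<le> D then dk c Y N' \<nu> J M else 0)"
    unfolding dk_apply[OF assms(3)] by (auto intro!: sum.cong sum.neutral)
  then show "dk c Y N' (deg_part \<nu>) J M = deg_part (dk c Y N' \<nu>) J M" by (simp add: deg_part_def)
qed

text \<open>
  The primitive obtained from the basis of the first factor is truncated, in order to control
  its degree.
\<close>

lemma slice_solve:
  assumes y: "y \<in> kz L NL" and dy: "dk c L NL y \<in> kz T {}"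
    and deg: "\<And>J M. y J M \<noteq> 0 ==> size M + card J + b \<le> D"
  shows "\<exists>h\<in>kz L NL. y - dk c L NL h \<in> kz T {} \<and> (\<forall>J M. h J M \<noteq> 0 --> size M + card J + b \<le> D) \<and> (y = 0 --> h = 0)"
proof (cases "y = 0")
  case True
  have "0 \<in> kz L NL" by (simp add: kz_def)
  moreover have "(0::'v kos) \<in> kz T {}" by (simp add: kz_def)
  ultimately show ?thesis using True by (intro bexI[of _ 0]) (simp_all add: dk_lin)
next
  case False
  let ?cut = "\<lambda>(\<nu>::'v kos) J M. if size M + card J + b \<le> D then \<nu> J M else 0"
  note me = mon_expand[OF dy]
  have "dk c L NL y {} \<alpha> = 0" for \<alpha>
    using kv.hbasisD(3)[OF hL me(1) y] me(2) by simp
  then have "dk c L NL y {} = (\<lambda>_. 0)" by auto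
  then have "dk c L NL y = 0" by (subst me(2)) simp
  then obtain c' \<eta> where c': "c' \<in> coefs T" "\<eta> \<in> kz L NL" "y = dk c L NL \<eta> + kv.lc mon c'"
    using kv.hbasisD(4)[OF hL y] by blast
  have lc0: "kv.lc mon c' J M = 0" if "\<not> (J = {} \<and> M \<in> T)" for J M
    unfolding lc_apply using that c'(1) by (intro sum.neutral) (auto simp: mon_def coefs_def)
  have "?cut \<eta> \<in> kz L NL" by (rule kzI[OF kzD(3)[OF c'(2)]]) (use kzD(1,2)[OF c'(2)] in \<open>auto split: if_splits\<close>)
  moreover have "y - dk c L NL (?cut \<eta>) \<in> kz T {}"
  proof (rule kzI)
    have "y - dk c L NL (?cut \<eta>) \<in> kz L NL"
      using y dk_kz[OF fin(1) okL calculation] by (rule kv.subspace_diff[OF kz_subspace])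
    then show "finite {(J, M). (y - dk c L NL (?cut \<eta>)) J M \<noteq> 0}" by (rule kzD(3))
    fix J M assume nz: "(y - dk c L NL (?cut \<eta>)) J M \<noteq> 0"
    have "y J M = ?cut y J M" using deg[of J M] by auto
    moreover have "dk c L NL (?cut \<eta>) = ?cut (dk c L NL \<eta>)" by (rule deg_part_dk[OF c'(2) fin(1)])
    ultimately have "(y - dk c L NL (?cut \<eta>)) J M = ?cut y J M - ?cut (dk c L NL \<eta>) J M"
      by (simp only: kos_minus_apply)
    also have "\<dots> = ?cut (kv.lc mon c') J M" by (simp add: c'(3))
    finally have eq: "(y - dk c L NL (?cut \<eta>)) J M = ?cut (kv.lc mon c') J M" .
    have "J = {} \<and> M \<in> T"
    proof (rule ccontr)
      assume "\<not> ?thesis"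
      then have "?cut (kv.lc mon c') J M = 0" using lc0 by simp
      then show False using nz eq by simp
    qed
    then show "(J, M) \<in> {(J, M). (y - dk c L NL (?cut \<eta>)) J M \<noteq> 0} \<and> J \<subseteq> {} \<and> M \<in> T"
      using nz by auto
  qed
  ultimately show ?thesis using False by (intro bexI[of _ "?cut \<eta>"]) (auto split: if_splits)
qed


text \<open>
  Subtracting boundaries pushes \<open>z\<close>, modulo \<open>K0\<close>, to higher and higher
  degree in the variables of the second factor. This degree is bounded by the total degree
  \<open>D\<close>, which does not change.
\<close>

lemma acyclic_step:
  "z \<in> kz X N ==> d z \<in> K0 ==>
    (\<And>J M. z J M \<noteq> 0 ==> size M + card J \<le> D \<and> D < size (pU M) + n) ==>
    \<exists>\<eta>\<in>kz X N. z - d \<eta> \<in> K0"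
proof (induction n arbitrary: z)
  case 0
  have "z J M = 0" for J M
  proof (rule ccontr)
    assume "z J M \<noteq> 0"
    then have "size M \<le> D" "D < size (pU M)" using 0(3) by fastforce+
    moreover have "size (pU M) \<le> size M" unfolding pU_def by (rule size_filter_mset_lesseq)
    ultimately show False by simp
  qed
  then have "z = 0" by (intro ext) simp
  then have "z - d 0 = 0" using dk_lin(3) by (metis diff_0_right)
  then have "z - d 0 \<in> K0" using kv.subspace_0[OF K0_subspace] by metis
  then show ?case using kv.subspace_0[OF kz_subspace] by blast
next
  case (Suc n)
  note z = Suc.prems(1) and dz = Suc.prems(2) and bd = Suc.prems(3)
  define p where "p = D - n"
  have lowz: "p \<le> size (pU M)" if "z J M \<noteq> 0" for J M using bd[OF that] by (auto simp: p_def)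
  define Q where "Q = (\<lambda>u B h. h \<in> kz L NL \<and> slice u B z - dk c L NL h \<in> kz T {} \<and>
      (\<forall>J M. h J M \<noteq> 0 --> size M + card J + (size u + card B) \<le> D) \<and> (slice u B z = 0 --> h = 0))"
  have "\<exists>h. Q u B h" if u: "u \<in> U" "size u = p" and B: "B \<subseteq> NU" for u B
  proof -
    have 1: "slice u B z \<in> kz L NL" by (rule slice_kz[OF z B])
    have "dk c L NL (slice u B z) = slice u B (d z)"
      by (rule slice_dk[OF z B u(1), symmetric]) (use lowz u(2) in auto)
    also have "slice u B (d z) \<in> kz T {}"
    proof (rule kzI[OF kzD(3)[OF slice_kz[OF dk_kz[OF finN okX z] B]]])
      fix J M assume nz: "slice u B (d z) J M \<noteq> 0"
      then have *: "J \<subseteq> NL" "M \<in> L" "d z (J \<union> B) (M + u) \<noteq> 0" by (auto simp: slice_def split: if_splits)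
      have "J \<union> B \<subseteq> NU" "pL (M + u) \<in> T" using kzD(1,2)[OF dz[unfolded K0_def] *(3)] by auto
      then have "J = {}" "M \<in> T" using *(1,2) dis part_sum(1)[OF *(2) u(1)] by auto
      then show "(J, M) \<in> {(J, M). slice u B (d z) J M \<noteq> 0} \<and> J \<subseteq> {} \<and> M \<in> T" using nz by auto
    qed
    finally have 2: "dk c L NL (slice u B z) \<in> kz T {}" .
    have "size M + card J + (size u + card B) \<le> D" if "slice u B z J M \<noteq> 0" for J M
    proof -
      have *: "J \<subseteq> NL" "M \<in> L" "z (J \<union> B) (M + u) \<noteq> 0" using that by (auto simp: slice_def split: if_splits)
      have "card (J \<union> B) = card J + card B"
        using *(1) B dis fin by (intro card_Un_disjoint) (auto intro: finite_subset)
      then show ?thesis using bd[OF *(3)] by simp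
    qed
    from slice_solve[OF 1 2 this] show ?thesis unfolding Q_def by blast
  qed
  then have "\<exists>h. \<forall>u B. u \<in> U \<and> size u = p \<and> B \<subseteq> NU --> Q u B (h u B)" by metis
  then obtain h where h: "\<And>u B. u \<in> U ==> size u = p ==> B \<subseteq> NU ==> Q u B (h u B)" by blast
  define \<eta> where "\<eta> = (\<lambda>J M. if J \<subseteq> N \<and> M \<in> X \<and> size (pU M) = p
      then wsg (J \<inter> NL) (J \<inter> NU) * h (pU M) (J \<inter> NU) (J \<inter> NL) (pL M) else 0)"
  have \<eta>: "\<eta> \<in> kz X N"
  proof -
    let ?P = "{(u, B). (u, B) \<in> (\<lambda>(J, M). (pU M, J \<inter> NU)) ` {(J, M). z J M \<noteq> 0} \<and> u \<in> U \<and> size u = p \<and> B \<subseteq> NU}"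
    let ?S = "\<Union>(u, B)\<in>?P. (\<lambda>(J, M). (J \<union> B, M + u)) ` {(J, M). h u B J M \<noteq> 0}"
    show ?thesis
    proof (rule kzI[of ?S])
      have "finite ?P" by (rule finite_subset[OF _ finite_imageI[OF kzD(3)[OF z], of "\<lambda>(J, M). (pU M, J \<inter> NU)"]]) auto
      moreover have "finite (case x of (u, B) => (\<lambda>(J, M). (J \<union> B, M + u)) ` {(J, M). h u B J M \<noteq> 0})"
        if "x \<in> ?P" for x
      proof -
        obtain u B where x: "x = (u, B)" by (cases x)
        then have "Q u B (h u B)" using that h by auto
        then have "h u B \<in> kz L NL" by (simp add: Q_def)
        then show ?thesis using kzD(3) unfolding x prod.case by (intro finite_imageI)
      qed
      ultimately show "finite ?S" by (rule finite_UN_I)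
      fix J M assume "\<eta> J M \<noteq> 0"
      then have *: "J \<subseteq> N" "M \<in> X" "size (pU M) = p" "h (pU M) (J \<inter> NU) (J \<inter> NL) (pL M) \<noteq> 0"
        by (auto simp: \<eta>_def split: if_splits)
      have U': "pU M \<in> U" using *(2) by (simp add: X_iff)
      have q: "Q (pU M) (J \<inter> NU) (h (pU M) (J \<inter> NU))" by (rule h[OF U' *(3)]) simp
      have "slice (pU M) (J \<inter> NU) z \<noteq> 0" using q *(4) unfolding Q_def by auto
      then obtain J' M' where "slice (pU M) (J \<inter> NU) z J' M' \<noteq> 0" by (metis ext zero_fun_apply)
      then have s: "J' \<subseteq> NL" "M' \<in> L" "z (J' \<union> (J \<inter> NU)) (M' + pU M) \<noteq> 0"
        by (auto simp: slice_def split: if_splits)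
      have "(\<lambda>(J, M). (pU M, J \<inter> NU)) (J' \<union> (J \<inter> NU), M' + pU M) = (pU M, J \<inter> NU)"
        using s(1) dis part_sum(2)[OF s(2) U'] by auto
      then have P: "(pU M, J \<inter> NU) \<in> ?P" using s(3) U' *(3) by (auto intro!: rev_image_eqI)
      have "(J, M) \<in> (\<lambda>(J', Ma). (J' \<union> (J \<inter> NU), Ma + pU M)) ` {(J', Ma). h (pU M) (J \<inter> NU) J' Ma \<noteq> 0}"
        using *(1,4) parts[of M] by (intro image_eqI[of _ _ "(J \<inter> NL, pL M)"]) auto
      then have "(J, M) \<in> ?S" using P by (intro UN_I[OF P]) auto
      then show "(J, M) \<in> ?S \<and> J \<subseteq> N \<and> M \<in> X" using * by blast
    qed
  qed
  have slice_eta: "slice u B \<eta> = h u B" if u: "u \<in> U" "size u = p" and B: "B \<subseteq> NU" for u B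
  proof (intro ext)
    fix J M
    have hk: "h u B \<in> kz L NL" using h[OF u B] by (simp add: Q_def)
    show "slice u B \<eta> J M = h u B J M"
    proof (cases "J \<subseteq> NL \<and> M \<in> L")
      case True
      then have "(J \<union> B) \<inter> NL = J" "(J \<union> B) \<inter> NU = B" "J \<union> B \<subseteq> N" using B dis by auto
      then show ?thesis using True part_sum[of M u] u sum_X[of M u] by (simp add: slice_def \<eta>_def)
    next
      case False
      then have "h u B J M = 0" using kzD(1,2)[OF hk] by blast
      moreover have "slice u B \<eta> J M = 0" using False unfolding slice_def by (rule if_not_P)
      ultimately show ?thesis by simp
    qed
  qed
  have eta_bd: "size (pU M) = p \<and> size M + card J \<le> D \<and> finite J" if "\<eta> J M \<noteq> 0" for J M
  proof -
    have *: "J \<subseteq> N" "M \<in> X" "size (pU M) = p" "h (pU M) (J \<inter> NU) (J \<inter> NL) (pL M) \<noteq> 0"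
      using that by (auto simp: \<eta>_def split: if_splits)
    have "Q (pU M) (J \<inter> NU) (h (pU M) (J \<inter> NU))" by (rule h[OF _ *(3)]) (use *(2) X_iff in auto)
    then have "size (pL M) + card (J \<inter> NL) + (size (pU M) + card (J \<inter> NU)) \<le> D"
      using *(4) unfolding Q_def by blast
    moreover have "card J = card (J \<inter> NL) + card (J \<inter> NU)"
    proof -
      have "J = (J \<inter> NL) \<union> (J \<inter> NU)" using *(1) by auto
      moreover have "card ((J \<inter> NL) \<union> (J \<inter> NU)) = card (J \<inter> NL) + card (J \<inter> NU)"
        using fin dis by (intro card_Un_disjoint) auto
      ultimately show ?thesis by simp
    qed
    moreover have "size M = size (pL M) + size (pU M)" using arg_cong[OF parts[of M], of size] by simp
    ultimately show ?thesis using *(1,3) finite_subset[OF _ finN] by auto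
  qed
  have deta_bd: "p \<le> size (pU M) \<and> size M + card J \<le> D" if "d \<eta> J M \<noteq> 0" for J M
  proof -
    have "dd c N \<eta> J M \<noteq> 0" using that by (auto simp: dk_def rs_def split: if_splits)
    from dd_nonzero[OF finN this] obtain j u where
      ju: "j \<notin> J" "u \<in># M" "\<eta> (insert j J) (M - {#u#}) \<noteq> 0" .
    have e: "size (pU (M - {#u#})) = p" "size (M - {#u#}) + card (insert j J) \<le> D" "finite J"
      using eta_bd[OF ju(3)] by auto
    have "pU (M - {#u#}) \<subseteq># pU M" unfolding pU_def by (rule multiset_filter_mono) simp
    then have "p \<le> size (pU M)" using e(1) size_mset_mono by blast
    moreover have "size M = Suc (size (M - {#u#}))" using ju(2) by (metis insert_DiffM size_add_mset)
    ultimately show ?thesis using e ju(1) by simp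
  qed
  define y where "y = z - d \<eta>"
  have y: "y \<in> kz X N" unfolding y_def
    by (rule kv.subspace_diff[OF kz_subspace z dk_kz[OF finN okX \<eta>]])
  define k where "k = (\<lambda>J M. if size (pU M) = p then y J M else 0)"
  have k0: "k \<in> K0" unfolding K0_def
  proof (rule kzI[OF kzD(3)[OF y]])
    fix J M assume "k J M \<noteq> 0"
    then have p: "size (pU M) = p" and nz: "y J M \<noteq> 0" by (auto simp: k_def split: if_splits)
    have JM: "J \<subseteq> N" "M \<in> X" using kzD(1,2)[OF y nz] .
    have LU: "pL M \<in> L" "pU M \<in> U" using JM(2) X_iff by auto
    let ?u = "pU M" and ?B = "J \<inter> NU"
    have "slice ?u ?B y = slice ?u ?B z - slice ?u ?B (d \<eta>)"
      unfolding y_def by (rule kv.lin_opD(5)[OF lin_slice])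
    also have "slice ?u ?B (d \<eta>) = dk c L NL (slice ?u ?B \<eta>)"
      by (rule slice_dk[OF \<eta> _ LU(2)]) (use eta_bd p in auto)
    also have "slice ?u ?B \<eta> = h ?u ?B" by (rule slice_eta[OF LU(2) p]) simp
    finally have "slice ?u ?B y = slice ?u ?B z - dk c L NL (h ?u ?B)" .
    then have sk: "slice ?u ?B y \<in> kz T {}" using h[OF LU(2) p, of ?B] by (simp add: Q_def)
    have "J \<inter> NL \<union> J \<inter> NU = J" using JM(1) by blast
    then have "slice ?u ?B y (J \<inter> NL) (pL M) \<noteq> 0" using LU nz parts[of M] by (simp add: slice_def)
    then have "J \<inter> NL = {}" "pL M \<in> T" using kzD(1,2)[OF sk] by auto
    then show "(J, M) \<in> {(J, M). y J M \<noteq> 0} \<and> J \<subseteq> NU \<and> M \<in> {M \<in> X. pL M \<in> T}"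
      using nz JM by auto
  qed
  define z2 where "z2 = y - k"
  have z2: "z2 \<in> kz X N" unfolding z2_def
    using kv.subspace_diff[OF kz_subspace y] k0 K0_kz by blast
  have "d z2 = d z - d k" unfolding z2_def y_def by (simp add: dk_lin dk_dk[OF finN okX \<eta>])
  then have dz2: "d z2 \<in> K0" using kv.subspace_diff[OF K0_subspace dz K0_closed[OF k0]] by simp
  have "size M + card J \<le> D \<and> D < size (pU M) + n" if "z2 J M \<noteq> 0" for J M
  proof -
    have "size (pU M) \<noteq> p" "y J M \<noteq> 0" using that by (auto simp: z2_def k_def split: if_splits)
    then have "z J M \<noteq> 0 \<or> d \<eta> J M \<noteq> 0" by (auto simp: y_def)
    then have "p \<le> size (pU M)" "size M + card J \<le> D" using lowz bd deta_bd by blast+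
    then show ?thesis using \<open>size (pU M) \<noteq> p\<close> by (auto simp: p_def)
  qed
  from Suc.IH[OF z2 dz2 this] obtain \<eta>2 where e2: "\<eta>2 \<in> kz X N" "z2 - d \<eta>2 \<in> K0" by blast
  have "z - d (\<eta> + \<eta>2) = (z2 - d \<eta>2) + k" by (simp add: z2_def y_def dk_lin)
  then have "z - d (\<eta> + \<eta>2) \<in> K0" using kv.subspace_add[OF K0_subspace e2(2) k0] by simp
  then show ?case using kv.subspace_add[OF kz_subspace \<eta> e2(1)] by blast
qed

lemma acyclic:
  assumes "z \<in> kz X N" "d z \<in> K0"
  shows "\<exists>\<eta>\<in>kz X N. z - d \<eta> \<in> K0"
proof -
  let ?S = "{(J, M). z J M \<noteq> 0}"
  \<comment> \<open>Any upper bound for the total degrees that occur in \<open>z\<close> would do.\<close>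
  define D where "D = (\<Sum>(J, M)\<in>?S. size M + card J)"
  have "size M + card J \<le> D \<and> D < size (pU M) + Suc D" if "z J M \<noteq> 0" for J M
  proof -
    have "(\<lambda>(J, M). size M + card J) (J, M) \<le> D"
      unfolding D_def by (rule member_le_sum) (use that kzD(3)[OF assms(1)] in auto)
    then show ?thesis by simp
  qed
  from acyclic_step[OF assms this] show ?thesis .
qed

lemma shift_dk:
  assumes \<nu>: "\<nu> \<in> kz U NU" and \<alpha>: "\<alpha> \<in> L"
  shows "d (shift \<alpha> \<nu>) = shift \<alpha> (dk c U NU \<nu>)"
proof (intro ext)
  fix J M
  have AL: "set_mset \<alpha> \<subseteq> VL" by (rule L[OF \<alpha>])
  show "d (shift \<alpha> \<nu>) J M = shift \<alpha> (dk c U NU \<nu>) J M"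
  proof (cases "\<exists>u\<in>U. M = \<alpha> + u")
    case True
    then obtain u where u: "u \<in> U" "M = \<alpha> + u" by blast
    have Ua: "set_mset u \<inter> set_mset \<alpha> = {}" using U[OF u(1)] AL by auto
    have *: "(\<Sum>w\<in>set_mset M. c j w * shift \<alpha> \<nu> (insert j J) (M - {#w#})) =
        (\<Sum>w\<in>set_mset u. c j w * \<nu> (insert j J) (u - {#w#}))" if "j \<in> NU" for j
    proof -
      have "(\<Sum>w\<in>set_mset M. c j w * shift \<alpha> \<nu> (insert j J) (M - {#w#})) =
          (\<Sum>w\<in>set_mset u. c j w * shift \<alpha> \<nu> (insert j J) (M - {#w#}))"
        using u(2) AL zero[OF that] by (intro sum.mono_neutral_right) auto
      also have "\<dots> = (\<Sum>w\<in>set_mset u. c j w * \<nu> (insert j J) (u - {#w#}))"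
      proof (intro sum.cong refl)
        fix w assume "w \<in> set_mset u"
        then have "M - {#w#} = \<alpha> + (u - {#w#})" unfolding u(2) by (rule diff_union_single_conv)
        then show "c j w * shift \<alpha> \<nu> (insert j J) (M - {#w#}) = c j w * \<nu> (insert j J) (u - {#w#})"
          by (simp add: shift_def)
      qed
      finally show ?thesis .
    qed
    have nl: "shift \<alpha> \<nu> (insert j J) M' = 0" if "j \<in> NL" for j M'
      using kzD(1)[OF \<nu>, of "insert j J"] that dis by (auto simp: shift_def)
    have "d (shift \<alpha> \<nu>) J M = (\<Sum>j\<in>N - J. sg j J * (\<Sum>w\<in>set_mset M. c j w * shift \<alpha> \<nu> (insert j J) (M - {#w#})))"
      using sum_X[OF \<alpha> u(1)] u(2) by (simp add: dk_apply[OF finN])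
    also have "\<dots> = (\<Sum>j\<in>NU - J. sg j J * (\<Sum>w\<in>set_mset M. c j w * shift \<alpha> \<nu> (insert j J) (M - {#w#})))"
      using finN nl by (intro sum.mono_neutral_right) auto
    also have "\<dots> = dk c U NU \<nu> J u" using u(1) * by (auto simp: dk_apply[OF fin(2)] intro!: sum.cong)
    finally show ?thesis using u(2) by (simp add: shift_def)
  next
    case False
    have "shift \<alpha> (dk c U NU \<nu>) J M = 0"
      using False kzD(2)[OF dk_kz[OF fin(2) okU \<nu>, of c], of J "M - \<alpha>"]
      by (auto simp: shift_def) (metis subset_mset.add_diff_inverse)
    moreover have "d (shift \<alpha> \<nu>) J M = 0"
    proof (rule ccontr)
      assume "\<not> ?thesis"
      then have M: "M \<in> X" "dd c N (shift \<alpha> \<nu>) J M \<noteq> 0" by (auto simp: dk_def rs_def split: if_splits)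
      from dd_nonzero[OF finN M(2)] obtain j w where
        jw: "w \<in># M" "c j w \<noteq> 0" "shift \<alpha> \<nu> (insert j J) (M - {#w#}) \<noteq> 0" .
      then have s: "\<alpha> \<subseteq># M - {#w#}" "\<nu> (insert j J) (M - {#w#} - \<alpha>) \<noteq> 0" by (auto simp: shift_def split: if_splits)
      have "j \<in> NU" using kzD(1)[OF \<nu> s(2)] by auto
      then have w: "w \<notin> VL" using jw(2) zero by auto
      have u: "M - {#w#} - \<alpha> \<in> U" by (rule kzD(2)[OF \<nu> s(2)])
      have "pL M = pL (M - {#w#})" by (rule pL_remove[OF w, symmetric])
      also have "\<dots> = pL (\<alpha> + (M - {#w#} - \<alpha>))"
        by (simp only: subset_mset.add_diff_inverse[OF s(1)])
      also have "\<dots> = \<alpha>" by (rule part_sum(1)[OF \<alpha> u])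
      finally have "pL M = \<alpha>" .
      then show False using False M(1) X_iff parts[of M] by metis
    qed
    ultimately show ?thesis by simp
  qed
qed

lemma shift_K0: assumes "\<nu> \<in> kz U NU" "\<alpha> \<in> T" shows "shift \<alpha> \<nu> \<in> K0"
  unfolding K0_def
proof (rule kzI)
  show "finite ((\<lambda>(J, M). (J, \<alpha> + M)) ` {(J, M). \<nu> J M \<noteq> 0})" using kzD(3)[OF assms(1)] by simp
  fix J M assume "shift \<alpha> \<nu> J M \<noteq> 0"
  then have *: "\<alpha> \<subseteq># M" "\<nu> J (M - \<alpha>) \<noteq> 0" by (auto simp: shift_def split: if_splits)
  have J: "J \<subseteq> NU" "M - \<alpha> \<in> U" using kzD(1,2)[OF assms(1) *(2)] .
  have M: "M = \<alpha> + (M - \<alpha>)" using *(1) by simp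
  have aL: "\<alpha> \<in> L" using TL assms(2) by auto
  have "M \<in> X" using sum_X[OF aL J(2)] M by simp
  moreover have "pL M = \<alpha>" using part_sum(1)[OF aL J(2)] M by simp
  ultimately show "(J, M) \<in> (\<lambda>(J, M). (J, \<alpha> + M)) ` {(J, M). \<nu> J M \<noteq> 0} \<and> J \<subseteq> NU \<and> M \<in> {M \<in> X. pL M \<in> T}"
    using J M *(2) assms(2) by (auto intro!: rev_image_eqI[of "(J, M - \<alpha>)"])
qed

text \<open>
  The coefficient of \<open>\<alpha>\<close> in an element of \<open>K0\<close>; the
  decomposition \<open>K0_decompose\<close> shows that \<open>K0\<close> is a direct sum of
  copies of the complex of the second factor.
\<close>

definition comp where "comp \<alpha> \<nu> = (\<lambda>J M. if M \<in> U then \<nu> J (\<alpha> + M) else 0)" for \<nu> :: "'v kos"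

lemma lin_comp: "kv.lin_op (comp \<alpha>)"
  by (simp add: kv.lin_op_def comp_def fun_eq_iff)

lemma comp_kz: assumes "\<nu> \<in> K0" shows "comp \<alpha> \<nu> \<in> kz U NU"
proof (rule kzI)
  show "finite ((\<lambda>(J, M). (J, M - \<alpha>)) ` {(J, M). \<nu> J M \<noteq> 0})"
    using kzD(3)[OF assms[unfolded K0_def]] by simp
  fix J M assume "comp \<alpha> \<nu> J M \<noteq> 0"
  then have *: "M \<in> U" "\<nu> J (\<alpha> + M) \<noteq> 0" by (auto simp: comp_def split: if_splits)
  then show "(J, M) \<in> (\<lambda>(J, M). (J, M - \<alpha>)) ` {(J, M). \<nu> J M \<noteq> 0} \<and> J \<subseteq> NU \<and> M \<in> U"
    using kzD(1)[OF assms[unfolded K0_def] *(2)] by (auto intro!: rev_image_eqI[of "(J, \<alpha> + M)"])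
qed

lemma comp_shift:
  assumes "\<nu> \<in> kz U NU" "\<alpha> \<in> L" "\<beta> \<in> L"
  shows "comp \<alpha> (shift \<beta> \<nu>) = (if \<alpha> = \<beta> then \<nu> else 0)"
proof (intro ext)
  fix J M
  show "comp \<alpha> (shift \<beta> \<nu>) J M = (if \<alpha> = \<beta> then \<nu> else 0) J M"
  proof (cases "M \<in> U \<and> \<beta> \<subseteq># \<alpha> + M \<and> \<nu> J (\<alpha> + M - \<beta>) \<noteq> 0")
    case True
    then have u: "\<alpha> + M - \<beta> \<in> U" using kzD(2)[OF assms(1)] by blast
    have "\<alpha> + M = \<beta> + (\<alpha> + M - \<beta>)" using True by simp
    then have "\<alpha> = \<beta>" using part_sum(1)[OF assms(2), of M] part_sum(1)[OF assms(3) u] True by metis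
    then show ?thesis using True by (simp add: comp_def shift_def)
  next
    case False
    then have "\<alpha> = \<beta> ==> \<nu> J M = 0" using kzD(2)[OF assms(1), of J M] by auto
    then show ?thesis using False by (auto simp: comp_def shift_def)
  qed
qed

lemma K0_decompose:
  assumes "\<nu> \<in> K0"
  obtains A where "finite A" "A \<subseteq> T" "\<nu> = (\<Sum>\<alpha>\<in>A. shift \<alpha> (comp \<alpha> \<nu>))"
proof
  let ?A = "(\<lambda>(J, M). pL M) ` {(J, M). \<nu> J M \<noteq> 0}"
  note k = assms[unfolded K0_def]
  show fin: "finite ?A" using kzD(3)[OF k] by simp
  show "?A \<subseteq> T" using kzD(2)[OF k] by auto
  show "\<nu> = (\<Sum>\<alpha>\<in>?A. shift \<alpha> (comp \<alpha> \<nu>))"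
  proof (intro ext)
    fix J M
    have "shift \<alpha> (comp \<alpha> \<nu>) J M = (if \<alpha> = pL M then \<nu> J M else 0)" if "\<alpha> \<in> ?A" for \<alpha>
    proof -
      have aL: "\<alpha> \<in> L" using that kzD(2)[OF k] TL by auto
      show ?thesis
      proof (cases "\<alpha> \<subseteq># M \<and> M - \<alpha> \<in> U")
        case True
        then have "pL M = \<alpha>" using part_sum(1)[OF aL, of "M - \<alpha>"] by simp
        then show ?thesis using True by (simp add: shift_def comp_def)
      next
        case False
        have "\<nu> J M = 0" if "\<alpha> = pL M"
        proof (rule ccontr)
          assume "\<nu> J M \<noteq> 0"
          then have "M \<in> X" using kzD(2)[OF k] by blast
          then have "pU M \<in> U" by (simp add: X_iff)
          moreover have "\<alpha> \<subseteq># M" "M - \<alpha> = pU M" using that parts[of M]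
            by (metis mset_subset_eq_add_left, metis add_diff_cancel_left')
          ultimately show False using False by simp
        qed
        then show ?thesis using False by (auto simp: shift_def comp_def)
      qed
    qed
    then have "(\<Sum>\<alpha>\<in>?A. shift \<alpha> (comp \<alpha> \<nu>)) J M = (\<Sum>\<alpha>\<in>?A. if \<alpha> = pL M then \<nu> J M else 0)"
      unfolding sum_kos_apply by (intro sum.cong) auto
    also have "\<dots> = \<nu> J M"
    proof (cases "\<nu> J M = 0")
      case False
      then have "pL M \<in> ?A" by force
      then show ?thesis using fin by simp
    qed (auto intro: sum.neutral)
    finally show "\<nu> J M = (\<Sum>\<alpha>\<in>?A. shift \<alpha> (comp \<alpha> \<nu>)) J M" by simp
  qed
qed

lemma hom_basis_tensor:
  assumes h: "hom_basis c U NU I s"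
  shows "hom_basis c X N (T \<times> I) (\<lambda>(\<alpha>, i). shift \<alpha> (s i))"
proof (rule kv.hbasis_quasi_iso[where K = "kz X N" and ?K0.0 = K0])
  show "kv.cpx d (kz X N)" by (rule cpx_dk[OF finN okX])
  show "kv.subspace K0" by (rule K0_subspace)
  show "K0 \<subseteq> kz X N" by (rule K0_kz)
  show "d x \<in> K0" if "x \<in> K0" for x using that by (rule K0_closed)
  show "\<exists>\<eta>\<in>kz X N. z - d \<eta> \<in> K0" if "z \<in> kz X N" "d z \<in> K0" for z using that by (rule acyclic)
  let ?s = "\<lambda>(\<alpha>, i). shift \<alpha> (s i)"
  have sU: "s i \<in> kz U NU" if "i \<in> I" for i by (rule kv.hbasisD(1)[OF h that])
  show "kv.hbasis d K0 (T \<times> I) ?s" unfolding kv.hbasis_def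
  proof (intro conjI ballI impI)
    fix t assume "t \<in> T \<times> I"
    then obtain \<alpha> i where t: "t = (\<alpha>, i)" "\<alpha> \<in> T" "i \<in> I" by auto
    then show "?s t \<in> K0" using shift_K0 sU by simp
    have aL: "\<alpha> \<in> L" using t(2) TL by auto
    show "d (?s t) = 0"
      using shift_dk[OF sU[OF t(3)] aL] kv.hbasisD(2)[OF h t(3)] kv.lin_opD(3)[OF lin_shift, of \<alpha>] t(1)
      by simp
  next
    fix e \<eta> assume e: "e \<in> coefs (T \<times> I)" "\<eta> \<in> K0" "kv.lc ?s e = d \<eta>"
    have fine: "finite {t. e t \<noteq> 0}" using e(1) by (simp add: coefs_def)
    obtain A where A: "finite A" "A \<subseteq> T" "\<eta> = (\<Sum>\<alpha>\<in>A. shift \<alpha> (comp \<alpha> \<eta>))"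
      using K0_decompose[OF e(2)] .
    have dA: "d \<eta> = (\<Sum>\<beta>\<in>A. shift \<beta> (dk c U NU (comp \<beta> \<eta>)))"
      by (subst A(3), unfold dk_lin) (use A(2) TL shift_dk[OF comp_kz[OF e(2)]] in \<open>auto intro!: sum.cong\<close>)
    show "e = (\<lambda>_. 0)"
    proof
      fix t show "e t = 0"
      proof (cases "t \<in> T \<times> I")
        case False then show ?thesis by (rule coefs_outside[OF e(1)])
      next
        case True
        then obtain \<alpha> i where t: "t = (\<alpha>, i)" "\<alpha> \<in> T" "i \<in> I" by auto
        have aL: "\<alpha> \<in> L" using t TL by auto
        have "comp \<alpha> (d \<eta>) = (\<Sum>\<beta>\<in>A. comp \<alpha> (shift \<beta> (dk c U NU (comp \<beta> \<eta>))))"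
          unfolding dA by (rule kv.lin_opD(6)[OF lin_comp])
        also have "\<dots> = (\<Sum>\<beta>\<in>A. if \<alpha> = \<beta> then dk c U NU (comp \<alpha> \<eta>) else 0)"
          using A(2) TL comp_shift[OF dk_kz[OF fin(2) okU comp_kz[OF e(2)]] aL] by (intro sum.cong) auto
        also have "\<dots> = dk c U NU (if \<alpha> \<in> A then comp \<alpha> \<eta> else 0)" using A(1) by (simp add: dk_lin)
        finally have 1: "comp \<alpha> (d \<eta>) = dk c U NU (if \<alpha> \<in> A then comp \<alpha> \<eta> else 0)" .
        have c1: "(\<lambda>i. e (\<alpha>, i)) \<in> coefs I"
        proof -
          have "{i. e (\<alpha>, i) \<noteq> 0} \<subseteq> snd ` {t. e t \<noteq> 0}" by force
          then show ?thesis using e(1) fine finite_surj by (auto simp: coefs_def)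
        qed
        have "comp \<alpha> (kv.lc ?s e) = kv.lc (\<lambda>t. comp \<alpha> (?s t)) e" by (rule kv.lin_op_lc[OF lin_comp])
        also have "\<dots> = (\<Sum>t | e t \<noteq> 0. if fst t = \<alpha> then smul (e t) (s (snd t)) else 0)"
          unfolding kv.lc_def
        proof (intro sum.cong refl)
          fix t assume "t \<in> {t. e t \<noteq> 0}"
          then have "t \<in> T \<times> I" using e(1) by (auto simp: coefs_def)
          then obtain \<beta> j where "t = (\<beta>, j)" "\<beta> \<in> L" "j \<in> I" using TL by auto
          then show "smul (e t) (comp \<alpha> (?s t)) = (if fst t = \<alpha> then smul (e t) (s (snd t)) else 0)"
            using comp_shift[OF sU aL] by auto
        qed
        also have "\<dots> = (\<Sum>t\<in>{t. e t \<noteq> 0} \<inter> {t. fst t = \<alpha>}. smul (e t) (s (snd t)))"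
          using fine by (simp add: sum.inter_restrict)
        also have "\<dots> = kv.lc s (\<lambda>i. e (\<alpha>, i))" unfolding kv.lc_def
          by (rule sum.reindex_bij_witness[of _ "\<lambda>i. (\<alpha>, i)" snd]) auto
        finally have 2: "kv.lc s (\<lambda>i. e (\<alpha>, i)) = dk c U NU (if \<alpha> \<in> A then comp \<alpha> \<eta> else 0)"
          using 1 e(3) by simp
        have "(if \<alpha> \<in> A then comp \<alpha> \<eta> else 0) \<in> kz U NU"
          by (cases "\<alpha> \<in> A") (simp_all only: if_True if_False comp_kz[OF e(2)] kv.subspace_0[OF kz_subspace])
        then show ?thesis using kv.hbasisD(3)[OF h c1 _ 2] t(1) by simp
      qed
    qed
  next
    fix z assume z: "z \<in> K0" "d z = 0"
    obtain A where A: "finite A" "A \<subseteq> T" "z = (\<Sum>\<alpha>\<in>A. shift \<alpha> (comp \<alpha> z))" using K0_decompose[OF z(1)] .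
    have dA: "d z = (\<Sum>\<beta>\<in>A. shift \<beta> (dk c U NU (comp \<beta> z)))"
      by (subst A(3), unfold dk_lin) (use A(2) TL shift_dk[OF comp_kz[OF z(1)]] in \<open>auto intro!: sum.cong\<close>)
    have "\<exists>e \<eta>. e \<in> coefs I \<and> \<eta> \<in> kz U NU \<and> comp \<alpha> z = dk c U NU \<eta> + kv.lc s e" if a: "\<alpha> \<in> A" for \<alpha>
    proof -
      have aL: "\<alpha> \<in> L" using a A TL by auto
      have "comp \<alpha> (d z) = (\<Sum>\<beta>\<in>A. comp \<alpha> (shift \<beta> (dk c U NU (comp \<beta> z))))"
        unfolding dA by (rule kv.lin_opD(6)[OF lin_comp])
      also have "\<dots> = (\<Sum>\<beta>\<in>A. if \<alpha> = \<beta> then dk c U NU (comp \<alpha> z) else 0)"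
        using A(2) TL comp_shift[OF dk_kz[OF fin(2) okU comp_kz[OF z(1)]] aL] by (intro sum.cong) auto
      also have "\<dots> = dk c U NU (comp \<alpha> z)" using A(1) a by simp
      finally have "dk c U NU (comp \<alpha> z) = 0" using z(2) kv.lin_opD(3)[OF lin_comp] by simp
      then show ?thesis using kv.hbasisD(4)[OF h comp_kz[OF z(1)]] by blast
    qed
    then obtain e \<eta> where e: "\<And>\<alpha>. \<alpha> \<in> A ==> e \<alpha> \<in> coefs I" "\<And>\<alpha>. \<alpha> \<in> A ==> \<eta> \<alpha> \<in> kz U NU"
      "\<And>\<alpha>. \<alpha> \<in> A ==> comp \<alpha> z = dk c U NU (\<eta> \<alpha>) + kv.lc s (e \<alpha>)" by metis
    define E where "E = (\<lambda>\<alpha> t. if fst t = \<alpha> then e \<alpha> (snd t) else 0)"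
    have E: "E \<alpha> \<in> coefs (T \<times> I)" if "\<alpha> \<in> A" for \<alpha>
    proof -
      have "{t. E \<alpha> t \<noteq> 0} = Pair \<alpha> ` {i. e \<alpha> i \<noteq> 0}" by (auto simp: E_def)
      then show ?thesis using e(1)[OF that] that A(2) by (auto simp: coefs_def)
    qed
    have lcE: "kv.lc ?s (E \<alpha>) = shift \<alpha> (kv.lc s (e \<alpha>))" for \<alpha>
    proof -
      have "kv.lc ?s (E \<alpha>) = (\<Sum>i | e \<alpha> i \<noteq> 0. smul (e \<alpha> i) (shift \<alpha> (s i)))" unfolding kv.lc_def
        by (rule sum.reindex_bij_witness[of _ "\<lambda>i. (\<alpha>, i)" snd]) (auto simp: E_def split: if_splits)
      then show ?thesis using kv.lin_op_lc[OF lin_shift, of \<alpha> s "e \<alpha>"] by (simp add: kv.lc_def)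
    qed
    have "z = (\<Sum>\<alpha>\<in>A. shift \<alpha> (dk c U NU (\<eta> \<alpha>)) + shift \<alpha> (kv.lc s (e \<alpha>)))"
      by (subst A(3), intro sum.cong refl) (simp add: e(3) kv.lin_opD(1)[OF lin_shift])
    also have "\<dots> = (\<Sum>\<alpha>\<in>A. d (shift \<alpha> (\<eta> \<alpha>))) + (\<Sum>\<alpha>\<in>A. kv.lc ?s (E \<alpha>))"
      using A(2) TL shift_dk[OF e(2)] by (auto simp: sum.distrib lcE intro!: sum.cong)
    also have "(\<Sum>\<alpha>\<in>A. kv.lc ?s (E \<alpha>)) = kv.lc ?s (\<lambda>t. \<Sum>\<alpha>\<in>A. E \<alpha> t)"
      by (rule kv.lc_sum[OF E, symmetric])
    also have "(\<Sum>\<alpha>\<in>A. d (shift \<alpha> (\<eta> \<alpha>))) = d (\<Sum>\<alpha>\<in>A. shift \<alpha> (\<eta> \<alpha>))" by (simp add: dk_lin)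
    finally have "z = d (\<Sum>\<alpha>\<in>A. shift \<alpha> (\<eta> \<alpha>)) + kv.lc ?s (\<lambda>t. \<Sum>\<alpha>\<in>A. E \<alpha> t)" .
    moreover have "(\<lambda>t. \<Sum>\<alpha>\<in>A. E \<alpha> t) \<in> coefs (T \<times> I)" by (rule coefs_sum[OF E])
    moreover have "(\<Sum>\<alpha>\<in>A. shift \<alpha> (\<eta> \<alpha>)) \<in> K0"
      by (rule kv.subspace_sum[OF K0_subspace]) (use A(2) shift_K0[OF e(2)] in auto)
    ultimately show "\<exists>e\<in>coefs (T \<times> I). \<exists>\<eta>\<in>K0. z = d \<eta> + kv.lc ?s e" by (intro bexI)
  qed
qed

end

section \<open>Adjoining and changing linear forms\<close>

definition supp_in :: "'v set set => 'v multiset set" where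
  "supp_in \<S> = {M. set_mset M \<in> \<S>}"

lemma supp_in_iff [simp]: "M \<in> supp_in \<S> \<longleftrightarrow> set_mset M \<in> \<S>"
  by (simp add: supp_in_def)

lemma okX_supp_in:
  assumes "finite V" "\<And>S. S \<in> \<S> ==> S \<subseteq> V"
    and "\<And>A B C. A \<in> \<S> ==> C \<in> \<S> ==> A \<subseteq> B ==> B \<subseteq> C ==> B \<in> \<S>"
  shows "okX (supp_in \<S>)"
  unfolding okX_def
proof (intro conjI ballI allI impI)
  show "\<exists>V. finite V \<and> (\<forall>M\<in>supp_in \<S>. set_mset M \<subseteq> V)"
    using assms(1,2) by (intro exI[of _ V] conjI ballI) simp_all
  fix A C B assume "A \<in> supp_in \<S>" "C \<in> supp_in \<S>" "A \<subseteq># B" "B \<subseteq># C"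
  then show "B \<in> supp_in \<S>" using assms(3)[of "set_mset A" "set_mset C" "set_mset B"] set_mset_mono by auto
qed

text \<open>
  Multiplication by \<open>z\<close> maps the powers \<open>z\<^sup>b\<close>, \<open>b \<ge>
  1\<close>, onto those with \<open>b \<ge> 2\<close>, and only \<open>z\<close> itself
  survives.
\<close>

lemma hom_basis_power:
  assumes "c v z \<noteq> 0" shows "hom_basis c (supp_in {{z}}) {v} {{#z#}} mon"
proof -
  let ?X = "supp_in {{z}}" and ?K0 = "kz {{#z#}} {} :: 'a kos set"
  have ok: "okX ?X" by (rule okX_supp_in[of "{z}"]) auto
  have d0: "dk c ?X {v} \<nu> = 0" if "\<nu> \<in> ?K0" for \<nu>
  proof (intro ext)
    fix J M
    have "\<nu> (insert v J) (M - {#u#}) = 0" for u using kzD(1)[OF that, of "insert v J"] by auto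
    then show "dk c ?X {v} \<nu> J M = 0 J M" by (simp add: dk_apply)
  qed
  show ?thesis
  proof (rule kv.hbasis_quasi_iso[where K = "kz ?X {v}" and ?K0.0 = ?K0])
    show "kv.cpx (dk c ?X {v}) (kz ?X {v})" by (rule cpx_dk[OF _ ok]) simp
    show "kv.subspace ?K0" by (rule kz_subspace)
    show "?K0 \<subseteq> kz ?X {v}" by (rule kz_mono) auto
    show "dk c ?X {v} x \<in> ?K0" if "x \<in> ?K0" for x using d0[OF that] kv.subspace_0[OF kz_subspace] by metis
    show "\<exists>\<eta>\<in>kz ?X {v}. y - dk c ?X {v} \<eta> \<in> ?K0" if y: "y \<in> kz ?X {v}" and dy: "dk c ?X {v} y \<in> ?K0" for y
    proof -
      have yv: "y {v} M = 0" for M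
      proof (rule ccontr)
        assume n: "y {v} M \<noteq> 0"
        then have M: "set_mset M = {z}" using kzD(2)[OF y] by auto
        have "dk c ?X {v} y {} (add_mset z M) = c v z * y {v} M" using M by (simp add: dk_apply sg_def)
        then have "add_mset z M = {#z#}" using kzD(2)[OF dy, of "{}" "add_mset z M"] n assms by auto
        then show False using M by simp
      qed
      define \<eta> where "\<eta> = (\<lambda>J M. if J = {v} \<and> M \<in> ?X then y {} (add_mset z M) / c v z else 0)"
      have \<eta>: "\<eta> \<in> kz ?X {v}"
      proof (rule kzI)
        show "finite ((\<lambda>(J, M). ({v}, M - {#z#})) ` {(J, M). y J M \<noteq> 0})" using kzD(3)[OF y] by simp
        fix J M assume "\<eta> J M \<noteq> 0"
        then have "J = {v}" "M \<in> ?X" "y {} (add_mset z M) \<noteq> 0" by (auto simp: \<eta>_def split: if_splits)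
        then show "(J, M) \<in> (\<lambda>(J, M). ({v}, M - {#z#})) ` {(J, M). y J M \<noteq> 0} \<and> J \<subseteq> {v} \<and> M \<in> ?X"
          by (auto intro!: rev_image_eqI[of "({}, add_mset z M)"])
      qed
      have z: "(y - dk c ?X {v} \<eta>) J M = 0" if "\<not> (J = {} \<and> M = {#z#})" for J M
      proof (cases "J = {} \<and> M \<in> ?X")
        case True
        then obtain M' where M': "M = add_mset z M'" by (metis insert_DiffM singletonI singletonD supp_in_iff)
        then have "M' \<noteq> {#}" "set_mset M' \<subseteq> {z}" using True that by auto
        then have "M' \<in> ?X" by (metis singletonI subset_singletonD set_mset_eq_empty_iff supp_in_iff)
        then have "dk c ?X {v} \<eta> {} M = y {} M" using True M' assms by (simp add: dk_apply sg_def \<eta>_def)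
        then show ?thesis using True by simp
      next
        case False
        have "y J M = 0"
        proof (rule ccontr)
          assume n: "y J M \<noteq> 0"
          then have "J \<subseteq> {v}" "M \<in> ?X" using kzD(1,2)[OF y] by auto
          then have "J = {v}" using False by auto
          then show False using n yv by simp
        qed
        moreover have "dk c ?X {v} \<eta> J M = 0"
        proof (rule ccontr)
          assume n: "dk c ?X {v} \<eta> J M \<noteq> 0"
          then have "J \<subseteq> {v}" "M \<in> ?X" using kzD(1,2)[OF dk_kz[OF _ ok \<eta>]] by auto
          then have "J = {v}" using False by auto
          moreover have "dk c ?X {v} \<eta> {v} M = 0" by (simp add: dk_apply)
          ultimately show False using n by simp
        qed
        ultimately show ?thesis by simp
      qed
      have "y - dk c ?X {v} \<eta> \<in> ?K0"
        by (rule kzI[of "{({}, {#z#})}"]) (use z in auto)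
      then show ?thesis using \<eta> by blast
    qed
    show "kv.hbasis (dk c ?X {v}) ?K0 {{#z#}} mon" unfolding kv.hbasis_def
    proof (intro conjI ballI impI)
      fix \<alpha> :: "'a multiset" assume a: "\<alpha> \<in> {{#z#}}"
      show m: "mon \<alpha> \<in> ?K0" by (rule kzI[of "{({}, {#z#})}"]) (use a in \<open>auto simp: mon_def split: if_splits\<close>)
      show "dk c ?X {v} (mon \<alpha>) = 0" by (rule d0[OF m])
    next
      fix e and \<eta> :: "'a kos" assume e: "e \<in> coefs {{#z#}}" "\<eta> \<in> ?K0" "kv.lc mon e = dk c ?X {v} \<eta>"
      have "kv.lc mon e = smul (e {#z#}) (mon {#z#})"
        using e(1) by (subst kv.lc_superset[of "{{#z#}}"]) (auto simp: coefs_def)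
      then have "smul (e {#z#}) (mon {#z#}) {} {#z#} = 0" using e(3) d0[OF e(2)] by (metis zero_fun_apply)
      then have "e {#z#} = 0" by (simp add: mon_def)
      then show "e = (\<lambda>_. 0)" using e(1) coefs_outside[OF e(1)] by (intro ext) (metis singletonD)
    next
      fix y :: "'a kos" assume y: "y \<in> ?K0"
      have "y = dk c ?X {v} 0 + kv.lc mon (y {})" using mon_expand(2)[OF y] dk_lin(3) by (metis add_0)
      then show "\<exists>e\<in>coefs {{#z#}}. \<exists>\<eta>\<in>?K0. y = dk c ?X {v} \<eta> + kv.lc mon e"
        using mon_expand(1)[OF y] kv.subspace_0[OF kz_subspace] by blast
    qed
  qed
qed

text \<open>
  Right multiplication by \<open>\<ell>\<^sub>v\<close> if \<open>v\<close> is larger than all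
  occurring indices; then there is no sign.
\<close>

definition rw :: "nat => 'v kos => 'v kos" where
  "rw v \<nu> = (\<lambda>J M. if v \<in> J then \<nu> (J - {v}) M else 0)"

lemma lin_rw: "kv.lin_op (rw v)"
  by (simp add: kv.lin_op_def rw_def fun_eq_iff)

lemma rw_kz:
  assumes "\<nu> \<in> kz X N" shows "rw v \<nu> \<in> kz X (insert v N)"
proof (rule kzI)
  show "finite ((\<lambda>(J, M). (insert v J, M)) ` {(J, M). \<nu> J M \<noteq> 0})" using kzD(3)[OF assms] by simp
  fix J M assume "rw v \<nu> J M \<noteq> 0"
  then have *: "v \<in> J" "\<nu> (J - {v}) M \<noteq> 0" by (auto simp: rw_def split: if_splits)
  then show "(J, M) \<in> (\<lambda>(J, M). (insert v J, M)) ` {(J, M). \<nu> J M \<noteq> 0} \<and> J \<subseteq> insert v N \<and> M \<in> X"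
    using kzD(1,2)[OF assms *(2)] by (auto intro!: rev_image_eqI[of "(J - {v}, M)"])
qed

lemma dk_adjoin_zero_form:
  assumes fin: "finite N" and v: "\<And>j. j \<in> N ==> j < v" and zero: "\<And>M w. M \<in> X ==> w \<in># M ==> c v w = 0"
  shows "dk c X (insert v N) \<nu> = dk c X N \<nu>"
proof -
  let ?N = "insert v N"
  have finN: "finite ?N" using fin by simp
  have d: "dk c X ?N \<nu> J M = (if M \<in> X then \<Sum>j\<in>N - J. sg j J * (\<Sum>u\<in>set_mset M. c j u * \<nu> (insert j J) (M - {#u#})) else 0)"
    for \<nu> J M
  proof (cases "M \<in> X")
    case True
    have "(\<Sum>j\<in>?N - J. sg j J * (\<Sum>u\<in>set_mset M. c j u * \<nu> (insert j J) (M - {#u#})))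
      = (\<Sum>j\<in>N - J. sg j J * (\<Sum>u\<in>set_mset M. c j u * \<nu> (insert j J) (M - {#u#})))"
      using finN zero[OF True] by (intro sum.mono_neutral_right) (auto intro!: sum.neutral)
    then show ?thesis using True by (simp add: dk_apply[OF finN])
  qed (simp add: dk_apply[OF finN])
  show ?thesis by (intro ext) (simp add: d dk_apply[OF fin])
qed

lemma dk_rw:
  assumes fin: "finite N" and v: "\<And>j. j \<in> N ==> j < v"
  shows "dk c X N (rw v \<nu>) = rw v (dk c X N \<nu>)"
proof -
  have vN: "v \<notin> N" using v by blast
  show ?thesis
  proof (intro ext)
    fix J M
    show "dk c X N (rw v \<nu>) J M = rw v (dk c X N \<nu>) J M"
    proof (cases "v \<in> J")
      case False
      then have "rw v \<nu> (insert j J) M' = 0" if "j \<in> N - J" for j M' using that vN by (auto simp: rw_def)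
      then show ?thesis using False by (simp add: rw_def[of v "dk c X N \<nu>"] dk_apply[OF fin])
    next
      case True
      have "N - (J - {v}) = N - J" using vN by auto
      moreover have "insert j J - {v} = insert j (J - {v})" if "j \<in> N - J" for j using that vN by auto
      ultimately show ?thesis using True v by (simp add: rw_def dk_apply[OF fin])
    qed
  qed
qed

text \<open>
  The complex is the direct sum of the old one and its right multiple by
  \<open>\<ell>\<^sub>v\<close>.
\<close>

lemma hom_basis_adjoin_zero_form:
  assumes fin: "finite N" and v: "\<And>j. j \<in> N ==> j < v" and ok: "okX X"
    and zero: "\<And>M w. M \<in> X ==> w \<in># M ==> c v w = 0"
    and h: "hom_basis c X N I s"
  shows "hom_basis c X (insert v N) (I \<times> UNIV) (\<lambda>(i, b). if b then rw v (s i) else s i)"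
proof -
  let ?N = "insert v N" and ?s = "\<lambda>(i, b). if b then rw v (s i) else s i"
  have vN: "v \<notin> N" using v by blast
  have finN: "finite ?N" using fin by simp
  have d1: "dk c X ?N \<nu> = dk c X N \<nu>" for \<nu> by (rule dk_adjoin_zero_form) (fact fin, fact v, fact zero)
  have d2: "dk c X N (rw v \<nu>) = rw v (dk c X N \<nu>)" for \<nu> by (rule dk_rw) (fact fin, fact v)
  define K2 where "K2 = rw v ` kz X N"
  define p where "p = (\<lambda>\<nu>::'a kos. \<lambda>J M. if v \<in> J then \<nu> J M else 0)"
  have low: "\<nu> J M = 0" if "\<nu> \<in> kz X N" "v \<in> J" for \<nu> :: "'a kos" and J M
    using kzD(1)[OF that(1), of J M] that(2) vN by auto
  have p: "p \<nu> = rw v (\<lambda>J M. if v \<in> J then 0 else \<nu> (insert v J) M)" for \<nu>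
    by (intro ext) (auto simp: p_def rw_def insert_absorb)
  have k1: "(\<lambda>J M. if v \<in> J then 0 else \<nu> (insert v J) M) \<in> kz X N" if "\<nu> \<in> kz X ?N" for \<nu> :: "'a kos"
  proof (rule kzI)
    show "finite ((\<lambda>(J, M). (J - {v}, M)) ` {(J, M). \<nu> J M \<noteq> 0})" using kzD(3)[OF that] by simp
    fix J M assume "(if v \<in> J then 0 else \<nu> (insert v J) M) \<noteq> 0"
    then have *: "v \<notin> J" "\<nu> (insert v J) M \<noteq> 0" by (auto split: if_splits)
    then show "(J, M) \<in> (\<lambda>(J, M). (J - {v}, M)) ` {(J, M). \<nu> J M \<noteq> 0} \<and> J \<subseteq> N \<and> M \<in> X"
      using kzD(1,2)[OF that *(2)] by (auto intro!: rev_image_eqI[of "(insert v J, M)"])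
  qed
  have K2sub: "K2 \<subseteq> kz X ?N" unfolding K2_def using rw_kz by blast
  have hK2: "kv.hbasis (dk c X ?N) K2 I (\<lambda>i. rw v (s i))"
  proof (rule kv.hbasis_iso[OF h lin_rw])
    show "rw v ` kz X N = K2" by (simp add: K2_def)
    show "x = 0" if "x \<in> kz X N" "rw v x = 0" for x
    proof (intro ext)
      fix J M
      have "rw v x (insert v J) M = 0" using that(2) by simp
      then show "x J M = 0 J M" using low[OF that(1), of J M] by (cases "v \<in> J") (auto simp: rw_def)
    qed
    show "rw v (dk c X N x) = dk c X ?N (rw v x)" for x by (simp add: d1 d2)
    show "kv.subspace (kz X N)" by (rule kz_subspace)
    show "kv.lin_op (dk c X N)" by (rule lin_dk)
    show "dk c X N x \<in> kz X N" if "x \<in> kz X N" for x by (rule dk_kz[OF fin ok that])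
  qed
  have K2s: "kv.subspace K2" unfolding K2_def
  proof (rule kv.subspaceI)
    show "0 \<in> rw v ` kz X N"
      by (rule image_eqI[where x = 0]) (simp_all only: kv.lin_opD(3)[OF lin_rw] kv.subspace_0[OF kz_subspace])
    fix x y assume "x \<in> rw v ` kz X N" "y \<in> rw v ` kz X N"
    then obtain x' y' where xy: "x = rw v x'" "y = rw v y'" "x' \<in> kz X N" "y' \<in> kz X N" by blast
    show "x + y \<in> rw v ` kz X N" unfolding xy kv.lin_opD(1)[OF lin_rw, symmetric]
      by (intro imageI kv.subspace_add[OF kz_subspace] xy)
  next
    fix a x assume "x \<in> rw v ` kz X N"
    then obtain x' where x: "x = rw v x'" "x' \<in> kz X N" by blast
    show "smul a x \<in> rw v ` kz X N" unfolding x kv.lin_opD(2)[OF lin_rw, symmetric]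
      by (intro imageI kv.subspace_scale[OF kz_subspace] x)
  qed
  have bij: "bij_betw fst (I \<times> {b}) I" for b :: bool by (auto simp: bij_betw_def inj_on_def)
  have "kv.hbasis (dk c X ?N) (kz X ?N) (I \<times> {False} \<union> I \<times> {True}) ?s"
  proof (rule kv.hbasis_extend[where p = p and ?K1.0 = "kz X N" and ?K2.0 = K2 and T = "{}" and \<rho> = id])
    show "kv.cpx (dk c X ?N) (kz X ?N)" by (rule cpx_dk[OF finN ok])
    show "kz X N \<subseteq> kz X ?N" by (rule kz_mono) auto
    show "dk c X ?N x \<in> kz X N" if "x \<in> kz X N" for x using dk_kz[OF fin ok that] d1 by simp
    show "kv.lin_op p" by (simp add: kv.lin_op_def p_def fun_eq_iff)
    show "p x \<in> K2" if "x \<in> kz X ?N" for x unfolding p K2_def using k1[OF that] by blast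
    show "x - p x \<in> kz X N" if "x \<in> kz X ?N" for x
    proof (rule kzI[OF kzD(3)[OF that]])
      fix J M assume "(x - p x) J M \<noteq> 0"
      then have "v \<notin> J" "x J M \<noteq> 0" by (auto simp: p_def split: if_splits)
      then show "(J, M) \<in> {(J, M). x J M \<noteq> 0} \<and> J \<subseteq> N \<and> M \<in> X" using kzD(1,2)[OF that, of J M] by auto
    qed
    show "p x = 0" if "x \<in> kz X N" for x using low[OF that] by (auto simp: p_def fun_eq_iff)
    show px: "p x = x" if "x \<in> K2" for x using that by (auto simp: p_def K2_def rw_def fun_eq_iff)
    have "kv.hbasis (dk c X ?N) (kz X N) (I \<times> {False}) (\<lambda>i. s (fst i))"
      using kv.hbasis_reindex[OF kv.hbasis_cong[OF h refl, of "dk c X ?N"] bij] d1 by simp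
    then have "kv.hbasis (dk c X ?N) (kz X N) (I \<times> {False}) ?s" by (rule kv.hbasis_cong) auto
    then show "kv.hbasis (dk c X ?N) (kz X N) (I \<times> {False} \<union> id ` {}) ?s"
      by (simp only: image_empty Un_empty_right)
    have "kv.hbasis (dk c X ?N) K2 (I \<times> {True}) (\<lambda>i. rw v (s (fst i)))"
      by (rule kv.hbasis_reindex[OF hK2 bij])
    then have "kv.hbasis (\<lambda>x. p (dk c X ?N x)) K2 (I \<times> {True}) ?s"
    proof (rule kv.hbasis_cong)
      fix x assume "x \<in> K2"
      then obtain y where y: "y \<in> kz X N" "x = rw v y" by (auto simp: K2_def)
      then have "dk c X ?N x \<in> K2" using d1 d2 dk_kz[OF fin ok y(1)] by (auto simp: K2_def)
      then show "dk c X ?N x = p (dk c X ?N x)" using px by simp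
    qed auto
    then show "kv.hbasis (\<lambda>x. p (dk c X ?N x)) K2 (I \<times> {True} \<union> {}) ?s" by (simp only: Un_empty_right)
    show "dk c X ?N (?s i) = 0" if "i \<in> I \<times> {True}" for i
      using that d1 d2 kv.hbasisD(2)[OF h] kv.lin_opD(3)[OF lin_rw] by auto
    show "kv.subspace (kz X N)" by (rule kz_subspace)
    show "kv.subspace K2" "K2 \<subseteq> kz X ?N" by (fact K2s, fact K2sub)
  qed auto
  moreover have "I \<times> {False} \<union> I \<times> {True} = I \<times> UNIV" by auto
  ultimately show ?thesis by simp
qed

lemma iota_kz:
  assumes "\<nu> \<in> kz X N" shows "iota j \<nu> \<in> kz X N"
proof (rule kzI)
  show "finite ((\<lambda>(J, M). (J - {j}, M)) ` {(J, M). \<nu> J M \<noteq> 0})" using kzD(3)[OF assms] by simp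
  fix J M assume "iota j \<nu> J M \<noteq> 0"
  then have *: "j \<notin> J" "\<nu> (insert j J) M \<noteq> 0" by (auto simp: iota_def split: if_splits)
  then show "(J, M) \<in> (\<lambda>(J, M). (J - {j}, M)) ` {(J, M). \<nu> J M \<noteq> 0} \<and> J \<subseteq> N \<and> M \<in> X"
    using kzD(1,2)[OF assms *(2)] by (auto intro!: rev_image_eqI[of "(insert j J, M)"])
qed

lemma eps_kz:
  assumes "\<nu> \<in> kz X N" "j \<in> N" shows "eps j \<nu> \<in> kz X N"
proof (rule kzI)
  show "finite ((\<lambda>(J, M). (insert j J, M)) ` {(J, M). \<nu> J M \<noteq> 0})" using kzD(3)[OF assms(1)] by simp
  fix J M assume "eps j \<nu> J M \<noteq> 0"
  then have *: "j \<in> J" "\<nu> (J - {j}) M \<noteq> 0" by (auto simp: eps_def split: if_splits)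
  then show "(J, M) \<in> (\<lambda>(J, M). (insert j J, M)) ` {(J, M). \<nu> J M \<noteq> 0} \<and> J \<subseteq> N \<and> M \<in> X"
    using kzD(1,2)[OF assms(1) *(2)] assms(2) by (auto intro!: rev_image_eqI[of "(J - {j}, M)"])
qed

lemma eps_eps_same: "eps j (eps j \<nu>) = 0"
  by (intro ext) (simp add: eps_def)

lemma iota_eps_same: "iota j (eps j \<nu>) = \<nu> - eps j (iota j \<nu>)"
  by (intro ext) (auto simp: iota_def eps_def insert_absorb)

lemma iota_eps:
  assumes "fj \<nu>" "i \<noteq> j" shows "iota i (eps j \<nu>) = - eps j (iota i \<nu>)"
proof (intro ext)
  fix J M
  show "iota i (eps j \<nu>) J M = (- eps j (iota i \<nu>)) J M"
  proof (cases "finite J \<and> j \<in> J \<and> i \<notin> J")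
    case True
    have e: "insert i J - {j} = insert i (J - {j})" using assms(2) by auto
    have "sg i J * sg j (insert i J) = - (sg j J * sg i (J - {j}))"
    proof (cases "j < i")
      case True2: True
      have "sg i (insert j (J - {j})) = - sg i (J - {j})" using True True2 by (subst sg_insert) auto
      then have "sg i J = - sg i (J - {j})" using True by (simp add: insert_absorb)
      then show ?thesis using True2 by simp
    next
      case False
      then show ?thesis using True assms(2) by (simp add: sg_insert)
    qed
    then show ?thesis using True e assms(2)
      by (simp add: iota_def eps_def mult.assoc[symmetric])
  next
    case False
    consider "infinite J" | "j \<notin> J" | "i \<in> J" using False by blast
    then show ?thesis
    proof cases
      case 1
      then have "\<nu> (insert i (J - {j})) M = 0" "\<nu> (insert i J - {j}) M = 0"
        using assms(1) unfolding fj_def by auto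
      then show ?thesis using assms(2) by (simp add: iota_def eps_def)
    qed (use assms(2) in \<open>simp_all add: iota_def eps_def\<close>)
  qed
qed

lemma dd_eps:
  assumes "finite N" "fj \<nu>" "t \<in> N"
  shows "dd c N (eps t \<nu>) = fm (c t) \<nu> - eps t (dd c N \<nu>)"
proof -
  have "fm (c j) (iota j (eps t \<nu>)) = (if j = t then fm (c t) \<nu> else 0) - eps t (fm (c j) (iota j \<nu>))" for j
    by (cases "j = t") (simp_all add: iota_eps_same iota_eps[OF assms(2)] fm_lin fm_eps)
  then have "dd c N (eps t \<nu>) = (\<Sum>j\<in>N. if j = t then fm (c t) \<nu> else 0) - (\<Sum>j\<in>N. eps t (fm (c j) (iota j \<nu>)))"
    by (simp add: dd_def sum_subtractf)
  then show ?thesis using assms(1,3) by (simp add: dd_def eps_lin)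
qed

lemma rs_eps: "rs X (eps j \<nu>) = eps j (rs X \<nu>)" by (intro ext) (simp add: rs_def eps_def)
lemma rs_iota: "rs X (iota j \<nu>) = iota j (rs X \<nu>)" by (intro ext) (simp add: rs_def iota_def)

lemma fj_iota: "fj \<nu> ==> fj (iota j \<nu>)" by (auto simp: fj_def iota_def)
lemma fj_eps: "fj \<nu> ==> fj (eps j \<nu>)" by (auto simp: fj_def eps_def)
lemma fj_add: "fj \<nu> ==> fj \<eta> ==> fj (\<nu> + \<eta>)" unfolding fj_def plus_fun_apply by (metis add_0)
lemma fj_diff: "fj \<nu> ==> fj \<eta> ==> fj (\<nu> - \<eta>)" unfolding fj_def kos_minus_apply by (metis diff_zero)
lemma fj_sum: "(\<And>t. t \<in> T ==> fj (f t)) ==> fj (\<Sum>t\<in>T. f t)"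
proof (induction T rule: infinite_finite_induct)
  case (insert t T)
  have "fj (f t)" "fj (sum f T)" using insert.IH insert.prems by blast+
  then show ?case by (simp only: sum.insert[OF insert.hyps] fj_add)
qed (simp_all add: fj_def)

definition isum :: "nat set => 'v kos => 'v kos" where "isum N \<nu> = (\<Sum>j\<in>N. iota j \<nu>)"

lemma isum_isum: assumes "finite N" "fj \<nu>" shows "isum N (isum N \<nu>) = 0"
proof -
  let ?S = "\<Sum>i\<in>N. \<Sum>j\<in>N. iota i (iota j \<nu>)"
  have anti: "iota i (iota j \<nu>) = - iota j (iota i \<nu>)" for i j
    by (cases "i = j") (simp add: iota_same, rule iota_iota[OF assms(2)])
  have "?S = (\<Sum>j\<in>N. \<Sum>i\<in>N. - iota j (iota i \<nu>))"
    by (subst sum.swap) (intro sum.cong refl anti)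
  also have "\<dots> = - ?S" by (simp add: sum_negf)
  finally have e: "?S = - ?S" .
  have "?S J M = 0" for J M using fun_cong[OF fun_cong[OF e, of J], of M] by simp
  then show ?thesis by (intro ext) (simp add: isum_def iota_lin)
qed

lemma dd_isum: assumes "finite N" "N' \<subseteq> N" "fj \<nu>" shows "dd c N (isum N' \<nu>) = - isum N' (dd c N \<nu>)"
proof -
  have anti: "iota i (iota j \<nu>) = - iota j (iota i \<nu>)" for i j
    by (cases "i = j") (simp add: iota_same, rule iota_iota[OF assms(3)])
  have "dd c N (isum N' \<nu>) = (\<Sum>j\<in>N. \<Sum>i\<in>N'. fm (c j) (iota j (iota i \<nu>)))"
    by (simp add: dd_def isum_def iota_lin fm_lin)
  also have "\<dots> = (\<Sum>j\<in>N. \<Sum>i\<in>N'. - iota i (fm (c j) (iota j \<nu>)))"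
  proof (intro sum.cong refl)
    fix i j
    have "fm (c j) (iota j (iota i \<nu>)) = fm (c j) (- iota i (iota j \<nu>))" by (simp only: anti[of j i])
    then show "fm (c j) (iota j (iota i \<nu>)) = - iota i (fm (c j) (iota j \<nu>))" by (simp only: fm_lin fm_iota)
  qed
  also have "\<dots> = - isum N' (dd c N \<nu>)"
    by (subst sum.swap) (simp add: dd_def isum_def iota_lin sum_negf)
  finally show ?thesis .
qed

text \<open>The automorphism of the exterior algebra with \<open>\<ell>\<^sub>j \<mapsto> \<ell>\<^sub>j - \<ell>\<^sub>t\<close> for \<open>j \<in> N\<close> and \<open>\<ell>\<^sub>t \<mapsto> \<ell>\<^sub>t\<close>.\<close>

definition subst_form :: "nat => nat set => 'v kos => 'v kos" where
  "subst_form t N \<nu> = \<nu> - eps t (isum N \<nu>)"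

lemma lin_isum: "kv.lin_op (isum N)"
  unfolding isum_def[abs_def] by (rule lin_sum) (rule lin_iota)

lemmas isum_lin = kv.lin_opD[OF lin_isum]

lemma lin_subst_form: "kv.lin_op (subst_form t N)"
  by (simp add: kv.lin_op_def subst_form_def isum_lin eps_lin algebra_simps kv.scale_right_diff_distrib)

lemma isum_eps:
  assumes "fj \<nu>" "t \<notin> N" shows "isum N (eps t \<nu>) = - eps t (isum N \<nu>)"
proof -
  have "iota j (eps t \<nu>) = - eps t (iota j \<nu>)" if "j \<in> N" for j
    by (rule iota_eps[OF assms(1)]) (use that assms(2) in auto)
  then show ?thesis by (simp add: isum_def eps_lin sum_negf)
qed

lemma subst_form_eps:
  assumes "fj \<nu>" "finite N" "t \<notin> N" "j \<in> N"
  shows "subst_form t N (eps j \<nu>) = eps j (subst_form t N \<nu>) - eps t (subst_form t N \<nu>)"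
proof -
  have "isum N (eps j \<nu>) = (\<Sum>i\<in>N. (if i = j then \<nu> else 0) - eps j (iota i \<nu>))"
    unfolding isum_def by (intro sum.cong refl) (auto simp: iota_eps_same iota_eps[OF assms(1)])
  then have 1: "isum N (eps j \<nu>) = \<nu> - eps j (isum N \<nu>)"
    using assms(2,4) by (simp add: sum_subtractf isum_def eps_lin)
  have 2: "eps t (eps j \<mu>) = - eps j (eps t \<mu>)" if "fj \<mu>" for \<mu> :: "'a kos"
  proof (intro ext)
    fix J M
    have tj: "t \<noteq> j" using assms by auto
    show "eps t (eps j \<mu>) J M = (- eps j (eps t \<mu>)) J M"
    proof (cases "finite J \<and> t \<in> J \<and> j \<in> J")
      case True
      have a: "sg a J = - sg a (J - {b})" if "a \<in> J" "b \<in> J" "b < a" for a b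
      proof -
        have "sg a (insert b (J - {b})) = - sg a (J - {b})" using True that by (subst sg_insert) auto
        then show ?thesis using that by (simp add: insert_absorb)
      qed
      have "sg t J * sg j (J - {t}) = - (sg j J * sg t (J - {j}))"
        using True tj a[of t j] a[of j t] by (cases "j < t") simp_all
      moreover have "J - {t} - {j} = J - {j} - {t}" by auto
      ultimately show ?thesis using True tj by (simp add: eps_def mult.assoc[symmetric])
    next
      case False
      have "\<mu> (J - {t} - {j}) M = 0" "\<mu> (J - {j} - {t}) M = 0" if "\<not> finite J"
        using \<open>fj \<mu>\<close> that by (auto simp: fj_def)
      then show ?thesis using False tj by (auto simp: eps_def)
    qed
  qed
  have fjs: "fj (isum N \<nu>)" unfolding isum_def by (intro fj_sum fj_iota assms(1))
  show ?thesis unfolding subst_form_def 1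
    by (simp add: eps_lin 2[OF fjs] eps_eps_same)
qed

text \<open>
  The automorphism \<open>subst_form\<close> intertwines the differentials of the two systems of
  forms.
\<close>

lemma hom_basis_subst_form:
  assumes fin: "finite N" "t \<notin> N" and ok: "okX X"
    and c': "\<And>j. j \<in> N ==> c' j = (\<lambda>w. c j w - c t w)" "c' t = c t"
    and h: "hom_basis c' X (insert t N) I s"
  shows "hom_basis c X (insert t N) I (\<lambda>i. subst_form t N (s i))"
proof (rule kv.hbasis_iso[OF h lin_subst_form])
  let ?N = "insert t N"
  have finN: "finite ?N" using fin by simp
  have isum_kz: "isum N \<nu> \<in> kz X ?N" if "\<nu> \<in> kz X ?N" for \<nu>
    unfolding isum_def by (intro kv.subspace_sum[OF kz_subspace] iota_kz that)
  have ek: "eps t (isum N \<nu>) \<in> kz X ?N" if "\<nu> \<in> kz X ?N" for \<nu> by (rule eps_kz[OF isum_kz[OF that]]) simp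
  have sk: "subst_form t N \<nu> \<in> kz X ?N" if "\<nu> \<in> kz X ?N" for \<nu>
    unfolding subst_form_def by (rule kv.subspace_diff[OF kz_subspace that ek[OF that]])
  have "isum N (eps t (isum N \<nu>)) = 0" if "\<nu> \<in> kz X ?N" for \<nu>
  proof -
    have "fj (isum N \<nu>)" by (rule fj_kz[OF finN isum_kz[OF that]])
    then have "isum N (eps t (isum N \<nu>)) = - eps t (isum N (isum N \<nu>))" by (rule isum_eps[OF _ fin(2)])
    then show ?thesis using isum_isum[OF fin(1) fj_kz[OF finN that]] by (simp add: eps_lin)
  qed
  then have inv: "subst_form t N (\<nu> + eps t (isum N \<nu>)) = \<nu>"
      "isum N (subst_form t N \<nu>) = isum N \<nu>" if "\<nu> \<in> kz X ?N" for \<nu>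
    using that by (simp_all add: subst_form_def isum_lin eps_lin)
  show "subst_form t N ` kz X ?N = kz X ?N"
  proof
    show "subst_form t N ` kz X ?N \<subseteq> kz X ?N" using sk by auto
    show "kz X ?N \<subseteq> subst_form t N ` kz X ?N"
    proof
      fix \<nu> assume k: "\<nu> \<in> kz X ?N"
      show "\<nu> \<in> subst_form t N ` kz X ?N"
        by (rule image_eqI[where x = "\<nu> + eps t (isum N \<nu>)"])
          (simp_all only: inv(1)[OF k] kv.subspace_add[OF kz_subspace k ek[OF k]])
    qed
  qed
  show "x = 0" if "x \<in> kz X ?N" "subst_form t N x = 0" for x
  proof -
    have "isum N x = 0" using inv(2)[OF that(1)] that(2) isum_lin(3) by metis
    then show ?thesis using that(2) by (simp add: subst_form_def eps_lin)
  qed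
  show "subst_form t N (dk c' X ?N x) = dk c X ?N (subst_form t N x)" if x: "x \<in> kz X ?N" for x
  proof -
    have fx: "fj x" by (rule fj_kz[OF finN x])
    have fs: "fj (isum N x)" by (rule fj_kz[OF finN isum_kz[OF x]])
    have fmd: "fm (c' j) y = fm (c j) y - fm (c t) y" if "j \<in> N" for j y
      by (intro ext) (simp add: fm_def c'(1)[OF that] algebra_simps sum_subtractf)
    have dc': "dd c' ?N x = dd c ?N x - fm (c t) (isum N x)"
    proof -
      have "(\<Sum>j\<in>N. fm (c' j) (iota j x)) = (\<Sum>j\<in>N. fm (c j) (iota j x)) - (\<Sum>j\<in>N. fm (c t) (iota j x))"
        unfolding sum_subtractf[symmetric] by (intro sum.cong refl fmd)
      then show ?thesis using fin by (simp add: dd_def c'(2) isum_def fm_lin)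
    qed
    have ii: "isum N (isum N x) = 0" by (rule isum_isum[OF fin(1) fx])
    have fi: "isum N (fm f y) = fm f (isum N y)" for f y by (simp add: isum_def fm_lin fm_iota)
    have "subst_form t N (dd c' ?N x) = dd c ?N x - fm (c t) (isum N x) - eps t (isum N (dd c ?N x))"
      unfolding subst_form_def dc' by (simp add: isum_lin eps_lin fi ii fm_lin)
    also have "\<dots> = dd c ?N (subst_form t N x)"
      unfolding subst_form_def using dd_eps[OF finN fs, of t c] dd_isum[OF finN, of N x c] fx
      by (simp add: dd_lin eps_lin subset_insertI)
    finally have e: "subst_form t N (dd c' ?N x) = dd c ?N (subst_form t N x)" .
    have "subst_form t N (rs X y) = rs X (subst_form t N y)" for y
      by (simp add: subst_form_def rs_lin rs_eps isum_def rs_iota)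
    then show ?thesis using e by (simp add: dk_def)
  qed
  show "kv.subspace (kz X ?N)" by (rule kz_subspace)
  show "kv.lin_op (dk c' X ?N)" by (rule lin_dk)
  show "dk c' X ?N x \<in> kz X ?N" if "x \<in> kz X ?N" for x by (rule dk_kz[OF finN ok that])
qed

section \<open>Filtrations by sets of monomials\<close>

declare smul_apply [simp del] sum_kos_apply [simp del]

context homology_space
begin

lemma hbasis_inj:
  assumes h: "hbasis d K I s" and d: "lin_op d" and K: "subspace K"
    and ij: "i \<in> I" "j \<in> I" "s i = s j" shows "i = j"
proof (rule ccontr)
  assume n: "i \<noteq> j"
  define c where "c = (\<lambda>k. (if k = i then 1 else 0) + (- 1) * (if k = j then (1::'a) else 0))"
  have "lc s c = lc s (\<lambda>k. if k = i then 1 else 0) + lc s (\<lambda>k. (- 1) * (if k = j then (1::'a) else 0))"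
    unfolding c_def by (rule lc_add[where I = I and J = I]) (intro coefs_scale coefs_single ij)+
  also have "lc s (\<lambda>k. (- 1) * (if k = j then (1::'a) else 0)) = - s j"
    by (subst lc_scale[OF coefs_single[OF ij(2)]]) (simp only: lc_single, simp)
  finally have "lc s c = 0" using ij(3) by simp
  moreover have "c \<in> coefs I" unfolding c_def by (intro coefs_add coefs_scale coefs_single ij)
  ultimately have "c i = 0" using hbasisD(3)[OF h _ subspace_0[OF K]] lin_opD(3)[OF d] by simp
  then show False using n by (simp add: c_def)
qed

lemma hbasis_nonzero:
  assumes h: "hbasis d K I s" and d: "lin_op d" and K: "subspace K" and i: "i \<in> I" shows "s i \<noteq> 0"
proof
  assume "s i = 0"
  then have "lc s (\<lambda>j. if j = i then 1 else 0) = d 0" by (simp add: lin_opD(3)[OF d])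
  from hbasisD(3)[OF h coefs_single[OF i] subspace_0[OF K] this, of i] show False by simp
qed

lemma hbasis_image:
  assumes h: "hbasis d K I s'" and d: "lin_op d" and K: "subspace K" and g: "\<And>i. i \<in> I ==> s (g i) = s' i"
  shows "hbasis d K (g ` I) s"
proof -
  have inj: "inj_on g I" by (rule inj_onI) (metis hbasis_inj[OF h d K] g)
  have "bij_betw (the_inv_into I g) (g ` I) I"
    by (rule bij_betw_the_inv_into) (simp add: bij_betw_def inj)
  from hbasis_reindex[OF h this] show ?thesis
    by (rule hbasis_cong) (auto simp: the_inv_into_f_f[OF inj] g)
qed

end

lemma hom_basis_image:
  assumes "hom_basis c X N I s'" "\<And>i. i \<in> I ==> s (g i) = s' i"
  shows "hom_basis c X N (g ` I) s"
  by (rule kv.hbasis_image[OF assms(1) lin_dk kz_subspace]) (rule assms(2))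

lemma hom_basis_tensor:
  fixes c :: "nat => 'v => rat"
  assumes fin: "finite NL" "finite NU" and dis: "NL \<inter> NU = {}"
    and okX: "okX X" and okL: "okX L" and okU: "okX U"
    and VL: "\<And>M. M \<in> L ==> set_mset M \<subseteq> VL" "\<And>M. M \<in> U ==> set_mset M \<inter> VL = {}"
    and X: "X = {l + u | l u. l \<in> L \<and> u \<in> U}"
    and zero: "\<And>j w. j \<in> NU ==> w \<in> VL ==> c j w = 0"
    and hL: "hom_basis c L NL I1 (\<lambda>i. mon (f i))" and hU: "hom_basis c U NU I2 s"
    and N: "N = NL \<union> NU"
  shows "hom_basis c X N (I1 \<times> I2) (\<lambda>(i, j). shift (f i) (s j))"
proof -
  have "hom_basis c L NL (f ` I1) mon" by (rule hom_basis_image[OF hL]) simp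
  note h1 = this
  interpret ts: tensor_split c VL L U X NL NU "f ` I1"
    by (rule tensor_split.intro[OF fin dis okX okL okU VL(1) VL(2) X zero h1])
  have h: "hom_basis c X (NL \<union> NU) (f ` I1 \<times> I2) (\<lambda>(\<alpha>, i). shift \<alpha> (s i))"
    by (rule ts.hom_basis_tensor[OF hU])
  have "inj_on f I1"
  proof (rule inj_onI)
    fix i j assume ij: "i \<in> I1" "j \<in> I1" "f i = f j"
    show "i = j" by (rule kv.hbasis_inj[OF hL lin_dk kz_subspace ij(1,2)]) (simp add: ij(3))
  qed
  then have "bij_betw (map_prod f id) (I1 \<times> I2) (f ` I1 \<times> I2)"
    by (intro bij_betw_map_prod) (auto simp: bij_betw_def)
  from kv.hbasis_reindex[OF h this] show ?thesis unfolding N by (rule kv.hbasis_cong) auto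
qed

lemma okX_upward:
  assumes ok: "okX X" and X1: "X1 \<subseteq> X"
    and up: "\<And>M u. M \<in> X1 ==> add_mset u M \<in> X ==> add_mset u M \<in> X1"
  shows "okX X1"
  unfolding okX_def
proof (intro conjI ballI allI impI)
  obtain V where "finite V" "\<forall>M\<in>X. set_mset M \<subseteq> V" using ok by (auto simp: okX_def)
  then show "\<exists>V. finite V \<and> (\<forall>M\<in>X1. set_mset M \<subseteq> V)" using X1 by (intro exI[of _ V]) auto
  fix A C B assume AC: "A \<in> X1" "C \<in> X1" "A \<subseteq># B" "B \<subseteq># C"
  have BX: "D \<in> X" if "A \<subseteq># D" "D \<subseteq># C" for D using okX_between[OF ok _ _ that] AC X1 by blast
  have "A + D \<in> X1" if "A + D \<subseteq># C" for D using that
  proof (induction D)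
    case (add x D)
    have "A + D \<subseteq># C" using add.prems
      by (metis add_mset_add_single mset_subset_eq_add_left subset_mset.order_trans union_mset_add_mset_right)
    then show ?case using add up[of "A + D" x] BX[of "A + add_mset x D"] by auto
  qed (use AC in auto)
  then show "B \<in> X1" using AC by (metis subset_mset.add_diff_inverse)
qed

lemma hom_basis_empty: "hom_basis c {} N {} s"
proof -
  have k: "\<nu> = 0" if "\<nu> \<in> kz {} N" for \<nu> :: "'a kos"
    using kzD(2)[OF that] by (intro ext) auto
  show ?thesis unfolding kv.hbasis_def
  proof (intro conjI ballI impI)
    fix e :: "'b => rat" assume "e \<in> coefs {}" then show "e = (\<lambda>_. 0)" by (auto simp: coefs_def)
  next
    fix z :: "'a kos" assume z: "z \<in> kz {} N"
    have "z = dk c {} N z + kv.lc s (\<lambda>_. 0)" using k[OF z] dk_lin(3) by (metis add_0 kv.lc_zero)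
    then show "\<exists>e\<in>coefs {}. \<exists>\<eta>\<in>kz {} N. z = dk c {} N \<eta> + kv.lc s e" using z coefs_zero by blast
  qed auto
qed

text \<open>
  Multiplication by a variable leads from a piece only to itself or to a piece of smaller rank,
  so that the pieces of small rank span subcomplexes. As all elements are cycles of the whole
  complex, nothing cancels.
\<close>

lemma hom_basis_pieces:
  fixes rank :: "'a => nat"
  assumes finA: "finite A" and fin: "finite N" and ok: "okX X" and X: "X = (\<Union>a\<in>A. P a)"
    and dis: "\<And>a b. a \<in> A ==> b \<in> A ==> a \<noteq> b ==> P a \<inter> P b = {}"
    and up: "\<And>a b M u. a \<in> A ==> b \<in> A ==> M \<in> P a ==> add_mset u M \<in> P b ==> a = b \<or> rank b < rank a"
    and h: "\<And>a. a \<in> A ==> hom_basis c (P a) N (I a) s"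
    and cyc: "\<And>a i. a \<in> A ==> i \<in> I a ==> dk c X N (s i) = 0"
  shows "hom_basis c X N (\<Union>a\<in>A. I a) s"
  using finA ok X dis up h cyc
proof (induction "card A" arbitrary: A X)
  case 0
  then have A: "A = {}" by simp
  show ?case unfolding 0(4) A UN_empty by (rule hom_basis_empty)
next
  case (Suc m)
  note A = Suc.prems
  have "A \<noteq> {}" using Suc.hyps(2) by auto
  then have "Max (rank ` A) \<in> rank ` A" using A(1) by simp
  then obtain a where a: "a \<in> A" "rank a = Max (rank ` A)" by auto
  have amax: "rank b \<le> rank a" if "b \<in> A" for b using a(2) A(1) that by simp
  define A' where "A' = A - {a}"
  define X1 where "X1 = (\<Union>b\<in>A'. P b)"
  have XX: "X = X1 \<union> P a" "X1 \<inter> P a = {}"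
  proof -
    show "X = X1 \<union> P a" using A(3) a(1) unfolding X1_def A'_def by blast
    show "X1 \<inter> P a = {}" using A(4)[OF _ a(1)] unfolding X1_def A'_def by blast
  qed
  have up1: "add_mset u M \<in> X1" if MX: "M \<in> X1" "add_mset u M \<in> X" for M u
  proof (rule ccontr)
    assume "add_mset u M \<notin> X1"
    then have "add_mset u M \<in> P a" using MX XX by auto
    moreover obtain b where "b \<in> A'" "M \<in> P b" using MX(1) unfolding X1_def by blast
    ultimately have "b = a \<or> rank a < rank b" using A(5)[of b a M u] a(1) by (auto simp: A'_def)
    then show False using \<open>b \<in> A'\<close> amax by (force simp: A'_def)
  qed
  have X1X: "X1 \<subseteq> X" using XX by auto
  have h1: "hom_basis c X1 N (\<Union>b\<in>A'. I b) s"
  proof (rule Suc.hyps(1))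
    show "m = card A'" using Suc.hyps(2) a(1) A(1) by (simp add: A'_def)
    show "okX X1" by (rule okX_upward[OF A(2) X1X up1])
    fix b i assume bi: "b \<in> A'" "i \<in> I b"
    have "s i \<in> kz (P b) N" using A(6)[of b] bi by (auto intro: kv.hbasisD(1) simp: A'_def)
    then have "s i \<in> kz X1 N" using kz_mono[of "P b" X1 N N] bi(1) by (auto simp: X1_def)
    then have "dk c X1 N (s i) = dk c X N (s i)"
      using dk_upward_closed[OF fin _ X1X up1] by simp
    then show "dk c X1 N (s i) = 0" using A(7) bi by (auto simp: A'_def)
  qed (use A in \<open>auto simp: A'_def X1_def\<close>)
  have ha: "hom_basis c (P a) N (I a) s" by (rule A(6)[OF a(1)])
  have disI: "(\<Union>b\<in>A'. I b) \<inter> I a = {}"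
  proof (rule ccontr)
    assume "\<not> ?thesis"
    then obtain i where i: "i \<in> (\<Union>b\<in>A'. I b)" "i \<in> I a" by blast
    have 1: "s i \<in> kz X1 N" and 2: "s i \<in> kz (P a) N"
      using kv.hbasisD(1)[OF h1 i(1)] kv.hbasisD(1)[OF ha i(2)] .
    have "s i J M = 0" for J M using kzD(2)[OF 1, of J M] kzD(2)[OF 2, of J M] XX(2) by blast
    then have "s i = 0" by (intro ext) simp
    then show False using kv.hbasis_nonzero[OF ha lin_dk kz_subspace i(2)] by simp
  qed
  have "hom_basis c X N ((\<Union>b\<in>A'. I b) \<union> I a) s"
    by (rule hom_basis_extend[where T = "{}" and \<rho> = id, OF fin A(2) XX up1])
      (use h1 ha disI A(7) a(1) in auto)
  moreover have "(\<Union>b\<in>A'. I b) \<union> I a = (\<Union>b\<in>A. I b)" using a(1) by (auto simp: A'_def)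
  ultimately show ?case by simp
qed

subsection \<open>Wedge products\<close>

text \<open>
  \<open>wlist f U\<close> applies the operators \<open>f u\<close>, \<open>u \<in> U\<close>,
  the largest \<open>u\<close> first. With \<open>f = lf E\<close>, where the successor of the
  largest element of \<open>E\<close> counts as zero, this is the multiplication by the wedge of
  the \<open>\<ell>\<^sub>u - \<ell>\<^bsub>succ(u)\<^esub>\<close>.
\<close>

definition wlist :: "(nat => 'v kos => 'v kos) => nat set => 'v kos => 'v kos" where
  "wlist f U \<nu> = foldr f (sorted_list_of_set U) \<nu>"

definition lf :: "nat set => nat => 'v kos => 'v kos" where
  "lf E u \<nu> = (if \<exists>w\<in>E. u < w then eps u \<nu> - eps (succ_in E u) \<nu> else eps u \<nu>)"

lemma wlist_empty [simp]: "wlist f {} \<nu> = \<nu>" by (simp add: wlist_def)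

lemma wlist_invariant:
  assumes "finite U" "P \<nu>" "\<And>u \<nu>. u \<in> U ==> P \<nu> ==> P (f u \<nu>)" shows "P (wlist f U \<nu>)"
proof -
  have "P (foldr f xs \<nu>)" if "set xs \<subseteq> U" for xs using that by (induction xs) (auto intro: assms)
  then show ?thesis using assms(1) by (simp add: wlist_def)
qed

lemma wlist_commute:
  assumes "finite U" "P \<nu>" "\<And>u \<nu>. u \<in> U ==> P \<nu> ==> P (f u \<nu>)"
    and "\<And>u \<nu>. u \<in> U ==> P \<nu> ==> \<Phi> (f u \<nu>) = g u (\<Phi> \<nu>)"
  shows "\<Phi> (wlist f U \<nu>) = wlist g U (\<Phi> \<nu>)"
proof -
  have "P (foldr f xs \<nu>) \<and> \<Phi> (foldr f xs \<nu>) = foldr g xs (\<Phi> \<nu>)" if "set xs \<subseteq> U" for xs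
    using that
  proof (induction xs)
    case (Cons u xs)
    then have "u \<in> U" "P (foldr f xs \<nu>)" "\<Phi> (foldr f xs \<nu>) = foldr g xs (\<Phi> \<nu>)" by auto
    then show ?case using assms(3,4)[of u "foldr f xs \<nu>"] by simp
  qed (simp add: assms(2))
  then show ?thesis using assms(1) by (simp add: wlist_def)
qed

lemma wlist_insert_max:
  assumes "finite U" "\<And>u. u \<in> U ==> u < v" shows "wlist f (insert v U) \<nu> = wlist f U (f v \<nu>)"
proof -
  have "sorted_list_of_set (insert v U) = sorted_list_of_set U @ [v]"
    using assms by (intro sorted_list_of_set_unique[THEN iffD1])
      (auto simp: sorted_wrt_append strict_sorted_iff[symmetric] card_insert_if)
  then show ?thesis by (simp add: wlist_def)
qed

lemma wlist_cong: "finite U ==> (\<And>u \<nu>. u \<in> U ==> f u \<nu> = g u \<nu>) ==> wlist f U \<nu> = wlist g U \<nu>"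
  using wlist_commute[where P = "\<lambda>_. True" and \<Phi> = id and f = f and g = g] by simp

lemma succ_in:
  assumes "finite E" "\<exists>w\<in>E. u < w" shows "succ_in E u \<in> E" "u < succ_in E u"
proof -
  have "Min {v \<in> E. u < v} \<in> {v \<in> E. u < v}" using assms by (intro Min_in) auto
  then show "succ_in E u \<in> E" "u < succ_in E u" by (auto simp: succ_in_def)
qed

lemma succ_in_insert_greater:
  assumes "finite E" "\<exists>w\<in>E. u < w" "\<And>w. w \<in> E ==> w < t"
  shows "succ_in (insert t E) u = succ_in E u"
proof -
  have 1: "{v \<in> insert t E. u < v} = insert t {v \<in> E. u < v}" using assms by force
  have "Min (insert t {v \<in> E. u < v}) = min t (Min {v \<in> E. u < v})"
    using assms by (intro Min_insert) auto
  also have "\<dots> = Min {v \<in> E. u < v}"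
    using assms(3)[OF succ_in(1)[OF assms(1,2)]] by (simp add: succ_in_def)
  finally show ?thesis unfolding succ_in_def 1 .
qed

lemma succ_in_insert_last:
  assumes "\<not> (\<exists>w\<in>E. u < w)" "u < t" shows "succ_in (insert t E) u = t"
proof -
  have "{v \<in> insert t E. u < v} = {t}" using assms by auto
  then show ?thesis by (simp add: succ_in_def)
qed

lemma lin_lf: "kv.lin_op (lf E u)"
  by (simp add: kv.lin_op_def lf_def eps_lin algebra_simps kv.scale_right_diff_distrib)

lemma lin_wlist: "(\<And>u. kv.lin_op (f u)) ==> kv.lin_op (wlist f U)"
proof -
  assume f: "\<And>u. kv.lin_op (f u)"
  have "kv.lin_op (foldr f xs)" for xs
  proof (induction xs)
    case Nil show ?case unfolding kv.lin_op_def by simp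
  next
    case (Cons x xs)
    have "foldr f (x # xs) = (\<lambda>\<nu>. f x (foldr f xs \<nu>))" by auto
    then show ?case using kv.lin_op_comp[OF f Cons] by simp
  qed
  then show ?thesis by (simp add: wlist_def[abs_def])
qed

lemma lf_kz: "finite E ==> E \<subseteq> N ==> u \<in> E ==> \<nu> \<in> kz X N ==> lf E u \<nu> \<in> kz X N"
  unfolding lf_def using succ_in(1)[of E u]
  by (auto intro!: kv.subspace_diff[OF kz_subspace] eps_kz)

lemma shift_eps: "shift \<alpha> (eps j \<nu>) = eps j (shift \<alpha> \<nu>)"
  by (intro ext) (simp add: shift_def eps_def)

lemma shift_lf: "shift \<alpha> (lf E u \<nu>) = lf E u (shift \<alpha> \<nu>)"
  by (simp add: lf_def shift_eps kv.lin_opD(5)[OF lin_shift])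

lemma rw_eps:
  assumes "j < v" shows "rw v (eps j \<nu>) = eps j (rw v \<nu>)"
proof (intro ext)
  fix J M
  have "J - {v} - {j} = J - {j} - {v}" by auto
  then show "rw v (eps j \<nu>) J M = eps j (rw v \<nu>) J M" using assms by (auto simp: rw_def eps_def)
qed

lemma fj_mon: "fj (mon \<alpha>)" by (simp add: fj_def mon_def)

lemma fj_lf: "fj \<nu> ==> fj (lf E u \<nu>)"
  unfolding lf_def by (auto intro: fj_diff fj_eps)

lemma sg_empty [simp]: "sg v {} = 1"
  by (simp add: sg_def)

lemma rw_mon: "rw v (mon \<alpha>) = eps v (mon \<alpha>)"
proof (intro ext)
  fix J M
  show "rw v (mon \<alpha>) J M = eps v (mon \<alpha>) J M"
    by (cases "J = {v}") (auto simp: rw_def eps_def mon_def)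
qed

lemma mon_kz: "\<alpha> \<in> X ==> mon \<alpha> \<in> kz X N"
  by (rule kzI[of "{({}, \<alpha>)}"]) (auto simp: mon_def split: if_splits)

lemma dk_mon: "finite N ==> dk c X N (mon \<alpha>) = 0"
  by (intro ext) (simp add: dk_apply mon_def)

text \<open>
  Each factor \<open>m\<close> preserves cycles \<open>\<omega>\<close> supported on \<open>\<alpha>\<close>: both terms of
  \<open>d (m \<and> \<omega>) = d m \<cdot> \<omega> - m \<and> d \<omega>\<close> vanish.
\<close>

lemma dk_wlist:
  assumes N: "finite N" "finite E" "E \<subseteq> N" and U: "U \<subseteq> N"
    and ann: "\<And>u w. u \<in> U ==> add_mset w \<alpha> \<in> X ==>
      (if \<exists>w\<in>E. u < w then c u w = c (succ_in E u) w else c u w = 0)"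
  shows "dk c X N (wlist (lf E) U (mon \<alpha>)) = 0"
proof -
  have finU: "finite U" using N U finite_subset by auto
  define P where "P = (\<lambda>\<nu>. fj \<nu> \<and> dk c X N \<nu> = 0 \<and> (\<forall>J M. \<nu> J M \<noteq> 0 --> M = \<alpha>))"
  have supp_eps: "M = \<alpha>" if "\<forall>J M. \<nu> J M \<noteq> 0 --> M = \<alpha>" "eps j \<nu> J M \<noteq> 0" for \<nu> j J M
    using that by (auto simp: eps_def split: if_splits)
  have "P (lf E u \<nu>)" if u: "u \<in> U" and k: "P \<nu>" for u \<nu>
  proof -
    have fk: "fj \<nu>" and dk0: "rs X (dd c N \<nu>) = 0" and sk: "\<forall>J M. \<nu> J M \<noteq> 0 --> M = \<alpha>"
      using k by (auto simp: P_def dk_def)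
    have uN: "u \<in> N" using u U by auto
    have de: "dk c X N (eps j \<nu>) = rs X (fm (c j) \<nu>)" if "j \<in> N" for j
      by (simp add: dk_def dd_eps[OF N(1) fk that] rs_lin rs_eps dk0 eps_lin)
    have sk': "\<forall>J M. lf E u \<nu> J M \<noteq> 0 --> M = \<alpha>"
    proof (intro allI impI)
      fix J M assume "lf E u \<nu> J M \<noteq> 0"
      then have "eps u \<nu> J M \<noteq> 0 \<or> eps (succ_in E u) \<nu> J M \<noteq> 0" by (auto simp: lf_def split: if_splits)
      then show "M = \<alpha>" using supp_eps[OF sk] by blast
    qed
    have "dk c X N (lf E u \<nu>) = 0"
    proof (cases "\<exists>w\<in>E. u < w")
      case True
      then have "succ_in E u \<in> N" using succ_in(1)[OF N(2)] N(3) by auto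
      then have "dk c X N (lf E u \<nu>) = rs X (fm (c u) \<nu>) - rs X (fm (c (succ_in E u)) \<nu>)"
        using True de uN by (simp add: lf_def dk_lin)
      also have "\<dots> = 0"
      proof (intro ext)
        fix J M
        have "c u w * \<nu> J (M - {#w#}) = c (succ_in E u) w * \<nu> J (M - {#w#})" if "M \<in> X" "w \<in># M" for w
        proof (cases "\<nu> J (M - {#w#}) = 0")
          case False
          then have "add_mset w \<alpha> = M" using sk that(2) by (metis insert_DiffM)
          then show ?thesis using ann[OF u, of w] True that(1) by simp
        qed simp
        then have "M \<in> X ==> fm (c u) \<nu> J M = fm (c (succ_in E u)) \<nu> J M"
          unfolding fm_def by (intro sum.cong) auto
        then show "(rs X (fm (c u) \<nu>) - rs X (fm (c (succ_in E u)) \<nu>)) J M = 0 J M"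
          by (simp add: rs_def)
      qed
      finally show ?thesis .
    next
      case False
      then have "dk c X N (lf E u \<nu>) = rs X (fm (c u) \<nu>)" using de uN by (simp add: lf_def)
      also have "\<dots> = 0"
      proof (intro ext)
        fix J M
        have "c u w * \<nu> J (M - {#w#}) = 0" if "M \<in> X" "w \<in># M" for w
        proof (cases "\<nu> J (M - {#w#}) = 0")
          case F: False
          then have "add_mset w \<alpha> = M" using sk that(2) by (metis insert_DiffM)
          then show ?thesis using ann[OF u, of w] False that(1) by simp
        qed simp
        then have "M \<in> X ==> fm (c u) \<nu> J M = 0" unfolding fm_def by (intro sum.neutral) auto
        then show "rs X (fm (c u) \<nu>) J M = 0 J M" by (simp add: rs_def)
      qed
      finally show ?thesis .
    qed
    then show "P (lf E u \<nu>)" using fj_lf[OF fk] sk' by (simp add: P_def)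
  qed
  moreover have "P (mon \<alpha>)" using fj_mon dk_mon[OF N(1)] by (auto simp: P_def mon_def)
  ultimately have "P (wlist (lf E) U (mon \<alpha>))" by (intro wlist_invariant[where P = P, OF finU])
  then show ?thesis by (simp add: P_def)
qed

lemma dk_eps_mon:
  assumes "finite N" "v \<in> N"
  shows "dk c X N (eps v (mon \<alpha>)) J M =
    (if J = {} \<and> M \<in> X then \<Sum>u\<in>set_mset M. if M = add_mset u \<alpha> then c v u else 0 else 0)"
proof -
  have "dd c N (mon \<alpha>) = 0"
    by (intro ext) (simp add: dd_apply[OF assms(1)] mon_def)
  then have "dk c X N (eps v (mon \<alpha>)) = rs X (fm (c v) (mon \<alpha>))"
    by (simp add: dk_def dd_eps[OF assms(1) fj_mon assms(2)] eps_lin)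
  moreover have "fm (c v) (mon \<alpha>) J M = (if J = {} then \<Sum>u\<in>set_mset M. if M = add_mset u \<alpha> then c v u else 0 else 0)"
  proof (cases "J = {}")
    case True
    have "c v u * mon \<alpha> J (M - {#u#}) = (if M = add_mset u \<alpha> then c v u else 0)" if "u \<in># M" for u
      using that True by (auto simp: mon_def insert_DiffM)
    then show ?thesis using True by (simp add: fm_def)
  qed (simp add: fm_def mon_def)
  ultimately show ?thesis unfolding rs_def by (cases "J = {}") simp_all
qed

lemma hom_basis_no_forms: "hom_basis c Y {} Y mon"
proof -
  have d0: "dk c Y {} \<nu> = 0" for \<nu> by (intro ext) (simp add: dk_apply)
  show ?thesis unfolding kv.hbasis_def
  proof (intro conjI ballI impI)
    fix e and \<eta> :: "'a kos" assume e: "e \<in> coefs Y" "kv.lc mon e = dk c Y {} \<eta>"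
    show "e = (\<lambda>_. 0)"
    proof
      fix \<alpha>
      have "kv.lc mon e {} \<alpha> = (\<Sum>\<beta> | e \<beta> \<noteq> 0. if \<beta> = \<alpha> then e \<alpha> else 0)"
        unfolding lc_apply by (intro sum.cong) (auto simp: mon_def)
      also have "\<dots> = e \<alpha>" using e(1) by (auto simp: coefs_def)
      finally show "e \<alpha> = 0" using e(2) d0 by simp
    qed
  next
    fix z assume z: "z \<in> kz Y {}"
    have "z = dk c Y {} z + kv.lc mon (z {})" using mon_expand(2)[OF z] d0 by (metis add_0)
    then show "\<exists>e\<in>coefs Y. \<exists>\<eta>\<in>kz Y {}. z = dk c Y {} \<eta> + kv.lc mon e"
      using z mon_expand(1)[OF z] by blast
  qed (auto simp: d0 mon_kz)
qed

section \<open>Skeleta of a simplex\<close>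

datatype var = Yv nat | Xv "nat set"

text \<open>
  The forms \<open>\<Sum>\<^bsub>G \<ni> j\<^esub> x\<^sub>G\<close> on flats, and
  \<open>y\<^sub>j\<close> on elements.
\<close>

definition cy :: "nat => var => rat" where
  "cy j w = (case w of Yv i => if i = j then 1 else 0 | Xv G => if j \<in> G then 1 else 0)"

lemma cy_simps [simp]: "cy j (Yv i) = (if i = j then 1 else 0)" "cy j (Xv G) = (if j \<in> G then 1 else 0)"
  by (simp_all add: cy_def)

definition skX :: "nat set => nat => var multiset set" where
  "skX V k = supp_in {Yv ` S | S. S \<subseteq> V \<and> card S \<le> k}"

text \<open>
  The index \<open>({}, {})\<close> stands for the class of \<open>1\<close>; the other indices
  are those of \<open>\<B>\<^sup>I\<^sup>N\<close>.
\<close>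

definition SK :: "nat set => nat => (nat set \<times> nat set) set" where
  "SK V k = insert ({}, {}) {(B, J). B \<subseteq> V \<and> card B = k \<and> J \<subseteq> V - B \<and> J \<noteq> {} \<and> (k = 0 \<or> Min J < Min B)}"

definition sk_el :: "nat set \<times> nat set => var kos" where
  "sk_el = (\<lambda>(B, J). wlist eps J (mon (mset_set (Yv ` B))))"

lemma okX_skX: assumes "finite V" shows "okX (skX V k)"
  unfolding skX_def
proof (rule okX_supp_in[of "Yv ` V"])
  show "finite (Yv ` V)" using assms by simp
  fix A B C assume *: "A \<in> {Yv ` S | S. S \<subseteq> V \<and> card S \<le> k}" "C \<in> {Yv ` S | S. S \<subseteq> V \<and> card S \<le> k}" "A \<subseteq> B" "B \<subseteq> C"
  then obtain S where S: "C = Yv ` S" "S \<subseteq> V" "card S \<le> k" by blast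
  then obtain S' where S': "B = Yv ` S'" "S' \<subseteq> S" using *(4) by (meson subset_imageE)
  have "card S' \<le> card S" using S'(2) S(2) assms by (intro card_mono) (auto intro: finite_subset)
  then show "B \<in> {Yv ` S | S. S \<subseteq> V \<and> card S \<le> k}" using S S' by (intro CollectI exI[of _ S']) auto
qed auto

lemma eps_lf: "eps = lf {}" by (intro ext) (simp add: lf_def)

lemma sk_el_insert_form:
  assumes "finite V" "\<And>a. a \<in> V ==> a < v" "J \<subseteq> V"
  shows "sk_el (B, insert v J) = rw v (sk_el (B, J))"
proof -
  have fJ: "finite J" using assms finite_subset by blast
  have "rw v (wlist eps J (mon \<alpha>)) = wlist eps J (rw v (mon \<alpha>))" for \<alpha> :: "var multiset"
    by (rule wlist_commute[where P = "\<lambda>_. True"]) (use fJ assms in \<open>auto intro: rw_eps\<close>)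
  moreover have "wlist eps (insert v J) \<nu> = wlist eps J (eps v \<nu>)" for \<nu> :: "var kos"
    by (rule wlist_insert_max[OF fJ]) (use assms in auto)
  ultimately show ?thesis by (simp add: sk_el_def rw_mon)
qed

lemma sk_el_insert_var:
  assumes "finite B" "finite J" "v \<notin> B"
  shows "sk_el (insert v B, J) = shift {#Yv v#} (sk_el (B, J))"
proof -
  have "shift {#Yv v#} (wlist eps J (mon \<alpha>)) = wlist eps J (shift {#Yv v#} (mon \<alpha>))" for \<alpha>
    by (rule wlist_commute[where P = "\<lambda>_. True"]) (use assms in \<open>auto simp: shift_eps\<close>)
  moreover have "mset_set (Yv ` insert v B) = add_mset (Yv v) (mset_set (Yv ` B))"
  proof -
    have "Yv v \<notin> Yv ` B" using assms(3) by auto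
    then show ?thesis using assms(1) by simp
  qed
  ultimately show ?thesis by (simp add: sk_el_def shift_mon)
qed

lemma star_decompose:
  assumes "\<And>S. S \<in> \<S> ==> z \<notin> S"
  shows "supp_in {insert z S | S. S \<in> \<S>} = {l + u | l u. l \<in> supp_in {{z}} \<and> u \<in> supp_in \<S>}"
proof (intro set_eqI iffI)
  fix M assume "M \<in> supp_in {insert z S | S. S \<in> \<S>}"
  then obtain S where S: "set_mset M = insert z S" "S \<in> \<S>" by auto
  have "M = filter_mset (\<lambda>w. w = z) M + filter_mset (\<lambda>w. w \<noteq> z) M" by (simp add: multiset_partition[symmetric])
  moreover have "set_mset (filter_mset (\<lambda>w. w = z) M) = {z}" "set_mset (filter_mset (\<lambda>w. w \<noteq> z) M) = S"
    using S assms by auto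
  ultimately show "M \<in> {l + u | l u. l \<in> supp_in {{z}} \<and> u \<in> supp_in \<S>}"
    using S(2) by (intro CollectI exI[of _ "filter_mset (\<lambda>w. w = z) M"] exI[of _ "filter_mset (\<lambda>w. w \<noteq> z) M"]) simp
qed auto

text \<open>
  The monomials divisible by \<open>z\<close> are those in the other variables times a power of
  \<open>z\<close>; the form \<open>c v\<close> removes all powers but the first.
\<close>

lemma hom_basis_star:
  assumes fin: "finite N" "v \<notin> N" and ok: "okX (supp_in \<S>)" and okS: "okX (supp_in {insert z S | S. S \<in> \<S>})"
    and z: "\<And>S. S \<in> \<S> ==> z \<notin> S" and c: "c v z \<noteq> 0" "\<And>j. j \<in> N ==> c j z = 0"
    and h: "hom_basis c (supp_in \<S>) N I s" and g: "\<And>i. i \<in> I ==> s' (g i) = shift {#z#} (s i)"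
  shows "hom_basis c (supp_in {insert z S | S. S \<in> \<S>}) (insert v N) (g ` I) s'"
proof -
  have hz: "hom_basis c (supp_in {{z}}) {v} {{#z#}} (\<lambda>i. mon (id i))"
    using hom_basis_power[of c v z] c(1) by simp
  have okz: "okX (supp_in {{z}})" by (rule okX_supp_in[of "{z}"]) auto
  have "hom_basis c (supp_in {insert z S | S. S \<in> \<S>}) (insert v N) ({{#z#}} \<times> I) (\<lambda>(i, j). shift (id i) (s j))"
  proof (rule hom_basis_tensor[OF _ fin(1) _ okS okz ok _ _ star_decompose[OF z] _ hz h, of "{z}"])
    show "set_mset M \<inter> {z} = {}" if "M \<in> supp_in \<S>" for M using z that by auto
  qed (use fin c in auto)
  then have "hom_basis c (supp_in {insert z S | S. S \<in> \<S>}) (insert v N) ((g \<circ> snd) ` ({{#z#}} \<times> I)) s'"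
    by (rule hom_basis_image) (use g in auto)
  moreover have "(g \<circ> snd) ` ({{#z#}} \<times> I) = g ` I" by force
  ultimately show ?thesis by simp
qed

text \<open>
  Induction on the largest vertex \<open>v\<close>. The monomials divisible by
  \<open>y\<^sub>v\<close> give the basis of a smaller skeleton times \<open>y\<^sub>v\<close>.
  On the other ones \<open>y\<^sub>v\<close> vanishes, and the basis doubles by
  \<open>\<ell>\<^sub>v\<close>. As \<open>v\<close> is the maximum, this preserves the
  condition on minima. Only \<open>\<ell>\<^sub>v\<close> and \<open>y\<^sub>v\<close> cancel.
\<close>

theorem hom_basis_skeleton:
  "finite V ==> hom_basis cy (skX V k) V (SK V k) sk_el"
proof (induction V arbitrary: k rule: finite_linorder_max_induct)
  case empty
  have "{Yv ` S | S. S \<subseteq> {} \<and> card S \<le> k} = {{}}" by auto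
  then have X: "skX {} k = {{#}}" unfolding skX_def supp_in_def by auto
  have "hom_basis cy (skX {} k) {} ((\<lambda>_. ({}, {})) ` ({{#}} :: var multiset set)) sk_el"
    unfolding X
    by (rule hom_basis_image[where s' = mon, OF hom_basis_no_forms]) (simp add: sk_el_def)
  moreover have "(\<lambda>_. ({}, {})) ` ({{#}} :: var multiset set) = SK {} k" by (auto simp: SK_def)
  ultimately show ?case by simp
next
  case (insert v V)
  note finV = insert.hyps(1)
  have v: "a < v" if "a \<in> V" for a using insert.hyps(2) that by blast
  have vV: "v \<notin> V" using v by blast
  let ?N = "insert v V"
  have finN: "finite ?N" using finV by simp
  let ?X = "skX ?N k" and ?X1 = "{M \<in> skX ?N k. Yv v \<in># M}" and ?X2 = "skX V k"
  have ok: "okX ?X" by (rule okX_skX[OF finN])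
  have XX: "?X = ?X1 \<union> ?X2"
  proof (intro set_eqI iffI)
    fix M assume M: "M \<in> ?X"
    then obtain S where S: "set_mset M = Yv ` S" "S \<subseteq> ?N" "card S \<le> k" by (auto simp: skX_def)
    show "M \<in> ?X1 \<union> ?X2"
    proof (cases "v \<in> S")
      case True then show ?thesis using M S by auto
    next
      case False
      then have "S \<subseteq> V" using S(2) by auto
      then show ?thesis using S by (auto simp: skX_def)
    qed
  next
    fix M assume "M \<in> ?X1 \<union> ?X2" then show "M \<in> ?X" unfolding skX_def supp_in_def by blast
  qed
  have skX_var: "i \<in> V'" if M: "M \<in> skX V' k'" "Yv i \<in># M" for M i V' k'
  proof -
    obtain S where "set_mset M = Yv ` S" "S \<subseteq> V'" using M(1) by (auto simp: skX_def)
    then show ?thesis using M(2) by auto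
  qed
  have X12: "?X1 \<inter> ?X2 = {}" using vV skX_var by blast
  define g2 where "g2 = (\<lambda>((B, J), b). (B :: nat set, if b then insert v J else J :: nat set))"
  have h2: "hom_basis cy ?X2 ?N (g2 ` (SK V k \<times> UNIV)) sk_el"
  proof (rule hom_basis_image)
    show "hom_basis cy ?X2 ?N (SK V k \<times> UNIV) (\<lambda>(i, b). if b then rw v (sk_el i) else sk_el i)"
    proof (rule hom_basis_adjoin_zero_form[OF finV v okX_skX[OF finV] _ insert.IH])
      fix M w assume M: "M \<in> skX V k" "w \<in># M"
      then obtain i where "w = Yv i" by (auto simp: skX_def)
      moreover have "i \<in> V" using M skX_var calculation by blast
      ultimately show "cy v w = 0" using vV by auto
    qed
    fix i assume "i \<in> SK V k \<times> (UNIV :: bool set)"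
    then obtain B J b where i: "i = ((B, J), b)" "(B, J) \<in> SK V k" by auto
    then have "J \<subseteq> V" by (auto simp: SK_def)
    then show "sk_el (g2 i) = (case i of (i, b) => if b then rw v (sk_el i) else sk_el i)"
      using sk_el_insert_form[OF finV v] i by (simp add: g2_def)
  qed
  define T where "T = (if k = 0 then {} else {({}, {v})} :: (nat set \<times> nat set) set)"
  define \<rho> where "\<rho> = (\<lambda>_::nat set \<times> nat set. ({v}, {}) :: nat set \<times> nat set)"
  define J1 where "J1 = (if k = 0 then {} else (\<lambda>(B, J). (insert v B, J)) ` SK V (k - 1))"
  have h1: "hom_basis cy ?X1 ?N J1 sk_el"
  proof (cases k)
    case 0
    have "S = {}" if "S \<subseteq> ?N" "card S \<le> k" for S
      using that finite_subset[OF that(1) finN] 0 by simp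
    then have e: "?X1 = {}" unfolding skX_def supp_in_def by blast
    have "J1 = {}" by (simp add: J1_def 0)
    then show ?thesis unfolding e by (simp only:) (rule hom_basis_empty)
  next
    case (Suc k')
    let ?S = "{Yv ` S | S. S \<subseteq> V \<and> card S \<le> k'}"
    have z: "Yv v \<notin> S" if "S \<in> ?S" for S using that vV by auto
    have X1: "?X1 = supp_in {insert (Yv v) S | S. S \<in> ?S}"
    proof (intro set_eqI iffI)
      fix M assume M: "M \<in> ?X1"
      then obtain S where S: "set_mset M = Yv ` S" "S \<subseteq> ?N" "card S \<le> k" by (auto simp: skX_def)
      have vS: "v \<in> S" using M S by auto
      have fS: "finite S" using S finN finite_subset by blast
      have "set_mset M = insert (Yv v) (Yv ` (S - {v}))" using S vS by auto
      moreover have "S - {v} \<subseteq> V" "card (S - {v}) \<le> k'" using S vS fS Suc by auto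
      ultimately show "M \<in> supp_in {insert (Yv v) S | S. S \<in> ?S}" by auto
    next
      fix M assume "M \<in> supp_in {insert (Yv v) S | S. S \<in> ?S}"
      then obtain S where S: "set_mset M = Yv ` insert v S" "S \<subseteq> V" "card S \<le> k'" by auto
      then have "card (insert v S) \<le> k" using Suc finite_subset[OF _ finV] by (simp add: card_insert_if)
      then show "M \<in> ?X1" unfolding skX_def supp_in_def using S by blast
    qed
    have "okX ?X1" by (rule okX_upward[OF ok]) auto
    then have okS: "okX (supp_in {insert (Yv v) S | S. S \<in> ?S})" using X1 by simp
    have "hom_basis cy ?X1 ?N ((\<lambda>(B, J). (insert v B, J)) ` SK V k') sk_el"
      unfolding X1
    proof (rule hom_basis_star[OF finV vV _ okS z _ _ insert.IH[of k', unfolded skX_def]])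
      show "okX (supp_in ?S)" using okX_skX[OF finV] by (simp add: skX_def)
      show "sk_el (case i of (B, J) => (insert v B, J)) = shift {#Yv v#} (sk_el i)" if iS: "i \<in> SK V k'" for i
      proof -
        obtain B J where i: "i = (B, J)" "B \<subseteq> V" "J \<subseteq> V" using iS by (auto simp: SK_def)
        then show ?thesis using sk_el_insert_var[of B J v] finite_subset[OF _ finV] vV by auto
      qed
    qed (use vV in auto)
    then show ?thesis using Suc by (simp add: J1_def)
  qed
  have SKdisj: "g2 ` (SK V k \<times> UNIV) \<inter> J1 = {}"
  proof -
    have "v \<in> B" if "(B, J) \<in> J1" for B J using that by (auto simp: J1_def split: if_splits)
    moreover have "v \<notin> B" if "(B, J) \<in> g2 ` (SK V k \<times> UNIV)" for B J
      using that vV by (auto simp: g2_def SK_def)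
    ultimately show ?thesis by (metis disjoint_iff surj_pair)
  qed
  have "hom_basis cy ?X ?N ((J1 - \<rho> ` T) \<union> (g2 ` (SK V k \<times> UNIV) - T)) sk_el"
  proof (rule hom_basis_extend[where T = T and \<rho> = \<rho>, OF finN ok XX X12])
    have RJ: "\<rho> ` T \<subseteq> J1" by (auto simp: T_def \<rho>_def J1_def SK_def image_iff intro!: bexI[of _ "({}, {})"])
    have TJ: "T \<subseteq> g2 ` (SK V k \<times> UNIV)"
      by (auto simp: T_def g2_def SK_def image_iff intro!: bexI[of _ "(({}, {}), True)"])
    show "hom_basis cy ?X1 ?N (J1 - \<rho> ` T \<union> \<rho> ` T) sk_el" using h1 RJ by (simp add: Un_absorb2)
    show "hom_basis cy ?X2 ?N (g2 ` (SK V k \<times> UNIV) - T \<union> T) sk_el" using h2 TJ by (simp add: Un_absorb2)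
    show "(J1 - \<rho> ` T) \<inter> (g2 ` (SK V k \<times> UNIV) - T) = {}" using SKdisj by auto
    show "inj_on \<rho> T" by (auto simp: T_def inj_on_def)
    show "add_mset u M \<in> ?X1" if "M \<in> ?X1" "add_mset u M \<in> ?X" for M u using that by auto
    fix i
    show "dk cy ?X ?N (sk_el i) = sk_el (\<rho> i)" if "i \<in> T"
    proof -
      have k: "k \<noteq> 0" and i: "i = ({}, {v})" using that by (auto simp: T_def split: if_splits)
      have e: "sk_el i = eps v (mon {#})" "sk_el (\<rho> i) = mon {#Yv v#}"
        by (simp_all add: i sk_el_def wlist_def \<rho>_def)
      have X1: "{#Yv v#} \<in> ?X" using k by (auto simp: skX_def intro!: exI[of _ "{v}"])
      have de: "dk cy ?X ?N (eps v (mon {#})) J M =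
          (if J = {} \<and> M \<in> ?X then \<Sum>u\<in>set_mset M. if M = {#u#} then cy v u else 0 else 0)" for J M
        by (rule dk_eps_mon[OF finN]) simp
      show ?thesis
      proof (intro ext)
        fix J M
        show "dk cy ?X ?N (sk_el i) J M = sk_el (\<rho> i) J M"
        proof (cases "J = {} \<and> M \<in> ?X \<and> (\<exists>w. M = {#w#})")
          case True
          then obtain w where w: "M = {#w#}" by auto
          have "w \<in> Yv ` ?N" using True w by (auto simp: skX_def)
          then show ?thesis using True w unfolding e de by (auto simp: mon_def split: if_splits)
        next
          case False
          then show ?thesis unfolding e de using X1 by (auto simp: mon_def intro!: sum.neutral)
        qed
      qed
    qed
    assume i: "i \<in> g2 ` (SK V k \<times> UNIV) - T"
    then obtain B J b where BJ: "(B, J) \<in> SK V k" "i = (B, if b then insert v J else J)"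
      by (auto simp: g2_def)
    show "dk cy ?X ?N (sk_el i) = 0"
    proof (cases "snd i = {}")
      case True
      then show ?thesis using BJ(2) dk_mon[OF finN] by (simp add: sk_el_def split: if_splits)
    next
      case False
      have cB: "card B = k"
      proof (cases "J = {}")
        case True
        then have "B = {}" "b" using BJ False by (auto simp: SK_def)
        then have "i = ({}, {v})" using BJ(2) True by simp
        then have "k = 0" using i by (auto simp: T_def split: if_splits)
        then show ?thesis using \<open>B = {}\<close> by simp
      next
        case F: False then show ?thesis using BJ by (auto simp: SK_def)
      qed
      have sub: "B \<subseteq> V" "J \<subseteq> V - B" using BJ(1) by (auto simp: SK_def)
      have fB: "finite B" using sub finite_subset[OF _ finV] by blast
      have e: "sk_el i = wlist (lf {}) (snd i) (mon (mset_set (Yv ` B)))"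
        using BJ(2) by (simp add: sk_el_def eps_lf)
      show ?thesis unfolding e
      proof (rule dk_wlist[OF finN])
        show "snd i \<subseteq> ?N" using BJ(2) sub by auto
        fix u w assume u: "u \<in> snd i" and w: "add_mset w (mset_set (Yv ` B)) \<in> ?X"
        then obtain S where S: "insert w (Yv ` B) = Yv ` S" "S \<subseteq> ?N" "card S \<le> k"
          using fB by (auto simp: skX_def)
        have "B \<subseteq> S" using S(1) by blast
        then have "S = B" using S(2,3) cB finite_subset[OF _ finN] by (metis card_seteq)
        then have "w \<in> Yv ` B" using S(1) by blast
        moreover have "u \<notin> B" using u BJ(2) sub vV by (auto split: if_splits)
        ultimately have "cy u w = 0" by auto
        then show "if \<exists>w\<in>{}. u < w then cy u w = cy (succ_in {} u) w else cy u w = 0" by simp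
      qed auto
    qed
  qed auto
  moreover have "(J1 - \<rho> ` T) \<union> (g2 ` (SK V k \<times> UNIV) - T) = SK ?N k"
  proof (intro set_eqI iffI)
    fix i assume "i \<in> (J1 - \<rho> ` T) \<union> (g2 ` (SK V k \<times> UNIV) - T)"
    then show "i \<in> SK ?N k"
    proof
      assume "i \<in> J1 - \<rho> ` T"
      then obtain B J where BJ: "k \<noteq> 0" "(B, J) \<in> SK V (k - 1)" "i = (insert v B, J)" "i \<noteq> ({v}, {})"
        by (auto simp: J1_def T_def \<rho>_def split: if_splits)
      then have *: "B \<subseteq> V" "card B = k - 1" "J \<subseteq> V - B" "J \<noteq> {}" "k - 1 = 0 \<or> Min J < Min B"
        by (auto simp: SK_def)
      have fin: "finite B" "finite J" using * finite_subset[OF _ finV] by blast+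
      have "Min J < Min (insert v B)"
      proof (cases "B = {}")
        case True
        have "Min J \<in> J" using fin * by simp
        then show ?thesis using True v * by auto
      next
        case False
        then have "Min B < v" using v * fin by (metis Min_in subsetD)
        then have "Min (insert v B) = Min B" using False fin by simp
        then show ?thesis using *(2,5) False fin by auto
      qed
      moreover have "card (insert v B) = k" using * fin vV BJ(1) by (auto simp: card_insert_if)
      ultimately show ?thesis using * BJ vV by (auto simp: SK_def)
    next
      assume i: "i \<in> g2 ` (SK V k \<times> UNIV) - T"
      then obtain B J b where BJ: "(B, J) \<in> SK V k" "i = (B, if b then insert v J else J)"
        by (auto simp: g2_def)
      show ?thesis
      proof (cases "J = {}")
        case True
        then have "B = {}" using BJ by (auto simp: SK_def)
        moreover have "b ==> k = 0" using i BJ(2) True \<open>B = {}\<close> by (auto simp: T_def split: if_splits)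
        ultimately show ?thesis using BJ(2) True by (auto simp: SK_def)
      next
        case False
        then have *: "B \<subseteq> V" "card B = k" "J \<subseteq> V - B" "k = 0 \<or> Min J < Min B"
          using BJ by (auto simp: SK_def)
        have fJ: "finite J" using * finite_subset[OF _ finV] by blast
        have "Min J < v" using v * fJ False by (metis DiffD1 Min_in subsetD)
        then have "Min (insert v J) = Min J" using False fJ by simp
        then show ?thesis using * False BJ(2) vV by (auto simp: SK_def)
      qed
    qed
  next
    fix i assume i: "i \<in> SK ?N k"
    obtain B J where BJ: "i = (B, J)" by (cases i)
    show "i \<in> (J1 - \<rho> ` T) \<union> (g2 ` (SK V k \<times> UNIV) - T)"
    proof (cases "J = {}")
      case True
      then have "i = g2 (({}, {}), False)" using i BJ by (auto simp: SK_def g2_def)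
      moreover have "({}, {}) \<in> SK V k" by (simp add: SK_def)
      ultimately have "i \<in> g2 ` (SK V k \<times> UNIV)" by (intro image_eqI[where x = "(({}, {}), False)"]) simp_all
      moreover have "i \<notin> T" using BJ True by (simp add: T_def)
      ultimately show ?thesis by simp
    next
      case False
      then have *: "B \<subseteq> ?N" "card B = k" "J \<subseteq> ?N - B" "k = 0 \<or> Min J < Min B"
        using i BJ by (auto simp: SK_def)
      have fin: "finite B" "finite J" using * finite_subset[OF _ finN] by blast+
      show ?thesis
      proof (cases "v \<in> B")
        case True
        then have k: "k \<noteq> 0" using *(2) fin by (auto simp: card_gt_0_iff)
        let ?B = "B - {v}"
        have B: "B = insert v ?B" using True by auto
        have JV: "J \<subseteq> V - ?B" using *(3) True by auto
        have "k - 1 = 0 \<or> Min J < Min ?B"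
        proof (cases "?B = {}")
          case False
          then have "Min ?B \<in> ?B" using fin by (intro Min_in) auto
          then have "Min ?B < v" using v *(1) by auto
          have "Min B = min v (Min ?B)" using fin False by (subst B) (rule Min_insert, auto)
          then have "Min B = Min ?B" using \<open>Min ?B < v\<close> by simp
          then show ?thesis using * k by auto
        next
          case B0: True
          then have "B = {v}" using True by auto
          then show ?thesis using *(2) by simp
        qed
        then have "(?B, J) \<in> SK V (k - 1)" using * fin True False JV by (auto simp: SK_def)
        moreover have "(\<lambda>(B, J). (insert v B, J)) (?B, J) = i" using BJ B by simp
        ultimately have "i \<in> (\<lambda>(B, J). (insert v B, J)) ` SK V (k - 1)" by (metis image_eqI)
        then have "i \<in> J1" using k by (simp add: J1_def)
        then show ?thesis using False BJ by (auto simp: T_def \<rho>_def)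
      next
        case vB: False
        let ?J = "J - {v}"
        have "(B, ?J) \<in> SK V k" if "?J \<noteq> {}"
        proof -
          have "Min J = Min ?J"
          proof (cases "v \<in> J")
            case True
            have "Min ?J \<in> ?J" using fin that by (intro Min_in) auto
            then have "Min ?J < v" using v *(3) by auto
            moreover have "Min (insert v ?J) = min v (Min ?J)" using fin that by (intro Min_insert) auto
            moreover have "insert v ?J = J" using True by auto
            ultimately show ?thesis by simp
          qed simp
          then show ?thesis using * vB that by (auto simp: SK_def)
        qed
        moreover have "B = {} \<and> k = 0" if "?J = {}"
        proof -
          have J: "J = {v}" using that False by auto
          have "B = {}"
          proof (rule ccontr)
            assume n: "B \<noteq> {}"
            then have "Min B \<in> B" using fin by (intro Min_in) auto
            then have "Min B \<in> V" using *(1) vB by auto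
            then have "Min B < v" by (rule v)
            have "k \<noteq> 0" using *(2) n fin by (auto simp: card_gt_0_iff)
            then have "Min J < Min B" using *(4) by simp
            then show False using J \<open>Min B < v\<close> by simp
          qed
          then show ?thesis using *(2) by simp
        qed
        ultimately have "(B, ?J) \<in> SK V k" by (cases "?J = {}") (auto simp: SK_def)
        moreover have "i = g2 ((B, ?J), v \<in> J)" using BJ by (auto simp: g2_def)
        ultimately have "i \<in> g2 ` (SK V k \<times> UNIV)" by (intro image_eqI) auto
        moreover have "i \<notin> T"
        proof
          assume "i \<in> T"
          then have "k \<noteq> 0" "B = {}" using BJ by (auto simp: T_def split: if_splits)
          then show False using *(2) by simp
        qed
        ultimately show ?thesis by simp
      qed
    qed
  qed
  ultimately show ?case by simp
qed

section \<open>Chains of sets and flags\<close>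

lemma dk_eps_mon_sum:
  assumes fin: "finite N" "v \<in> N" and A: "finite A" "\<And>w. w \<in> A \<longleftrightarrow> add_mset w x \<in> X \<and> c v w \<noteq> 0"
    and c: "\<And>w. w \<in> A ==> c v w = 1"
  shows "dk c X N (eps v (mon x)) = (\<Sum>w\<in>A. mon (add_mset w x))"
proof (intro ext)
  fix J M
  have R: "(\<Sum>w\<in>A. mon (add_mset w x)) J M = (\<Sum>w\<in>A. if J = {} \<and> M = add_mset w x then 1 else 0)"
    unfolding sum_kos_apply by (simp add: mon_def)
  show "dk c X N (eps v (mon x)) J M = (\<Sum>w\<in>A. mon (add_mset w x)) J M"
  proof (cases "J = {} \<and> (\<exists>w. M = add_mset w x)")
    case True
    then obtain w where w: "M = add_mset w x" by blast
    have "(\<Sum>u\<in>set_mset M. if M = add_mset u x then c v u else 0) = (\<Sum>u\<in>set_mset M. if u = w then c v w else 0)"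
      by (intro sum.cong) (auto simp: w)
    also have "\<dots> = c v w" by (simp add: w)
    finally have 1: "dk c X N (eps v (mon x)) J M = (if M \<in> X then c v w else 0)"
      using True by (simp add: dk_eps_mon[OF fin])
    have "(\<Sum>u\<in>A. if J = {} \<and> M = add_mset u x then 1 else 0) = (\<Sum>u\<in>A. if u = w then 1 else (0::rat))"
      by (intro sum.cong) (use True w in auto)
    also have "\<dots> = (if w \<in> A then 1 else 0)" using A(1) by simp
    finally show ?thesis unfolding R 1 using A(2)[of w] c[of w] w by auto
  next
    case False
    then show ?thesis unfolding R dk_eps_mon[OF fin] by (auto intro!: sum.neutral split: if_splits)
  qed
qed

subsection \<open>Chains of sets\<close>

text \<open>Monomials whose set of flats belongs to \<open>\<S>\<close>.\<close>

definition vX :: "nat set set set => var multiset set" where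
  "vX \<S> = supp_in ((`) Xv ` \<S>)"

lemma vX_iff: "M \<in> vX \<S> \<longleftrightarrow> (\<exists>\<G>\<in>\<S>. set_mset M = Xv ` \<G>)"
  by (auto simp: vX_def)

lemma okX_vX:
  assumes "finite W" "\<And>\<G> G. \<G> \<in> \<S> ==> G \<in> \<G> ==> G \<subseteq> W"
    and "\<And>A B C. A \<in> \<S> ==> C \<in> \<S> ==> A \<subseteq> B ==> B \<subseteq> C ==> B \<in> \<S>"
  shows "okX (vX \<S>)"
  unfolding vX_def
proof (rule okX_supp_in[of "Xv ` Pow W"])
  show "finite (Xv ` Pow W)" using assms(1) by simp
  show "S \<subseteq> Xv ` Pow W" if "S \<in> (`) Xv ` \<S>" for S using that assms(2) by auto
  fix A B C assume *: "A \<in> (`) Xv ` \<S>" "C \<in> (`) Xv ` \<S>" "A \<subseteq> B" "B \<subseteq> C"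
  then obtain a c where ac: "A = Xv ` a" "a \<in> \<S>" "C = Xv ` c" "c \<in> \<S>" by blast
  obtain b where b: "B = Xv ` b" "b \<subseteq> c" using *(4) ac(3) by (meson subset_imageE)
  have "a \<subseteq> b" using *(3) ac(1) b(1) by blast
  then show "B \<in> (`) Xv ` \<S>" using assms(3)[OF ac(2,4) _ b(2)] b(1) by blast
qed

text \<open>
  Chains strictly above \<open>H\<close> in the flats below \<open>W\<close> of size at most
  \<open>k\<close>; \<open>sdX\<close> are the monomials supported on them, and
  \<open>stX\<close> those in which in addition the flat \<open>F\<close> below the chain
  occurs.
\<close>

definition chS :: "nat set => nat set => nat => nat set set set" where
  "chS H W k = {\<G>. (\<forall>G\<in>\<G>. H \<subset> G \<and> G \<subseteq> W \<and> card G \<le> k) \<and> (\<forall>A\<in>\<G>. \<forall>B\<in>\<G>. A \<subseteq> B \<or> B \<subseteq> A)}"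

abbreviation "sdX H W k \<equiv> vX (chS H W k)"
abbreviation "stX F W k \<equiv> vX (insert F ` chS F W k)"

lemma chS_D: "\<G> \<in> chS H W k ==> G \<in> \<G> ==> H \<subset> G" "\<G> \<in> chS H W k ==> G \<in> \<G> ==> G \<subseteq> W"
  "\<G> \<in> chS H W k ==> G \<in> \<G> ==> card G \<le> k"
  "\<G> \<in> chS H W k ==> A \<in> \<G> ==> B \<in> \<G> ==> A \<subseteq> B \<or> B \<subseteq> A"
  by (auto simp: chS_def)

lemma chS_I:
  assumes "\<And>G. G \<in> \<G> ==> H \<subset> G \<and> G \<subseteq> W \<and> card G \<le> k"
    and "\<And>A B. A \<in> \<G> ==> B \<in> \<G> ==> A \<subseteq> B \<or> B \<subseteq> A"
  shows "\<G> \<in> chS H W k"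
  using assms by (auto simp: chS_def)

lemma chS_subset: "\<G> \<in> chS H W k ==> \<G>' \<subseteq> \<G> ==> \<G>' \<in> chS H W k"
  unfolding chS_def by blast

lemma okX_sdX: "finite W ==> okX (sdX H W k)"
  by (rule okX_vX) (auto dest: chS_D intro: chS_subset)

lemma chS_self: "\<G> \<in> chS F W k ==> F \<notin> \<G>" by (auto dest: chS_D(1))

lemma okX_stX: assumes "finite W" "F \<subseteq> W" shows "okX (stX F W k)"
proof (rule okX_vX[OF assms(1)])
  fix \<G> G assume "\<G> \<in> insert F ` chS F W k" "G \<in> \<G>"
  then obtain \<G>' where "\<G>' \<in> chS F W k" "G = F \<or> G \<in> \<G>'" by blast
  then show "G \<subseteq> W" using assms(2) chS_D(2)[of \<G>' F W k G] by metis
next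
  fix A B C assume *: "A \<in> insert F ` chS F W k" "C \<in> insert F ` chS F W k" "A \<subseteq> B" "B \<subseteq> C"
  then obtain c where c: "C = insert F c" "c \<in> chS F W k" by blast
  have B: "B = insert F (B - {F})" "B - {F} \<subseteq> c" using * c by auto
  show "B \<in> insert F ` chS F W k" using B(1) chS_subset[OF c(2) B(2)] by (rule image_eqI)
qed

definition pcS :: "nat set => nat set => nat => nat => nat set => nat set set set" where
  "pcS H W k v F = {\<G> \<in> chS H W k. insert v F \<in> \<G> \<and> (\<forall>G\<in>\<G>. v \<in> G --> insert v F \<subseteq> G)}"

lemma okX_pcS: assumes "finite W" shows "okX (vX (pcS H W k v F))"
proof (rule okX_vX[OF assms])
  show "G \<subseteq> W" if "\<G> \<in> pcS H W k v F" "G \<in> \<G>" for \<G> G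
    using that chS_D(2)[of \<G> H W k G] by (simp add: pcS_def)
  fix A B C assume *: "A \<in> pcS H W k v F" "C \<in> pcS H W k v F" "A \<subseteq> B" "B \<subseteq> C"
  have "B \<in> chS H W k" by (rule chS_subset[OF _ *(4)]) (use *(2) in \<open>simp add: pcS_def\<close>)
  then show "B \<in> pcS H W k v F" using * unfolding pcS_def by (simp add: subset_iff)
qed

lemma upper_part:
  assumes up: "\<And>G. G \<in> \<G> ==> \<not> G \<subseteq> F ==> F' \<subseteq> G" and F': "F' \<in> \<G>" "\<not> F' \<subseteq> F"
  shows "{G \<in> \<G>. \<not> G \<subseteq> F} = insert F' {G \<in> \<G>. F' \<subset> G}"
proof -
  have "G \<in> \<G> \<and> \<not> G \<subseteq> F \<longleftrightarrow> G = F' \<or> G \<in> \<G> \<and> F' \<subset> G" for G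
  proof
    assume "G \<in> \<G> \<and> \<not> G \<subseteq> F"
    then have "F' \<subseteq> G" "G \<in> \<G>" using up[of G] by simp_all
    then show "G = F' \<or> G \<in> \<G> \<and> F' \<subset> G" by (metis psubsetI)
  next
    assume "G = F' \<or> G \<in> \<G> \<and> F' \<subset> G"
    then have "G \<in> \<G>" "F' \<subseteq> G" using F'(1) by (metis order_refl psubset_imp_subset)+
    then show "G \<in> \<G> \<and> \<not> G \<subseteq> F" using F'(2) by (metis order_trans)
  qed
  then show ?thesis by (simp add: set_eq_iff)
qed

text \<open>
  The members of such a chain that do not contain \<open>v\<close> lie in \<open>F\<close>, so
  that the chain splits at \<open>insert v F\<close>.
\<close>

lemma pcS_split:
  assumes H: "H \<subseteq> F" "v \<notin> F" "F \<subseteq> W" "v \<in> W" "finite W" "card F < k"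
  shows "vX (pcS H W k v F) = {l + u | l u. l \<in> sdX H F (card F) \<and> u \<in> stX (insert v F) W k}"
proof (intro set_eqI iffI)
  have finF: "finite F" using H finite_subset by blast
  fix M assume "M \<in> vX (pcS H W k v F)"
  then obtain \<G> where G: "set_mset M = Xv ` \<G>" "\<G> \<in> chS H W k" "insert v F \<in> \<G>" "\<And>G. G \<in> \<G> ==> v \<in> G ==> insert v F \<subseteq> G"
    by (auto simp: vX_iff pcS_def)
  define P where "P = (\<lambda>w. w \<in> Xv ` {G. G \<subseteq> F})"
  have PX: "P (Xv G) \<longleftrightarrow> G \<subseteq> F" for G by (auto simp: P_def)
  have M: "M = filter_mset P M + filter_mset (\<lambda>w. \<not> P w) M" by (simp add: multiset_partition[symmetric])
  have l: "filter_mset P M \<in> sdX H F (card F)"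
  proof -
    have "set_mset (filter_mset P M) = Xv ` {G \<in> \<G>. G \<subseteq> F}" using G(1) PX by auto
    moreover have "{G \<in> \<G>. G \<subseteq> F} \<in> chS H F (card F)"
      using G(2) card_mono[OF finF] unfolding chS_def by auto
    ultimately show ?thesis by (auto simp: vX_iff)
  qed
  have u: "filter_mset (\<lambda>w. \<not> P w) M \<in> stX (insert v F) W k"
  proof -
    have up: "insert v F \<subseteq> G" if g: "G \<in> \<G>" "\<not> G \<subseteq> F" for G
    proof (cases "v \<in> G")
      case True then show ?thesis using G(4) g by blast
    next
      case False
      have "G \<subseteq> insert v F \<or> insert v F \<subseteq> G" using chS_D(4)[OF G(2) g(1) G(3)] .
      then show ?thesis using False g(2) by blast
    qed
    have "set_mset (filter_mset (\<lambda>w. \<not> P w) M) = Xv ` {G \<in> \<G>. \<not> G \<subseteq> F}" using G(1) PX by auto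
    moreover have "{G \<in> \<G>. \<not> G \<subseteq> F} = insert (insert v F) {G \<in> \<G>. insert v F \<subset> G}"
      by (rule upper_part[OF up G(3)]) (use H(2) in auto)
    moreover have "{G \<in> \<G>. insert v F \<subset> G} \<in> chS (insert v F) W k"
      using G(2) unfolding chS_def by blast
    ultimately show ?thesis by (auto simp: vX_iff)
  qed
  show "M \<in> {l + u | l u. l \<in> sdX H F (card F) \<and> u \<in> stX (insert v F) W k}"
    using M l u by (intro CollectI exI[of _ "filter_mset P M"] exI[of _ "filter_mset (\<lambda>w. \<not> P w) M"]) simp
next
  have finF: "finite F" using H finite_subset by blast
  fix M assume "M \<in> {l + u | l u. l \<in> sdX H F (card F) \<and> u \<in> stX (insert v F) W k}"
  then obtain l u a b where lu: "M = l + u" "set_mset l = Xv ` a" "a \<in> chS H F (card F)"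
      "set_mset u = Xv ` insert (insert v F) b" "b \<in> chS (insert v F) W k" by (auto simp: vX_iff)
  have "set_mset M = Xv ` (a \<union> insert (insert v F) b)" using lu by auto
  moreover have "a \<union> insert (insert v F) b \<in> pcS H W k v F"
  proof -
    have aF: "A \<subseteq> F" "H \<subset> A" if "A \<in> a" for A using chS_D(1,2)[OF lu(3) that] by auto
    have bF: "insert v F \<subseteq> B" "B \<subseteq> W" "card B \<le> k" if "B \<in> insert (insert v F) b" for B
      using that chS_D(1-3)[OF lu(5)] H by (auto simp: card_insert_if finF)
    have "a \<union> insert (insert v F) b \<in> chS H W k"
    proof (rule chS_I)
      fix G assume G: "G \<in> a \<union> insert (insert v F) b"
      show "H \<subset> G \<and> G \<subseteq> W \<and> card G \<le> k"
      proof (cases "G \<in> a")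
        case True
        then have "card G \<le> card F" using aF finF by (intro card_mono)
        then show ?thesis using aF[OF True] H by auto
      next
        case False
        then have *: "insert v F \<subseteq> G" "G \<subseteq> W" "card G \<le> k" using bF G by auto
        then have "v \<in> G" "v \<notin> H" "H \<subseteq> G" using H by auto
        then show ?thesis using * by blast
      qed
    next
      fix G G' assume G: "G \<in> a \<union> insert (insert v F) b" and G': "G' \<in> a \<union> insert (insert v F) b"
      have bb: "A \<subseteq> B \<or> B \<subseteq> A" if "A \<in> insert (insert v F) b" "B \<in> insert (insert v F) b" for A B
        using that chS_D(4)[OF lu(5)] bF(1) by (metis insertE)
      consider "G \<in> a" "G' \<in> a" | "G \<in> a" "G' \<in> insert (insert v F) b"
        | "G \<in> insert (insert v F) b" "G' \<in> a" | "G \<in> insert (insert v F) b" "G' \<in> insert (insert v F) b"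
        using G G' by blast
      then show "G \<subseteq> G' \<or> G' \<subseteq> G"
      proof cases
        case 1 then show ?thesis by (rule chS_D(4)[OF lu(3)])
      next
        case 2
        have "G \<subseteq> F" by (rule aF(1)[OF 2(1)])
        moreover have "insert v F \<subseteq> G'" by (rule bF(1)[OF 2(2)])
        ultimately show ?thesis by blast
      next
        case 3
        have "G' \<subseteq> F" by (rule aF(1)[OF 3(2)])
        moreover have "insert v F \<subseteq> G" by (rule bF(1)[OF 3(1)])
        ultimately show ?thesis by blast
      next
        case 4 then show ?thesis by (rule bb)
      qed
    qed
    then show ?thesis unfolding pcS_def using aF(1) bF(1) H(2) by blast
  qed
  ultimately show "M \<in> vX (pcS H W k v F)" unfolding vX_iff by blast
qed

definition Fls :: "nat set => nat set => nat => nat => nat set set" where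
  "Fls H W k v = {F. H \<subseteq> F \<and> F \<subseteq> W - {v} \<and> card F < k}"

text \<open>
  Multiplication can only lower the smallest member that contains \<open>v\<close>. The
  monomials without such a member are those of the interval without \<open>v\<close>.
\<close>

lemma vX_chain_decompose:
  fixes H W :: "nat set" and k v :: nat
  assumes v: "v \<in> W" "v \<notin> H" and fin: "finite W"
  shows "sdX H W k = (\<Union>F\<in>Fls H W k v. vX (pcS H W k v F)) \<union> sdX H (W - {v}) k" (is "_ = ?L")
    "(\<Union>F\<in>Fls H W k v. vX (pcS H W k v F)) \<inter> sdX H (W - {v}) k = {}"
    "\<And>F F'. F \<in> Fls H W k v ==> F' \<in> Fls H W k v ==> F \<noteq> F' ==> vX (pcS H W k v F) \<inter> vX (pcS H W k v F') = {}"
    "\<And>F F' M u. F \<in> Fls H W k v ==> F' \<in> Fls H W k v ==> M \<in> vX (pcS H W k v F) ==> add_mset u M \<in> vX (pcS H W k v F')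
      ==> F = F' \<or> card F' < card F"
    "\<And>M u. M \<in> (\<Union>F\<in>Fls H W k v. vX (pcS H W k v F)) ==> add_mset u M \<in> sdX H W k ==> add_mset u M \<in> (\<Union>F\<in>Fls H W k v. vX (pcS H W k v F))"
proof -
  have inj: "F = F'" if "insert v F = insert v F'" "F \<in> Fls H W k v" "F' \<in> Fls H W k v" for F F'
  proof -
    have "v \<notin> F" "v \<notin> F'" using that(2,3) by (auto simp: Fls_def)
    then show ?thesis using that(1) by (simp add: insert_ident)
  qed
  have in1: "M \<in> (\<Union>F\<in>Fls H W k v. vX (pcS H W k v F))" if M: "set_mset M = Xv ` \<G>" "\<G> \<in> chS H W k" "G0 \<in> \<G>" "v \<in> G0" for M \<G> G0
  proof -
    have "\<G> \<subseteq> Pow W" using chS_D(2)[OF M(2)] by blast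
    then have "finite \<G>" by (rule finite_subset) (simp add: fin)
    then have finV: "finite {G \<in> \<G>. v \<in> G}" by simp
    have "\<exists>G\<in>{G \<in> \<G>. v \<in> G}. \<forall>G'\<in>{G \<in> \<G>. v \<in> G}. \<not> G' \<subset> G"
      using finite_has_minimal[OF finV] M(3,4) by (auto simp: psubset_eq)
    then obtain G where G: "G \<in> \<G>" "v \<in> G" "\<And>G'. G' \<in> \<G> ==> v \<in> G' ==> \<not> G' \<subset> G" by auto
    have Gd: "H \<subset> G" "G \<subseteq> W" "card G \<le> k" using chS_D(1-3)[OF M(2) G(1)] by auto
    have fG: "finite G" using Gd(2) fin finite_subset by blast
    have e: "insert v (G - {v}) = G" using G(2) by auto
    have "card (G - {v}) < k" using Gd(3) G(2) fG card_gt_0_iff by (metis card_Diff1_less order_less_le_trans)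
    then have "G - {v} \<in> Fls H W k v" using Gd v(2) by (auto simp: Fls_def)
    moreover have "\<G> \<in> pcS H W k v (G - {v})" unfolding pcS_def e
      using M(2) G chS_D(4)[OF M(2) _ G(1)] by blast
    ultimately show ?thesis using M(1) by (auto simp: vX_iff)
  qed
  show "sdX H W k = ?L"
  proof (intro set_eqI iffI)
    fix M assume "M \<in> sdX H W k"
    then obtain \<G> where G: "set_mset M = Xv ` \<G>" "\<G> \<in> chS H W k" by (auto simp: vX_iff)
    show "M \<in> ?L"
    proof (cases "\<exists>G0\<in>\<G>. v \<in> G0")
      case True then show ?thesis using in1[OF G] by blast
    next
      case False
      then have "\<G> \<in> chS H (W - {v}) k" using G(2) unfolding chS_def by blast
      then show ?thesis using G(1) by (auto simp: vX_iff)
    qed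
  next
    have "chS H (W - {v}) k \<subseteq> chS H W k" unfolding chS_def by blast
    moreover have "pcS H W k v F \<subseteq> chS H W k" for F by (auto simp: pcS_def)
    ultimately show "M \<in> sdX H W k" if "M \<in> ?L" for M using that by (auto simp: vX_iff)
  qed
  have eqG: "\<G> = \<G>'" if "Xv ` \<G> = Xv ` \<G>'" for \<G> \<G>' using that by (simp add: inj_image_eq_iff inj_on_def)
  show "(\<Union>F\<in>Fls H W k v. vX (pcS H W k v F)) \<inter> sdX H (W - {v}) k = {}"
  proof (rule equals0I)
    fix M assume "M \<in> (\<Union>F\<in>Fls H W k v. vX (pcS H W k v F)) \<inter> sdX H (W - {v}) k"
    then obtain F where F: "M \<in> vX (pcS H W k v F)" and "M \<in> sdX H (W - {v}) k" by blast
    then obtain \<G>' where "set_mset M = Xv ` \<G>'" "\<G>' \<in> chS H (W - {v}) k" unfolding vX_iff by blast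
    moreover obtain \<G> where "set_mset M = Xv ` \<G>" "\<G> \<in> pcS H W k v F" using F unfolding vX_iff by blast
    ultimately have "insert v F \<in> \<G>'" "\<G>' \<in> chS H (W - {v}) k" using eqG by (auto simp: pcS_def)
    then show False using chS_D(2) by blast
  qed
  show "vX (pcS H W k v F) \<inter> vX (pcS H W k v F') = {}" if FF: "F \<in> Fls H W k v" "F' \<in> Fls H W k v" "F \<noteq> F'" for F F'
  proof (rule equals0I)
    fix M assume "M \<in> vX (pcS H W k v F) \<inter> vX (pcS H W k v F')"
    then have M: "M \<in> vX (pcS H W k v F)" "M \<in> vX (pcS H W k v F')" by blast+
    obtain \<G>' where "set_mset M = Xv ` \<G>'" "\<G>' \<in> pcS H W k v F'" using M(2) unfolding vX_iff by blast
    moreover obtain \<G> where "set_mset M = Xv ` \<G>" "\<G> \<in> pcS H W k v F" using M(1) unfolding vX_iff by blast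
    ultimately have "\<G> \<in> pcS H W k v F" "\<G> \<in> pcS H W k v F'" using eqG by metis+
    then have "insert v F \<in> \<G>" "insert v F' \<in> \<G>" "\<And>G. G \<in> \<G> ==> v \<in> G ==> insert v F \<subseteq> G"
      "\<And>G. G \<in> \<G> ==> v \<in> G ==> insert v F' \<subseteq> G" unfolding pcS_def by simp_all
    then have "insert v F = insert v F'" by (metis insertI1 subset_antisym)
    then show False using inj FF by metis
  qed
  show "F = F' \<or> card F' < card F" if FF: "F \<in> Fls H W k v" "F' \<in> Fls H W k v" "M \<in> vX (pcS H W k v F)" "add_mset u M \<in> vX (pcS H W k v F')"
    for F F' M u
  proof -
    obtain \<G> \<G>' where g: "set_mset M = Xv ` \<G>" "\<G> \<in> pcS H W k v F" "set_mset (add_mset u M) = Xv ` \<G>'" "\<G>' \<in> pcS H W k v F'"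
      using FF(3,4) by (auto simp: vX_iff)
    then have "insert v F \<in> \<G>'" by (auto simp: pcS_def)
    then have "insert v F' \<subseteq> insert v F" using g(4) by (auto simp: pcS_def)
    then have "F' \<subseteq> F" using FF(1,2) by (auto simp: Fls_def)
    moreover have "finite F" using FF(1) fin by (auto simp: Fls_def intro: finite_subset)
    ultimately show ?thesis by (metis psubsetI psubset_card_mono)
  qed
  show "add_mset u M \<in> (\<Union>F\<in>Fls H W k v. vX (pcS H W k v F))"
    if MM: "M \<in> (\<Union>F\<in>Fls H W k v. vX (pcS H W k v F))" "add_mset u M \<in> sdX H W k" for M u
  proof -
    obtain F \<G> where g: "set_mset M = Xv ` \<G>" "\<G> \<in> pcS H W k v F" using MM(1) by (auto simp: vX_iff)
    obtain \<G>' where g': "set_mset (add_mset u M) = Xv ` \<G>'" "\<G>' \<in> chS H W k" using MM(2) by (auto simp: vX_iff)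
    have "insert v F \<in> \<G>'" using g g'(1) by (auto simp: pcS_def)
    then show ?thesis using in1[OF g'] by blast
  qed
qed

subsection \<open>Flags as lists\<close>

text \<open>
  Retrality at all inner positions of the flag. Retrality of a flag is \<open>ir\<close> of the
  flag with the whole set appended, and weak retrality is \<open>ir\<close> of the flag itself,
  apart from the size of the last flat.
\<close>

fun ir :: "nat set list => bool" where
  "ir (A # B # C # r) \<longleftrightarrow> (covers B A --> B - A = {Max (C - A)}) \<and> ir (B # C # r)"
| "ir _ \<longleftrightarrow> True"

text \<open>The last step is not a covering step.\<close>

fun nsl :: "nat set list => bool" where
  "nsl (A # B # C # r) \<longleftrightarrow> nsl (B # C # r)"
| "nsl [A, B] \<longleftrightarrow> \<not> covers B A"
| "nsl _ \<longleftrightarrow> True"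

lemma nsl_iff: "nsl Fs \<longleftrightarrow> (2 \<le> length Fs --> \<not> covers (last Fs) (last (butlast Fs)))"
  by (induction Fs rule: nsl.induct) auto

definition fc :: "nat set => nat set => nat => nat set list set" where
  "fc H W k = {Fs. Fs \<noteq> [] \<and> hd Fs = H \<and> sorted_wrt (\<subset>) Fs \<and> last Fs \<subseteq> W \<and> card (last Fs) \<le> k}"

lemma sorted_hd_last:
  assumes "sorted_wrt (\<subset>) Fs" "G \<in> set Fs" shows "hd Fs \<subseteq> G" "G \<subseteq> last Fs"
  using assms by (induction Fs) (auto split: if_splits)

lemma covers_insert: assumes "covers (insert v F) A" "A \<subseteq> F" "v \<notin> F" shows "A = F"
proof -
  obtain x where "insert v F - A = {x}" using assms(1) by (auto simp: covers_def card_1_singleton_iff)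
  moreover have "v \<notin> A" using assms(2,3) by auto
  ultimately have "F - A \<subseteq> {}" using assms(3) by (metis Diff_iff insertI1 insertI2 insert_Diff_if singletonD subsetI)
  then show ?thesis using assms(2) by auto
qed

text \<open>
  Where \<open>insert v F\<close> follows \<open>lo\<close>, the maximum in the definition of
  \<open>ir\<close> is \<open>v\<close> itself. Hence the last step of \<open>lo\<close> must
  not be a cover, while the step that adds \<open>v\<close> satisfies the condition.
\<close>

lemma ir_join:
  assumes v: "\<And>x. x \<in> W - H ==> x \<le> v" "finite W"
    and hi: "v \<notin> F" "F \<subseteq> W" "v \<in> W" "\<And>C. C \<in> set up ==> insert v F \<subset> C \<and> C \<subseteq> W"
    and lo: "lo \<noteq> []" "sorted_wrt (\<subset>) lo" "\<And>A. A \<in> set lo ==> H \<subseteq> A \<and> A \<subseteq> F"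
  shows "ir (lo @ insert v F # up) \<longleftrightarrow> ir lo \<and> nsl lo \<and> ir (insert v F # up)"
proof -
  have mx: "Max (S - A) = v" if "v \<in> S" "v \<notin> A" "H \<subseteq> A" "S \<subseteq> W" for S A
    using that v by (intro Max_eqI) (auto intro: finite_subset)
  show ?thesis using lo
  proof (induction lo rule: ir.induct)
    case (1 A B C r)
    have "ir ((B # C # r) @ insert v F # up) \<longleftrightarrow> ir (B # C # r) \<and> nsl (B # C # r) \<and> ir (insert v F # up)"
      by (rule "1.IH") (use "1.prems" in auto)
    then show ?case by auto
  next
    case ("2_3" A B)
    have m: "Max (insert v F - A) = v" by (rule mx) (use "2_3" hi in auto)
    have m': "Max (C - B) = v" if C: "C \<in> set up" for C
    proof -
      have "v \<in> C" "C \<subseteq> W" using hi(4)[OF C] by auto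
      moreover have "H \<subseteq> B" "B \<subseteq> F" using "2_3"(3)[of B] by simp_all
      ultimately show ?thesis using mx[of C B] hi(1) by blast
    qed
    have nB: "v \<notin> B" using "2_3" hi by auto
    have c1: "(covers B A --> B - A = {v}) \<longleftrightarrow> \<not> covers B A" using nB by blast
    have c2: "covers (insert v F) B --> insert v F - B = {v}" using covers_insert[of v F B] "2_3" hi by auto
    show ?case using m c1 c2 m' by (cases up) (simp_all)
  next
    case ("2_2" A)
    have m': "Max (C - A) = v" if C: "C \<in> set up" for C
    proof -
      have "v \<in> C" "C \<subseteq> W" using hi(4)[OF C] by auto
      moreover have "H \<subseteq> A" "A \<subseteq> F" using "2_2"(3)[of A] by simp_all
      ultimately show ?thesis using mx[of C A] hi(1) by blast
    qed
    have c2: "covers (insert v F) A --> insert v F - A = {v}" using covers_insert[of v F A] "2_2" hi by auto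
    show ?case using m' c2 by (cases up) simp_all
  qed simp
qed

text \<open>The condition on the minimum of the index set of an admissible wedge.\<close>

definition lc_ok :: "nat set list => nat set => bool" where
  "lc_ok Fs U \<longleftrightarrow> (2 \<le> length Fs \<and> covers (last Fs) (last (butlast Fs)) -->
      Min U < the_elem (last Fs - last (butlast Fs)))"

text \<open>
  The index of a basis element is a flag with the index set of its wedge. The empty index set
  stands for the flag without a wedge.
\<close>

definition SI :: "nat set => nat set => nat => (nat set list \<times> nat set) set" where
  "SI H W k = {(Fs, U). Fs \<in> fc H W k \<and> ir Fs \<and>
     (U = {} \<and> nsl Fs \<or> card (last Fs) = k \<and> U \<noteq> {} \<and> U \<subseteq> W - last Fs \<and> lc_ok Fs U)}"

definition xm :: "nat set list => var multiset" where
  "xm Fs = mset (map Xv (tl Fs))"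

text \<open>
  The element \<open>x\<^sub>\<F> \<otimes> \<xi>\<close>; \<open>xm\<close> omits the first
  flat of the flag.
\<close>

definition fel :: "nat set => nat set list \<times> nat set => var kos" where
  "fel W = (\<lambda>(Fs, U). wlist (lf (W - last Fs)) U (mon (xm Fs)))"

lemma xm_join: "lo \<noteq> [] ==> hi \<noteq> [] ==> xm (lo @ hi) = xm lo + {#Xv (hd hi)#} + xm hi"
  by (cases hi) (simp_all add: xm_def)

lemma shift_wlist: "finite U ==> shift \<alpha> (wlist (lf E) U (mon \<beta>)) = wlist (lf E) U (mon (\<alpha> + \<beta>))"
  unfolding shift_mon[symmetric]
  by (rule wlist_commute[where P = "\<lambda>_. True"]) (auto simp: shift_lf)

lemma fel_join:
  assumes "lo \<noteq> []" "hi \<noteq> []" "finite U"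
  shows "fel W (lo @ hi, U) = shift (xm lo) (shift {#Xv (hd hi)#} (fel W (hi, U)))"
  using assms by (simp add: fel_def shift_wlist xm_join add.assoc)

lemma SI_finite_U: "finite W ==> (Fs, U) \<in> SI H W k ==> finite U"
  by (auto simp: SI_def intro: finite_subset)

text \<open>
  Without a bound on the sizes, basis elements have no exterior part: a flag that carries a
  wedge ends with the whole set, which leaves no indices.
\<close>

lemma SI_complete: assumes "finite F" "(lo, U) \<in> SI H F (card F)" shows "U = {}"
proof (rule ccontr)
  assume "U \<noteq> {}"
  then have "card (last lo) = card F" "last lo \<subseteq> F" "U \<subseteq> F - last lo" using assms(2) by (auto simp: SI_def fc_def)
  then show False using \<open>U \<noteq> {}\<close> card_subset_eq[OF assms(1)] by auto
qed

lemma hom_basis_complete: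
  assumes "finite F" "hom_basis c X N (SI H F (card F)) (fel F)"
  shows "hom_basis c X N (SI H F (card F)) (\<lambda>i. mon (xm (fst i)))"
proof (rule kv.hbasis_cong[OF assms(2)])
  fix i assume i: "i \<in> SI H F (card F)"
  obtain lo U where lo: "i = (lo, U)" by (cases i)
  then have "U = {}" using SI_complete[OF assms(1)] i by blast
  then show "fel F i = mon (xm (fst i))" by (simp add: fel_def lo)
qed simp

lemma xm_in_sdX:
  assumes "Fs \<in> fc H W k" "finite W" shows "xm Fs \<in> sdX H W k"
proof -
  have s: "sorted_wrt (\<subset>) Fs" "Fs \<noteq> []" "hd Fs = H" "last Fs \<subseteq> W" "card (last Fs) \<le> k"
    using assms by (auto simp: fc_def)
  obtain r where r: "Fs = H # r" using s(2,3) by (cases Fs) auto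
  have "set r \<in> chS H W k"
  proof (rule chS_I)
    fix G assume G: "G \<in> set r"
    have "G \<subseteq> last Fs" using sorted_hd_last(2)[OF s(1)] G r by auto
    moreover have "card G \<le> card (last Fs)" by (rule card_mono[OF finite_subset[OF s(4) assms(2)] calculation])
    ultimately show "H \<subset> G \<and> G \<subseteq> W \<and> card G \<le> k" using s r G by auto
  next
    fix A B assume "A \<in> set r" "B \<in> set r"
    then obtain i j where "i < length r" "A = r ! i" "j < length r" "B = r ! j" by (auto simp: in_set_conv_nth)
    moreover have "sorted_wrt (\<subset>) r" using s(1) r by simp
    ultimately show "A \<subseteq> B \<or> B \<subseteq> A"
      by (metis linorder_neqE_nat order_refl psubset_imp_subset sorted_wrt_nth_less)
  qed
  then show ?thesis by (auto simp: vX_iff xm_def r)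
qed

lemma add_xm_in_sdX:
  assumes Fs: "Fs \<in> fc H W k" "finite W" and x: "add_mset w (xm Fs) \<in> sdX H W k"
  obtains G where "w = Xv G" "H \<subset> G" "G \<subseteq> W" "card G \<le> k" "G \<subseteq> last Fs \<or> last Fs \<subset> G"
proof -
  obtain \<G> where g: "insert w (set_mset (xm Fs)) = Xv ` \<G>" "\<G> \<in> chS H W k" using x by (auto simp: vX_iff)
  then obtain G where G: "w = Xv G" "G \<in> \<G>" by blast
  have d: "H \<subset> G" "G \<subseteq> W" "card G \<le> k" using chS_D(1-3)[OF g(2) G(2)] by auto
  have "G \<subseteq> last Fs \<or> last Fs \<subset> G"
  proof (cases "tl Fs = []")
    case True
    then have "last Fs = H" using Fs by (cases Fs) (auto simp: fc_def)
    then show ?thesis using d by auto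
  next
    case False
    then have "Xv (last Fs) \<in># xm Fs" by (cases Fs) (auto simp: xm_def)
    then have "last Fs \<in> \<G>" using g(1) by blast
    then show ?thesis using chS_D(4)[OF g(2) G(2)] by blast
  qed
  then show thesis using that G(1) d by blast
qed

text \<open>A flat compatible with the monomial is comparable with the last flat, and it is not larger.\<close>

lemma top_flat:
  assumes "Fs \<in> fc H W k" "finite W" "add_mset w (xm Fs) \<in> sdX H W k" "card (last Fs) = k"
  obtains G where "w = Xv G" "G \<subseteq> last Fs"
proof -
  obtain G where G: "w = Xv G" "card G \<le> k" "G \<subseteq> W" "G \<subseteq> last Fs \<or> last Fs \<subset> G"
    using add_xm_in_sdX[OF assms(1-3)] by metis
  have "\<not> last Fs \<subset> G"
    using psubset_card_mono[of G "last Fs"] G(2,3) assms(2,4) finite_subset by fastforce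
  then show thesis using that G by blast
qed

text \<open>
  Forms in the wedge have indices outside of the last flat, which is as large as possible; so
  they annihilate the monomial by \<open>top_flat\<close>.
\<close>

lemma fel_cycle:
  assumes "finite W" "Fs \<in> fc H W k" "U \<subseteq> W - last Fs" "U = {} \<or> card (last Fs) = k"
  shows "dk cy (sdX H W k) (W - H) (fel W (Fs, U)) = 0"
proof (cases "U = {}")
  case True then show ?thesis using assms(1) by (simp add: fel_def dk_mon)
next
  case False
  have Fs: "Fs \<in> fc H W k" "card (last Fs) = k" "U \<subseteq> W - last Fs" using assms False by auto
  have H: "H \<subseteq> last Fs" using Fs(1) sorted_hd_last(1)[of Fs "last Fs"] by (auto simp: fc_def)
  have z: "cy u w = 0" if uw: "u \<in> W - last Fs" "add_mset w (xm Fs) \<in> sdX H W k" for u w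
  proof -
    obtain G where "w = Xv G" "G \<subseteq> last Fs" using top_flat[OF Fs(1) assms(1) uw(2) Fs(2)] .
    then show ?thesis using uw(1) by auto
  qed
  show ?thesis unfolding fel_def prod.case
  proof (rule dk_wlist)
    show "U \<subseteq> W - H" "W - last Fs \<subseteq> W - H" using Fs(3) H by auto
    fix u w assume u: "u \<in> U" "add_mset w (xm Fs) \<in> sdX H W k"
    have "cy u w = 0" using z[OF _ u(2)] u(1) Fs(3) by auto
    moreover have "cy (succ_in (W - last Fs) u) w = 0" if "\<exists>w\<in>W - last Fs. u < w"
      using z[OF succ_in(1)[OF _ that] u(2)] assms(1) by simp
    ultimately show "if \<exists>w\<in>W - last Fs. u < w then cy u w = cy (succ_in (W - last Fs) u) w else cy u w = 0"
      by simp
  qed (use assms(1) in auto)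
qed

lemma fel_kz:
  assumes "finite W" "Fs \<in> fc H W k" "U \<subseteq> W - last Fs"
  shows "fel W (Fs, U) \<in> kz (sdX H W k) (W - H)"
proof -
  have H: "H \<subseteq> last Fs" using assms(2) sorted_hd_last(1)[of Fs "last Fs"] by (auto simp: fc_def)
  have E: "finite (W - last Fs)" "W - last Fs \<subseteq> W - H" using assms(1) H by auto
  show ?thesis unfolding fel_def prod.case
  proof (rule wlist_invariant[where P = "\<lambda>\<nu>. \<nu> \<in> kz (sdX H W k) (W - H)"])
    show "finite U" using assms(3) E(1) by (rule finite_subset)
    show "mon (xm Fs) \<in> kz (sdX H W k) (W - H)" by (rule mon_kz[OF xm_in_sdX[OF assms(2,1)]])
    show "lf (W - last Fs) u \<nu> \<in> kz (sdX H W k) (W - H)" if "u \<in> U" "\<nu> \<in> kz (sdX H W k) (W - H)" for u \<nu>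
      by (rule lf_kz[OF E subsetD[OF assms(3) that(1)] that(2)])
  qed
qed

section \<open>Chains in an interval\<close>

lemma stX_star: "stX F W k = supp_in {insert (Xv F) S | S. S \<in> (`) Xv ` chS F W k}"
proof -
  have "(`) Xv ` insert F ` chS F W k = {insert (Xv F) S | S. S \<in> (`) Xv ` chS F W k}"
    by (simp only: Setcompr_eq_image image_image image_insert)
  then show ?thesis by (simp only: vX_def)
qed

text \<open>
  The piece of the monomials with smallest member \<open>insert v F\<close> containing
  \<open>v\<close> is a product: chains below \<open>F\<close> times chains from \<open>insert v
  F\<close>.
\<close>

lemma hom_basis_piece:
  assumes H: "H \<subseteq> F" "v \<notin> F" "F \<subseteq> W" "v \<in> W" "finite W" "card F < k"
    and NU: "finite NU" "(F - H) \<inter> NU = {}"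
    and zero: "\<And>j G. j \<in> NU ==> G \<subseteq> F ==> c j (Xv G) = 0"
    and hL: "hom_basis c (sdX H F (card F)) (F - H) I1 (\<lambda>i. mon (f i))"
    and hU: "hom_basis c (stX (insert v F) W k) NU I2 s"
  shows "hom_basis c (vX (pcS H W k v F)) ((F - H) \<union> NU) (I1 \<times> I2) (\<lambda>(i, j). shift (f i) (s j))"
proof (rule hom_basis_tensor[where VL = "Xv ` Pow F", OF _ NU(1,2) _ _ _ _ _ pcS_split[OF H] _ hL hU refl])
  have finF: "finite F" using H finite_subset by blast
  show "finite (F - H)" using finF by simp
  show "okX (vX (pcS H W k v F))" by (rule okX_pcS[OF H(5)])
  show "okX (sdX H F (card F))" by (rule okX_sdX[OF finF])
  show "okX (stX (insert v F) W k)" by (rule okX_stX[OF H(5)]) (use H in auto)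
  show "set_mset M \<subseteq> Xv ` Pow F" if M: "M \<in> sdX H F (card F)" for M
  proof -
    obtain \<G> where "set_mset M = Xv ` \<G>" "\<G> \<in> chS H F (card F)" using M by (auto simp: vX_iff)
    then have "\<And>G. G \<in> \<G> ==> G \<subseteq> F" using chS_D(2) by metis
    then show ?thesis using \<open>set_mset M = Xv ` \<G>\<close> by auto
  qed
  show "set_mset M \<inter> Xv ` Pow F = {}" if M: "M \<in> stX (insert v F) W k" for M
  proof -
    obtain \<G> where g: "set_mset M = Xv ` insert (insert v F) \<G>" "\<G> \<in> chS (insert v F) W k"
      using M by (auto simp: vX_iff)
    have "v \<in> G" if "G \<in> insert (insert v F) \<G>" for G using that chS_D(1)[OF g(2), of G] by auto
    then show ?thesis using g(1) H(2) by auto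
  qed
  show "c j w = 0" if "j \<in> NU" "w \<in> Xv ` Pow F" for j w using that zero by auto
qed

lemma last_butlast_append: "hi \<noteq> [] ==> lo \<noteq> [] ==> last (butlast (lo @ hi)) = (if tl hi = [] then last lo else last (butlast hi))"
  by (cases hi) (auto simp: butlast_append)

lemma list_append_facts:
  assumes "hi \<noteq> []" "lo \<noteq> []"
  shows "2 \<le> length (lo @ hi)" "last (lo @ hi) = last hi" "tl hi = [] ==> last hi = hd hi" "tl hi \<noteq> [] ==> 2 \<le> length hi"
    "tl hi = [] ==> length hi < 2"
proof -
  obtain a b c d where h: "hi = a # b" "lo = c # d" using assms by (meson neq_Nil_conv)
  show "2 \<le> length (lo @ hi)" "last (lo @ hi) = last hi" "tl hi = [] ==> last hi = hd hi" "tl hi = [] ==> length hi < 2"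
    using h by simp_all
  show "2 \<le> length hi" if "tl hi \<noteq> []" using h that by (cases b) auto
qed

lemma nsl_append: "hi \<noteq> [] ==> lo \<noteq> [] ==> nsl (lo @ hi) \<longleftrightarrow> (if tl hi = [] then \<not> covers (hd hi) (last lo) else nsl hi)"
  using list_append_facts[of hi lo] unfolding nsl_iff by (simp add: last_butlast_append)

lemma lc_ok_append: "hi \<noteq> [] ==> lo \<noteq> [] ==>
    lc_ok (lo @ hi) U \<longleftrightarrow> (if tl hi = [] then covers (hd hi) (last lo) --> Min U < the_elem (hd hi - last lo) else lc_ok hi U)"
  using list_append_facts[of hi lo] unfolding lc_ok_def by (simp add: last_butlast_append)

lemma lc_ok_single: "length Fs < 2 ==> lc_ok Fs U" by (simp add: lc_ok_def)

lemma lc_ok_nsl: "nsl Fs ==> lc_ok Fs U" unfolding lc_ok_def nsl_iff by blast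

definition JF :: "nat set => nat set => nat => nat => nat set => (nat set list \<times> nat set) set" where
  "JF H W k v F = (\<lambda>((lo, _), (hi, U)). (lo @ hi, U)) ` (SI H F (card F) \<times> SI (insert v F) W k)"

definition RS :: "nat set => nat set => nat => nat => (nat set list \<times> nat set) set" where
  "RS H W k v = {(lo @ [insert v (last lo)], {}) | lo. (lo, {}) \<in> SI H (W - {v}) k \<and> card (last lo) < k}"

lemma fc_append:
  assumes lo: "lo \<in> fc H F m" and hi: "hi \<in> fc (insert v F) W k" and v: "v \<notin> F"
  shows "lo @ hi \<in> fc H W k"
proof -
  have "\<forall>x\<in>set lo. \<forall>y\<in>set hi. x \<subset> y"
  proof (intro ballI)
    fix x y assume xy: "x \<in> set lo" "y \<in> set hi"
    have "x \<subseteq> F" using sorted_hd_last(2)[of lo x] lo xy(1) by (auto simp: fc_def)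
    moreover have "insert v F \<subseteq> y" using sorted_hd_last(1)[of hi y] hi xy(2) by (auto simp: fc_def)
    ultimately show "x \<subset> y" using v by blast
  qed
  then show ?thesis using lo hi by (auto simp: fc_def sorted_wrt_append)
qed

lemma fc_split:
  assumes Fs: "Fs \<in> fc H W k" and v: "v \<in> last Fs" "v \<notin> H" and fin: "finite W"
  obtains lo hi F where "Fs = lo @ hi" "F \<in> Fls H W k v" "lo \<in> fc H F (card F)" "hi \<in> fc (insert v F) W k"
proof -
  let ?lo = "takeWhile (\<lambda>G. v \<notin> G) Fs" and ?hi = "dropWhile (\<lambda>G. v \<notin> G) Fs"
  have s: "sorted_wrt (\<subset>) Fs" "Fs \<noteq> []" "hd Fs = H" "last Fs \<subseteq> W" "card (last Fs) \<le> k"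
    using Fs by (auto simp: fc_def)
  have e: "Fs = ?lo @ ?hi" by simp
  have hi: "?hi \<noteq> []" using v(1) s(2) by (auto simp: dropWhile_eq_Nil_conv)
  have lo: "?lo \<noteq> []" "hd ?lo = H" using s(2,3) v(2) by (cases Fs; auto)+
  have vh: "v \<in> hd ?hi" using hd_dropWhile[OF hi] by simp
  define F where "F = hd ?hi - {v}"
  have F: "insert v F = hd ?hi" using vh by (auto simp: F_def)
  have lh: "last ?hi = last Fs" using hi e by (metis last_appendR)
  have hW: "hd ?hi \<subseteq> last Fs" using sorted_hd_last(2)[OF s(1), of "hd ?hi"] hi by (metis hd_in_set set_dropWhileD)
  have fl: "finite (last Fs)" using s(4) fin finite_subset by blast
  have ss: "sorted_wrt (\<subset>) ?lo" "sorted_wrt (\<subset>) ?hi" "\<forall>x\<in>set ?lo. \<forall>y\<in>set ?hi. x \<subset> y"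
    using s(1) e by (metis sorted_wrt_append)+
  have ll: "last ?lo \<subset> hd ?hi" using ss(3) lo(1) hi by (meson hd_in_set last_in_set)
  have "v \<notin> last ?lo" using lo(1) by (metis last_in_set set_takeWhileD)
  then have lF: "last ?lo \<subseteq> F" using ll by (auto simp: F_def)
  have HF: "H \<subseteq> F" using sorted_hd_last(1)[OF ss(1), of "last ?lo"] lo lF by auto
  have finF: "finite F" using fl hW by (auto simp: F_def intro: finite_subset)
  have "card F < card (hd ?hi)" using vh finF F by (metis card_insert_disjoint F_def Diff_iff insertI1 lessI)
  also have "\<dots> \<le> card (last Fs)" by (rule card_mono[OF fl hW])
  finally have cF: "card F < k" using s(5) by simp
  have "F \<in> Fls H W k v" using HF cF hW s(4) by (auto simp: Fls_def F_def)
  moreover have "?lo \<in> fc H F (card F)" using lo ss(1) lF card_mono[OF finF lF] by (simp add: fc_def)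
  moreover have "?hi \<in> fc (insert v F) W k" using hi ss(2) s(4,5) lh F by (simp add: fc_def)
  ultimately show thesis using that[OF e] by blast
qed

lemma ir_join_fc:
  assumes v: "\<And>x. x \<in> W - H ==> x \<le> v" "finite W" "v \<in> W" and F: "F \<in> Fls H W k v"
    and lo: "lo \<in> fc H F m" and hi: "hi \<in> fc (insert v F) W k"
  shows "ir (lo @ hi) \<longleftrightarrow> ir lo \<and> nsl lo \<and> ir hi"
proof -
  obtain up where up: "hi = insert v F # up" using hi by (cases hi) (auto simp: fc_def)
  have FF: "v \<notin> F" "F \<subseteq> W" using F by (auto simp: Fls_def)
  have "insert v F \<subset> C \<and> C \<subseteq> W" if "C \<in> set up" for C
    using hi that sorted_hd_last(2)[of hi C] by (auto simp: fc_def up)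
  moreover have "H \<subseteq> A \<and> A \<subseteq> F" if "A \<in> set lo" for A
    using lo that sorted_hd_last[of lo A] by (auto simp: fc_def)
  moreover have "lo \<noteq> []" "sorted_wrt (\<subset>) lo" using lo by (auto simp: fc_def)
  ultimately show ?thesis unfolding up by (intro ir_join[OF v(1,2) FF v(3)])
qed

lemma Fls_finite: "finite W ==> finite (Fls H W k v)"
  by (rule finite_subset[of _ "Pow W"]) (auto simp: Fls_def)

lemma covers_insert_iff:
  assumes "v \<notin> F" "A \<subseteq> F" shows "covers (insert v F) A \<longleftrightarrow> A = F"
proof
  show "covers (insert v F) A ==> A = F" using covers_insert assms by metis
  have "insert v F - F = {v}" using assms(1) by auto
  then show "A = F ==> covers (insert v F) A" by (auto simp: covers_def)
qed

lemma dk_restrict_zero: "X1 \<subseteq> X ==> dk c X N \<nu> = 0 ==> dk c X1 N \<nu> = 0"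
proof (intro ext)
  fix J M assume X: "X1 \<subseteq> X" and z: "dk c X N \<nu> = 0"
  have "dk c X N \<nu> J M = 0" by (simp add: z)
  then show "dk c X1 N \<nu> J M = 0 J M" using X by (auto simp: dk_def rs_def split: if_splits)
qed

lemma eps_rw_same: "eps v (rw v \<nu>) = 0"
  by (intro ext) (simp add: eps_def rw_def)

lemma rw_lf:
  assumes "finite E" "\<And>x. x \<in> E ==> x < v" "u \<in> E"
  shows "rw v (lf E u \<nu>) = lf (insert v E) u (rw v \<nu>)"
proof (cases "\<exists>w\<in>E. u < w")
  case True
  have "succ_in E u < v" using succ_in(1)[OF assms(1) True] assms(2) by blast
  then show ?thesis using True succ_in_insert_greater[OF assms(1) True assms(2)] assms(2,3)
    by (auto simp: lf_def kv.lin_opD(5)[OF lin_rw] rw_eps)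
next
  case False
  have "succ_in (insert v E) u = v" by (rule succ_in_insert_last[OF False assms(2)[OF assms(3)]])
  then show ?thesis using False assms(2,3) by (auto simp: lf_def rw_eps eps_rw_same)
qed

context
  fixes H W :: "nat set" and k v :: nat
  assumes v: "\<And>x. x \<in> W - H ==> x \<le> v" "v \<in> W" "v \<notin> H" and fin: "finite W"
begin

lemma vless: "x \<in> W - H ==> x \<noteq> v ==> x < v" using v(1) by force

lemma JF_elim:
  assumes "i \<in> JF H W k v F" "F \<in> Fls H W k v"
  shows "i \<in> SI H W k \<and> v \<in> last (fst i) \<or> i \<in> RS H W k v"
proof -
  obtain lo Ul hi U where i: "i = (lo @ hi, U)" "(lo, Ul) \<in> SI H F (card F)" "(hi, U) \<in> SI (insert v F) W k"
    using assms(1) by (auto simp: JF_def)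
  have F: "v \<notin> F" "F \<subseteq> W - {v}" "H \<subseteq> F" "card F < k" using assms(2) by (auto simp: Fls_def)
  have finF: "finite F" using F fin finite_subset by blast
  have lo: "lo \<in> fc H F (card F)" "ir lo" "nsl lo"
    using i(2) SI_complete[OF finF i(2)] by (auto simp: SI_def)
  have hi: "hi \<in> fc (insert v F) W k" "ir hi" using i(3) by (auto simp: SI_def)
  have ne: "lo \<noteq> []" "hi \<noteq> []" "hd hi = insert v F" "last lo \<subseteq> F" using lo(1) hi(1) by (auto simp: fc_def)
  have fcj: "lo @ hi \<in> fc H W k" by (rule fc_append[OF lo(1) hi(1) F(1)])
  have irj: "ir (lo @ hi)" using ir_join_fc[OF v(1) fin v(2) assms(2) lo(1) hi(1)] lo hi by simp
  have "insert v F \<subseteq> last hi" using hi(1) sorted_hd_last(1)[of hi "last hi"] by (auto simp: fc_def)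
  then have vl: "v \<in> last (lo @ hi)" and HL: "H \<subseteq> last hi" using ne F by auto
  have cov: "covers (hd hi) (last lo) \<longleftrightarrow> last lo = F" using covers_insert_iff[OF F(1) ne(4)] ne(3) by simp
  show ?thesis
  proof (cases "U = {}")
    case True
    then have nh: "nsl hi" using i(3) by (auto simp: SI_def)
    show ?thesis
    proof (cases "tl hi = [] \<and> last lo = F")
      case False
      then have "nsl (lo @ hi)" using nh cov nsl_append[OF ne(2,1)] by (simp split: if_splits)
      then show ?thesis using i(1) True fcj irj vl by (simp add: SI_def)
    next
      case T: True
      have "hi = [insert v F]" using T ne(2,3) by (cases hi) auto
      moreover have "(lo, {}) \<in> SI H (W - {v}) k" using lo F T by (auto simp: SI_def fc_def)
      ultimately show ?thesis using i(1) True T F(4) by (auto simp: RS_def)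
    qed
  next
    case False
    then have U: "card (last hi) = k" "U \<subseteq> W - last hi" "lc_ok hi U" using i(3) by (auto simp: SI_def)
    have "Min U \<in> U" using False U(2) fin by (intro Min_in) (auto intro: finite_subset)
    then have "Min U < v" using U(2) vl HL ne vless[of "Min U"] by auto
    moreover have "insert v F - F = {v}" using F(1) by auto
    ultimately have "lc_ok (lo @ hi) U" using U(3) cov ne(3) lc_ok_append[OF ne(2,1)] by auto
    then show ?thesis using i(1) False U fcj irj vl ne by (simp add: SI_def)
  qed
qed

lemma JF_intro:
  assumes "i \<in> SI H W k" "v \<in> last (fst i)"
  shows "\<exists>F\<in>Fls H W k v. i \<in> JF H W k v F"
proof -
  obtain Fs U where i: "i = (Fs, U)" by (cases i)
  have Fs: "Fs \<in> fc H W k" "ir Fs" "v \<in> last Fs" using assms i by (auto simp: SI_def)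
  obtain lo hi F where s: "Fs = lo @ hi" "F \<in> Fls H W k v" "lo \<in> fc H F (card F)" "hi \<in> fc (insert v F) W k"
    using fc_split[OF Fs(1,3) v(3) fin] .
  have irs: "ir lo" "nsl lo" "ir hi" using ir_join_fc[OF v(1) fin v(2) s(2,3,4)] Fs(2) s(1) by auto
  have ne: "lo \<noteq> []" "hi \<noteq> []" using s(3,4) by (auto simp: fc_def)
  have "(lo, {}) \<in> SI H F (card F)" using s(3) irs by (simp add: SI_def)
  moreover have "(hi, U) \<in> SI (insert v F) W k"
  proof (cases "U = {}")
    case True
    then have "nsl (lo @ hi)" using assms(1) i s(1) by (auto simp: SI_def)
    then have "nsl hi" using nsl_append[OF ne(2,1)] ne(2) by (cases hi; cases "tl hi") (auto split: if_splits)
    then show ?thesis using True s(4) irs by (simp add: SI_def)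
  next
    case False
    then have U: "card (last hi) = k" "U \<subseteq> W - last hi" "lc_ok (lo @ hi) U" using assms(1) i s(1) ne by (auto simp: SI_def)
    then have "lc_ok hi U" using lc_ok_append[OF ne(2,1)] ne(2)
      by (cases "tl hi = []") (auto simp: neq_Nil_conv intro: lc_ok_single)
    then show ?thesis using False U s(4) irs by (simp add: SI_def)
  qed
  ultimately have "i \<in> JF H W k v F" unfolding JF_def i s(1)
    by (intro image_eqI[of _ _ "((lo, {}), (hi, U))"]) auto
  then show ?thesis using s(2) by blast
qed

lemma RS_in_JF: "i \<in> RS H W k v ==> \<exists>F\<in>Fls H W k v. i \<in> JF H W k v F"
proof -
  assume "i \<in> RS H W k v"
  then obtain lo where lo: "i = (lo @ [insert v (last lo)], {})" "(lo, {}) \<in> SI H (W - {v}) k" "card (last lo) < k"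
    by (auto simp: RS_def)
  let ?F = "last lo"
  have l: "lo \<in> fc H (W - {v}) k" "ir lo" "nsl lo" using lo(2) by (auto simp: SI_def)
  then have F: "?F \<in> Fls H W k v" using lo(3) sorted_hd_last(1)[of lo ?F] by (auto simp: Fls_def fc_def)
  have finF: "finite ?F" using l(1) fin by (auto simp: fc_def intro: finite_subset)
  have "(lo, {}) \<in> SI H ?F (card ?F)" using l by (auto simp: SI_def fc_def)
  moreover have "([insert v ?F], {}) \<in> SI (insert v ?F) W k"
    using F lo(3) v(2) finF by (auto simp: SI_def fc_def Fls_def card_insert_if)
  ultimately have "i \<in> JF H W k v ?F" unfolding JF_def lo(1)
    by (intro image_eqI[of _ _ "((lo, {}), ([insert v ?F], {}))"]) auto
  then show ?thesis using F by blast
qed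

text \<open>
  Joined flags are the basis flags that meet \<open>v\<close>, together with the superfluous
  flags \<open>RS\<close>: these end with the covering step that adds \<open>v\<close>.
\<close>

lemma JF_union: "(\<Union>F\<in>Fls H W k v. JF H W k v F) = {i \<in> SI H W k. v \<in> last (fst i)} \<union> RS H W k v"
  using JF_elim JF_intro RS_in_JF by blast

lemma RS_last: "i \<in> RS H W k v ==> v \<in> last (fst i)" by (auto simp: RS_def)

lemma RS_not_SI: "i \<in> RS H W k v ==> i \<notin> SI H W k"
proof
  assume i: "i \<in> RS H W k v" "i \<in> SI H W k"
  then obtain lo where lo: "i = (lo @ [insert v (last lo)], {})" "(lo, {}) \<in> SI H (W - {v}) k"
    by (auto simp: RS_def)
  then have l: "lo \<noteq> []" "v \<notin> last lo" by (auto simp: SI_def fc_def)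
  have "nsl (lo @ [insert v (last lo)])" using i(2) lo(1) by (auto simp: SI_def)
  then show False using nsl_append[of "[insert v (last lo)]" lo] l covers_insert_iff[OF l(2) order_refl] by simp
qed

lemma SI_below:
  assumes "(Fs, U) \<in> SI H (W - {v}) k"
  shows "Fs \<in> fc H W k" "v \<notin> last Fs" "U \<subseteq> (W - {v}) - last Fs" "U = {} \<or> card (last Fs) = k"
  using assms by (auto simp: SI_def fc_def)

text \<open>
  Doubling the basis of the interval without \<open>v\<close> by \<open>\<ell>\<^sub>v\<close>
  gives the basis flags that do not meet \<open>v\<close>, and superfluous elements
  \<open>\<ell>\<^sub>v\<close> times a flag that ends below the maximal size. The latter cancel
  with \<open>RS\<close>.
\<close>

lemma SI_adjoin:
  "(\<lambda>((Fs, U), b). (Fs, if b then insert v U else U)) ` (SI H (W - {v}) k \<times> UNIV) =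
    {i \<in> SI H W k. v \<notin> last (fst i)} \<union> {(lo, {v}) | lo. (lo, {}) \<in> SI H (W - {v}) k \<and> card (last lo) < k}"
    (is "?g ` ?S = ?A \<union> ?T")
proof (intro set_eqI iffI)
  fix i assume "i \<in> ?g ` ?S"
  then obtain Fs U b where i: "(Fs, U) \<in> SI H (W - {v}) k" "i = (Fs, if b then insert v U else U)" by auto
  note b = SI_below[OF i(1)]
  have irF: "ir Fs" "Fs \<in> fc H (W - {v}) k" using i(1) by (auto simp: SI_def)
  show "i \<in> ?A \<union> ?T"
  proof (cases "U = {}")
    case True
    then have n: "nsl Fs" using i(1) by (auto simp: SI_def)
    show ?thesis
    proof (cases b)
      case False then show ?thesis using True n b irF i(2) by (auto simp: SI_def)
    next
      case bT: True
      show ?thesis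
      proof (cases "card (last Fs) < k")
        case True then show ?thesis using i bT \<open>U = {}\<close> by auto
      next
        case False
        then have "card (last Fs) = k" using irF by (auto simp: fc_def)
        then show ?thesis using i(2) bT True b irF lc_ok_nsl[OF n] v(2) by (auto simp: SI_def)
      qed
    qed
  next
    case False
    have finU: "finite U" using b(3) fin by (auto intro: finite_subset)
    have H: "H \<subseteq> last Fs" using irF(2) sorted_hd_last(1)[of Fs "last Fs"] by (auto simp: fc_def)
    have "Min U \<in> U" using finU False by simp
    then have "Min U < v" using b(3) H vless[of "Min U"] by auto
    then have "Min (insert v U) = Min U" using finU False by simp
    then have "lc_ok Fs (insert v U) = lc_ok Fs U" by (simp add: lc_ok_def)
    then show ?thesis using i False b irF v(2) by (auto simp: SI_def)
  qed
next
  fix i assume "i \<in> ?A \<union> ?T"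
  then show "i \<in> ?g ` ?S"
  proof
    assume "i \<in> ?T"
    then obtain lo where "i = (lo, {v})" "(lo, {}) \<in> SI H (W - {v}) k" by blast
    then show ?thesis by (intro image_eqI[of _ _ "((lo, {}), True)"]) auto
  next
    assume "i \<in> ?A"
    then obtain Fs U where i: "i = (Fs, U)" "(Fs, U) \<in> SI H W k" "v \<notin> last Fs" by (cases i) auto
    have Fs: "Fs \<in> fc H (W - {v}) k" "ir Fs" using i(2,3) by (auto simp: SI_def fc_def)
    have H: "H \<subseteq> last Fs" using Fs(1) sorted_hd_last(1)[of Fs "last Fs"] by (auto simp: fc_def)
    have "(Fs, U - {v}) \<in> SI H (W - {v}) k"
    proof (cases "U = {}")
      case True then show ?thesis using i Fs by (auto simp: SI_def)
    next
      case False
      then have U: "card (last Fs) = k" "U \<subseteq> W - last Fs" "lc_ok Fs U" using i by (auto simp: SI_def)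
      have finU: "finite U" using U(2) fin by (auto intro: finite_subset)
      show ?thesis
      proof (cases "U - {v} = {}")
        case True
        then have Uv: "U = {v}" using False by auto
        have "nsl Fs"
        proof (rule ccontr)
          assume "\<not> nsl Fs"
          then have c: "2 \<le> length Fs" "covers (last Fs) (last (butlast Fs))" by (auto simp: nsl_iff)
          then obtain x where x: "last Fs - last (butlast Fs) = {x}" by (auto simp: covers_def card_1_singleton_iff)
          then have "v < x" using U(3) c Uv by (simp add: lc_ok_def)
          moreover have "last (butlast Fs) \<in> set Fs" using c(1)
            by (metis One_nat_def in_set_butlastD last_in_set length_butlast list.size(3) not_less_eq_eq numeral_2_eq_2 diff_Suc_1 le_zero_eq nat.simps(3) diff_is_0_eq)
          then have "H \<subseteq> last (butlast Fs)" using Fs(1) sorted_hd_last(1)[of Fs] by (auto simp: fc_def)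
          then have "x \<in> W - H" using x Fs(1) by (auto simp: fc_def)
          ultimately show False using v(1) by force
        qed
        then show ?thesis using True Fs by (simp add: SI_def)
      next
        case ne: False
        have "Min (U - {v}) \<in> U - {v}" using finU ne by (intro Min_in) auto
        then have "Min (U - {v}) < v" using U(2) H vless[of "Min (U - {v})"] by auto
        have "Min U = Min (U - {v})"
        proof (cases "v \<in> U")
          case True
          then have "insert v (U - {v}) = U" by auto
          then have "Min U = min v (Min (U - {v}))" using Min_insert[of "U - {v}" v] finU ne by auto
          then show ?thesis using \<open>Min (U - {v}) < v\<close> by simp
        qed simp
        then have "lc_ok Fs (U - {v})" using U(3) by (simp add: lc_ok_def)
        then show ?thesis using U Fs ne by (auto simp: SI_def)
      qed
    qed
    then show ?thesis using i(1) by (intro image_eqI[of _ _ "((Fs, U - {v}), v \<in> U)"]) auto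
  qed
qed

text \<open>
  The new largest element \<open>v\<close> of the complement becomes the successor of the old
  one, \<open>u\<close>. This changes nothing after multiplication by
  \<open>\<ell>\<^sub>v\<close>, because \<open>(\<ell>\<^sub>u - \<ell>\<^sub>v) \<and>
  \<ell>\<^sub>v = \<ell>\<^sub>u \<and> \<ell>\<^sub>v\<close>.
\<close>

lemma fel_insert_max:
  assumes "finite U" "U \<subseteq> W - {v} - last Fs" "H \<subseteq> last Fs" "v \<notin> last Fs"
  shows "fel W (Fs, insert v U) = rw v (fel (W - {v}) (Fs, U))"
proof -
  let ?E = "W - last Fs" and ?E' = "W - {v} - last Fs"
  have E: "?E = insert v ?E'" "finite ?E'" using assms(4) v(2) fin by auto
  have lt: "x < v" if "x \<in> ?E'" for x using that assms(3) vless by auto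
  have nex: "\<not> (\<exists>w\<in>?E. v < w)" using lt E(1) by force
  have l1: "lf ?E v (mon (xm Fs)) = eps v (mon (xm Fs))" unfolding lf_def using nex by simp
  have "rw v (wlist (lf ?E') U (mon (xm Fs))) = wlist (lf ?E) U (rw v (mon (xm Fs)))"
    by (rule wlist_commute[where P = "\<lambda>_. True", OF assms(1)])
      (use rw_lf[OF E(2) lt] assms(2) E(1) in auto)
  moreover have "wlist (lf ?E) (insert v U) (mon (xm Fs)) = wlist (lf ?E) U (lf ?E v (mon (xm Fs)))"
    by (rule wlist_insert_max[OF assms(1)]) (use lt assms(2) in auto)
  ultimately show ?thesis by (simp add: fel_def l1 rw_mon)
qed

text \<open>
  The wedges for \<open>W\<close> and for \<open>W - {v}\<close> differ by a multiple of
  \<open>\<ell>\<^sub>v\<close>, which comes from the factor \<open>\<ell>\<^sub>u -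
  \<ell>\<^sub>v\<close> with the old maximum \<open>u\<close>.
\<close>

lemma fel_not_max:
  assumes "finite U" "U \<subseteq> W - {v} - last Fs" "H \<subseteq> last Fs" "v \<notin> last Fs"
  shows "fel W (Fs, U) = fel (W - {v}) (Fs, U) \<or>
    (U \<noteq> {} \<and> (\<exists>U1\<subseteq>U. fel W (Fs, U) = fel (W - {v}) (Fs, U) - rw v (fel (W - {v}) (Fs, U1))))"
proof -
  let ?E = "W - last Fs" and ?E' = "W - {v} - last Fs"
  have E: "?E = insert v ?E'" "finite ?E'" using assms(4) v(2) fin by auto
  have lt: "x < v" if "x \<in> ?E'" for x using that assms(3) vless by auto
  have same: "lf ?E u \<nu> = lf ?E' u \<nu>" if "\<exists>w\<in>?E'. u < w" for u and \<nu> :: "var kos"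
    using succ_in_insert_greater[OF E(2) that lt] that unfolding lf_def E(1) by auto
  show ?thesis
  proof (cases "\<forall>u\<in>U. \<exists>w\<in>?E'. u < w")
    case True
    have "wlist (lf ?E) U (mon (xm Fs)) = wlist (lf ?E') U (mon (xm Fs))"
      by (rule wlist_cong[OF assms(1)]) (use same True in blast)
    then show ?thesis by (simp add: fel_def)
  next
    case False
    then obtain u0 where u0: "u0 \<in> U" "\<And>w. w \<in> ?E' ==> \<not> u0 < w" by blast
    let ?U = "U - {u0}"
    have U: "U = insert u0 ?U" "finite ?U" using u0 assms(1) by auto
    have ltu: "u < u0" if "u \<in> ?U" for u
    proof -
      have "u \<in> ?E'" "u \<noteq> u0" using that assms(2) by auto
      then show ?thesis using u0(2)[of u] by simp
    qed
    have u0E: "u0 \<in> ?E'" using u0(1) assms(2) by blast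
    have m0: "lf ?E u0 (mon (xm Fs)) = eps u0 (mon (xm Fs)) - eps v (mon (xm Fs))"
      "lf ?E' u0 (mon (xm Fs)) = eps u0 (mon (xm Fs))"
    proof -
      have nex: "\<not> (\<exists>w\<in>?E'. u0 < w)" using u0(2) by blast
      show "lf ?E' u0 (mon (xm Fs)) = eps u0 (mon (xm Fs))" unfolding lf_def using nex by simp
      have "\<exists>w\<in>insert v ?E'. u0 < w" using lt[OF u0E] by blast
      then show "lf ?E u0 (mon (xm Fs)) = eps u0 (mon (xm Fs)) - eps v (mon (xm Fs))"
        unfolding lf_def E(1) using succ_in_insert_last[OF nex lt[OF u0E]] by simp
    qed
    have lv: "lf ?E v (mon (xm Fs)) = eps v (mon (xm Fs))"
    proof -
      have "\<not> (\<exists>w\<in>?E. v < w)" using lt E(1) by force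
      then show ?thesis unfolding lf_def by simp
    qed
    have e1: "wlist (lf ?E) ?U \<nu> = wlist (lf ?E') ?U \<nu>" for \<nu> :: "var kos"
      by (rule wlist_cong[OF U(2)]) (use same ltu u0E in blast)
    have e2: "wlist (lf D) U \<nu> = wlist (lf D) ?U (lf D u0 \<nu>)" for D and \<nu> :: "var kos"
      by (subst U(1)) (rule wlist_insert_max[OF U(2) ltu])
    have e3: "wlist (lf ?E) (insert v ?U) (mon (xm Fs)) = wlist (lf ?E) ?U (eps v (mon (xm Fs)))"
      unfolding lv[symmetric] by (rule wlist_insert_max[OF U(2)]) (use lt assms(2) in auto)
    have "fel W (Fs, U) = wlist (lf ?E) ?U (eps u0 (mon (xm Fs))) - wlist (lf ?E) ?U (eps v (mon (xm Fs)))"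
      by (simp only: fel_def prod.case e2 m0 kv.lin_opD(5)[OF lin_wlist[OF lin_lf]])
    also have "wlist (lf ?E) ?U (eps u0 (mon (xm Fs))) = fel (W - {v}) (Fs, U)"
      by (simp only: fel_def prod.case e1 e2[of ?E'] m0)
    also have "wlist (lf ?E) ?U (eps v (mon (xm Fs))) = fel W (Fs, insert v ?U)"
      by (simp only: fel_def prod.case e3)
    also have "\<dots> = rw v (fel (W - {v}) (Fs, ?U))"
      by (rule fel_insert_max) (use assms in auto)
    finally show ?thesis using u0(1) by blast
  qed
qed

context
  assumes HW: "H \<subseteq> W" "card H \<le> k"
    and IH: "\<And>H' W' k'. finite W' ==> H' \<subseteq> W' ==> card H' \<le> k' ==> card (W' - H') < card (W - H) ==>
      hom_basis cy (sdX H' W' k') (W' - H') (SI H' W' k') (fel W')"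
begin

lemma sd_piece:
  assumes F: "F \<in> Fls H W k v"
  shows "hom_basis cy (vX (pcS H W k v F)) (W - H) (JF H W k v F) (fel W)"
proof -
  have F': "H \<subseteq> F" "v \<notin> F" "F \<subseteq> W" "card F < k" using F by (auto simp: Fls_def)
  have finF: "finite F" using F'(3) fin by (rule finite_subset)
  have c1: "card (F - H) < card (W - H)" by (rule psubset_card_mono) (use F' v fin in auto)
  have c2: "card (W - insert v F) < card (W - H)" by (rule psubset_card_mono) (use F' v fin in auto)
  have hL: "hom_basis cy (sdX H F (card F)) (F - H) (SI H F (card F)) (\<lambda>i. mon (xm (fst i)))"
    by (rule hom_basis_complete[OF finF IH[OF finF F'(1) card_mono[OF finF F'(1)] c1]])
  have hi: "hom_basis cy (sdX (insert v F) W k) (W - insert v F) (SI (insert v F) W k) (fel W)"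
    by (rule IH[OF fin _ _ c2]) (use F' v finF in auto)
  have hU: "hom_basis cy (stX (insert v F) W k) (insert v (W - insert v F)) (id ` SI (insert v F) W k)
      (\<lambda>i. shift {#Xv (insert v F)#} (fel W i))"
    unfolding stX_star
  proof (rule hom_basis_star[OF _ _ _ _ _ _ _ hi[unfolded vX_def]])
    show "okX (supp_in ((`) Xv ` chS (insert v F) W k))" using okX_sdX[OF fin] by (simp only: vX_def)
    show "okX (supp_in {insert (Xv (insert v F)) S | S. S \<in> (`) Xv ` chS (insert v F) W k})"
      using okX_stX[OF fin, of "insert v F" k] F' v(2) by (simp only: stX_star insert_subset simp_thms)
    fix S assume "S \<in> (`) Xv ` chS (insert v F) W k"
    then show "Xv (insert v F) \<notin> S" using chS_self by auto
  qed (use fin in auto)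
  have e: "insert v (W - insert v F) = W - F" using F' v by auto
  have N: "(F - H) \<union> (W - F) = W - H" using F' by auto
  have "hom_basis cy (vX (pcS H W k v F)) ((F - H) \<union> (W - F)) (SI H F (card F) \<times> id ` SI (insert v F) W k)
      (\<lambda>(i, j). shift (xm (fst i)) (shift {#Xv (insert v F)#} (fel W j)))"
    by (rule hom_basis_piece[OF F'(1,2,3) v(2) fin F'(4) _ _ _ hL hU[unfolded e]]) (use fin in auto)
  then have "hom_basis cy (vX (pcS H W k v F)) (W - H)
      ((\<lambda>((lo, _), (hi, U)). (lo @ hi, U)) ` (SI H F (card F) \<times> id ` SI (insert v F) W k)) (fel W)"
    unfolding N
  proof (rule hom_basis_image)
    fix i assume "i \<in> SI H F (card F) \<times> id ` SI (insert v F) W k"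
    then obtain lo Ul hi U where i: "i = ((lo, Ul), (hi, U))" "(lo, Ul) \<in> SI H F (card F)" "(hi, U) \<in> SI (insert v F) W k"
      by auto
    have ne: "lo \<noteq> []" "hi \<noteq> []" "hd hi = insert v F" using i(2,3) by (auto simp: SI_def fc_def)
    show "fel W (case i of (x, y) => (case x of (lo, _) => \<lambda>(hi, U). (lo @ hi, U)) y) =
        (case i of (i, j) => shift (xm (fst i)) (shift {#Xv (insert v F)#} (fel W j)))"
      using fel_join[OF ne(1,2) SI_finite_U[OF fin i(3)]] ne(3) i(1) by simp
  qed
  then show ?thesis by (simp add: JF_def)
qed

lemma sd_cycle: "i \<in> SI H W k \<or> i \<in> RS H W k v ==> dk cy (sdX H W k) (W - H) (fel W i) = 0"
proof -
  assume a: "i \<in> SI H W k \<or> i \<in> RS H W k v"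
  obtain Fs U where i: "i = (Fs, U)" by (cases i)
  have "Fs \<in> fc H W k \<and> U \<subseteq> W - last Fs \<and> (U = {} \<or> card (last Fs) = k)"
    using a
  proof
    assume "i \<in> SI H W k" then show ?thesis by (auto simp: SI_def i)
  next
    assume r: "i \<in> RS H W k v"
    obtain F where "F \<in> Fls H W k v" "i \<in> JF H W k v F" using RS_in_JF[OF r] by blast
    then obtain lo Ul hi U' where "i = (lo @ hi, U')" "(lo, Ul) \<in> SI H F (card F)" "(hi, U') \<in> SI (insert v F) W k"
      by (auto simp: JF_def)
    moreover have "v \<notin> F" using \<open>F \<in> Fls H W k v\<close> by (auto simp: Fls_def)
    ultimately have lh: "Fs = lo @ hi" "(lo, Ul) \<in> SI H F (card F)" "(hi, U) \<in> SI (insert v F) W k" "v \<notin> F"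
      by (simp_all add: i)
    have "Fs \<in> fc H W k" unfolding lh(1) by (rule fc_append[OF _ _ lh(4)]) (use lh(2,3) in \<open>auto simp: SI_def\<close>)
    moreover have "U = {}" using r by (auto simp: RS_def i)
    ultimately show ?thesis by simp
  qed
  then show ?thesis unfolding i using fel_cycle[OF fin] by blast
qed

lemma sd_upper:
  "hom_basis cy (\<Union>F\<in>Fls H W k v. vX (pcS H W k v F)) (W - H) ({i \<in> SI H W k. v \<in> last (fst i)} \<union> RS H W k v) (fel W)"
proof -
  note dec = vX_chain_decompose[OF v(2,3) fin, where k = k]
  have sub: "(\<Union>F\<in>Fls H W k v. vX (pcS H W k v F)) \<subseteq> sdX H W k" using dec(1) by blast
  show ?thesis unfolding JF_union[symmetric]
  proof (rule hom_basis_pieces[where rank = card])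
    show "okX (\<Union>F\<in>Fls H W k v. vX (pcS H W k v F))" by (rule okX_upward[OF okX_sdX[OF fin] sub dec(5)])
    show "finite (Fls H W k v)" by (rule Fls_finite[OF fin])
    show "finite (W - H)" using fin by simp
    show "vX (pcS H W k v a) \<inter> vX (pcS H W k v b) = {}" if "a \<in> Fls H W k v" "b \<in> Fls H W k v" "a \<noteq> b" for a b
      by (rule dec(3)[OF that])
    show "a = b \<or> card b < card a"
      if "a \<in> Fls H W k v" "b \<in> Fls H W k v" "M \<in> vX (pcS H W k v a)" "add_mset u M \<in> vX (pcS H W k v b)" for a b M u
      by (rule dec(4)[OF that])
    show "hom_basis cy (vX (pcS H W k v a)) (W - H) (JF H W k v a) (fel W)" if "a \<in> Fls H W k v" for a
      by (rule sd_piece[OF that])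
    fix F i assume "F \<in> Fls H W k v" "i \<in> JF H W k v F"
    then have "i \<in> SI H W k \<or> i \<in> RS H W k v" using JF_elim by blast
    then show "dk cy (\<Union>F\<in>Fls H W k v. vX (pcS H W k v F)) (W - H) (fel W i) = 0"
      by (intro dk_restrict_zero[OF sub] sd_cycle)
  qed (rule refl)
qed

definition TS where "TS = {(lo, {v}) | lo. (lo, {}) \<in> SI H (W - {v}) k \<and> card (last lo) < k}"

text \<open>
  On the quotient the form with index \<open>v\<close> vanishes. The doubled basis is adjusted
  to the wedges for \<open>W\<close>; by \<open>fel_not_max\<close> the corrections are
  multiples of \<open>\<ell>\<^sub>v\<close> by cycles, hence combinations of the basis elements
  with \<open>\<ell>\<^sub>v\<close> up to boundaries.
\<close>

lemma sd_lower:
  "hom_basis cy (sdX H (W - {v}) k) (W - H) ({i \<in> SI H W k. v \<notin> last (fst i)} \<union> TS) (fel W)"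
proof -
  let ?W = "W - {v}" and ?N = "W - {v} - H" and ?X = "sdX H (W - {v}) k" and ?I = "SI H (W - {v}) k"
  have finW: "finite ?W" "finite ?N" using fin by auto
  have N: "insert v ?N = W - H" using v by auto
  have lt: "x < v" if "x \<in> ?N" for x using that vless by auto
  have ok: "okX ?X" by (rule okX_sdX[OF finW(1)])
  have c1: "card ?N < card (W - H)" by (rule psubset_card_mono) (use v fin in auto)
  have IHs: "hom_basis cy ?X ?N ?I (fel ?W)"
    by (rule IH[OF finW(1) _ HW(2) c1]) (use HW v in auto)
  have zero: "cy v w = 0" if "M \<in> ?X" "w \<in># M" for M w
  proof -
    obtain \<G> where g: "set_mset M = Xv ` \<G>" "\<G> \<in> chS H ?W k" using \<open>M \<in> ?X\<close> by (auto simp: vX_iff)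
    then obtain G where "w = Xv G" "G \<in> \<G>" using \<open>w \<in># M\<close> by auto
    then show ?thesis using chS_D(2)[OF g(2)] by auto
  qed
  have d1: "dk cy ?X (W - H) \<nu> = dk cy ?X ?N \<nu>" for \<nu>
    unfolding N[symmetric] by (rule dk_adjoin_zero_form) (fact finW(2), fact lt, fact zero)
  let ?s = "\<lambda>(i, b). if b then rw v (fel ?W i) else fel ?W i"
  let ?g = "\<lambda>((Fs, U), b). (Fs :: nat set list, if b then insert v U else U)"
  have h: "hom_basis cy ?X (W - H) (?I \<times> UNIV) ?s"
    unfolding N[symmetric] by (rule hom_basis_adjoin_zero_form) (fact finW(2), fact lt, fact ok, fact zero, fact IHs)
  have UN: "?I \<times> (UNIV :: bool set) = ?I \<times> {False} \<union> ?I \<times> {True}" by auto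
  have key: "\<exists>\<eta> g. \<eta> \<in> kz ?X (W - H) \<and> g \<in> coefs (?I \<times> {True}) \<and>
      fel W (?g i) = ?s i + dk cy ?X (W - H) \<eta> + kv.lc ?s g" if iI: "i \<in> ?I \<times> {False}" for i
  proof -
    obtain Fs U where i: "i = ((Fs, U), False)" "(Fs, U) \<in> ?I" using iI by auto
    note b = SI_below[OF i(2)]
    have H: "H \<subseteq> last Fs" using b(1) sorted_hd_last(1)[of Fs "last Fs"] by (auto simp: fc_def)
    have fU: "finite U" by (rule SI_finite_U[OF finW(1) i(2)])
    have fcW: "Fs \<in> fc H ?W k" using i(2) by (simp add: SI_def)
    from fel_not_max[OF fU b(3) H b(2)] show ?thesis
    proof (elim disjE conjE exE)
      assume e: "fel W (Fs, U) = fel ?W (Fs, U)"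
      have e0: "fel W (?g i) = ?s i + dk cy ?X (W - H) 0 + kv.lc ?s (\<lambda>_. 0)" by (simp add: i e dk_lin)
      show ?thesis by (intro exI conjI, rule kv.subspace_0[OF kz_subspace], rule coefs_zero, rule e0)
    next
      fix U1 assume ne: "U \<noteq> {}" and U1: "U1 \<subseteq> U" and e: "fel W (Fs, U) = fel ?W (Fs, U) - rw v (fel ?W (Fs, U1))"
      have kk: "card (last Fs) = k" using b(4) ne by simp
      have sub: "U1 \<subseteq> ?W - last Fs" using U1 b(3) by (rule order_trans)
      let ?\<nu> = "fel ?W (Fs, U1)"
      have "?\<nu> \<in> kz ?X ?N" by (rule fel_kz[OF finW(1) fcW sub])
      moreover have "dk cy ?X ?N ?\<nu> = 0" by (rule fel_cycle[OF finW(1) fcW sub]) (simp add: kk)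
      ultimately obtain c \<eta> where ce: "c \<in> coefs ?I" "\<eta> \<in> kz ?X ?N" "?\<nu> = dk cy ?X ?N \<eta> + kv.lc (fel ?W) c"
        using kv.hbasisD(4)[OF IHs] by blast
      have "kv.lc ?s (\<lambda>(j, b). if b then c j else 0) = rw v (kv.lc (fel ?W) c)"
      proof -
        have "{t. (case t of (j, b) => if b then c j else 0) \<noteq> 0} = (\<lambda>j. (j, True)) ` {j. c j \<noteq> 0}"
          by (auto simp: image_iff split: if_splits)
        then have "kv.lc ?s (\<lambda>(j, b). if b then c j else 0) = (\<Sum>j | c j \<noteq> 0. smul (c j) (rw v (fel ?W j)))"
          unfolding kv.lc_def by (simp add: sum.reindex inj_on_def)
        also have "\<dots> = rw v (kv.lc (fel ?W) c)"
          unfolding kv.lin_op_lc[OF lin_rw] by (simp add: kv.lc_def)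
        finally show ?thesis .
      qed
      note lcr = this
      \<comment> \<open>The correction term enters with a minus sign.\<close>
      define g where "g = (\<lambda>t. (- 1) * (case t of (j, b) => if b then c j else 0))"
      have c0: "(\<lambda>(j, b). if b then c j else 0) \<in> coefs (?I \<times> {True})"
      proof -
        have "{t. (case t of (j, b) => if b then c j else 0) \<noteq> 0} = (\<lambda>j. (j, True)) ` {j. c j \<noteq> 0}"
          by (auto simp: image_iff split: if_splits)
        then show ?thesis using ce(1) by (auto simp: coefs_def)
      qed
      have g: "g \<in> coefs (?I \<times> {True})" unfolding g_def by (rule coefs_scale[OF c0])
      have lcg: "kv.lc ?s g = - rw v (kv.lc (fel ?W) c)"
        unfolding g_def kv.lc_scale[OF c0] lcr by simp
      have "dk cy ?X (W - H) (- rw v \<eta>) = - rw v (dk cy ?X ?N \<eta>)"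
        using dk_rw[OF finW(2) lt, of cy ?X \<eta>] by (simp only: dk_lin d1)
      then have eg: "fel W (?g i) = ?s i + dk cy ?X (W - H) (- rw v \<eta>) + kv.lc ?s g"
        unfolding lcg by (simp add: i e ce(3) kv.lin_opD[OF lin_rw])
      have ek: "- rw v \<eta> \<in> kz ?X (W - H)"
        using kv.subspace_neg[OF kz_subspace rw_kz[OF ce(2), of v]] N by simp
      show ?thesis by (intro exI conjI, rule ek, rule g, rule eg)
    qed
  qed
  note key = this
  define \<eta> where "\<eta> i = (SOME \<eta>. \<exists>g. \<eta> \<in> kz ?X (W - H) \<and> g \<in> coefs (?I \<times> {True}) \<and>
      fel W (?g i) = ?s i + dk cy ?X (W - H) \<eta> + kv.lc ?s g)" for i
  define g where "g i = (SOME g. \<eta> i \<in> kz ?X (W - H) \<and> g \<in> coefs (?I \<times> {True}) \<and>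
      fel W (?g i) = ?s i + dk cy ?X (W - H) (\<eta> i) + kv.lc ?s g)" for i
  have e1: "\<exists>g. \<eta> i \<in> kz ?X (W - H) \<and> g \<in> coefs (?I \<times> {True}) \<and>
      fel W (?g i) = ?s i + dk cy ?X (W - H) (\<eta> i) + kv.lc ?s g" if "i \<in> ?I \<times> {False}" for i
    unfolding \<eta>_def by (rule someI_ex[OF key[OF that]])
  have e2: "\<eta> i \<in> kz ?X (W - H) \<and> g i \<in> coefs (?I \<times> {True}) \<and>
      fel W (?g i) = ?s i + dk cy ?X (W - H) (\<eta> i) + kv.lc ?s (g i)" if "i \<in> ?I \<times> {False}" for i
    unfolding g_def by (rule someI_ex[OF e1[OF that]])
  note eg = conjunct1[OF e2] conjunct1[OF conjunct2[OF e2]] conjunct2[OF conjunct2[OF e2]]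
  have "hom_basis cy ?X (W - H) (?I \<times> {False} \<union> ?I \<times> {True}) (\<lambda>i. fel W (?g i))"
  proof (rule kv.hbasis_change[OF h[unfolded UN] _ _ _ eg(3,1,2)])
    show "kv.cpx (dk cy ?X (W - H)) (kz ?X (W - H))" by (rule cpx_dk[OF _ ok]) (use fin in simp)
    fix i assume "i \<in> ?I \<times> {True}"
    then obtain Fs U where i: "i = ((Fs, U), True)" "(Fs, U) \<in> ?I" by auto
    note b = SI_below[OF i(2)]
    have H: "H \<subseteq> last Fs" using b(1) sorted_hd_last(1)[of Fs "last Fs"] by (auto simp: fc_def)
    show "fel W (?g i) = ?s i"
      using fel_insert_max[OF SI_finite_U[OF finW(1) i(2)] b(3) H b(2)] i(1) by simp
  qed auto
  then have "hom_basis cy ?X (W - H) (?g ` (?I \<times> UNIV)) (fel W)"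
    unfolding UN[symmetric] by (rule hom_basis_image) simp
  then show ?thesis unfolding SI_adjoin TS_def .
qed

text \<open>
  The connecting map: \<open>d\<close> of \<open>\<ell>\<^sub>v\<close> times a flag. Its term
  with \<open>F\<close> the last flat is the superfluous flag, and all other terms are basis
  flags.
\<close>

lemma sd_connect:
  assumes lo: "(lo, {}) \<in> SI H (W - {v}) k" "card (last lo) < k"
  defines "G \<equiv> {F. last lo \<subseteq> F \<and> F \<subseteq> W - {v} \<and> card F < k}"
  shows "finite G" "last lo \<in> G"
    and "dk cy (sdX H W k) (W - H) (fel W (lo, {v})) = (\<Sum>F\<in>G. fel W (lo @ [insert v F], {}))"
    and "F \<in> G ==> F \<noteq> last lo ==> (lo @ [insert v F], {}) \<in> {i \<in> SI H W k. v \<in> last (fst i)}"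
proof -
  show finG: "finite G" by (rule finite_subset[of _ "Pow W"]) (use fin in \<open>auto simp: G_def\<close>)
  have l: "lo \<in> fc H (W - {v}) k" "ir lo" "nsl lo" using lo(1) by (auto simp: SI_def)
  have ll: "last lo \<subseteq> W - {v}" "lo \<noteq> []" "hd lo = H" "sorted_wrt (\<subset>) lo" using l(1) by (auto simp: fc_def)
  have HL: "H \<subseteq> last lo" using sorted_hd_last(1)[OF ll(4), of "last lo"] ll by simp
  show "last lo \<in> G" using lo(2) ll(1) by (simp add: G_def)
  have single: "[insert v F] \<in> fc (insert v F) W k" and FF: "F \<in> Fls H W k v" if "F \<in> G" for F
  proof -
    have "finite F" using that fin by (auto simp: G_def intro: finite_subset)
    then show "[insert v F] \<in> fc (insert v F) W k" using that v(2) by (auto simp: fc_def G_def card_insert_if)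
    show "F \<in> Fls H W k v" using that HL by (auto simp: Fls_def G_def)
  qed
  have low: "lo \<in> fc H F k" if "F \<in> G" for F using l(1) that by (auto simp: fc_def G_def)
  have fcG: "lo @ [insert v F] \<in> fc H W k" if "F \<in> G" for F
    by (rule fc_append[OF low[OF that] single[OF that]]) (use that in \<open>auto simp: G_def\<close>)
  have xmG: "xm (lo @ [insert v F]) = add_mset (Xv (insert v F)) (xm lo)" for F
    using xm_join[OF ll(2), of "[insert v F]"] by (simp add: xm_def)
  have loW: "lo \<in> fc H W k" using l(1) by (auto simp: fc_def)
  show "dk cy (sdX H W k) (W - H) (fel W (lo, {v})) = (\<Sum>F\<in>G. fel W (lo @ [insert v F], {}))"
  proof -
    have nex: "\<not> (\<exists>w\<in>W - last lo. v < w)"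
    proof
      assume "\<exists>w\<in>W - last lo. v < w"
      then obtain w where "w \<in> W - H" "v < w" using HL by blast
      then show False using v(1)[of w] by simp
    qed
    have "fel W (lo, {v}) = eps v (mon (xm lo))" using nex by (simp add: fel_def wlist_def lf_def)
    then have "dk cy (sdX H W k) (W - H) (fel W (lo, {v})) = dk cy (sdX H W k) (W - H) (eps v (mon (xm lo)))" by simp
    also have "\<dots> = (\<Sum>w\<in>(\<lambda>F. Xv (insert v F)) ` G. mon (add_mset w (xm lo)))"
    proof (rule dk_eps_mon_sum)
      fix w
      show "w \<in> (\<lambda>F. Xv (insert v F)) ` G \<longleftrightarrow> add_mset w (xm lo) \<in> sdX H W k \<and> cy v w \<noteq> 0"
      proof
        assume "w \<in> (\<lambda>F. Xv (insert v F)) ` G"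
        then obtain F where F: "w = Xv (insert v F)" "F \<in> G" by blast
        then show "add_mset w (xm lo) \<in> sdX H W k \<and> cy v w \<noteq> 0"
          using xm_in_sdX[OF fcG[OF F(2)] fin] by (simp add: xmG)
      next
        assume w: "add_mset w (xm lo) \<in> sdX H W k \<and> cy v w \<noteq> 0"
        obtain G' where G': "w = Xv G'" "G' \<subseteq> W" "card G' \<le> k" "G' \<subseteq> last lo \<or> last lo \<subset> G'"
          using add_xm_in_sdX[OF loW fin, of w] w by metis
        have vG: "v \<in> G'" using w G'(1) by (simp split: if_splits)
        have fG: "finite G'" using G'(2) fin by (rule finite_subset)
        have "last lo \<subset> G'" using G'(4) vG ll(1) by blast
        then have "G' - {v} \<in> G" using G' vG fG ll(1) card_Diff1_less[OF fG vG] by (auto simp: G_def)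
        moreover have "w = Xv (insert v (G' - {v}))" using G'(1) vG by (simp add: insert_absorb)
        ultimately show "w \<in> (\<lambda>F. Xv (insert v F)) ` G" by blast
      qed
    qed (use fin v finG in auto)
    also have "\<dots> = (\<Sum>F\<in>G. mon (add_mset (Xv (insert v F)) (xm lo)))"
    proof (rule sum.reindex_cong[OF _ refl refl])
      show "inj_on (\<lambda>F. Xv (insert v F)) G" by (rule inj_onI) (auto simp: G_def insert_ident)
    qed
    also have "\<dots> = (\<Sum>F\<in>G. fel W (lo @ [insert v F], {}))"
      by (rule sum.cong[OF refl]) (simp add: fel_def xmG)
    finally show ?thesis .
  qed
  assume F: "F \<in> G" "F \<noteq> last lo"
  have Fd: "v \<notin> F" "last lo \<subseteq> F" using F(1) by (auto simp: G_def)
  have "ir (lo @ [insert v F])"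
    using ir_join_fc[OF v(1) fin v(2) FF[OF F(1)] low[OF F(1)] single[OF F(1)]] l by simp
  moreover have "nsl (lo @ [insert v F])"
    using nsl_append[of "[insert v F]" lo] ll(2) covers_insert_iff[OF Fd] F(2) by simp
  ultimately show "(lo @ [insert v F], {}) \<in> {i \<in> SI H W k. v \<in> last (fst i)}"
    using fcG[OF F(1)] by (simp add: SI_def)
qed

text \<open>
  In the basis of the subcomplex the superfluous flags are replaced by the differentials
  computed in \<open>sd_connect\<close>, and then they cancel.
\<close>

lemma sd_step: "hom_basis cy (sdX H W k) (W - H) (SI H W k) (fel W)"
proof -
  note dec = vX_chain_decompose[OF v(2,3) fin, where k = k]
  let ?X = "sdX H W k" and ?X1 = "\<Union>F\<in>Fls H W k v. vX (pcS H W k v F)"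
  let ?A1 = "{i \<in> SI H W k. v \<in> last (fst i)}" and ?A2 = "{i \<in> SI H W k. v \<notin> last (fst i)}"
  have finN: "finite (W - H)" using fin by simp
  have ok: "okX ?X" by (rule okX_sdX[OF fin])
  have sub: "?X1 \<subseteq> ?X" using dec(1) by blast
  have ok1: "okX ?X1" by (rule okX_upward[OF ok sub dec(5)])
  define \<rho> where "\<rho> = (\<lambda>(lo, U :: nat set). (lo @ [insert v (last lo)], {} :: nat set))"
  define t where "t = (\<lambda>i :: nat set list \<times> nat set. (butlast (fst i), {v}))"
  define s where "s = (\<lambda>i. if i \<in> RS H W k v then dk cy ?X (W - H) (fel W (t i)) else fel W i)"
  have rT: "\<rho> ` TS = RS H W k v" unfolding TS_def RS_def \<rho>_def by (auto simp: image_iff)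
  have tr: "t (\<rho> i) = i" if "i \<in> TS" for i using that by (auto simp: TS_def t_def \<rho>_def)
  have TSv: "v \<notin> last (fst i)" "v \<in> snd i" "card (last (fst i)) < k" if "i \<in> TS" for i
    using that by (auto simp: TS_def SI_def fc_def)
  have key: "\<exists>g. g \<in> coefs ?A1 \<and> s i = fel W i + dk cy ?X1 (W - H) 0 + kv.lc (fel W) g" if iR: "i \<in> RS H W k v" for i
  proof -
    obtain lo where lo: "i = (lo @ [insert v (last lo)], {})" "(lo, {}) \<in> SI H (W - {v}) k" "card (last lo) < k"
      using iR by (auto simp: RS_def)
    let ?G = "{F. last lo \<subseteq> F \<and> F \<subseteq> W - {v} \<and> card F < k}"
    let ?e = "\<lambda>F. (lo @ [insert v F], {} :: nat set)"
    note c = sd_connect[OF lo(2,3)]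
    let ?B = "?e ` (?G - {last lo})"
    have B1: "finite ?B" by (intro finite_imageI finite_Diff c(1))
    have B2: "?B \<subseteq> ?A1"
    proof (rule image_subsetI)
      fix F assume F: "F \<in> ?G - {last lo}"
      have "F \<noteq> last lo" using F by blast
      then show "?e F \<in> ?A1" by (rule c(4)[OF DiffD1[OF F]])
    qed
    have inj: "inj_on ?e (?G - {last lo})" by (rule inj_onI) (auto simp: insert_ident)
    define g where "g = (\<lambda>j. if j \<in> ?B then 1 else (0::rat))"
    have gB: "{j. g j \<noteq> 0} = ?B" unfolding g_def by (simp only: if_True if_False zero_neq_one one_neq_zero simp_thms split: if_split) blast
    have "g \<in> coefs ?A1" unfolding coefs_def mem_Collect_eq gB using B1 B2 by (rule conjI)
    moreover have "kv.lc (fel W) g = (\<Sum>F\<in>?G - {last lo}. fel W (?e F))"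
    proof -
      have "kv.lc (fel W) g = (\<Sum>j\<in>?B. fel W j)"
        unfolding kv.lc_def gB by (rule sum.cong[OF refl]) (simp add: g_def del: image_iff)
      then show ?thesis by (simp only: sum.reindex[OF inj] o_def)
    qed
    moreover have "s i = fel W i + (\<Sum>F\<in>?G - {last lo}. fel W (?e F))"
    proof -
      have "s i = dk cy ?X (W - H) (fel W (lo, {v}))" using iR by (simp add: s_def t_def lo(1))
      also have "\<dots> = (\<Sum>F\<in>?G. fel W (?e F))" by (rule c(3))
      also have "\<dots> = fel W (?e (last lo)) + (\<Sum>F\<in>?G - {last lo}. fel W (?e F))"
        by (rule sum.remove[OF c(1,2)])
      finally show ?thesis using lo(1) by simp
    qed
    ultimately show ?thesis by (intro exI[of _ g]) (simp add: dk_lin)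
  qed
  note key = this
  define g where "g i = (SOME g. g \<in> coefs ?A1 \<and> s i = fel W i + dk cy ?X1 (W - H) 0 + kv.lc (fel W) g)" for i
  have gg: "g i \<in> coefs ?A1 \<and> s i = fel W i + dk cy ?X1 (W - H) 0 + kv.lc (fel W) (g i)" if "i \<in> RS H W k v" for i
    unfolding g_def by (rule someI_ex[OF key[OF that]])
  note g = conjunct1[OF gg] conjunct2[OF gg]
  have disj: "RS H W k v \<inter> ?A1 = {}" using RS_not_SI by blast
  have K1: "hom_basis cy ?X1 (W - H) (RS H W k v \<union> ?A1) s"
  proof (rule kv.hbasis_change[where \<eta> = "\<lambda>_. 0" and g = g and s = "fel W", OF _ _ disj])
    show "s i = fel W i + dk cy ?X1 (W - H) 0 + kv.lc (fel W) (g i)" if "i \<in> RS H W k v" for i by (rule g(2)[OF that])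
    show "g i \<in> coefs ?A1" if "i \<in> RS H W k v" for i by (rule g(1)[OF that])
    show "hom_basis cy ?X1 (W - H) (RS H W k v \<union> ?A1) (fel W)" using sd_upper by (simp only: Un_commute)
    show "kv.cpx (dk cy ?X1 (W - H)) (kz ?X1 (W - H))" by (rule cpx_dk[OF finN ok1])
    show "s i = fel W i" if "i \<in> ?A1" for i using that disj by (auto simp: s_def)
    show "0 \<in> kz ?X1 (W - H)" by (rule kv.subspace_0[OF kz_subspace])
  qed
  have nR: "i \<notin> RS H W k v" if "i \<in> ?A2 \<union> TS" for i
    using that RS_last TSv(1) by blast
  have K2: "hom_basis cy (sdX H (W - {v}) k) (W - H) (?A2 \<union> TS) s"
    by (rule kv.hbasis_cong[OF sd_lower _ refl]) (use nR in \<open>simp add: s_def\<close>)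
  have "hom_basis cy ?X (W - H) (?A1 \<union> ?A2) s"
  proof (rule hom_basis_extend[OF finN ok dec(1,2,5)])
    show "hom_basis cy ?X1 (W - H) (?A1 \<union> \<rho> ` TS) s" using K1 by (simp only: rT Un_commute)
    show "hom_basis cy (sdX H (W - {v}) k) (W - H) (?A2 \<union> TS) s" by (rule K2)
    show "?A1 \<inter> ?A2 = {}" by auto
    show "\<rho> ` TS \<inter> ?A1 = {}" unfolding rT by (rule disj)
    have "i \<notin> SI H W k" if "i \<in> TS" for i
      using TSv[OF that] by (cases i) (auto simp: SI_def)
    then show "?A2 \<inter> TS = {}" by blast
    show "inj_on \<rho> TS" by (rule inj_on_inverseI[of _ t]) (rule tr)
    show "dk cy ?X (W - H) (s i) = 0" if i: "i \<in> ?A2" for i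
      using sd_cycle[of i] i nR[of i] by (simp add: s_def)
    show "dk cy ?X (W - H) (s i) = s (\<rho> i)" if i: "i \<in> TS" for i
    proof -
      have "\<rho> i \<in> RS H W k v" using i rT by blast
      then show ?thesis using i nR[of i] tr[OF i] by (simp add: s_def)
    qed
  qed
  moreover have "?A1 \<union> ?A2 = SI H W k" by auto
  ultimately have hs: "hom_basis cy ?X (W - H) (SI H W k) s" by simp
  have "s i = fel W i" if i: "i \<in> SI H W k" for i
  proof -
    have "i \<notin> RS H W k v" using RS_not_SI i by metis
    then show ?thesis by (simp add: s_def)
  qed
  then show ?thesis by (rule kv.hbasis_cong[OF hs _ refl])
qed

end

end

theorem hom_basis_chains:
  "finite W ==> H \<subseteq> W ==> card H \<le> k ==> hom_basis cy (sdX H W k) (W - H) (SI H W k) (fel W)"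
proof (induction "card (W - H)" arbitrary: H W k rule: less_induct)
  case less
  show ?case
  proof (cases "W = H")
    case True
    have "chS H H k = {{}}" by (auto simp: chS_def)
    then have X: "sdX H W k = {{#}}" unfolding True vX_def supp_in_def by auto
    have hdl: "Fs = [H]" if "Fs \<in> fc H H k" for Fs
    proof -
      have s: "Fs \<noteq> []" "hd Fs = H" "sorted_wrt (\<subset>) Fs" "last Fs \<subseteq> H" using that by (auto simp: fc_def)
      obtain r where r: "Fs = H # r" using s(1,2) by (cases Fs) auto
      have "r = []"
      proof (rule ccontr)
        assume "r \<noteq> []"
        then have "H \<subset> last r" "last r \<subseteq> H" using s(3,4) r by auto
        then show False by blast
      qed
      then show ?thesis using r by simp
    qed
    have "SI H W k = {([H], {})}"
    proof -
      have "(Fs, U) \<in> SI H H k \<longleftrightarrow> Fs = [H] \<and> U = {}" for Fs U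
      proof
        assume a: "(Fs, U) \<in> SI H H k"
        then have "Fs = [H]" using hdl[of Fs] by (simp add: SI_def)
        then show "Fs = [H] \<and> U = {}" using a by (auto simp: SI_def)
      next
        assume "Fs = [H] \<and> U = {}"
        then show "(Fs, U) \<in> SI H H k" using less.prems by (simp add: SI_def fc_def)
      qed
      then show ?thesis unfolding True by (intro set_eqI) (metis prod.collapse singleton_iff prod.inject)
    qed
    moreover have "hom_basis cy {{#}} {} ((\<lambda>_. ([H], {})) ` ({{#}} :: var multiset set)) (fel W)"
      by (rule hom_basis_image[where s' = mon, OF hom_basis_no_forms]) (simp add: fel_def xm_def)
    ultimately show ?thesis unfolding X using True by simp
  next
    case False
    define v where "v = Max (W - H)"
    have ne: "finite (W - H)" "W - H \<noteq> {}" using less.prems False by auto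
    have "v \<in> W - H" unfolding v_def by (rule Max_in[OF ne])
    then have v: "v \<in> W" "v \<notin> H" by auto
    have vm: "x \<le> v" if "x \<in> W - H" for x unfolding v_def by (rule Max_ge[OF ne(1) that])
    show ?thesis
      by (rule sd_step[OF vm v less.prems(1) less.prems(2,3)]) (assumption | rule less.hyps)+
  qed
qed

section \<open>Bergman fans of contractions\<close>

text \<open>
  The forms of the augmented fan: \<open>y\<^sub>j - \<Sum>\<^bsub>j \<notin> G\<^esub>
  x\<^sub>G\<close>.
\<close>

definition ct :: "nat => var => rat" where
  "ct j w = (case w of Yv i => if i = j then 1 else 0 | Xv G => if j \<in> G then 0 else - 1)"

lemma ct_simps [simp]: "ct j (Yv i) = (if i = j then 1 else 0)" "ct j (Xv G) = (if j \<in> G then 0 else - 1)"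
  by (simp_all add: ct_def)

text \<open>
  After subtraction of the form with index \<open>t\<close>, the other forms agree with
  \<open>cy\<close> on flats that do not contain \<open>t\<close> and with \<open>ct\<close> on
  the flats that contain it.
\<close>

definition cp :: "nat => nat => var => rat" where
  "cp t j w = (if j = t then ct t w else ct j w - ct t w)"

text \<open>
  The indices of the retral basis of the contraction at \<open>H\<close>, with \<open>W\<close>
  for the ground set and \<open>q\<close> for the size of hyperplanes.
\<close>

definition BI :: "nat set => nat => nat set => (nat set list \<times> nat set) set" where
  "BI W q H = {(Fs, U). Fs \<in> fc H W q \<and>
     (U = {} \<and> ir (Fs @ [W]) \<or>
      card (last Fs) = q \<and> ir Fs \<and> U \<noteq> {} \<and> U \<subseteq> W - last Fs \<and> (\<forall>u\<in>U. \<exists>w\<in>W - last Fs. u < w) \<and> lc_ok Fs U)}"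

definition bel :: "nat set => nat set list \<times> nat set => var kos" where
  "bel W i = shift {#Xv (hd (fst i))#} (fel W i)"

lemma BI_finite_U: "finite W ==> (Fs, U) \<in> BI W q H ==> finite U"
  by (auto simp: BI_def intro: finite_subset)

lemma fc_last: "Fs \<in> fc H W q ==> H \<subseteq> last Fs" "Fs \<in> fc H W q ==> last Fs \<subseteq> W"
  using sorted_hd_last(1)[of Fs "last Fs"] by (auto simp: fc_def)

lemma subst_form_mon: "subst_form t N (mon \<alpha>) = mon \<alpha>"
proof -
  have "iota j (mon \<alpha>) = 0" for j by (intro ext) (simp add: iota_def mon_def)
  then show ?thesis by (simp add: subst_form_def isum_def eps_lin)
qed

text \<open>
  The substitution \<open>\<ell>\<^sub>j \<mapsto> \<ell>\<^sub>j - \<ell>\<^sub>t\<close> fixes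
  differences, and it makes \<open>t\<close> the successor of the largest element of
  \<open>E'\<close>.
\<close>

lemma subst_form_lf:
  assumes "fj \<nu>" "finite N" "t \<notin> N" "E' \<subseteq> N" "u \<in> E'"
    and E: "E = E' \<and> (\<exists>w\<in>E'. u < w) \<or> E = insert t E' \<and> (\<forall>x\<in>E'. x < t)"
  shows "subst_form t N (lf E' u \<nu>) = lf E u (subst_form t N \<nu>)"
proof -
  have fE: "finite E'" using assms(2,4) by (rule rev_finite_subset)
  have e: "subst_form t N (eps j \<nu>) = eps j (subst_form t N \<nu>) - eps t (subst_form t N \<nu>)" if "j \<in> E'" for j
    by (rule subst_form_eps[OF assms(1-3)]) (use that assms(4) in blast)
  have d: "subst_form t N (x - y) = subst_form t N x - subst_form t N y" for x y :: "'a kos"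
    by (rule kv.lin_opD(5)[OF lin_subst_form])
  show ?thesis
  proof (cases "\<exists>w\<in>E'. u < w")
    case True
    have s: "succ_in E' u \<in> E'" by (rule succ_in(1)[OF fE True])
    have "succ_in E u = succ_in E' u" "\<exists>w\<in>E. u < w"
      using E succ_in_insert_greater[OF fE True, of t] True by auto
    then show ?thesis using True by (simp add: lf_def d e[OF assms(5)] e[OF s])
  next
    case False
    then have E: "E = insert t E'" "u < t" using E assms(5) by auto
    have "succ_in E u = t" unfolding E(1) by (rule succ_in_insert_last[OF False E(2)])
    then show ?thesis using False E by (simp add: lf_def e[OF assms(5)])
  qed
qed

context
  fixes H W :: "nat set" and q t :: nat
  assumes t: "\<And>x. x \<in> W - H ==> x \<le> t" "t \<in> W" "t \<notin> H" and fin: "finite W"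
    and HW: "H \<subseteq> W" "card H \<le> q" "q < card W"
    and IH: "\<And>H'. H' \<subseteq> W ==> card H' \<le> q ==> card (W - H') < card (W - H) ==>
      hom_basis ct (stX H' W q) (W - H') (BI W q H') (bel W)"
begin

lemma tless: "x \<in> W - H ==> x \<noteq> t ==> x < t" using t(1) by force

definition JB where "JB F = (\<lambda>((lo, _), (hi, U)). (lo @ hi, U)) ` (SI H F (card F) \<times> BI W q (insert t F))"

lemma ir_join_top:
  assumes F: "F \<in> Fls H W q t" and lo: "lo \<in> fc H F m" and hi: "hi \<in> fc (insert t F) W q"
  shows "ir ((lo @ hi) @ [W]) \<longleftrightarrow> ir lo \<and> nsl lo \<and> ir (hi @ [W])"
proof -
  obtain up where up: "hi = insert t F # up" using hi by (cases hi) (auto simp: fc_def)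
  have FF: "t \<notin> F" "F \<subseteq> W" using F by (auto simp: Fls_def)
  have 1: "insert t F \<subset> C \<and> C \<subseteq> W" if "C \<in> set (up @ [W])" for C
  proof (cases "C = W")
    case True
    have "card (insert t F) \<le> card (last hi)"
      by (rule card_mono) (use fc_last[OF hi] fin in \<open>auto intro: finite_subset\<close>)
    then have "insert t F \<noteq> W" using hi HW(3) by (auto simp: fc_def)
    then show ?thesis using True FF t(2) by auto
  next
    case False
    then have "C \<in> set up" using that by auto
    moreover have "C \<subseteq> last hi" using sorted_hd_last(2)[of hi C] hi calculation by (simp add: fc_def up)
    ultimately show ?thesis using hi by (auto simp: fc_def up)
  qed
  have 2: "H \<subseteq> A \<and> A \<subseteq> F" if "A \<in> set lo" for A
    using lo that sorted_hd_last[of lo A] by (auto simp: fc_def)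
  have "lo \<noteq> []" "sorted_wrt (\<subset>) lo" using lo by (auto simp: fc_def)
  from ir_join[where up = "up @ [W]", OF t(1) fin FF t(2) 1 this 2] show ?thesis unfolding up by simp
qed

lemma ir_join_last:
  assumes "Fs \<in> fc H (W - {t}) q" shows "ir (Fs @ [W]) \<longleftrightarrow> ir Fs \<and> nsl Fs"
proof -
  have 2: "H \<subseteq> A \<and> A \<subseteq> W - {t}" if "A \<in> set Fs" for A
    using assms that sorted_hd_last[of Fs A] by (auto simp: fc_def)
  have "Fs \<noteq> []" "sorted_wrt (\<subset>) Fs" using assms by (auto simp: fc_def)
  from ir_join[where F = "W - {t}" and up = "[]", OF t(1) fin _ _ t(2) _ this 2] show ?thesis
    using t(2) by (simp add: insert_absorb)
qed

text \<open>
  For a flag that does not meet \<open>t\<close>, the whole set is a next member that contains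
  \<open>t\<close>. So retrality means that the last step is no cover, as in \<open>SI\<close>.
\<close>

lemma BI_below: "{i \<in> BI W q H. t \<notin> last (fst i)} = SI H (W - {t}) q"
proof -
  have "(Fs, U) \<in> BI W q H \<and> t \<notin> last Fs \<longleftrightarrow> (Fs, U) \<in> SI H (W - {t}) q" for Fs U
  proof (cases "Fs \<in> fc H (W - {t}) q")
    case True
    then have Fs: "Fs \<in> fc H W q" "t \<notin> last Fs" "H \<subseteq> last Fs" using fc_last[OF True] by (auto simp: fc_def)
    have mx: "(U \<subseteq> W - last Fs \<and> (\<forall>u\<in>U. \<exists>w\<in>W - last Fs. u < w)) \<longleftrightarrow> U \<subseteq> W - {t} - last Fs"
    proof
      assume a: "U \<subseteq> W - last Fs \<and> (\<forall>u\<in>U. \<exists>w\<in>W - last Fs. u < w)"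
      have "u \<noteq> t" if u: "u \<in> U" for u
      proof
        assume ut: "u = t"
        have "\<exists>w\<in>W - last Fs. u < w" using conjunct2[OF a] u by simp
        then obtain w where w: "w \<in> W - last Fs" "u < w" by blast
        have "w \<in> W - H" using w(1) Fs(3) by (metis Diff_iff subsetD)
        then show False using t(1)[of w] w(2) ut by simp
      qed
      then show "U \<subseteq> W - {t} - last Fs" using conjunct1[OF a] by auto
    next
      assume a: "U \<subseteq> W - {t} - last Fs"
      have "u < t" if u: "u \<in> U" for u
      proof (rule tless)
        have "u \<in> W - {t} - last Fs" using a u by (rule subsetD)
        then show "u \<in> W - H" "u \<noteq> t" using Fs(3) by auto
      qed
      moreover have "t \<in> W - last Fs" using t(2) Fs(2) by simp
      moreover have "U \<subseteq> W - last Fs" using a by auto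
      ultimately show "U \<subseteq> W - last Fs \<and> (\<forall>u\<in>U. \<exists>w\<in>W - last Fs. u < w)" by metis
    qed
    show ?thesis using Fs True ir_join_last[OF True] mx unfolding BI_def SI_def by auto
  next
    case False
    then show ?thesis by (auto simp: BI_def SI_def fc_def)
  qed
  note e = this
  show ?thesis
  proof (intro set_eqI)
    fix i show "i \<in> {i \<in> BI W q H. t \<notin> last (fst i)} \<longleftrightarrow> i \<in> SI H (W - {t}) q"
      using e[of "fst i" "snd i"] by simp
  qed
qed

lemma JB_elim:
  assumes "i \<in> JB F" "F \<in> Fls H W q t" shows "i \<in> BI W q H \<and> t \<in> last (fst i)"
proof -
  obtain lo Ul hi U where i: "i = (lo @ hi, U)" "(lo, Ul) \<in> SI H F (card F)" "(hi, U) \<in> BI W q (insert t F)"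
    using assms(1) by (auto simp: JB_def)
  have F: "t \<notin> F" "F \<subseteq> W - {t}" "H \<subseteq> F" "card F < q" using assms(2) by (auto simp: Fls_def)
  have finF: "finite F" using F fin finite_subset by blast
  have lo: "lo \<in> fc H F (card F)" "ir lo" "nsl lo"
    using i(2) SI_complete[OF finF i(2)] by (auto simp: SI_def)
  have hi: "hi \<in> fc (insert t F) W q" using i(3) by (simp add: BI_def)
  have ne: "lo \<noteq> []" "hi \<noteq> []" "hd hi = insert t F" "last lo \<subseteq> F" using lo(1) hi by (auto simp: fc_def)
  have fcj: "lo @ hi \<in> fc H W q" by (rule fc_append[OF lo(1) hi F(1)])
  have vl: "t \<in> last hi" "H \<subseteq> last hi" using fc_last[OF hi] F by auto
  have cov: "covers (hd hi) (last lo) \<longleftrightarrow> last lo = F" using covers_insert_iff[OF F(1) ne(4)] ne(3) by simp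
  show ?thesis
  proof (cases "U = {}")
    case True
    then have "ir (hi @ [W])" using i(3) by (simp add: BI_def)
    then have "ir ((lo @ hi) @ [W])" using ir_join_top[OF assms(2) lo(1) hi] lo(2,3) by blast
    then show ?thesis using i(1) True fcj vl ne by (simp add: BI_def)
  next
    case False
    then have U: "card (last hi) = q" "U \<subseteq> W - last hi" "ir hi" "lc_ok hi U" "\<forall>u\<in>U. \<exists>w\<in>W - last hi. u < w"
      using i(3) by (auto simp: BI_def)
    have "Min U \<in> U" using False U(2) fin by (intro Min_in) (auto intro: finite_subset)
    then have "Min U \<in> W - H" "Min U \<noteq> t" using U(2) vl by auto
    then have "Min U < t" by (rule tless)
    moreover have "insert t F - F = {t}" using F(1) by auto
    ultimately have "lc_ok (lo @ hi) U" using U(4) cov ne(3) lc_ok_append[OF ne(2,1)] by auto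
    moreover have "ir (lo @ hi)" using ir_join_fc[OF t(1) fin t(2) assms(2) lo(1) hi] lo U by simp
    ultimately show ?thesis using i(1) False U fcj vl ne by (simp add: BI_def)
  qed
qed

lemma JB_intro:
  assumes "i \<in> BI W q H" "t \<in> last (fst i)" shows "\<exists>F\<in>Fls H W q t. i \<in> JB F"
proof -
  obtain Fs U where i: "i = (Fs, U)" by (cases i)
  have Fs: "Fs \<in> fc H W q" "t \<in> last Fs" using assms i by (auto simp: BI_def)
  obtain lo hi F where s: "Fs = lo @ hi" "F \<in> Fls H W q t" "lo \<in> fc H F (card F)" "hi \<in> fc (insert t F) W q"
    using fc_split[OF Fs t(3) fin] .
  have ne: "lo \<noteq> []" "hi \<noteq> []" using s(3,4) by (auto simp: fc_def)
  have irs: "ir lo \<and> nsl lo"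
    using assms(1) ir_join_fc[OF t(1) fin t(2) s(2,3,4)] ir_join_top[OF s(2,3,4)] unfolding i s(1) BI_def by auto
  then have "(lo, {}) \<in> SI H F (card F)" using s(3) by (simp add: SI_def)
  moreover have "(hi, U) \<in> BI W q (insert t F)"
  proof (cases "U = {}")
    case True
    then have "ir ((lo @ hi) @ [W])" using assms(1) i s(1) by (simp add: BI_def)
    then show ?thesis using True s(4) ir_join_top[OF s(2,3,4)] by (simp add: BI_def)
  next
    case False
    then have U: "card (last hi) = q" "ir (lo @ hi)" "U \<subseteq> W - last hi" "lc_ok (lo @ hi) U" "\<forall>u\<in>U. \<exists>w\<in>W - last hi. u < w"
      using assms(1) i s(1) ne by (auto simp: BI_def)
    have "lc_ok hi U"
    proof (cases "tl hi = []")
      case True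
      then show ?thesis using list_append_facts(5)[OF ne(2,1)] lc_ok_single by blast
    next
      case False then show ?thesis using U(4) lc_ok_append[OF ne(2,1)] by simp
    qed
    moreover have "ir hi" using ir_join_fc[OF t(1) fin t(2) s(2,3,4)] U(2) by blast
    ultimately show ?thesis using False U s(4) by (simp add: BI_def)
  qed
  ultimately have "i \<in> JB F" unfolding JB_def i s(1)
    by (intro image_eqI[of _ _ "((lo, {}), (hi, U))"]) auto
  then show ?thesis using s(2) by blast
qed

text \<open>
  In contrast to \<open>JF_union\<close> there are no superfluous flags, since the whole set
  always follows the last flat.
\<close>

lemma JB_union: "(\<Union>F\<in>Fls H W q t. JB F) = {i \<in> BI W q H. t \<in> last (fst i)}"
proof (intro set_eqI iffI)
  fix i assume "i \<in> (\<Union>F\<in>Fls H W q t. JB F)"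
  then obtain F where "F \<in> Fls H W q t" "i \<in> JB F" by blast
  then have "i \<in> BI W q H \<and> t \<in> last (fst i)" using JB_elim by metis
  then show "i \<in> {i \<in> BI W q H. t \<in> last (fst i)}" by blast
next
  fix i assume "i \<in> {i \<in> BI W q H. t \<in> last (fst i)}"
  then have "\<exists>F\<in>Fls H W q t. i \<in> JB F" using JB_intro[of i] by simp
  then show "i \<in> (\<Union>F\<in>Fls H W q t. JB F)" by simp
qed

lemma cp_cy: "j \<noteq> t ==> t \<notin> G ==> cp t j (Xv G) = cy j (Xv G)"
  by (simp add: cp_def)

lemma cp_ct: "j \<noteq> t ==> t \<in> G ==> cp t j (Xv G) = ct j (Xv G)"
  by (simp add: cp_def)

lemma berg_piece:
  assumes F: "F \<in> Fls H W q t"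
  shows "hom_basis (cp t) (vX (pcS H W q t F)) (W - {t} - H) (JB F) (fel (W - {t}))"
proof -
  have F': "H \<subseteq> F" "t \<notin> F" "F \<subseteq> W" "card F < q" using F by (auto simp: Fls_def)
  have finF: "finite F" using F'(3) fin by (rule finite_subset)
  have c2: "card (W - insert t F) < card (W - H)" by (rule psubset_card_mono) (use F' t fin in auto)
  have "hom_basis cy (sdX H F (card F)) (F - H) (SI H F (card F)) (\<lambda>i. mon (xm (fst i)))"
    by (rule hom_basis_complete[OF finF hom_basis_chains[OF finF F'(1) card_mono[OF finF F'(1)]]])
  then have hL: "hom_basis (cp t) (sdX H F (card F)) (F - H) (SI H F (card F)) (\<lambda>i. mon (xm (fst i)))"
  proof (rule hom_basis_cong_forms)
    fix j u M assume a: "j \<in> F - H" "u \<in># M" "M \<in> sdX H F (card F)"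
    obtain \<G> where g: "set_mset M = Xv ` \<G>" "\<G> \<in> chS H F (card F)" using a(3) by (auto simp: vX_iff)
    obtain G where G: "u = Xv G" "G \<in> \<G>" using g(1) a(2) by auto
    have "G \<subseteq> F" by (rule chS_D(2)[OF g(2) G(2)])
    then have "t \<notin> G" "j \<noteq> t" using F'(2) a(1) by auto
    then show "cy j u = cp t j u" unfolding G(1) by (simp add: cp_cy del: cy_simps)
  qed (use finF in simp)
  have "hom_basis ct (stX (insert t F) W q) (W - insert t F) (BI W q (insert t F)) (bel W)"
    by (rule IH[OF _ _ c2]) (use F' t finF in auto)
  then have hU: "hom_basis (cp t) (stX (insert t F) W q) (W - insert t F) (BI W q (insert t F)) (bel W)"
  proof (rule hom_basis_cong_forms)
    fix j u M assume a: "j \<in> W - insert t F" "u \<in># M" "M \<in> stX (insert t F) W q"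
    obtain \<G> where g: "set_mset M = Xv ` insert (insert t F) \<G>" "\<G> \<in> chS (insert t F) W q" using a(3) by (auto simp: vX_iff)
    obtain G where G: "u = Xv G" "G = insert t F \<or> G \<in> \<G>" using g(1) a(2) by auto
    have "t \<in> G" using G(2) chS_D(1)[OF g(2), of G] by auto
    moreover have "j \<noteq> t" using a(1) by auto
    ultimately show "ct j u = cp t j u" unfolding G(1) by (simp add: cp_ct del: ct_simps)
  qed (use fin in simp)
  have N: "(F - H) \<union> (W - insert t F) = W - {t} - H" using F' by auto
  have "hom_basis (cp t) (vX (pcS H W q t F)) ((F - H) \<union> (W - insert t F)) (SI H F (card F) \<times> BI W q (insert t F))
      (\<lambda>(i, j). shift (xm (fst i)) (bel W j))"
  proof (rule hom_basis_piece[OF F'(1,2,3) t(2) fin F'(4) _ _ _ hL hU])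
    fix j G assume "j \<in> W - insert t F" "G \<subseteq> F"
    then have "t \<notin> G" "j \<noteq> t" "j \<notin> G" using F'(2) by auto
    then show "cp t j (Xv G) = 0" by (simp add: cp_def)
  qed (use fin in auto)
  then show ?thesis unfolding N JB_def
  proof (rule hom_basis_image)
    fix i assume "i \<in> SI H F (card F) \<times> BI W q (insert t F)"
    then obtain lo Ul hi U where i: "i = ((lo, Ul), (hi, U))" "(lo, Ul) \<in> SI H F (card F)" "(hi, U) \<in> BI W q (insert t F)"
      by auto
    have hi: "hi \<in> fc (insert t F) W q" using i(3) by (simp add: BI_def)
    have ne: "lo \<noteq> []" "hi \<noteq> []" using i(2) hi by (auto simp: SI_def fc_def)
    have "t \<in> last hi" using fc_last(1)[OF hi] by auto
    then have "W - {t} - last hi = W - last hi" by auto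
    then have "fel (W - {t}) (lo @ hi, U) = fel W (lo @ hi, U)" using ne by (simp add: fel_def)
    also have "\<dots> = shift (xm lo) (bel W (hi, U))"
      unfolding bel_def using fel_join[OF ne BI_finite_U[OF fin i(3)]] by simp
    finally show "fel (W - {t}) (case i of (x, y) => (case x of (lo, _) => \<lambda>(hi, U). (lo @ hi, U)) y) =
        (case i of (i, j) => shift (xm (fst i)) (bel W j))"
      by (simp add: i(1))
  qed
qed

text \<open>
  The largest flat has the size of a hyperplane, so it contains every flat compatible with the
  monomial; on these all forms with index outside of it agree.
\<close>

lemma berg_cycle:
  assumes "i \<in> BI W q H" shows "dk (cp t) (sdX H W q) (W - {t} - H) (fel (W - {t}) i) = 0"
proof -
  obtain Fs U where i: "i = (Fs, U)" by (cases i)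
  have finN: "finite (W - {t} - H)" using fin by simp
  show ?thesis
  proof (cases "U = {}")
    case True then show ?thesis using finN by (simp add: i fel_def dk_mon)
  next
    case False
    then have b: "Fs \<in> fc H W q" "card (last Fs) = q" "U \<subseteq> W - last Fs" "\<forall>u\<in>U. \<exists>w\<in>W - last Fs. u < w"
      using assms by (auto simp: BI_def i)
    note H = fc_last[OF b(1)]
    have Ut: "t \<notin> U"
    proof
      assume "t \<in> U"
      then obtain w where "w \<in> W - H" "t < w" using b(4) H(1) by blast
      then show False using t(1)[of w] by simp
    qed
    have tG: "\<exists>G. w = Xv G \<and> G \<subseteq> last Fs" if "add_mset w (xm Fs) \<in> sdX H W q" for w
      using top_flat[OF b(1) fin that b(2)] by metis
    show ?thesis unfolding i fel_def prod.case
    proof (rule dk_wlist)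
      show "U \<subseteq> W - {t} - H" "W - {t} - last Fs \<subseteq> W - {t} - H" using b(3) H Ut by auto
      fix u w assume u: "u \<in> U" "add_mset w (xm Fs) \<in> sdX H W q"
      obtain G where G: "w = Xv G" "G \<subseteq> last Fs" using tG[OF u(2)] by blast
      have ou: "u \<notin> G" "u \<noteq> t" using u(1) b(3) G(2) Ut by auto
      show "if \<exists>w\<in>W - {t} - last Fs. u < w then cp t u w = cp t (succ_in (W - {t} - last Fs) u) w else cp t u w = 0"
      proof (cases "\<exists>w\<in>W - {t} - last Fs. u < w")
        case True
        have "succ_in (W - {t} - last Fs) u \<in> W - {t} - last Fs" by (rule succ_in(1)[OF _ True]) (use fin in simp)
        then have "succ_in (W - {t} - last Fs) u \<notin> G" "succ_in (W - {t} - last Fs) u \<noteq> t" using G(2) by auto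
        then show ?thesis using True ou by (simp add: G(1) cp_def)
      next
        case no: False
        have "t \<notin> last Fs"
        proof
          assume "t \<in> last Fs"
          then have "W - {t} - last Fs = W - last Fs" by auto
          then show False using no b(4) u(1) by auto
        qed
        then have "t \<notin> G" using G(2) by blast
        then have "cp t u w = 0" using ou by (simp add: G(1) cp_def)
        then show ?thesis using no by simp
      qed
    qed (use fin in auto)
  qed
qed

lemma berg_chains: "hom_basis (cp t) (sdX H W q) (W - {t} - H) (BI W q H) (fel (W - {t}))"
proof -
  note dec = vX_chain_decompose[OF t(2,3) fin, where k = q]
  let ?X = "sdX H W q" and ?X1 = "\<Union>F\<in>Fls H W q t. vX (pcS H W q t F)" and ?N = "W - {t} - H"
  let ?A1 = "{i \<in> BI W q H. t \<in> last (fst i)}" and ?A2 = "{i \<in> BI W q H. t \<notin> last (fst i)}"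
  have finN: "finite ?N" using fin by simp
  have ok: "okX ?X" by (rule okX_sdX[OF fin])
  have sub: "?X1 \<subseteq> ?X" using dec(1) by blast
  have h1: "hom_basis (cp t) ?X1 ?N ?A1 (fel (W - {t}))"
    unfolding JB_union[symmetric]
  proof (rule hom_basis_pieces[where rank = card])
    show "okX ?X1" by (rule okX_upward[OF ok sub dec(5)])
    show "finite (Fls H W q t)" by (rule Fls_finite[OF fin])
    show "finite ?N" by (rule finN)
    show "vX (pcS H W q t a) \<inter> vX (pcS H W q t b) = {}" if "a \<in> Fls H W q t" "b \<in> Fls H W q t" "a \<noteq> b" for a b
      by (rule dec(3)[OF that])
    show "a = b \<or> card b < card a"
      if "a \<in> Fls H W q t" "b \<in> Fls H W q t" "M \<in> vX (pcS H W q t a)" "add_mset u M \<in> vX (pcS H W q t b)" for a b M u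
      by (rule dec(4)[OF that])
    show "hom_basis (cp t) (vX (pcS H W q t a)) ?N (JB a) (fel (W - {t}))" if "a \<in> Fls H W q t" for a
      by (rule berg_piece[OF that])
    fix F i assume "F \<in> Fls H W q t" "i \<in> JB F"
    then have "i \<in> BI W q H" using JB_elim by metis
    then show "dk (cp t) ?X1 ?N (fel (W - {t}) i) = 0" by (intro dk_restrict_zero[OF sub] berg_cycle)
  qed (rule refl)
  have h2: "hom_basis (cp t) (sdX H (W - {t}) q) ?N ?A2 (fel (W - {t}))"
    unfolding BI_below
  proof (rule hom_basis_cong_forms[OF hom_basis_chains])
    show "finite (W - {t})" "H \<subseteq> W - {t}" "card H \<le> q" "finite ?N" using fin HW t by auto
    fix j u M assume a: "j \<in> ?N" "u \<in># M" "M \<in> sdX H (W - {t}) q"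
    obtain \<G> where g: "set_mset M = Xv ` \<G>" "\<G> \<in> chS H (W - {t}) q" using a(3) by (auto simp: vX_iff)
    obtain G where G: "u = Xv G" "G \<in> \<G>" using g(1) a(2) by auto
    have "G \<subseteq> W - {t}" by (rule chS_D(2)[OF g(2) G(2)])
    then have "t \<notin> G" "j \<noteq> t" using a(1) by auto
    then show "cy j u = cp t j u" unfolding G(1) by (simp add: cp_cy del: cy_simps)
  qed
  have "hom_basis (cp t) ?X ?N (?A1 \<union> ?A2) (fel (W - {t}))"
  proof (rule hom_basis_extend[where T = "{}" and \<rho> = id, OF finN ok dec(1,2,5)])
    show "hom_basis (cp t) ?X1 ?N (?A1 \<union> id ` {}) (fel (W - {t}))" using h1 by (simp only: image_empty Un_empty_right)
    show "hom_basis (cp t) (sdX H (W - {t}) q) ?N (?A2 \<union> {}) (fel (W - {t}))" using h2 by (simp only: Un_empty_right)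
    show "dk (cp t) ?X ?N (fel (W - {t}) i) = 0" if "i \<in> ?A2" for i using berg_cycle that by blast
  qed auto
  moreover have "?A1 \<union> ?A2 = BI W q H" by auto
  ultimately show ?thesis by simp
qed

lemma berg_step: "hom_basis ct (stX H W q) (W - H) (BI W q H) (bel W)"
proof -
  let ?N = "W - {t} - H"
  have finN: "finite ?N" "t \<notin> ?N" using fin by auto
  have N: "insert t ?N = W - H" using t by auto
  have "hom_basis (cp t) (stX H W q) (insert t ?N) (id ` BI W q H) (\<lambda>i. shift {#Xv H#} (fel (W - {t}) i))"
    unfolding stX_star
  proof (rule hom_basis_star[OF finN _ _ _ _ _ berg_chains[unfolded vX_def]])
    show "okX (supp_in ((`) Xv ` chS H W q))" using okX_sdX[OF fin] by (simp only: vX_def)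
    show "okX (supp_in {insert (Xv H) S | S. S \<in> (`) Xv ` chS H W q})"
      using okX_stX[OF fin HW(1), of q] by (simp only: stX_star)
    fix S assume "S \<in> (`) Xv ` chS H W q"
    then show "Xv H \<notin> S" using chS_self by auto
  next
    show "cp t t (Xv H) \<noteq> 0" using t(3) by (simp add: cp_def)
    show "cp t j (Xv H) = 0" if "j \<in> ?N" for j using that t(3) by (simp add: cp_def)
  qed auto
  then have "hom_basis (cp t) (stX H W q) (insert t ?N) (BI W q H) (\<lambda>i. shift {#Xv H#} (fel (W - {t}) i))"
    by (simp only: image_id id_apply)
  then have "hom_basis ct (stX H W q) (insert t ?N) (BI W q H) (\<lambda>i. subst_form t ?N (shift {#Xv H#} (fel (W - {t}) i)))"
    by (rule hom_basis_subst_form[OF finN okX_stX[OF fin HW(1)], rotated 2]) (auto simp: cp_def fun_eq_iff)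
  then show ?thesis unfolding N
  proof (rule kv.hbasis_cong)
    fix i assume iB: "i \<in> BI W q H"
    obtain Fs U where i: "i = (Fs, U)" by (cases i)
    have b: "Fs \<in> fc H W q" "U \<subseteq> W - last Fs" "\<And>u. u \<in> U ==> \<exists>w\<in>W - last Fs. u < w"
      using iB by (auto simp: BI_def i)
    note H = fc_last[OF b(1)]
    have fU: "finite U" using b(2) fin by (auto intro: finite_subset)
    have Ut: "t \<notin> U"
    proof
      assume "t \<in> U"
      then obtain w where "w \<in> W - H" "t < w" using b(3) H(1) by blast
      then show False using t(1)[of w] by simp
    qed
    let ?E = "W - last Fs" and ?E' = "W - {t} - last Fs"
    have E': "?E' \<subseteq> ?N" using H by auto
    have lt: "\<forall>x\<in>?E'. x < t" using E' tless by blast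
    have EE: "?E = ?E' \<and> (\<exists>w\<in>?E'. u < w) \<or> ?E = insert t ?E' \<and> (\<forall>x\<in>?E'. x < t)" if "u \<in> U" for u
    proof (cases "t \<in> last Fs")
      case True
      then have "?E = ?E'" by auto
      then show ?thesis using b(3)[OF that] by auto
    next
      case False
      then have "?E = insert t ?E'" using t(2) by auto
      then show ?thesis using lt by blast
    qed
    have "subst_form t ?N (wlist (lf ?E') U (mon \<alpha>)) = wlist (lf ?E) U (subst_form t ?N (mon \<alpha>))" for \<alpha> :: "var multiset"
    proof (rule wlist_commute[where P = fj, OF fU fj_mon])
      show "fj (lf ?E' u \<nu>)" if "fj \<nu>" for u and \<nu> :: "var kos" by (rule fj_lf[OF that])
      fix u and \<nu> :: "var kos" assume u: "u \<in> U" "fj \<nu>"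
      have "u \<in> ?E'" using u(1) b(2) Ut by auto
      then show "subst_form t ?N (lf ?E' u \<nu>) = lf ?E u (subst_form t ?N \<nu>)"
        by (rule subst_form_lf[OF u(2) finN E' _ EE[OF u(1)]])
    qed
    moreover have "hd Fs = H" using b(1) by (simp add: fc_def)
    ultimately show "subst_form t ?N (shift {#Xv H#} (fel (W - {t}) i)) = bel W i"
      by (simp add: i bel_def fel_def shift_wlist[OF fU] subst_form_mon)
  qed simp
qed

end

text \<open>
  Induction on the number of elements outside of \<open>H\<close>; the bound \<open>q < card
  W\<close> ensures that there is a largest one.
\<close>

theorem hom_basis_bergman:
  "finite W ==> q < card W ==> H \<subseteq> W ==> card H \<le> q ==> hom_basis ct (stX H W q) (W - H) (BI W q H) (bel W)"
proof (induction "card (W - H)" arbitrary: H rule: less_induct)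
  case less
  define t where "t = Max (W - H)"
  have "W \<noteq> H" using less.prems by auto
  then have ne: "finite (W - H)" "W - H \<noteq> {}" using less.prems by auto
  have "t \<in> W - H" unfolding t_def by (rule Max_in[OF ne])
  then have t: "t \<in> W" "t \<notin> H" by auto
  have tm: "x \<le> t" if "x \<in> W - H" for x unfolding t_def by (rule Max_ge[OF ne(1) that])
  show ?case
    by (rule berg_step[OF tm t less.prems(1,3,4,2)]) (assumption | rule less.hyps[OF _ less.prems(1,2)])+
qed

section \<open>The augmented complex\<close>

text \<open>The sets of variables that span a cone.\<close>

definition aug_faces :: "nat set => nat => var set set" where
  "aug_faces W r = {Yv ` I \<union> Xv ` \<F> | I \<F>. I \<subseteq> W \<and> card I \<le> r \<and>
     (\<forall>F\<in>\<F>. F \<subseteq> W \<and> card F + 1 \<le> r \<and> I \<subseteq> F) \<and> (\<forall>A\<in>\<F>. \<forall>B\<in>\<F>. A \<subseteq> B \<or> B \<subseteq> A)}"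

lemma aug_faces_iff:
  "S \<in> aug_faces W r \<longleftrightarrow> {i. Yv i \<in> S} \<subseteq> W \<and> card {i. Yv i \<in> S} \<le> r \<and>
     (\<forall>F. Xv F \<in> S --> F \<subseteq> W \<and> card F + 1 \<le> r \<and> {i. Yv i \<in> S} \<subseteq> F) \<and>
     (\<forall>A B. Xv A \<in> S --> Xv B \<in> S --> A \<subseteq> B \<or> B \<subseteq> A)" (is "_ \<longleftrightarrow> ?R S")
proof
  assume "S \<in> aug_faces W r"
  then obtain I \<F> where S: "S = Yv ` I \<union> Xv ` \<F>" "I \<subseteq> W" "card I \<le> r"
      "\<forall>F\<in>\<F>. F \<subseteq> W \<and> card F + 1 \<le> r \<and> I \<subseteq> F" "\<forall>A\<in>\<F>. \<forall>B\<in>\<F>. A \<subseteq> B \<or> B \<subseteq> A"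
    unfolding aug_faces_def mem_Collect_eq by (elim exE conjE) (rule that; assumption)
  have 1: "{i. Yv i \<in> S} = I" and 2: "\<And>F. Xv F \<in> S \<longleftrightarrow> F \<in> \<F>" using S(1) by auto
  show "?R S" unfolding 1 2 using S(2-5) by metis
next
  assume R: "?R S"
  have "S = Yv ` {i. Yv i \<in> S} \<union> Xv ` {F. Xv F \<in> S}"
  proof (intro set_eqI)
    fix w show "w \<in> S \<longleftrightarrow> w \<in> Yv ` {i. Yv i \<in> S} \<union> Xv ` {F. Xv F \<in> S}" by (cases w) auto
  qed
  then show "S \<in> aug_faces W r"
    unfolding aug_faces_def using R by (intro CollectI exI[of _ "{i. Yv i \<in> S}"] exI[of _ "{F. Xv F \<in> S}"]) simp
qed

lemma aug_faces_D:
  assumes "S \<in> aug_faces W r" "Xv F \<in> S"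
  shows "F \<subseteq> W" "card F + 1 \<le> r" "Yv i \<in> S ==> i \<in> F" "Xv G \<in> S ==> F \<subseteq> G \<or> G \<subseteq> F"
proof -
  note R = assms(1)[unfolded aug_faces_iff]
  note F = R[THEN conjunct2, THEN conjunct2, THEN conjunct1, rule_format, OF assms(2)]
  show "F \<subseteq> W" "card F + 1 \<le> r" "Yv i \<in> S ==> i \<in> F" using F by auto
  show "Xv G \<in> S ==> F \<subseteq> G \<or> G \<subseteq> F"
    by (rule R[THEN conjunct2, THEN conjunct2, THEN conjunct2, rule_format, OF assms(2)])
qed

lemma aug_faces_subset:
  assumes "finite W" "S \<in> aug_faces W r" "T \<subseteq> S" shows "T \<in> aug_faces W r"
proof -
  note S = assms(2)[unfolded aug_faces_iff]
  have s: "{i. Yv i \<in> T} \<subseteq> {i. Yv i \<in> S}" using assms(3) by auto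
  have "card {i. Yv i \<in> T} \<le> card {i. Yv i \<in> S}"
    by (rule card_mono[OF finite_subset[OF _ assms(1)] s]) (use S in simp)
  then show ?thesis unfolding aug_faces_iff using S s assms(3)
    by (meson le_trans order_trans subsetD)
qed

abbreviation "augX W r \<equiv> supp_in (aug_faces W r)"

lemma okX_augX: assumes "finite W" shows "okX (augX W r)"
proof (rule okX_supp_in[of "Yv ` W \<union> Xv ` Pow W"])
  show "finite (Yv ` W \<union> Xv ` Pow W)" using assms by simp
  fix S assume S: "S \<in> aug_faces W r"
  show "S \<subseteq> Yv ` W \<union> Xv ` Pow W"
  proof
    fix w assume w: "w \<in> S"
    show "w \<in> Yv ` W \<union> Xv ` Pow W"
    proof (cases w)
      case (Yv i) then show ?thesis using S w unfolding aug_faces_iff by auto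
    next
      case (Xv F) then show ?thesis using S w unfolding aug_faces_iff by auto
    qed
  qed
next
  fix A B C assume "C \<in> aug_faces W r" "B \<subseteq> C"
  then show "B \<in> aug_faces W r" by (rule aug_faces_subset[OF assms])
qed

definition aug_piece :: "nat set => nat => nat set => var multiset set" where
  "aug_piece W r F = {M \<in> augX W r. Xv F \<in># M \<and> (\<forall>G. Xv G \<in># M --> F \<subseteq> G)}"

text \<open>The proper flats.\<close>

definition FF :: "nat set => nat => nat set set" where
  "FF W r = {F. F \<subseteq> W \<and> card F + 1 \<le> r}"

lemma skX_iff: "M \<in> skX V k \<longleftrightarrow> (\<forall>F. Xv F \<notin># M) \<and> {i. Yv i \<in># M} \<subseteq> V \<and> card {i. Yv i \<in># M} \<le> k"
proof
  assume "M \<in> skX V k"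
  then obtain S where S: "set_mset M = Yv ` S" "S \<subseteq> V" "card S \<le> k" by (auto simp: skX_def)
  have 1: "{i. Yv i \<in># M} = S" "\<And>F. Xv F \<notin># M" using S(1) by auto
  then show "(\<forall>F. Xv F \<notin># M) \<and> {i. Yv i \<in># M} \<subseteq> V \<and> card {i. Yv i \<in># M} \<le> k" using S by simp
next
  assume R: "(\<forall>F. Xv F \<notin># M) \<and> {i. Yv i \<in># M} \<subseteq> V \<and> card {i. Yv i \<in># M} \<le> k"
  have "set_mset M = Yv ` {i. Yv i \<in># M}"
  proof (intro set_eqI)
    fix w show "w \<in># M \<longleftrightarrow> w \<in> Yv ` {i. Yv i \<in># M}" using R by (cases w) auto
  qed
  then show "M \<in> skX V k" using R unfolding skX_def supp_in_iff by blast
qed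

lemma stX_iff: "M \<in> stX F W q \<longleftrightarrow> (\<forall>i. Yv i \<notin># M) \<and> Xv F \<in># M \<and>
    (\<forall>G. Xv G \<in># M --> G = F \<or> F \<subset> G \<and> G \<subseteq> W \<and> card G \<le> q) \<and>
    (\<forall>A B. Xv A \<in># M --> Xv B \<in># M --> A \<subseteq> B \<or> B \<subseteq> A)" (is "_ \<longleftrightarrow> ?R")
proof
  assume "M \<in> stX F W q"
  then obtain \<G> where g: "set_mset M = Xv ` insert F \<G>" "\<G> \<in> chS F W q" by (auto simp: vX_iff)
  have 1: "\<And>i. Yv i \<notin># M" "\<And>G. Xv G \<in># M \<longleftrightarrow> G = F \<or> G \<in> \<G>" using g(1) by auto
  have "A \<subseteq> B \<or> B \<subseteq> A" if "A = F \<or> A \<in> \<G>" "B = F \<or> B \<in> \<G>" for A B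
    using that chS_D(4)[OF g(2)] chS_D(1)[OF g(2)] by (metis order_refl psubset_imp_subset)
  then show ?R using 1 chS_D(1-3)[OF g(2)] by simp
next
  assume R: ?R
  have "set_mset M = Xv ` insert F {G. Xv G \<in># M \<and> G \<noteq> F}"
  proof (intro set_eqI)
    fix w show "w \<in># M \<longleftrightarrow> w \<in> Xv ` insert F {G. Xv G \<in># M \<and> G \<noteq> F}" using R by (cases w) auto
  qed
  moreover have "{G. Xv G \<in># M \<and> G \<noteq> F} \<in> chS F W q" by (rule chS_I) (use R in auto)
  ultimately show "M \<in> stX F W q" unfolding vX_iff by blast
qed

text \<open>
  As the independent set must lie in \<open>F\<close>, its size is automatically bounded.
\<close>

lemma aug_piece_split:
  assumes "finite W" "F \<in> FF W r"
  shows "aug_piece W r F = {l + u | l u. l \<in> skX F (card F) \<and> u \<in> stX F W (r - 1)}"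
proof (intro set_eqI iffI)
  have F: "F \<subseteq> W" "card F + 1 \<le> r" "finite F" using assms by (auto simp: FF_def intro: finite_subset)
  fix M assume "M \<in> aug_piece W r F"
  then have M: "set_mset M \<in> aug_faces W r" "Xv F \<in># M" "\<And>G. Xv G \<in># M ==> F \<subseteq> G"
    by (auto simp: aug_piece_def)
  note R = M(1)[unfolded aug_faces_iff]
  define P where "P = (\<lambda>w. \<exists>i. w = Yv i)"
  have "{i. Yv i \<in># M} \<subseteq> F" using R M(2) by blast
  then have "filter_mset P M \<in> skX F (card F)"
    unfolding skX_iff using card_mono[OF F(3)] by (auto simp: P_def)
  moreover have "filter_mset (\<lambda>w. \<not> P w) M \<in> stX F W (r - 1)"
  proof -
    have "G = F \<or> F \<subset> G \<and> G \<subseteq> W \<and> card G \<le> r - 1" if G: "Xv G \<in># M" for G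
    proof -
      have "G \<subseteq> W \<and> card G + 1 \<le> r" using R G by blast
      then show ?thesis using M(3)[OF G] by auto
    qed
    then show ?thesis unfolding stX_iff using M(2) R by (simp add: P_def)
  qed
  moreover have "M = filter_mset P M + filter_mset (\<lambda>w. \<not> P w) M" by (simp add: multiset_partition[symmetric])
  ultimately show "M \<in> {l + u | l u. l \<in> skX F (card F) \<and> u \<in> stX F W (r - 1)}" by blast
next
  have F: "F \<subseteq> W" "card F + 1 \<le> r" "finite F" using assms by (auto simp: FF_def intro: finite_subset)
  fix M assume "M \<in> {l + u | l u. l \<in> skX F (card F) \<and> u \<in> stX F W (r - 1)}"
  then obtain l u where lu: "M = l + u" "l \<in> skX F (card F)" "u \<in> stX F W (r - 1)" by blast
  note L = lu(2)[unfolded skX_iff] and U = lu(3)[unfolded stX_iff]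
  have Y: "Yv i \<in># M \<longleftrightarrow> Yv i \<in># l" and X: "Xv G \<in># M \<longleftrightarrow> Xv G \<in># u" for i G
    using lu(1) L U by auto
  have XG: "F \<subseteq> G \<and> G \<subseteq> W \<and> card G + 1 \<le> r" if G: "Xv G \<in># u" for G
  proof -
    have "G = F \<or> F \<subset> G \<and> G \<subseteq> W \<and> card G \<le> r - 1" using U G by blast
    then show ?thesis using F by auto
  qed
  have "set_mset M \<in> aug_faces W r"
    unfolding aug_faces_iff Y X
  proof (intro conjI allI impI)
    show "{i. Yv i \<in># l} \<subseteq> W" "card {i. Yv i \<in># l} \<le> r" using L F by auto
    show "A \<subseteq> B \<or> B \<subseteq> A" if "Xv A \<in># u" "Xv B \<in># u" for A B using U that by blast
    fix G assume G: "Xv G \<in># u"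
    show "G \<subseteq> W" "card G + 1 \<le> r" using XG[OF G] by blast+
    have "{i. Yv i \<in># l} \<subseteq> F" using L by blast
    also have "F \<subseteq> G" using XG[OF G] by blast
    finally show "{i. Yv i \<in># l} \<subseteq> G" .
  qed
  then show "M \<in> aug_piece W r F" using U XG by (auto simp: aug_piece_def X)
qed

definition aug_index :: "nat set => nat => ((nat set list \<times> nat set) + (nat set \<times> nat set)) set" where
  "aug_index W r = Inl ` (\<Union>F\<in>FF W r. BI W (r - 1) F) \<union> Inr ` SK W r"

definition aug_el :: "nat set => (nat set list \<times> nat set) + (nat set \<times> nat set) => var kos" where
  "aug_el W = case_sum (bel W) sk_el"

lemma bel_wlist:
  assumes "finite W" "Fs \<in> fc H W q" "U \<subseteq> W - last Fs"
  shows "bel W (Fs, U) = wlist (lf (W - last Fs)) U (mon (mset (map Xv Fs)))"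
proof -
  have "finite U" using assms(1,3) by (auto intro: finite_subset)
  moreover have "{#Xv (hd Fs)#} + xm Fs = mset (map Xv Fs)" using assms(2) by (cases Fs) (auto simp: fc_def xm_def)
  ultimately show ?thesis by (simp add: bel_def fel_def shift_wlist)
qed

lemma bel_cycle:
  assumes fin: "finite W" and F: "F \<in> FF W r" and i: "i \<in> BI W (r - 1) F"
  shows "dk ct (augX W r) W (bel W i) = 0"
proof -
  obtain Fs U where i': "i = (Fs, U)" by (cases i)
  have b: "Fs \<in> fc F W (r - 1)" "U \<subseteq> W - last Fs" "\<And>u. u \<in> U ==> \<exists>w\<in>W - last Fs. u < w"
      "U \<noteq> {} ==> card (last Fs) = r - 1" using i by (auto simp: BI_def i')
  have Fs: "Fs \<noteq> []" "last Fs \<subseteq> W" using b(1) by (auto simp: fc_def)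
  show ?thesis
  proof (cases "U = {}")
    case True
    then show ?thesis unfolding i' bel_wlist[OF fin b(1,2)] using dk_mon[OF fin] by simp
  next
    case False
    have "dk ct (augX W r) W (wlist (lf (W - last Fs)) U (mon (mset (map Xv Fs)))) = 0"
    proof (rule dk_wlist)
      fix u w assume u: "u \<in> U" "add_mset w (mset (map Xv Fs)) \<in> augX W r"
      have "set_mset (add_mset w (mset (map Xv Fs))) = insert w (Xv ` set Fs)" by auto
      then have R: "insert w (Xv ` set Fs) \<in> aug_faces W r" using u(2) by (simp only: supp_in_iff)
      have s: "succ_in (W - last Fs) u \<in> W - last Fs" by (rule succ_in(1)[OF _ b(3)[OF u(1)]]) (use fin in simp)
      have "ct x w = ct y w" if "x \<in> W - last Fs" "y \<in> W - last Fs" for x y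
      proof (cases w)
        case (Yv i)
        have "Xv (last Fs) \<in> insert w (Xv ` set Fs)" using Fs(1) by simp
        then have "i \<in> last Fs" by (rule aug_faces_D(3)[OF R]) (simp add: Yv)
        then show ?thesis using that Yv by auto
      next
        case (Xv G)
        have L: "Xv (last Fs) \<in> insert w (Xv ` set Fs)" "Xv G \<in> insert w (Xv ` set Fs)" using Fs(1) Xv by auto
        note c = aug_faces_D(4)[OF R L(2,1)] aug_faces_D(1,2)[OF R L(2)]
        have "G \<subseteq> last Fs"
        proof (cases "last Fs \<subseteq> G")
          case True
          have "card G \<le> card (last Fs)" using c(3) b(4)[OF False] by simp
          then have "last Fs = G" using True c(2) fin card_seteq[of G "last Fs"] finite_subset by blast
          then show ?thesis by simp
        next
          case False then show ?thesis using c(1) by blast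
        qed
        then show ?thesis using that Xv by auto
      qed
      then have "ct u w = ct (succ_in (W - last Fs) u) w" using s u(1) b(2) by blast
      then show "if \<exists>w\<in>W - last Fs. u < w then ct u w = ct (succ_in (W - last Fs) u) w else ct u w = 0"
        using b(3)[OF u(1)] by simp
    qed (use fin b(2) in auto)
    then show ?thesis by (simp only: i' bel_wlist[OF fin b(1,2)])
  qed
qed

lemma sk_el_cycle:
  assumes fin: "finite W" and i: "i \<in> SK W r" shows "dk ct (augX W r) W (sk_el i) = 0"
proof -
  obtain B J where i': "i = (B, J)" by (cases i)
  show ?thesis
  proof (cases "J = {}")
    case True then show ?thesis using dk_mon[OF fin] by (simp add: i' sk_el_def)
  next
    case False
    then have b: "B \<subseteq> W" "card B = r" "J \<subseteq> W - B" using i by (auto simp: SK_def i')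
    have fB: "finite B" using b(1) fin by (rule finite_subset)
    show ?thesis unfolding i' sk_el_def prod.case eps_lf
    proof (rule dk_wlist)
      fix u w assume u: "u \<in> J" "add_mset w (mset_set (Yv ` B)) \<in> augX W r"
      have R: "insert w (Yv ` B) \<in> aug_faces W r" using u(2) fB by simp
      have "ct u w = 0"
      proof (cases w)
        case (Yv i)
        have I: "{j. Yv j \<in> insert w (Yv ` B)} = insert i B" using Yv by auto
        have "card (insert i B) \<le> r" using R I unfolding aug_faces_iff by metis
        then have "i \<in> B" using b(2) fB by (auto simp: card_insert_if split: if_splits)
        then show ?thesis using u(1) b(3) Yv by auto
      next
        case (Xv G)
        have I: "{j. Yv j \<in> insert w (Yv ` B)} = B" "Xv G \<in> insert w (Yv ` B)" using Xv by auto
        have "G \<subseteq> W \<and> card G + 1 \<le> r \<and> B \<subseteq> G" using R I unfolding aug_faces_iff by metis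
        then have "card B \<le> card G" using fin by (intro card_mono) (auto intro: finite_subset)
        then show ?thesis using \<open>G \<subseteq> W \<and> card G + 1 \<le> r \<and> B \<subseteq> G\<close> b(2) by simp
      qed
      then show "if \<exists>w\<in>{}. u < w then ct u w = ct (succ_in {} u) w else ct u w = 0" by simp
    qed (use fin b in auto)
  qed
qed

text \<open>
  The basis of the full simplex on \<open>F\<close> consists of \<open>1\<close> only: a wedge
  would need an index outside of \<open>F\<close>.
\<close>

lemma hom_basis_aug_piece:
  assumes fin: "finite W" and r: "r \<le> card W" and F: "F \<in> FF W r"
  shows "hom_basis ct (aug_piece W r F) W (Inl ` BI W (r - 1) F) (aug_el W)"
proof -
  have F': "F \<subseteq> W" "card F + 1 \<le> r" "finite F" using F fin by (auto simp: FF_def intro: finite_subset)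
  have SK0: "SK F (card F) = {({}, {})}"
  proof -
    have "B = F" if "B \<subseteq> F" "card B = card F" for B using card_subset_eq[OF F'(3) that] .
    then show ?thesis unfolding SK_def by auto
  qed
  have "hom_basis cy (skX F (card F)) F {({}, {})} sk_el"
    using hom_basis_skeleton[OF F'(3), of "card F"] by (simp only: SK0)
  then have "hom_basis cy (skX F (card F)) F {({} :: nat set, {} :: nat set)} (\<lambda>_. mon {#})"
    by (rule kv.hbasis_cong) (auto simp: sk_el_def)
  then have hL: "hom_basis ct (skX F (card F)) F {({} :: nat set, {} :: nat set)} (\<lambda>_. mon {#})"
  proof (rule hom_basis_cong_forms[OF _ F'(3)])
    fix j u M assume a: "u \<in># M" "M \<in> skX F (card F)"
    then obtain i where "u = Yv i" unfolding skX_iff by (cases u) auto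
    then show "cy j u = ct j u" by simp
  qed
  have hU: "hom_basis ct (stX F W (r - 1)) (W - F) (BI W (r - 1) F) (bel W)"
    by (rule hom_basis_bergman[OF fin _ F'(1)]) (use r F'(2) in auto)
  have okp: "okX (aug_piece W r F)"
    unfolding okX_def
  proof (intro conjI ballI allI impI)
    obtain V where "finite V" "\<forall>M\<in>augX W r. set_mset M \<subseteq> V" using okX_augX[OF fin, of r] unfolding okX_def by blast
    then show "\<exists>V. finite V \<and> (\<forall>M\<in>aug_piece W r F. set_mset M \<subseteq> V)"
      by (intro exI[of _ V]) (simp add: aug_piece_def)
    fix A C B assume a: "A \<in> aug_piece W r F" "C \<in> aug_piece W r F" "A \<subseteq># B" "B \<subseteq># C"
    have "B \<in> augX W r" by (rule okX_between[OF okX_augX[OF fin] _ _ a(3,4)]) (use a in \<open>auto simp: aug_piece_def\<close>)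
    then show "B \<in> aug_piece W r F"
      using a(1,2) mset_subset_eqD[OF a(3)] mset_subset_eqD[OF a(4)] by (auto simp: aug_piece_def)
  qed
  have "hom_basis ct (aug_piece W r F) W ({({} :: nat set, {} :: nat set)} \<times> BI W (r - 1) F) (\<lambda>(i, j). shift {#} (bel W j))"
  proof (rule hom_basis_tensor[where VL = "Yv ` F", OF F'(3) _ _ okp okX_skX[OF F'(3)] okX_stX[OF fin F'(1)] _ _
        aug_piece_split[OF fin F] _ hL hU])
    show "set_mset M \<subseteq> Yv ` F" if "M \<in> skX F (card F)" for M using that by (auto simp: skX_def)
    show "set_mset M \<inter> Yv ` F = {}" if "M \<in> stX F W (r - 1)" for M using that unfolding stX_iff by auto
  qed (use fin F' in auto)
  then have "hom_basis ct (aug_piece W r F) W ((Inl \<circ> snd) ` ({({} :: nat set, {} :: nat set)} \<times> BI W (r - 1) F)) (aug_el W)"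
    by (rule hom_basis_image) (auto simp: aug_el_def shift_def)
  moreover have "(Inl \<circ> snd) ` ({({} :: nat set, {} :: nat set)} \<times> BI W (r - 1) F) = (Inl ` BI W (r - 1) F :: ((nat set list \<times> nat set) + (nat set \<times> nat set)) set)" by force
  ultimately show ?thesis by (simp only:)
qed

theorem hom_basis_augmented:
  assumes fin: "finite W" and r: "r \<le> card W"
  shows "hom_basis ct (augX W r) W (aug_index W r) (aug_el W)"
proof -
  let ?X = "augX W r" and ?X1 = "\<Union>F\<in>FF W r. aug_piece W r F" and ?X2 = "skX W r"
  let ?I1 = "\<Union>F\<in>FF W r. Inl ` BI W (r - 1) F :: ((nat set list \<times> nat set) + (nat set \<times> nat set)) set"
  let ?I2 = "Inr ` SK W r :: ((nat set list \<times> nat set) + (nat set \<times> nat set)) set"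
  have ok: "okX ?X" by (rule okX_augX[OF fin])
  have finFF: "finite (FF W r)" by (rule finite_subset[of _ "Pow W"]) (use fin in \<open>auto simp: FF_def\<close>)
  have sub: "?X1 \<subseteq> ?X" by (auto simp: aug_piece_def)
  have inX1: "M \<in> ?X1" if M: "M \<in> ?X" "Xv G \<in># M" for M G
  proof -
    let ?\<F> = "{F. Xv F \<in># M}"
    have R: "set_mset M \<in> aug_faces W r" using M(1) by simp
    have "finite ?\<F>" by (rule finite_subset[of _ "Pow W"]) (use R fin in \<open>auto simp: aug_faces_iff\<close>)
    then obtain F where F: "F \<in> ?\<F>" "\<forall>G\<in>?\<F>. \<not> G \<subset> F" using finite_has_minimal[of ?\<F>] M(2) by auto
    have "F \<subseteq> G" if "Xv G \<in># M" for G
    proof -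
      have "F \<subseteq> G \<or> G \<subseteq> F" by (rule aug_faces_D(4)[OF R _ that]) (use F(1) in simp)
      then show ?thesis using F(2) that by blast
    qed
    moreover have "F \<in> FF W r" using aug_faces_D(1,2)[OF R, of F] F(1) by (simp add: FF_def)
    ultimately show ?thesis using M(1) F(1) by (auto simp: aug_piece_def)
  qed
  have noX: "M \<in> ?X2" if M: "M \<in> ?X" "\<And>G. Xv G \<notin># M" for M
    using M unfolding skX_iff supp_in_iff aug_faces_iff by simp
  have skin: "M \<in> ?X" if M: "M \<in> ?X2" for M
    using M unfolding skX_iff supp_in_iff aug_faces_iff by simp
  have X: "?X = ?X1 \<union> ?X2"
  proof (intro set_eqI iffI)
    fix M assume M: "M \<in> ?X"
    show "M \<in> ?X1 \<union> ?X2"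
    proof (cases "\<exists>G. Xv G \<in># M")
      case True
      then obtain G where "Xv G \<in># M" ..
      then show ?thesis by (intro UnI1 inX1[OF M])
    next
      case False
      then show ?thesis using noX[OF M] by simp
    qed
  next
    fix M assume "M \<in> ?X1 \<union> ?X2"
    then show "M \<in> ?X" using subsetD[OF sub] skin by (elim UnE)
  qed
  have dis: "?X1 \<inter> ?X2 = {}"
  proof (rule Int_emptyI)
    fix M assume M: "M \<in> ?X1" "M \<in> ?X2"
    obtain F where "M \<in> aug_piece W r F" using M(1) by (rule UN_E) (rule that)
    then show False using M(2) by (simp add: aug_piece_def skX_iff)
  qed
  have up: "add_mset u M \<in> ?X1" if M: "M \<in> ?X1" "add_mset u M \<in> ?X" for M u
  proof -
    obtain F where "M \<in> aug_piece W r F" using M(1) by (rule UN_E) (rule that)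
    then have "Xv F \<in># add_mset u M" by (simp add: aug_piece_def)
    then show ?thesis by (rule inX1[OF M(2)])
  qed
  have h1: "hom_basis ct ?X1 W ?I1 (aug_el W)"
  proof (rule hom_basis_pieces[where rank = card, OF finFF fin okX_upward[OF ok sub up] refl])
    fix F G assume FG: "F \<in> FF W r" "G \<in> FF W r"
    show "aug_piece W r F \<inter> aug_piece W r G = {}" if "F \<noteq> G"
    proof -
      have "F \<subseteq> G \<and> G \<subseteq> F" if "M \<in> aug_piece W r F" "M \<in> aug_piece W r G" for M
        using that by (simp add: aug_piece_def)
      then show ?thesis using that by blast
    qed
    show "F = G \<or> card G < card F" if M: "M \<in> aug_piece W r F" "add_mset u M \<in> aug_piece W r G" for M u
    proof -
      have "G \<subseteq> F" using M by (simp add: aug_piece_def)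
      moreover have "finite F" using FG(1) fin by (auto simp: FF_def intro: finite_subset)
      ultimately show ?thesis using psubset_card_mono by blast
    qed
  next
    fix F and i :: "(nat set list \<times> nat set) + (nat set \<times> nat set)" assume F: "F \<in> FF W r"
    show "hom_basis ct (aug_piece W r F) W (Inl ` BI W (r - 1) F) (aug_el W)" by (rule hom_basis_aug_piece[OF fin r F])
    assume "i \<in> Inl ` BI W (r - 1) F"
    then obtain j where "i = Inl j" "j \<in> BI W (r - 1) F" by blast
    then show "dk ct ?X1 W (aug_el W i) = 0"
      using dk_restrict_zero[OF sub bel_cycle[OF fin F]] by (simp add: aug_el_def)
  qed
  have h2: "hom_basis ct ?X2 W ?I2 (aug_el W)"
  proof (rule hom_basis_image[where s' = sk_el])
    show "hom_basis ct ?X2 W (SK W r) sk_el"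
    proof (rule hom_basis_cong_forms[OF hom_basis_skeleton[OF fin] fin])
      fix j u M assume a: "u \<in># M" "M \<in> skX W r"
      then obtain i where "u = Yv i" unfolding skX_iff by (cases u) auto
      then show "cy j u = ct j u" by simp
    qed
  qed (simp add: aug_el_def)
  have "hom_basis ct ?X W (?I1 \<union> ?I2) (aug_el W)"
  proof (rule hom_basis_extend[where T = "{}" and \<rho> = id, OF fin ok X dis up])
    show "hom_basis ct ?X1 W (?I1 \<union> id ` {}) (aug_el W)" using h1 by (simp only: image_empty Un_empty_right)
    show "hom_basis ct ?X2 W (?I2 \<union> {}) (aug_el W)" using h2 by (simp only: Un_empty_right)
    show "dk ct ?X W (aug_el W i) = 0" if "i \<in> ?I2" for i
      using that sk_el_cycle[OF fin] by (auto simp: aug_el_def)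
  qed auto
  moreover have "?I1 \<union> ?I2 = aug_index W r" by (auto simp: aug_index_def)
  ultimately show ?thesis by simp
qed

section \<open>Comparison with the Koszul complex of a fan\<close>

lemma lookup_single_mult:
  fixes k m :: "'a :: cancel_comm_monoid_add" and p :: "'a \<Rightarrow>\<^sub>0 'b :: comm_semiring_0"
  shows "Poly_Mapping.lookup (Poly_Mapping.single k a * p) (k + m) = a * Poly_Mapping.lookup p m"
proof -
  have "Poly_Mapping.lookup (Poly_Mapping.single k a * p) (k + m)
      = (\<Sum>l. (a * (\<Sum>q. Poly_Mapping.lookup p q when k + m = l + q)) when k = l)"
    by (simp add: lookup_mult lookup_single when_mult)
  also have "\<dots> = a * (\<Sum>q. Poly_Mapping.lookup p q when m = q)" by simp
  finally show ?thesis by simp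
qed

lemma lookup_single_mult_zero:
  fixes k m :: "'a :: comm_monoid_add" and p :: "'a \<Rightarrow>\<^sub>0 'b :: comm_semiring_0"
  assumes "\<And>q. m \<noteq> k + q"
  shows "Poly_Mapping.lookup (Poly_Mapping.single k a * p) m = 0"
proof -
  have "Poly_Mapping.lookup (Poly_Mapping.single k a * p) m
      = (\<Sum>l. (a * (\<Sum>q. Poly_Mapping.lookup p q when m = l + q)) when k = l)"
    by (simp add: lookup_mult lookup_single when_mult)
  also have "\<dots> = a * (\<Sum>q. Poly_Mapping.lookup p q when m = k + q)" by simp
  finally show ?thesis using assms by simp
qed

lemma lookup_const_mult:
  fixes p :: "'a :: cancel_comm_monoid_add \<Rightarrow>\<^sub>0 'b :: comm_semiring_0"
  shows "Poly_Mapping.lookup (Poly_Mapping.single 0 a * p) m = a * Poly_Mapping.lookup p m"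
  using lookup_single_mult[of 0 a p m] by simp

lemma lookup_wedge_sign_mult:
  "Poly_Mapping.lookup (wedge_sign A B * p) m = (- 1) ^ card {(a, b). a \<in> A \<and> b \<in> B \<and> b < a} * Poly_Mapping.lookup p m"
  unfolding wedge_sign_def by (cases "even (card {(a, b). a \<in> A \<and> b \<in> B \<and> b < a})") simp_all

lemma wedge_sign_single: "{(a, b). a \<in> {j} \<and> b \<in> B \<and> b < a} = Pair j ` {i \<in> B. i < j}"
  by auto

lemma lookup_wedge_sign_sg: "Poly_Mapping.lookup (wedge_sign {j} B * p) m = sg j B * Poly_Mapping.lookup p m"
  unfolding lookup_wedge_sign_mult wedge_sign_single sg_def by (simp add: card_image inj_on_def)

subsection \<open>Polynomials in a set of variables\<close>

lemma poly_ring_0: "0 \<in> poly_ring R" and poly_ring_1: "1 \<in> poly_ring R"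
  by (simp_all add: poly_ring_def)

lemma poly_ring_add: "p \<in> poly_ring R ==> q \<in> poly_ring R ==> p + q \<in> poly_ring R"
  using Poly_Mapping.keys_add[of p q] unfolding poly_ring_def by blast

lemma poly_ring_uminus: "p \<in> poly_ring R ==> - p \<in> poly_ring R"
  by (simp add: poly_ring_def in_keys_iff)

lemma poly_ring_mult:
  assumes "p \<in> poly_ring R" "q \<in> poly_ring R" shows "p * q \<in> poly_ring R"
  unfolding poly_ring_def
proof (intro CollectI ballI)
  fix m assume "m \<in> Poly_Mapping.keys (p * q)"
  then obtain a b where m: "m = a + b" "a \<in> Poly_Mapping.keys p" "b \<in> Poly_Mapping.keys q"
    using keys_mult[of p q] by blast
  have "Poly_Mapping.keys a \<subseteq> R" "Poly_Mapping.keys b \<subseteq> R" using assms m by (auto simp: poly_ring_def)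
  then show "Poly_Mapping.keys m \<subseteq> R" unfolding m(1) using Poly_Mapping.keys_add[of a b] by blast
qed

lemma poly_ring_sum: "(\<And>i. i \<in> T ==> f i \<in> poly_ring R) ==> sum f T \<in> poly_ring R"
  by (induction T rule: infinite_finite_induct) (auto intro: poly_ring_0 poly_ring_add)

lemma poly_ring_single: "Poly_Mapping.keys m \<subseteq> R ==> Poly_Mapping.single m a \<in> poly_ring R"
  by (simp add: poly_ring_def)

lemma poly_ring_wedge_sign: "wedge_sign A B \<in> poly_ring R"
  unfolding wedge_sign_def
  by (cases "even (card {(a, b). a \<in> A \<and> b \<in> B \<and> b < a})") (simp_all add: poly_ring_1 poly_ring_uminus)

lemma poly_ring_of_int: "of_int k \<in> poly_ring R"
  using poly_ring_single[of 0 R "of_int k"] by simp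

lemma poly_ring_ray_var: "\<rho> \<in> R ==> ray_var \<rho> \<in> poly_ring R"
  unfolding ray_var_def by (rule poly_ring_single) simp

subsection \<open>Monomials as multisets\<close>

definition img :: "('v => 'c) => 'v multiset => ('c \<Rightarrow>\<^sub>0 nat)" where
  "img g M = (\<Sum>v\<in>#M. Poly_Mapping.single (g v) 1)"

lemma img_empty [simp]: "img g {#} = 0" and img_add: "img g (add_mset v M) = Poly_Mapping.single (g v) 1 + img g M"
  by (simp_all add: img_def)

lemma lookup_img: "Poly_Mapping.lookup (img g M) k = size (filter_mset (\<lambda>v. g v = k) M)"
  by (induction M) (simp_all add: img_add lookup_add lookup_single when_def)

lemma keys_img: "Poly_Mapping.keys (img g M) = g ` set_mset M"
proof (intro set_eqI)
  fix k show "k \<in> Poly_Mapping.keys (img g M) \<longleftrightarrow> k \<in> g ` set_mset M"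
    unfolding in_keys_iff lookup_img by (auto simp: filter_mset_eq_conv size_eq_0_iff_empty)
qed

lemma lookup_img_count:
  assumes "inj_on g V" "set_mset M \<subseteq> V" "v \<in> V"
  shows "Poly_Mapping.lookup (img g M) (g v) = count M v"
proof -
  have "filter_mset (\<lambda>x. g x = g v) M = filter_mset (\<lambda>x. x = v) M"
    by (rule filter_mset_cong[OF refl]) (use assms in \<open>auto dest: inj_onD\<close>)
  then show ?thesis by (simp add: lookup_img filter_eq_replicate_mset)
qed

lemma img_inj:
  assumes "inj_on g V" "set_mset M \<subseteq> V" "set_mset M' \<subseteq> V" "img g M = img g M'"
  shows "M = M'"
proof (rule multiset_eqI)
  fix v
  show "count M v = count M' v"
  proof (cases "v \<in> V")
    case True
    then show ?thesis using lookup_img_count[OF assms(1,2)] lookup_img_count[OF assms(1,3)] assms(4) by metis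
  next
    case False
    then show ?thesis using assms(2,3) by (metis count_eq_zero_iff subsetD)
  qed
qed

lemma img_surj:
  assumes "finite V" "inj_on g V" "Poly_Mapping.keys m \<subseteq> g ` V"
  obtains M where "set_mset M \<subseteq> V" "img g M = m"
proof -
  define f where "f v = (if v \<in> V then Poly_Mapping.lookup m (g v) else 0)" for v
  define M where "M = Abs_multiset f"
  have "finite {v. 0 < f v}" by (rule finite_subset[OF _ assms(1)]) (auto simp: f_def split: if_splits)
  then have c: "count M v = f v" for v by (simp add: M_def)
  have MV: "set_mset M \<subseteq> V"
  proof
    fix v assume "v \<in># M"
    then have "f v \<noteq> 0" using c[of v] by (metis count_eq_zero_iff)
    then show "v \<in> V" by (simp add: f_def split: if_splits)
  qed
  have "img g M = m"
  proof (rule poly_mapping_eqI)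
    fix k
    show "Poly_Mapping.lookup (img g M) k = Poly_Mapping.lookup m k"
    proof (cases "k \<in> g ` V")
      case True
      then obtain v where v: "v \<in> V" "k = g v" by blast
      then show ?thesis using lookup_img_count[OF assms(2) MV v(1)] c[of v] by (simp add: f_def)
    next
      case False
      then have "k \<notin> Poly_Mapping.keys m" "k \<notin> Poly_Mapping.keys (img g M)"
        using assms(3) MV keys_img[of g M] by auto
      then show ?thesis by (simp add: in_keys_iff)
    qed
  qed
  then show thesis using that MV by blast
qed

subsection \<open>The transfer\<close>

text \<open>
  The rays of \<open>\<Sigma>\<close> are labelled by \<open>V\<close>, with \<open>\<S>\<close>
  for the label sets of its cones and \<open>c j v\<close> for the coordinates of the primitive
  generators.
\<close>

locale fan_transfer =
  fixes n :: nat and \<Sigma> :: "(nat => real) set set" and V :: "'v set" and g :: "'v => (nat => real) set"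
    and \<S> :: "'v set set" and c :: "nat => 'v => rat"
  assumes finV: "finite V" and inj: "inj_on g V" and rays: "fan_rays n \<Sigma> = g ` V"
    and gen: "\<And>v j. v \<in> V ==> j \<in> {1..n} ==> c j v = of_int (prim_gen n (g v) j)"
    and faces: "\<And>S. S \<in> \<S> \<longleftrightarrow> S \<subseteq> V \<and> cone_hull (\<Union>(g ` S)) \<in> \<Sigma>"
    and down: "\<And>S T. S \<in> \<S> ==> T \<subseteq> S ==> T \<in> \<S>"
begin

abbreviation "R \<equiv> fan_rays n \<Sigma>"
abbreviation "X \<equiv> supp_in \<S>"
abbreviation "L \<equiv> koszul_lift n \<Sigma>"

text \<open>
  The class modulo the Stanley--Reisner ideal is determined by the coefficients of the monomials
  supported on cones.
\<close>

definition Psi :: "koszul => 'v kos" where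
  "Psi \<nu> J M = (if M \<in> X then Poly_Mapping.lookup (\<nu> J) (img g M) else 0)"

lemma X_V: "M \<in> X ==> set_mset M \<subseteq> V" using faces by auto

lemma img_eq_iff: "M \<in> X ==> M' \<in> X ==> img g M = img g M' \<longleftrightarrow> M = M'"
  using img_inj[OF inj X_V X_V] by blast

lemma sr_ideal_zero:
  assumes "p \<in> sr_ideal n \<Sigma>" "M \<in> X" shows "Poly_Mapping.lookup p (img g M) = 0"
proof -
  obtain G q where p: "p = (\<Sum>g\<in>G. q g * g)" "G \<subseteq> sr_gens n \<Sigma>" using assms(1) by (auto simp: sr_ideal_def)
  have "Poly_Mapping.lookup (q h * h) (img g M) = 0" if hG: "h \<in> G" for h
  proof (rule ccontr)
    assume nz: "Poly_Mapping.lookup (q h * h) (img g M) \<noteq> 0"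
    obtain A where A: "h = (\<Prod>\<rho>\<in>A. ray_var \<rho>)" "finite A" "A \<subseteq> R" "cone_hull (\<Union>A) \<notin> \<Sigma>"
      using subsetD[OF p(2) hG] by (auto simp: sr_gens_def)
    have h: "h = Poly_Mapping.single (\<Sum>\<rho>\<in>A. Poly_Mapping.single \<rho> 1) 1"
      unfolding A(1) using A(2) by (induction A) (simp_all add: ray_var_def mult_single)
    obtain m where m: "img g M = (\<Sum>\<rho>\<in>A. Poly_Mapping.single \<rho> 1) + m"
      using nz lookup_single_mult_zero[of "img g M" "\<Sum>\<rho>\<in>A. Poly_Mapping.single \<rho> 1" 1 "q h"]
      unfolding h by (auto simp: mult.commute)
    have "A \<subseteq> Poly_Mapping.keys (img g M)"
    proof
      fix \<rho> assume "\<rho> \<in> A"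
      then have "Poly_Mapping.lookup (\<Sum>\<rho>\<in>A. Poly_Mapping.single \<rho> (1::nat)) \<rho> = 1"
        using A(2) by (simp add: lookup_sum lookup_single when_def)
      then show "\<rho> \<in> Poly_Mapping.keys (img g M)" unfolding m by (simp add: in_keys_iff lookup_add)
    qed
    then have "A \<subseteq> g ` set_mset M" by (simp add: keys_img)
    then obtain S where S: "S \<subseteq> set_mset M" "A = g ` S" by (meson subset_imageE)
    have "S \<in> \<S>" using down[OF _ S(1)] assms(2) by simp
    then show False using A(4) S(2) faces by simp
  qed
  then show ?thesis by (simp add: p(1) lookup_sum)
qed

text \<open>
  Grouping the terms of \<open>p\<close> by their supports writes \<open>p\<close> as a
  combination of squarefree generators.
\<close>

lemma sr_ideal_iff:
  assumes p: "p \<in> poly_ring R"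
  shows "p \<in> sr_ideal n \<Sigma> \<longleftrightarrow> (\<forall>M\<in>X. Poly_Mapping.lookup p (img g M) = 0)"
proof
  assume z: "\<forall>M\<in>X. Poly_Mapping.lookup p (img g M) = 0"
  define e where "e A = (\<Sum>\<rho>\<in>A. Poly_Mapping.single \<rho> (1::nat))" for A :: "(nat => real) set set"
  define h where "h m = (\<Prod>\<rho>\<in>Poly_Mapping.keys m. ray_var \<rho>)" for m :: "(nat => real) set \<Rightarrow>\<^sub>0 nat"
  let ?K = "Poly_Mapping.keys p"
  define q where "q w = (\<Sum>m | m \<in> ?K \<and> h m = w. Poly_Mapping.single (m - e (Poly_Mapping.keys m)) (Poly_Mapping.lookup p m))" for w
  have hs: "h m = Poly_Mapping.single (e (Poly_Mapping.keys m)) 1" for m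
  proof -
    have "(\<Prod>\<rho>\<in>A. ray_var \<rho>) = Poly_Mapping.single (e A) 1" if "finite A" for A
      using that unfolding e_def by (induction A) (simp_all add: ray_var_def mult_single)
    then show ?thesis by (simp add: h_def)
  qed
  have em: "m - e (Poly_Mapping.keys m) + e (Poly_Mapping.keys m) = m" for m :: "(nat => real) set \<Rightarrow>\<^sub>0 nat"
  proof (rule poly_mapping_eqI)
    fix k
    have "Poly_Mapping.lookup (e (Poly_Mapping.keys m)) k = (if k \<in> Poly_Mapping.keys m then 1 else 0)"
      by (simp add: e_def lookup_sum lookup_single when_def)
    then show "Poly_Mapping.lookup (m - e (Poly_Mapping.keys m) + e (Poly_Mapping.keys m)) k = Poly_Mapping.lookup m k"
      by (auto simp: lookup_add lookup_minus in_keys_iff)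
  qed
  have R: "Poly_Mapping.keys m \<subseteq> R" if "m \<in> ?K" for m using p that by (auto simp: poly_ring_def)
  have gens: "h ` ?K \<subseteq> sr_gens n \<Sigma>"
  proof
    fix w assume "w \<in> h ` ?K"
    then obtain m where m: "m \<in> ?K" "w = h m" by blast
    obtain M where M: "set_mset M \<subseteq> V" "img g M = m" using img_surj[OF finV inj, of m] R[OF m(1)] rays by metis
    have "M \<notin> X" using z M(2) m(1) by (auto simp: in_keys_iff)
    then have "cone_hull (\<Union>(g ` set_mset M)) \<notin> \<Sigma>" using faces[of "set_mset M"] M(1) by simp
    then have "cone_hull (\<Union>(Poly_Mapping.keys m)) \<notin> \<Sigma>" using keys_img[of g M] M(2) by simp
    then show "w \<in> sr_gens n \<Sigma>" unfolding m(2) h_def sr_gens_def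
      using R[OF m(1)] by (intro CollectI exI[of _ "Poly_Mapping.keys m"]) simp
  qed
  have "p = (\<Sum>m\<in>?K. Poly_Mapping.single m (Poly_Mapping.lookup p m))"
  proof (rule poly_mapping_eqI)
    fix k show "Poly_Mapping.lookup p k = Poly_Mapping.lookup (\<Sum>m\<in>?K. Poly_Mapping.single m (Poly_Mapping.lookup p m)) k"
      by (simp add: lookup_sum lookup_single when_def in_keys_iff)
  qed
  also have "\<dots> = (\<Sum>w\<in>h ` ?K. \<Sum>m | m \<in> ?K \<and> h m = w. Poly_Mapping.single m (Poly_Mapping.lookup p m))"
    by (rule sum.image_gen) simp
  also have "\<dots> = (\<Sum>w\<in>h ` ?K. q w * w)"
  proof (rule sum.cong[OF refl])
    fix w
    have "Poly_Mapping.single m (Poly_Mapping.lookup p m)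
        = Poly_Mapping.single (m - e (Poly_Mapping.keys m)) (Poly_Mapping.lookup p m) * w" if "h m = w" for m
      unfolding that[symmetric] hs mult_single em by simp
    then show "(\<Sum>m | m \<in> ?K \<and> h m = w. Poly_Mapping.single m (Poly_Mapping.lookup p m)) = q w * w"
      unfolding q_def sum_distrib_right by (intro sum.cong) auto
  qed
  finally have pe: "p = (\<Sum>w\<in>h ` ?K. q w * w)" .
  have "q w \<in> poly_ring R" for w unfolding q_def
  proof (intro poly_ring_sum poly_ring_single)
    fix m assume "m \<in> {m \<in> ?K. h m = w}"
    then have "Poly_Mapping.keys m \<subseteq> R" using R by simp
    moreover have "Poly_Mapping.keys (m - e (Poly_Mapping.keys m)) \<subseteq> Poly_Mapping.keys m"
      by (auto simp: in_keys_iff lookup_minus)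
    ultimately show "Poly_Mapping.keys (m - e (Poly_Mapping.keys m)) \<subseteq> R" by blast
  qed
  then show "p \<in> sr_ideal n \<Sigma>" unfolding sr_ideal_def
    using gens pe by (intro CollectI exI[of _ "h ` ?K"] exI[of _ q]) simp
qed (use sr_ideal_zero in blast)

lemma lift_null_iff: "\<nu> \<in> L ==> \<nu> \<in> koszul_null n \<Sigma> \<longleftrightarrow> Psi \<nu> = 0"
proof -
  assume k: "\<nu> \<in> L"
  then have "\<nu> J \<in> sr_ideal n \<Sigma> \<longleftrightarrow> (\<forall>M\<in>X. Poly_Mapping.lookup (\<nu> J) (img g M) = 0)" for J
    by (intro sr_ideal_iff) (simp add: koszul_lift_def)
  then show ?thesis using k by (auto simp: koszul_null_def Psi_def fun_eq_iff)
qed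

lemma Psi_kz: "\<nu> \<in> L ==> Psi \<nu> \<in> kz X {1..n}"
proof -
  assume k: "\<nu> \<in> L"
  let ?A = "\<lambda>J. {M \<in> X. img g M \<in> Poly_Mapping.keys (\<nu> J)}"
  have fA: "finite (?A J)" for J
  proof (rule finite_imageD)
    show "finite (img g ` ?A J)" by (rule finite_subset[of _ "Poly_Mapping.keys (\<nu> J)"]) auto
    show "inj_on (img g) (?A J)" by (rule inj_onI) (use img_eq_iff in auto)
  qed
  have J: "J \<subseteq> {1..n}" if "Psi \<nu> J M \<noteq> 0" for J M
  proof (rule ccontr)
    assume "\<not> J \<subseteq> {1..n}"
    then have "\<nu> J = 0" using k by (simp add: koszul_lift_def)
    then show False using that by (simp add: Psi_def split: if_splits)
  qed
  show ?thesis
  proof (rule kzI)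
    show "finite (SIGMA J:Pow {1..n}. ?A J)" by (rule finite_SigmaI) (simp, rule fA)
    fix J M assume nz: "Psi \<nu> J M \<noteq> 0"
    then have "M \<in> X" "Poly_Mapping.lookup (\<nu> J) (img g M) \<noteq> 0" by (auto simp: Psi_def split: if_splits)
    then show "(J, M) \<in> (SIGMA J:Pow {1..n}. ?A J) \<and> J \<subseteq> {1..n} \<and> M \<in> X"
      using J[OF nz] by (simp add: in_keys_iff)
  qed
qed

lemma Psi_surj: assumes "k \<in> kz X {1..n}" obtains \<nu> where "\<nu> \<in> L" "Psi \<nu> = k"
proof -
  define \<nu> where "\<nu> J = (\<Sum>M | k J M \<noteq> 0. Poly_Mapping.single (img g M) (k J M))" for J
  have fin: "finite {M. k J M \<noteq> 0}" for J
    by (rule finite_subset[of _ "snd ` {(J, M). k J M \<noteq> 0}"]) (use kzD(3)[OF assms] in \<open>force+\<close>)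
  have "\<nu> \<in> L" unfolding koszul_lift_def
  proof (intro CollectI conjI allI impI)
    fix J
    show "\<nu> J \<in> poly_ring R" unfolding \<nu>_def
    proof (intro poly_ring_sum poly_ring_single)
      fix M assume "M \<in> {M. k J M \<noteq> 0}"
      then have "set_mset M \<subseteq> V" using kzD(2)[OF assms] X_V by blast
      then show "Poly_Mapping.keys (img g M) \<subseteq> R" unfolding keys_img rays by (rule image_mono)
    qed
    assume "\<not> J \<subseteq> {1..n}"
    then have "{M. k J M \<noteq> 0} = {}" using kzD(1)[OF assms] by blast
    then show "\<nu> J = 0" unfolding \<nu>_def by (simp only: sum.empty)
  qed
  moreover have "Psi \<nu> = k"
  proof (intro ext)
    fix J M
    show "Psi \<nu> J M = k J M"
    proof (cases "M \<in> X")
      case True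
      have "Psi \<nu> J M = (\<Sum>M' | k J M' \<noteq> 0. if M' = M then k J M else 0)"
        unfolding Psi_def \<nu>_def lookup_sum using True
        by (simp add: lookup_single when_def) (intro sum.cong refl, use kzD(2)[OF assms] img_eq_iff in auto)
      then show ?thesis using fin[of J] by simp
    next
      case False then show ?thesis using kzD(2)[OF assms] by (auto simp: Psi_def)
    qed
  qed
  ultimately show thesis by (rule that)
qed

lemma lookup_theta_mult:
  assumes j: "j \<in> {1..n}" and M: "M \<in> X"
  shows "Poly_Mapping.lookup (koszul_theta n \<Sigma> j * p) (img g M) =
    (\<Sum>v\<in>set_mset M. c j v * Poly_Mapping.lookup p (img g (M - {#v#})))"
proof -
  note MV = X_V[OF M]
  have t: "koszul_theta n \<Sigma> j = (\<Sum>v\<in>V. of_int (prim_gen n (g v) j) * ray_var (g v))"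
    unfolding koszul_theta_def rays by (simp add: sum.reindex[OF inj])
  have v: "Poly_Mapping.lookup (of_int (prim_gen n (g v) j) * ray_var (g v) * p) (img g M)
      = (if v \<in># M then c j v * Poly_Mapping.lookup p (img g (M - {#v#})) else 0)" if v: "v \<in> V" for v
  proof -
    have "of_int (prim_gen n (g v) j) = (Poly_Mapping.single 0 (c j v) :: ray_poly)"
      by (simp add: gen[OF v j])
    then have e: "Poly_Mapping.lookup (of_int (prim_gen n (g v) j) * ray_var (g v) * p) (img g M)
        = c j v * Poly_Mapping.lookup (ray_var (g v) * p) (img g M)"
      by (simp only: mult.assoc lookup_const_mult)
    show ?thesis
    proof (cases "v \<in># M")
      case True
      have "img g M = Poly_Mapping.single (g v) 1 + img g (M - {#v#})"
        using img_add[of g v "M - {#v#}"] True by simp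
      then have "Poly_Mapping.lookup (ray_var (g v) * p) (img g M) = Poly_Mapping.lookup p (img g (M - {#v#}))"
        unfolding ray_var_def by (simp only: lookup_single_mult mult_1_left)
      then show ?thesis using True by (simp only: e if_True)
    next
      case False
      have "img g M \<noteq> Poly_Mapping.single (g v) 1 + q" for q
      proof
        assume a: "img g M = Poly_Mapping.single (g v) 1 + q"
        have "Poly_Mapping.lookup (img g M) (g v) \<noteq> 0" unfolding a by (simp add: lookup_add)
        then show False using lookup_img_count[OF inj MV v] False by (simp add: count_eq_zero_iff)
      qed
      then have "Poly_Mapping.lookup (ray_var (g v) * p) (img g M) = 0"
        unfolding ray_var_def by (rule lookup_single_mult_zero)
      then show ?thesis using False by (simp only: e if_False mult_zero_right)
    qed
  qed
  have "Poly_Mapping.lookup (koszul_theta n \<Sigma> j * p) (img g M)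
      = (\<Sum>v\<in>V. if v \<in># M then c j v * Poly_Mapping.lookup p (img g (M - {#v#})) else 0)"
    unfolding t sum_distrib_right lookup_sum by (rule sum.cong[OF refl v])
  also have "\<dots> = (\<Sum>v\<in>set_mset M. c j v * Poly_Mapping.lookup p (img g (M - {#v#})))"
    using finV MV by (intro sum.mono_neutral_cong_right) auto
  finally show ?thesis .
qed

lemma Psi_d: "Psi (koszul_d n \<Sigma> \<nu>) = dk c X {1..n} (Psi \<nu>)"
proof (intro ext)
  fix J M
  show "Psi (koszul_d n \<Sigma> \<nu>) J M = dk c X {1..n} (Psi \<nu>) J M"
  proof (cases "M \<in> X")
    case False then show ?thesis by (simp add: Psi_def dk_apply)
  next
    case True
    have sub: "M - {#v#} \<in> X" for v
    proof -
      have "set_mset (M - {#v#}) \<subseteq> set_mset M" by (auto dest: in_diffD)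
      then show ?thesis using down True by auto
    qed
    have "Psi (koszul_d n \<Sigma> \<nu>) J M = (\<Sum>j\<in>{1..n} - J. Poly_Mapping.lookup
        (wedge_sign {j} J * (koszul_theta n \<Sigma> j * \<nu> (insert j J))) (img g M))"
      using True by (simp add: Psi_def koszul_d_def lookup_sum)
    also have "\<dots> = (\<Sum>j\<in>{1..n} - J. sg j J * (\<Sum>v\<in>set_mset M. c j v * Psi \<nu> (insert j J) (M - {#v#})))"
    proof (rule sum.cong[OF refl])
      fix j assume "j \<in> {1..n} - J"
      then have j: "j \<in> {1..n}" by simp
      show "Poly_Mapping.lookup (wedge_sign {j} J * (koszul_theta n \<Sigma> j * \<nu> (insert j J))) (img g M)
          = sg j J * (\<Sum>v\<in>set_mset M. c j v * Psi \<nu> (insert j J) (M - {#v#}))"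
        unfolding lookup_wedge_sign_sg lookup_theta_mult[OF j True] by (simp only: Psi_def sub if_True)
    qed
    also have "\<dots> = dk c X {1..n} (Psi \<nu>) J M" using True by (simp only: dk_apply[OF finite_atLeastAtMost] if_True)
    finally show ?thesis .
  qed
qed

lemma koszul_d_lift: assumes "\<nu> \<in> L" shows "koszul_d n \<Sigma> \<nu> \<in> L"
  unfolding koszul_lift_def
proof (intro CollectI conjI allI impI)
  have t: "koszul_theta n \<Sigma> j \<in> poly_ring R" for j
    unfolding koszul_theta_def by (intro poly_ring_sum poly_ring_mult poly_ring_of_int poly_ring_ray_var)
  fix J
  show "koszul_d n \<Sigma> \<nu> J \<in> poly_ring R" unfolding koszul_d_def
    by (intro poly_ring_sum poly_ring_mult poly_ring_wedge_sign t) (use assms in \<open>simp add: koszul_lift_def\<close>)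
  assume "\<not> J \<subseteq> {1..n}"
  then have "\<nu> (insert j J) = 0" for j using assms by (simp add: koszul_lift_def)
  then show "koszul_d n \<Sigma> \<nu> J = 0" by (simp add: koszul_d_def)
qed

lemma lift_diff: "\<nu> \<in> L ==> \<eta> \<in> L ==> (\<lambda>J. \<nu> J - \<eta> J) \<in> L"
  using poly_ring_add[OF _ poly_ring_uminus] by (force simp: koszul_lift_def)

lemma Psi_diff: "Psi (\<lambda>J. \<nu> J - \<eta> J) = Psi \<nu> - Psi \<eta>"
  by (intro ext) (simp add: Psi_def lookup_minus)

lemma cycles_iff: "\<nu> \<in> koszul_cycles n \<Sigma> \<longleftrightarrow> \<nu> \<in> L \<and> dk c X {1..n} (Psi \<nu>) = 0"
  unfolding koszul_cycles_def using lift_null_iff[OF koszul_d_lift] Psi_d by auto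

lemma boundaries_iff:
  "\<nu> \<in> koszul_boundaries n \<Sigma> \<longleftrightarrow> \<nu> \<in> L \<and> (\<exists>\<eta>\<in>kz X {1..n}. Psi \<nu> = dk c X {1..n} \<eta>)"
proof -
  have e: "(\<lambda>J. \<nu> J - koszul_d n \<Sigma> \<eta> J) \<in> koszul_null n \<Sigma> \<longleftrightarrow> Psi \<nu> = dk c X {1..n} (Psi \<eta>)"
    if "\<nu> \<in> L" "\<eta> \<in> L" for \<eta>
    unfolding lift_null_iff[OF lift_diff[OF that(1) koszul_d_lift[OF that(2)]]] Psi_diff Psi_d by simp
  show ?thesis
  proof
    assume "\<nu> \<in> koszul_boundaries n \<Sigma>"
    then obtain \<eta> where "\<nu> \<in> L" "\<eta> \<in> L" "(\<lambda>J. \<nu> J - koszul_d n \<Sigma> \<eta> J) \<in> koszul_null n \<Sigma>"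
      by (auto simp: koszul_boundaries_def)
    then show "\<nu> \<in> L \<and> (\<exists>\<eta>\<in>kz X {1..n}. Psi \<nu> = dk c X {1..n} \<eta>)" using e Psi_kz by blast
  next
    assume a: "\<nu> \<in> L \<and> (\<exists>\<eta>\<in>kz X {1..n}. Psi \<nu> = dk c X {1..n} \<eta>)"
    then obtain k where k: "k \<in> kz X {1..n}" "Psi \<nu> = dk c X {1..n} k" by blast
    obtain \<eta> where "\<eta> \<in> L" "Psi \<eta> = k" using Psi_surj[OF k(1)] by blast
    then show "\<nu> \<in> koszul_boundaries n \<Sigma>" using a e k(2) by (auto simp: koszul_boundaries_def)
  qed
qed

lemma lin_comb_lift: "(\<And>\<nu>. \<nu> \<in> T ==> \<nu> \<in> L) ==> lin_comb T a \<in> L"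
  unfolding koszul_lift_def lin_comb_def
proof (intro CollectI conjI allI impI)
  assume T: "\<And>\<nu>. \<nu> \<in> T ==> \<nu> \<in> {\<nu>. (\<forall>J. \<nu> J \<in> poly_ring R) \<and> (\<forall>J. \<not> J \<subseteq> {1..n} --> \<nu> J = 0)}"
  fix J
  show "(\<Sum>\<nu>\<in>T. const_poly (a \<nu>) * \<nu> J) \<in> poly_ring R"
    unfolding const_poly_def by (intro poly_ring_sum poly_ring_mult poly_ring_single) (use T in auto)
  assume "\<not> J \<subseteq> {1..n}"
  then have z: "\<nu> J = 0" if "\<nu> \<in> T" for \<nu> using T[OF that] by simp
  show "(\<Sum>\<nu>\<in>T. const_poly (a \<nu>) * \<nu> J) = 0" by (intro sum.neutral ballI) (simp add: z)
qed

lemma Psi_lin_comb: "Psi (lin_comb T a) = (\<Sum>\<nu>\<in>T. smul (a \<nu>) (Psi \<nu>))"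
  by (intro ext) (simp add: Psi_def lin_comb_def sum_kos_apply smul_apply lookup_sum const_poly_def lookup_const_mult)

text \<open>
  \<open>Psi\<close> induces an isomorphism of the complex of the fan with the model: it is
  onto, commutes with the differentials, and its kernel consists of the representatives of zero.
\<close>

theorem homology_basis_transfer:
  assumes h: "hom_basis c X {1..n} I s" and \<sigma>: "\<And>i. i \<in> I ==> \<sigma> i \<in> L" "\<And>i. i \<in> I ==> Psi (\<sigma> i) = s i"
  shows "homology_basis n \<Sigma> (\<sigma> ` I)" "inj_on \<sigma> I"
proof -
  let ?d = "dk c X {1..n}" and ?K = "kz X {1..n}"
  show injs: "inj_on \<sigma> I"
  proof (rule inj_onI)
    fix i j assume ij: "i \<in> I" "j \<in> I" "\<sigma> i = \<sigma> j"
    show "i = j" by (rule kv.hbasis_inj[OF h lin_dk kz_subspace ij(1,2)]) (metis ij \<sigma>(2))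
  qed
  have lcc: "Psi (lin_comb (\<sigma> ` A) a) = kv.lc s (\<lambda>i. if i \<in> A then a (\<sigma> i) else 0)" if A: "A \<subseteq> I" "finite A" for A a
  proof -
    have "Psi (lin_comb (\<sigma> ` A) a) = (\<Sum>i\<in>A. smul (a (\<sigma> i)) (Psi (\<sigma> i)))"
      unfolding Psi_lin_comb using inj_on_subset[OF injs A(1)] by (simp add: sum.reindex)
    also have "\<dots> = (\<Sum>i\<in>A. smul (if i \<in> A then a (\<sigma> i) else 0) (s i))"
      by (rule sum.cong[OF refl]) (use A(1) \<sigma>(2) in auto)
    also have "\<dots> = kv.lc s (\<lambda>i. if i \<in> A then a (\<sigma> i) else 0)"
      by (rule kv.lc_superset[OF A(2), symmetric]) auto
    finally show ?thesis .
  qed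
  show "homology_basis n \<Sigma> (\<sigma> ` I)"
    unfolding homology_basis_def
  proof (intro conjI allI impI ballI)
    show "\<sigma> ` I \<subseteq> koszul_cycles n \<Sigma>" using cycles_iff \<sigma> kv.hbasisD(2)[OF h] by auto
  next
    fix T a \<nu> assume T: "finite T \<and> T \<subseteq> \<sigma> ` I \<and> lin_comb T a \<in> koszul_boundaries n \<Sigma>" and \<nu>: "\<nu> \<in> T"
    then obtain A where A: "A \<subseteq> I" "finite A" "T = \<sigma> ` A" by (meson finite_subset_image)
    obtain \<eta> where \<eta>: "\<eta> \<in> ?K" "Psi (lin_comb T a) = ?d \<eta>" using T boundaries_iff by blast
    obtain i where i: "i \<in> A" "\<nu> = \<sigma> i" using \<nu> A(3) by blast
    have "(\<lambda>i. if i \<in> A then a (\<sigma> i) else 0) \<in> coefs I" using A by (auto simp: coefs_def)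
    from kv.hbasisD(3)[OF h this \<eta>(1), of i] show "a \<nu> = 0"
      using lcc[OF A(1,2), of a] \<eta>(2) i A(3) by simp
  next
    fix z assume "z \<in> koszul_cycles n \<Sigma>"
    then have z: "z \<in> L" "?d (Psi z) = 0" using cycles_iff by auto
    obtain e \<eta> where e: "e \<in> coefs I" "\<eta> \<in> ?K" "Psi z = ?d \<eta> + kv.lc s e"
      using kv.hbasisD(4)[OF h Psi_kz[OF z(1)] z(2)] by blast
    define A where "A = {i. e i \<noteq> 0}"
    have A: "A \<subseteq> I" "finite A" using e(1) by (auto simp: coefs_def A_def)
    define a where "a \<nu> = e (the_inv_into I \<sigma> \<nu>)" for \<nu>
    have "(\<lambda>i. if i \<in> A then a (\<sigma> i) else 0) = e"
    proof
      fix i show "(if i \<in> A then a (\<sigma> i) else 0) = e i"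
        using the_inv_into_f_f[OF injs, of i] A(1) by (auto simp: a_def A_def)
    qed
    then have P: "Psi (lin_comb (\<sigma> ` A) a) = kv.lc s e" using lcc[OF A, of a] by simp
    have l: "lin_comb (\<sigma> ` A) a \<in> L" by (rule lin_comb_lift) (use A(1) \<sigma>(1) in auto)
    have "Psi (\<lambda>J. z J - lin_comb (\<sigma> ` A) a J) = ?d \<eta>" unfolding Psi_diff P e(3) by simp
    then have "(\<lambda>J. z J - lin_comb (\<sigma> ` A) a J) \<in> koszul_boundaries n \<Sigma>"
      unfolding boundaries_iff using lift_diff[OF z(1) l] e(2) by blast
    then show "\<exists>T a. finite T \<and> T \<subseteq> \<sigma> ` I \<and> (\<lambda>J. z J - lin_comb T a J) \<in> koszul_boundaries n \<Sigma>"
      using A by (intro exI[of _ "\<sigma> ` A"] exI[of _ a]) auto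
  qed
qed

subsection \<open>Decomposable elements\<close>

lemma tensor_lift: "p \<in> poly_ring R ==> \<xi> \<in> L ==> tensor p \<xi> \<in> L"
  by (simp add: koszul_lift_def tensor_def poly_ring_mult)

lemma one_lift: "koszul_one \<in> L"
  by (simp add: koszul_lift_def koszul_one_def poly_ring_0 poly_ring_1)

lemma ell_lift: "u \<in> {1..n} ==> ell u \<in> L"
  by (auto simp: koszul_lift_def ell_def poly_ring_0 poly_ring_1)

lemma mult_lift: assumes "\<nu> \<in> L" "\<eta> \<in> L" shows "koszul_mult \<nu> \<eta> \<in> L"
  unfolding koszul_lift_def
proof (intro CollectI conjI allI impI)
  fix J
  show "koszul_mult \<nu> \<eta> J \<in> poly_ring R" unfolding koszul_mult_def
    by (intro poly_ring_sum poly_ring_mult poly_ring_wedge_sign) (use assms in \<open>simp_all add: koszul_lift_def\<close>)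
  assume J: "\<not> J \<subseteq> {1..n}"
  have "\<nu> A * \<eta> (J - A) = 0" for A
  proof (cases "A \<subseteq> {1..n}")
    case True
    then have "\<not> J - A \<subseteq> {1..n}" using J by auto
    then show ?thesis using assms(2) by (simp add: koszul_lift_def)
  next
    case False
    then show ?thesis using assms(1) by (simp add: koszul_lift_def)
  qed
  then show "koszul_mult \<nu> \<eta> J = 0" by (simp add: koszul_mult_def)
qed

lemma wedge_list_lift: "(\<And>m. m \<in> set ms ==> m \<in> L) ==> wedge_list ms \<in> L"
  unfolding wedge_list_def by (induction ms) (auto intro: one_lift mult_lift)

text \<open>
  For infinite \<open>J\<close> the sum that defines the product ranges over an infinite set and
  is zero.
\<close>

lemma koszul_mult_ell:
  "koszul_mult (ell u) \<eta> J = (if u \<in> J \<and> finite J then wedge_sign {u} (J - {u}) * \<eta> (J - {u}) else 0)"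
proof (cases "finite J")
  case True
  have "koszul_mult (ell u) \<eta> J = (\<Sum>A\<in>Pow J. if A = {u} then wedge_sign {u} (J - {u}) * \<eta> (J - {u}) else 0)"
    unfolding koszul_mult_def by (intro sum.cong refl) (simp add: ell_def)
  then show ?thesis using True by (auto simp: sum.delta)
next
  case False
  then show ?thesis by (simp add: koszul_mult_def)
qed

lemma Psi_tensor_ell:
  assumes "\<And>J. infinite J ==> \<eta> J = 0"
  shows "Psi (tensor p (koszul_mult (ell u) \<eta>)) = eps u (Psi (tensor p \<eta>))"
proof (intro ext)
  fix J M
  show "Psi (tensor p (koszul_mult (ell u) \<eta>)) J M = eps u (Psi (tensor p \<eta>)) J M"
  proof (cases "u \<in> J \<and> finite J")
    case True
    have e: "p * (wedge_sign {u} (J - {u}) * \<eta> (J - {u})) = wedge_sign {u} (J - {u}) * (p * \<eta> (J - {u}))"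
      by (rule mult.left_commute)
    then show ?thesis using True
      by (simp add: Psi_def tensor_def koszul_mult_ell eps_def e lookup_wedge_sign_sg)
  next
    case False
    then have "u \<in> J ==> \<eta> (J - {u}) = 0" using assms[of "J - {u}"] by simp
    then show ?thesis using False by (auto simp: Psi_def tensor_def koszul_mult_ell eps_def)
  qed
qed

lemma Psi_tensor_ell_diff:
  assumes "\<And>J. infinite J ==> \<eta> J = 0"
  shows "Psi (tensor p (koszul_mult (\<lambda>J. ell u J - ell w J) \<eta>)) = eps u (Psi (tensor p \<eta>)) - eps w (Psi (tensor p \<eta>))"
proof -
  have "tensor p (koszul_mult (\<lambda>J. ell u J - ell w J) \<eta>)
      = (\<lambda>J. tensor p (koszul_mult (ell u) \<eta>) J - tensor p (koszul_mult (ell w) \<eta>) J)"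
    by (simp add: tensor_def koszul_mult_def sum_subtractf algebra_simps)
  moreover have "Psi (tensor p (koszul_mult (ell x) \<eta>)) = eps x (Psi (tensor p \<eta>))" for x
    by (rule Psi_tensor_ell) (rule assms)
  ultimately show ?thesis by (simp only: Psi_diff)
qed

lemma Psi_tensor_one:
  assumes "\<alpha> \<in> X" shows "Psi (tensor (Poly_Mapping.single (img g \<alpha>) 1) koszul_one) = mon \<alpha>"
proof (intro ext)
  fix J M
  have "img g \<alpha> = img g M \<longleftrightarrow> M = \<alpha>" if "M \<in> X" using img_eq_iff[OF assms that] by blast
  then show "Psi (tensor (Poly_Mapping.single (img g \<alpha>) 1) koszul_one) J M = mon \<alpha> J M"
    using assms by (cases "M \<in> X") (auto simp: Psi_def tensor_def koszul_one_def mon_def lookup_single when_def)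
qed

lemma Psi_tensor_wedge:
  assumes "\<alpha> \<in> X" "finite U"
    and f: "\<And>u \<eta>. u \<in> U ==> (\<And>J. infinite J ==> \<eta> J = 0) ==>
      Psi (tensor (Poly_Mapping.single (img g \<alpha>) 1) (koszul_mult (h u) \<eta>)) = f u (Psi (tensor (Poly_Mapping.single (img g \<alpha>) 1) \<eta>))"
  shows "Psi (tensor (Poly_Mapping.single (img g \<alpha>) 1) (wedge_list (map h (sorted_list_of_set U)))) = wlist f U (mon \<alpha>)"
proof -
  have inf: "wedge_list ms J = 0" if "infinite J" for ms J
  proof (cases ms)
    case Nil then show ?thesis using that by (auto simp: wedge_list_def koszul_one_def)
  next
    case (Cons m ms') then show ?thesis using that by (simp add: wedge_list_def koszul_mult_def)
  qed
  have "Psi (tensor (Poly_Mapping.single (img g \<alpha>) 1) (wedge_list (map h us))) = foldr f us (mon \<alpha>)" if "set us \<subseteq> U" for us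
    using that
  proof (induction us)
    case Nil then show ?case using Psi_tensor_one[OF assms(1)] by (simp add: wedge_list_def)
  next
    case (Cons u us)
    have "wedge_list (map h (u # us)) = koszul_mult (h u) (wedge_list (map h us))" by (simp add: wedge_list_def)
    then show ?case using Cons f[of u "wedge_list (map h us)"] inf by simp
  qed
  then show ?thesis using assms(2) by (simp add: wlist_def)
qed

end

section \<open>The augmented Bergman fan of a uniform matroid\<close>

subsection \<open>Cones\<close>

text \<open>
  Coefficients may be indexed by the labels of the generators even if some generators coincide.
\<close>

lemma cone_hull_image:
  assumes "finite S"
  shows "x \<in> cone_hull (f ` S) \<longleftrightarrow> (\<exists>a. (\<forall>s\<in>S. 0 \<le> a s) \<and> x = (\<lambda>i. \<Sum>s\<in>S. a s * f s i))"
proof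
  assume "x \<in> cone_hull (f ` S)"
  then obtain T c where T: "x = (\<lambda>i. \<Sum>v\<in>T. c v * v i)" "finite T" "T \<subseteq> f ` S" "\<forall>v\<in>T. 0 \<le> c v"
    unfolding cone_hull_def by blast
  obtain S' where S': "S' \<subseteq> S" "inj_on f S'" "T = f ` S'" using T(3) by (metis subset_image_inj)
  define a where "a s = (if s \<in> S' then c (f s) else 0)" for s
  have "x = (\<lambda>i. \<Sum>s\<in>S. a s * f s i)"
  proof
    fix i
    have "x i = (\<Sum>s\<in>S'. c (f s) * f s i)" unfolding T(1) S'(3) by (simp add: sum.reindex[OF S'(2)])
    also have "\<dots> = (\<Sum>s\<in>S. a s * f s i)"
      using assms S'(1) by (intro sum.mono_neutral_cong_left) (auto simp: a_def)
    finally show "x i = (\<Sum>s\<in>S. a s * f s i)" .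
  qed
  moreover have "\<forall>s\<in>S. 0 \<le> a s" using T(4) S'(3) by (auto simp: a_def)
  ultimately show "\<exists>a. (\<forall>s\<in>S. 0 \<le> a s) \<and> x = (\<lambda>i. \<Sum>s\<in>S. a s * f s i)" by blast
next
  assume "\<exists>a. (\<forall>s\<in>S. 0 \<le> a s) \<and> x = (\<lambda>i. \<Sum>s\<in>S. a s * f s i)"
  then obtain a where a: "\<forall>s\<in>S. 0 \<le> a s" "x = (\<lambda>i. \<Sum>s\<in>S. a s * f s i)" by blast
  define c where "c v = (\<Sum>s | s \<in> S \<and> f s = v. a s)" for v
  have "x = (\<lambda>i. \<Sum>v\<in>f ` S. c v * v i)"
  proof
    fix i
    have "x i = (\<Sum>v\<in>f ` S. \<Sum>s | s \<in> S \<and> f s = v. a s * f s i)" unfolding a(2) by (rule sum.image_gen[OF assms])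
    also have "\<dots> = (\<Sum>v\<in>f ` S. c v * v i)" by (intro sum.cong refl) (simp add: c_def sum_distrib_right)
    finally show "x i = (\<Sum>v\<in>f ` S. c v * v i)" .
  qed
  moreover have "\<forall>v\<in>f ` S. 0 \<le> c v" unfolding c_def using a(1) by (auto intro: sum_nonneg)
  ultimately show "x \<in> cone_hull (f ` S)" unfolding cone_hull_def using assms
    by (intro CollectI exI[of _ "f ` S"] exI[of _ c]) simp
qed

lemma cone_hull_single: "x \<in> cone_hull {w} \<longleftrightarrow> (\<exists>a\<ge>0. x = (\<lambda>i. a * w i))"
  using cone_hull_image[of "{w}" x id] by force

lemma cone_hull_empty: "cone_hull {} = {\<lambda>_. 0}"
  using cone_hull_image[of "{}" _ id] by auto

lemma cone_hull_generator: "w \<in> A ==> w \<in> cone_hull A"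
  unfolding cone_hull_def by (intro CollectI exI[of _ "{w}"] exI[of _ "\<lambda>_. 1"]) auto

lemma cone_hull_mono: "A \<subseteq> B ==> cone_hull A \<subseteq> cone_hull B"
  unfolding cone_hull_def by blast

lemma cone_hull_least:
  assumes S: "finite S" and A: "A \<subseteq> cone_hull (f ` S)"
  shows "cone_hull A \<subseteq> cone_hull (f ` S)"
proof
  fix x assume "x \<in> cone_hull A"
  then obtain T c where T: "x = (\<lambda>i. \<Sum>v\<in>T. c v * v i)" "finite T" "T \<subseteq> A" "\<forall>v\<in>T. 0 \<le> c v"
    unfolding cone_hull_def by blast
  have "\<exists>a. (\<forall>s\<in>S. 0 \<le> a s) \<and> v = (\<lambda>i. \<Sum>s\<in>S. a s * f s i)" if "v \<in> T" for v
    using that T(3) A cone_hull_image[OF S, of v f] by blast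
  then obtain a where a: "\<And>v s. v \<in> T ==> s \<in> S ==> 0 \<le> a v s" "\<And>v. v \<in> T ==> v = (\<lambda>i. \<Sum>s\<in>S. a v s * f s i)"
    by metis
  have "x = (\<lambda>i. \<Sum>s\<in>S. (\<Sum>v\<in>T. c v * a v s) * f s i)"
  proof
    fix i
    have "x i = (\<Sum>v\<in>T. c v * (\<Sum>s\<in>S. a v s * f s i))"
      unfolding T(1) by (rule sum.cong[OF refl]) (use a(2) in metis)
    also have "\<dots> = (\<Sum>s\<in>S. (\<Sum>v\<in>T. c v * a v s) * f s i)"
      unfolding sum_distrib_left sum_distrib_right by (subst sum.swap) (simp add: mult.assoc)
    finally show "x i = (\<Sum>s\<in>S. (\<Sum>v\<in>T. c v * a v s) * f s i)" .
  qed
  moreover have "\<forall>s\<in>S. 0 \<le> (\<Sum>v\<in>T. c v * a v s)" using T(4) a(1) by (auto intro!: sum_nonneg)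
  ultimately show "x \<in> cone_hull (f ` S)" unfolding cone_hull_image[OF S] by (intro exI[of _ "\<lambda>s. \<Sum>v\<in>T. c v * a v s"] conjI)
qed

lemma cone_hull_rays:
  assumes "finite S" shows "cone_hull (\<Union>((\<lambda>s. cone_hull {f s}) ` S)) = cone_hull (f ` S)"
proof
  show "cone_hull (\<Union>((\<lambda>s. cone_hull {f s}) ` S)) \<subseteq> cone_hull (f ` S)"
    by (rule cone_hull_least[OF assms]) (use cone_hull_mono[of _ "f ` S"] in blast)
  show "cone_hull (f ` S) \<subseteq> cone_hull (\<Union>((\<lambda>s. cone_hull {f s}) ` S))"
    by (rule cone_hull_mono) (use cone_hull_generator in auto)
qed

lemma minkowski_cone_hull:
  assumes "finite S" "finite T" "S \<inter> T = {}"
  shows "minkowski_sum (cone_hull (f ` S)) (cone_hull (f ` T)) = cone_hull (f ` (S \<union> T))"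
proof (intro set_eqI iffI)
  fix x assume "x \<in> minkowski_sum (cone_hull (f ` S)) (cone_hull (f ` T))"
  then obtain y z where x: "x = (\<lambda>i. y i + z i)" "y \<in> cone_hull (f ` S)" "z \<in> cone_hull (f ` T)"
    by (auto simp: minkowski_sum_def)
  obtain a where a: "\<forall>s\<in>S. 0 \<le> a s" "y = (\<lambda>i. \<Sum>s\<in>S. a s * f s i)" using x(2) unfolding cone_hull_image[OF assms(1)] by blast
  obtain b where b: "\<forall>s\<in>T. 0 \<le> b s" "z = (\<lambda>i. \<Sum>s\<in>T. b s * f s i)" using x(3) unfolding cone_hull_image[OF assms(2)] by blast
  define e where "e s = (if s \<in> S then a s else b s)" for s
  have 1: "(\<Sum>s\<in>S. a s * f s i) = (\<Sum>s\<in>S. e s * f s i)" for i by (rule sum.cong) (auto simp: e_def)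
  have 2: "(\<Sum>s\<in>T. b s * f s i) = (\<Sum>s\<in>T. e s * f s i)" for i by (rule sum.cong) (use assms(3) in \<open>auto simp: e_def\<close>)
  have "x = (\<lambda>i. \<Sum>s\<in>S \<union> T. e s * f s i)"
    unfolding x(1) a(2) b(2) 1 2 by (simp add: sum.union_disjoint[OF assms])
  moreover have "\<forall>s\<in>S \<union> T. 0 \<le> e s" using a(1) b(1) by (auto simp: e_def)
  ultimately show "x \<in> cone_hull (f ` (S \<union> T))" using assms unfolding cone_hull_image[OF finite_UnI[OF assms(1,2)]] by blast
next
  fix x assume "x \<in> cone_hull (f ` (S \<union> T))"
  then obtain a where a: "\<forall>s\<in>S \<union> T. 0 \<le> a s" "x = (\<lambda>i. \<Sum>s\<in>S \<union> T. a s * f s i)"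
    unfolding cone_hull_image[OF finite_UnI[OF assms(1,2)]] by blast
  have "x = (\<lambda>i. (\<Sum>s\<in>S. a s * f s i) + (\<Sum>s\<in>T. a s * f s i))"
    unfolding a(2) by (simp add: sum.union_disjoint[OF assms])
  moreover have "(\<lambda>i. \<Sum>s\<in>S. a s * f s i) \<in> cone_hull (f ` S)"
    unfolding cone_hull_image[OF assms(1)] using a(1) by (intro exI[of _ a]) simp
  moreover have "(\<lambda>i. \<Sum>s\<in>T. a s * f s i) \<in> cone_hull (f ` T)"
    unfolding cone_hull_image[OF assms(2)] using a(1) by (intro exI[of _ a]) simp
  ultimately show "x \<in> minkowski_sum (cone_hull (f ` S)) (cone_hull (f ` T))"
    unfolding minkowski_sum_def
    by (intro CollectI exI[of _ "\<lambda>i. \<Sum>s\<in>S. a s * f s i"] exI[of _ "\<lambda>i. \<Sum>s\<in>T. a s * f s i"] conjI)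
qed

lemma cone_hull_scale:
  assumes "x = (\<lambda>i. a * w i)" "(0::real) < a" shows "cone_hull {x} = cone_hull {w}"
proof (intro set_eqI)
  fix y
  have "(\<exists>b\<ge>0. y = (\<lambda>i. b * x i)) \<longleftrightarrow> (\<exists>b\<ge>0. y = (\<lambda>i. b * w i))"
  proof
    assume "\<exists>b\<ge>0. y = (\<lambda>i. b * x i)"
    then obtain b where "b \<ge> 0" "y = (\<lambda>i. b * x i)" by blast
    then show "\<exists>b\<ge>0. y = (\<lambda>i. b * w i)" using assms by (intro exI[of _ "b * a"]) (simp add: mult.assoc)
  next
    assume "\<exists>b\<ge>0. y = (\<lambda>i. b * w i)"
    then obtain b where "b \<ge> 0" "y = (\<lambda>i. b * w i)" by blast
    then show "\<exists>b\<ge>0. y = (\<lambda>i. b * x i)" using assms by (intro exI[of _ "b / a"]) simp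
  qed
  then show "y \<in> cone_hull {x} \<longleftrightarrow> y \<in> cone_hull {w}" unfolding cone_hull_single .
qed

text \<open>
  A coordinate \<open>\<plusminus>1\<close> forces real multiples of \<open>u\<close> that are
  lattice points to be integral.
\<close>

lemma prim_gen_unit:
  assumes u: "u \<in> int_lattice n" and j: "u j = 1 \<or> u j = - 1"
  shows "prim_gen n (cone_hull {rvec u}) = u"
  unfolding prim_gen_def
proof (rule the_equality)
  let ?M = "\<lambda>u. {\<lambda>i. int k * u i | k. True}"
  have M: "{w \<in> int_lattice n. rvec w \<in> cone_hull {rvec u}} = ?M u"
  proof (intro set_eqI iffI)
    fix w assume "w \<in> {w \<in> int_lattice n. rvec w \<in> cone_hull {rvec u}}"
    then obtain a where a: "a \<ge> 0" "rvec w = (\<lambda>i. a * rvec u i)" unfolding mem_Collect_eq cone_hull_single by blast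
    have e: "real_of_int (w i) = a * real_of_int (u i)" for i using fun_cong[OF a(2), of i] by (simp add: rvec_def)
    have "a = real_of_int (w j * u j)" using e[of j] j by auto
    moreover have "0 \<le> w j * u j" using a(1) calculation by (metis of_int_0_le_iff)
    ultimately have "a = real (nat (w j * u j))" by (metis of_nat_nat)
    then have "real_of_int (w i) = real_of_int (int (nat (w j * u j)) * u i)" for i using e[of i] by simp
    then have "w = (\<lambda>i. int (nat (w j * u j)) * u i)" using of_int_eq_iff by blast
    then show "w \<in> ?M u" by blast
  next
    fix w assume "w \<in> ?M u"
    then obtain k where k: "w = (\<lambda>i. int k * u i)" by blast
    have "rvec w = (\<lambda>i. real k * rvec u i)" by (simp add: rvec_def k)
    moreover have "w \<in> int_lattice n" using u by (simp add: int_lattice_def k)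
    ultimately show "w \<in> {w \<in> int_lattice n. rvec w \<in> cone_hull {rvec u}}"
      unfolding mem_Collect_eq cone_hull_single by (intro conjI exI[of _ "real k"]) simp_all
  qed
  then show "u \<in> int_lattice n \<and> {w \<in> int_lattice n. rvec w \<in> cone_hull {rvec u}} = ?M u" using u by blast
  fix u' assume "u' \<in> int_lattice n \<and> {w \<in> int_lattice n. rvec w \<in> cone_hull {rvec u}} = ?M u'"
  then have MM: "?M u = ?M u'" using M by simp
  have "u \<in> ?M u" "u' \<in> ?M u'" by (auto intro: exI[of _ 1])
  then obtain k l where kl: "u = (\<lambda>i. int k * u' i)" "u' = (\<lambda>i. int l * u i)" using MM by blast
  have "u j = int k * (int l * u j)" using fun_cong[OF kl(1), of j] fun_cong[OF kl(2), of j] by simp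
  then have "int (k * l) = 1" using j by auto
  then have "k * l = 1" by (simp only: of_nat_eq_1_iff)
  then have "l = 1" by simp
  then show "u' = u" using kl(2) by simp
qed

subsection \<open>The fan\<close>

definition vvec :: "nat => var => nat => int" where
  "vvec n w = (case w of Yv i => e_vec {i} | Xv F => \<lambda>i. - e_vec ({1..n} - F) i)"

definition gcone :: "nat => var => (nat => real) set" where
  "gcone n w = cone_hull {rvec (vvec n w)}"

definition fan_vars :: "nat => nat => var set" where
  "fan_vars r n = {w. {w} \<in> aug_faces {1..n} r}"

lemma vvec_coord: "j \<in> {1..n} ==> vvec n (Yv i) j = (if j = i then 1 else 0)"
  "j \<in> {1..n} ==> vvec n (Xv F) j = (if j \<in> F then 0 else - 1)"
  by (simp_all add: vvec_def e_vec_def)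

lemma fan_vars_iff: "Yv i \<in> fan_vars r n \<longleftrightarrow> i \<in> {1..n} \<and> 1 \<le> r" "Xv F \<in> fan_vars r n \<longleftrightarrow> F \<in> FF {1..n} r"
proof -
  have "{j. Yv j \<in> {Yv i}} = {i}" by auto
  then show "Yv i \<in> fan_vars r n \<longleftrightarrow> i \<in> {1..n} \<and> 1 \<le> r" by (simp add: fan_vars_def aug_faces_iff)
  show "Xv F \<in> fan_vars r n \<longleftrightarrow> F \<in> FF {1..n} r" by (auto simp: fan_vars_def aug_faces_iff FF_def)
qed

lemma aug_faces_vars: "S \<in> aug_faces {1..n} r ==> S \<subseteq> fan_vars r n"
  unfolding fan_vars_def using aug_faces_subset[of "{1..n}" S r] by auto

lemma finite_fan_vars: "finite (fan_vars r n)"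
proof (rule finite_subset)
  show "fan_vars r n \<subseteq> Yv ` {1..n} \<union> Xv ` Pow {1..n}"
  proof
    fix w assume "w \<in> fan_vars r n"
    then show "w \<in> Yv ` {1..n} \<union> Xv ` Pow {1..n}" by (cases w) (auto simp: fan_vars_iff FF_def)
  qed
qed simp

lemma vvec_unit:
  assumes "w \<in> fan_vars r n" "r \<le> n"
  shows "vvec n w \<in> int_lattice n" "\<exists>j\<in>{1..n}. vvec n w j = 1 \<or> vvec n w j = - 1"
proof -
  show "vvec n w \<in> int_lattice n"
    using assms(1) by (cases w) (auto simp: fan_vars_iff int_lattice_def vvec_def e_vec_def)
  show "\<exists>j\<in>{1..n}. vvec n w j = 1 \<or> vvec n w j = - 1"
  proof (cases w)
    case (Yv i)
    then have "i \<in> {1..n}" using assms(1) by (simp add: fan_vars_iff)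
    then show ?thesis using Yv vvec_coord(1)[of i n i] by (intro bexI[of _ i]) auto
  next
    case (Xv F)
    then have F: "F \<subseteq> {1..n}" "card F + 1 \<le> r" using assms(1) by (auto simp: fan_vars_iff FF_def)
    have "F \<noteq> {1..n}" using F(2) assms(2) by auto
    then obtain j where "j \<in> {1..n}" "j \<notin> F" using F(1) by blast
    then show ?thesis using Xv vvec_coord(2)[of j n F] by (intro bexI[of _ j]) auto
  qed
qed

lemma aug_cone_eq:
  assumes "finite I" "finite \<F>"
  shows "aug_cone n I \<F> = cone_hull ((\<lambda>w. rvec (vvec n w)) ` (Yv ` I \<union> Xv ` \<F>))"
proof -
  have "elem_vec ` I = (\<lambda>w. rvec (vvec n w)) ` Yv ` I" by (simp add: image_image elem_vec_def vvec_def)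
  moreover have "flat_vec n ` \<F> = (\<lambda>w. rvec (vvec n w)) ` Xv ` \<F>" by (simp add: image_image flat_vec_def vvec_def)
  moreover have "minkowski_sum (cone_hull ((\<lambda>w. rvec (vvec n w)) ` Yv ` I)) (cone_hull ((\<lambda>w. rvec (vvec n w)) ` Xv ` \<F>))
      = cone_hull ((\<lambda>w. rvec (vvec n w)) ` (Yv ` I \<union> Xv ` \<F>))"
    by (rule minkowski_cone_hull) (use assms in auto)
  ultimately show ?thesis by (simp only: aug_cone_def)
qed

lemma aug_bergman_fan_eq:
  "aug_bergman_fan r n = (\<lambda>S. cone_hull ((\<lambda>w. rvec (vvec n w)) ` S)) ` aug_faces {1..n} r"
proof (intro set_eqI iffI)
  fix \<sigma> assume "\<sigma> \<in> aug_bergman_fan r n"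
  then obtain I \<F> where s: "\<sigma> = aug_cone n I \<F>" "unif_indep r n I" "\<forall>F\<in>\<F>. unif_proper_flat r n F" "chain\<^sub>\<subseteq> \<F>" "\<forall>F\<in>\<F>. I \<subseteq> F"
    unfolding aug_bergman_fan_def by blast
  have fin: "finite I" "finite \<F>"
  proof -
    show "finite I" using s(2) by (auto simp: unif_indep_def intro: finite_subset)
    show "finite \<F>" by (rule finite_subset[of _ "Pow {1..n}"]) (use s(3) in \<open>auto simp: unif_proper_flat_def\<close>)
  qed
  have "Yv ` I \<union> Xv ` \<F> \<in> aug_faces {1..n} r" unfolding aug_faces_def
    using s(2-5) by (intro CollectI exI[of _ I] exI[of _ \<F>]) (simp add: unif_indep_def unif_proper_flat_def chain_subset_def)
  then show "\<sigma> \<in> (\<lambda>S. cone_hull ((\<lambda>w. rvec (vvec n w)) ` S)) ` aug_faces {1..n} r"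
    using aug_cone_eq[OF fin] s(1) by (intro image_eqI[of _ _ "Yv ` I \<union> Xv ` \<F>"]) simp_all
next
  fix \<sigma> assume "\<sigma> \<in> (\<lambda>S. cone_hull ((\<lambda>w. rvec (vvec n w)) ` S)) ` aug_faces {1..n} r"
  then obtain S where S: "\<sigma> = cone_hull ((\<lambda>w. rvec (vvec n w)) ` S)" "S \<in> aug_faces {1..n} r" by blast
  obtain I \<F> where IF: "S = Yv ` I \<union> Xv ` \<F>" "I \<subseteq> {1..n}" "card I \<le> r"
     "\<forall>F\<in>\<F>. F \<subseteq> {1..n} \<and> card F + 1 \<le> r \<and> I \<subseteq> F" "\<forall>A\<in>\<F>. \<forall>B\<in>\<F>. A \<subseteq> B \<or> B \<subseteq> A"
    using S(2) unfolding aug_faces_def mem_Collect_eq by (elim exE conjE) (rule that; assumption)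
  have fin: "finite I" "finite \<F>"
  proof -
    show "finite I" using IF(2) by (rule finite_subset) simp
    show "finite \<F>" by (rule finite_subset[of _ "Pow {1..n}"]) (use IF(4) in auto)
  qed
  show "\<sigma> \<in> aug_bergman_fan r n" unfolding aug_bergman_fan_def S(1) IF(1) aug_cone_eq[OF fin, symmetric]
    using IF(2-5) by (intro CollectI exI[of _ I] exI[of _ \<F>]) (simp add: unif_indep_def unif_proper_flat_def chain_subset_def)
qed

text \<open>
  Write the generator \<open>u\<close> of the ray as a nonnegative combination. A positive
  coordinate \<open>i\<close> can come only from \<open>e\<^sub>i\<close>. If \<open>u\<close>
  belongs to a flat \<open>G\<close>, all flats with positive coefficient contain
  \<open>G\<close>, since the coordinates in \<open>G\<close> vanish; and the smallest of them
  lies in \<open>G\<close>, since the other coordinates do not vanish.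
\<close>

lemma ray_in_cone:
  assumes w: "w \<in> fan_vars r n" and rn: "r \<le> n" and S: "S \<in> aug_faces {1..n} r"
    and wS: "rvec (vvec n w) \<in> cone_hull ((\<lambda>w. rvec (vvec n w)) ` S)"
  shows "w \<in> S"
proof -
  obtain I \<F> where IF: "S = Yv ` I \<union> Xv ` \<F>" "I \<subseteq> {1..n}"
     "\<forall>F\<in>\<F>. F \<subseteq> {1..n} \<and> card F + 1 \<le> r \<and> I \<subseteq> F" "\<forall>A\<in>\<F>. \<forall>B\<in>\<F>. A \<subseteq> B \<or> B \<subseteq> A"
    using S unfolding aug_faces_def mem_Collect_eq by (elim exE conjE) (rule that; assumption)
  have fin: "finite I" "finite \<F>"
  proof -
    show "finite I" using IF(2) by (rule finite_subset) simp
    show "finite \<F>" by (rule finite_subset[of _ "Pow {1..n}"]) (use IF(3) in auto)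
  qed
  have finS: "finite S" using fin by (simp add: IF(1))
  obtain a where a: "\<forall>s\<in>S. 0 \<le> a s" "rvec (vvec n w) = (\<lambda>i. \<Sum>s\<in>S. a s * rvec (vvec n s) i)"
    using wS unfolding cone_hull_image[OF finS] by blast
  have aX: "0 \<le> a (Xv F)" if "F \<in> \<F>" for F using a(1) that by (simp add: IF(1))
  have coord: "real_of_int (vvec n w j) = (if j \<in> I then a (Yv j) else 0) - (\<Sum>F\<in>\<F>. if j \<in> F then 0 else a (Xv F))"
    if j: "j \<in> {1..n}" for j
  proof -
    have "real_of_int (vvec n w j) = (\<Sum>s\<in>Yv ` I \<union> Xv ` \<F>. a s * rvec (vvec n s) j)"
      using fun_cong[OF a(2), of j] by (simp add: rvec_def IF(1))
    also have "\<dots> = (\<Sum>s\<in>Yv ` I. a s * rvec (vvec n s) j) + (\<Sum>s\<in>Xv ` \<F>. a s * rvec (vvec n s) j)"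
      using fin by (intro sum.union_disjoint) auto
    also have "(\<Sum>s\<in>Yv ` I. a s * rvec (vvec n s) j) = (\<Sum>i\<in>I. if i = j then a (Yv j) else 0)"
      by (subst sum.reindex) (auto simp: inj_on_def rvec_def vvec_coord[OF j] intro!: sum.cong)
    also have "\<dots> = (if j \<in> I then a (Yv j) else 0)" using fin by simp
    also have "(\<Sum>s\<in>Xv ` \<F>. a s * rvec (vvec n s) j) = - (\<Sum>F\<in>\<F>. if j \<in> F then 0 else a (Xv F))"
      unfolding sum_negf[symmetric]
      by (subst sum.reindex) (auto simp: inj_on_def rvec_def vvec_coord[OF j] intro!: sum.cong)
    finally show ?thesis by simp
  qed
  show ?thesis
  proof (cases w)
    case (Yv i)
    then have i: "i \<in> {1..n}" using w by (simp add: fan_vars_iff)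
    have "0 \<le> (\<Sum>F\<in>\<F>. if i \<in> F then 0 else a (Xv F))" using aX by (intro sum_nonneg) auto
    then have "i \<in> I" using coord[OF i] Yv vvec_coord(1)[OF i, of i] by (auto split: if_splits)
    then show ?thesis using Yv IF(1) by simp
  next
    case (Xv G)
    then have G: "G \<subseteq> {1..n}" "card G + 1 \<le> r" using w by (auto simp: fan_vars_iff FF_def)
    let ?P = "{F \<in> \<F>. 0 < a (Xv F)}"
    have up: "G \<subseteq> F" if F: "F \<in> ?P" for F
    proof
      fix j assume jG: "j \<in> G"
      then have j: "j \<in> {1..n}" using G by auto
      show "j \<in> F"
      proof (rule ccontr)
        assume n: "j \<notin> F"
        then have "j \<notin> I" using IF(3) F by auto
        have "a (Xv F) \<le> (\<Sum>F\<in>\<F>. if j \<in> F then 0 else a (Xv F))"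
          using member_le_sum[of F \<F> "\<lambda>F. if j \<in> F then 0 else a (Xv F)"] F n fin aX by auto
        then show False using coord[OF j] \<open>j \<notin> I\<close> vvec_coord(2)[OF j, of G] jG F Xv by auto
      qed
    qed
    have neg: "?P \<inter> {F. j \<notin> F} \<noteq> {}" if j: "j \<in> {1..n}" "j \<notin> G" for j
    proof
      assume e: "?P \<inter> {F. j \<notin> F} = {}"
      have "(if j \<in> F then 0 else a (Xv F)) = 0" if "F \<in> \<F>" for F
      proof (cases "j \<in> F")
        case False
        then have "\<not> 0 < a (Xv F)" using e that by blast
        then show ?thesis using aX[OF that] by simp
      qed simp
      then have "(\<Sum>F\<in>\<F>. if j \<in> F then 0 else a (Xv F)) = 0" by (rule sum.neutral[OF ballI])
      moreover have "0 \<le> (if j \<in> I then a (Yv j) else 0)" using a(1) IF(1) by auto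
      ultimately show False using coord[OF j(1)] vvec_coord(2)[OF j(1), of G] j(2) Xv by simp
    qed
    have "G \<noteq> {1..n}" using G(2) rn by auto
    then obtain j0 where "j0 \<in> {1..n}" "j0 \<notin> G" using G(1) by blast
    then have "?P \<noteq> {}" using neg by blast
    then obtain F0 where F0: "F0 \<in> ?P" "\<forall>F\<in>?P. \<not> F \<subset> F0" using finite_has_minimal[of ?P] fin by auto
    have min: "F0 \<subseteq> F" if "F \<in> ?P" for F
    proof -
      have "F0 \<subseteq> F \<or> F \<subseteq> F0" using IF(4) F0(1) that by simp
      then show ?thesis using F0(2) that by blast
    qed
    have "F0 \<subseteq> G"
    proof
      fix j assume j: "j \<in> F0"
      have "F0 \<subseteq> {1..n}" using IF(3) F0(1) by simp
      then have jn: "j \<in> {1..n}" using j by blast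
      show "j \<in> G"
      proof (rule ccontr)
        assume "j \<notin> G"
        then obtain F where "F \<in> ?P" "j \<notin> F" using neg[OF jn] by blast
        then show False using min j by blast
      qed
    qed
    then have "G = F0" using up[OF F0(1)] by blast
    then show ?thesis using F0(1) Xv IF(1) by simp
  qed
qed

text \<open>
  By \<open>ray_in_cone\<close> a cone of the fan determines its generators, so a set of rays
  that spans a cone is a face.
\<close>

lemma fan_transfer_aug:
  assumes rn: "r \<le> n"
  shows "fan_transfer n (aug_bergman_fan r n) (fan_vars r n) (gcone n) (aug_faces {1..n} r) ct"
proof
  let ?f = "\<lambda>w. rvec (vvec n w)" and ?\<Sigma> = "aug_bergman_fan r n"
  have nz: "rvec (vvec n w) \<noteq> (\<lambda>_. 0)" if wV: "w \<in> fan_vars r n" for w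
  proof -
    obtain j where "vvec n w j = 1 \<or> vvec n w j = - 1" using vvec_unit(2)[OF wV rn] by blast
    then have "rvec (vvec n w) j \<noteq> 0" by (auto simp: rvec_def)
    then show ?thesis by metis
  qed
  have single: "{w} \<in> aug_faces {1..n} r" if "w \<in> fan_vars r n" for w using that by (simp add: fan_vars_def)
  have gs: "gcone n w = cone_hull (?f ` {w})" for w by (simp add: gcone_def)
  show "finite (fan_vars r n)" by (rule finite_fan_vars)
  show "inj_on (gcone n) (fan_vars r n)"
  proof (rule inj_onI)
    fix w w' assume a: "w \<in> fan_vars r n" "w' \<in> fan_vars r n" "gcone n w = gcone n w'"
    have "?f w \<in> cone_hull (?f ` {w'})" using a(3) cone_hull_generator[of "?f w" "{?f w}"] by (simp add: gcone_def)
    then have "w \<in> {w'}" by (rule ray_in_cone[OF a(1) rn single[OF a(2)]])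
    then show "w = w'" by simp
  qed
  show "fan_rays n ?\<Sigma> = gcone n ` fan_vars r n"
  proof (intro set_eqI iffI)
    fix \<rho> assume "\<rho> \<in> fan_rays n ?\<Sigma>"
    then obtain u where u: "\<rho> \<in> ?\<Sigma>" "u \<noteq> (\<lambda>_. 0)" "\<rho> = cone_hull {rvec u}" by (auto simp: fan_rays_def)
    obtain S where S: "S \<in> aug_faces {1..n} r" "\<rho> = cone_hull (?f ` S)" using u(1) by (auto simp: aug_bergman_fan_eq)
    have "S \<noteq> {}"
    proof
      assume "S = {}"
      then have "rvec u \<in> {\<lambda>_. 0}" using u(3) S(2) cone_hull_generator[of "rvec u" "{rvec u}"] by (simp add: cone_hull_empty)
      then have "u = (\<lambda>_. 0)" by (auto simp: rvec_def fun_eq_iff)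
      then show False using u(2) by simp
    qed
    then obtain w where w: "w \<in> S" by blast
    have wV: "w \<in> fan_vars r n" using aug_faces_vars[OF S(1)] w by blast
    have "?f w \<in> cone_hull {rvec u}" using u(3) S(2) cone_hull_generator[of "?f w" "?f ` S"] w by auto
    then obtain a where a: "a \<ge> 0" "?f w = (\<lambda>i. a * rvec u i)" unfolding cone_hull_single by blast
    have "a \<noteq> 0" using nz[OF wV] a(2) by auto
    then have "gcone n w = \<rho>" unfolding gcone_def u(3) using a by (intro cone_hull_scale) auto
    then show "\<rho> \<in> gcone n ` fan_vars r n" using wV by blast
  next
    fix \<rho> assume "\<rho> \<in> gcone n ` fan_vars r n"
    then obtain w where w: "w \<in> fan_vars r n" "\<rho> = gcone n w" by blast
    have "\<rho> \<in> ?\<Sigma>" unfolding aug_bergman_fan_eq w(2) gs using single[OF w(1)] by (rule image_eqI[OF refl])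
    moreover have "vvec n w \<noteq> (\<lambda>_. 0)"
    proof
      assume "vvec n w = (\<lambda>_. 0)"
      then show False using nz[OF w(1)] by (simp add: rvec_def)
    qed
    ultimately show "\<rho> \<in> fan_rays n ?\<Sigma>" unfolding fan_rays_def
      using vvec_unit(1)[OF w(1) rn] w(2) gcone_def by blast
  qed
  show "ct j w = of_int (prim_gen n (gcone n w) j)" if w: "w \<in> fan_vars r n" and j: "j \<in> {1..n}" for w j
  proof -
    have "prim_gen n (gcone n w) = vvec n w"
      using vvec_unit[OF w rn] prim_gen_unit unfolding gcone_def by blast
    then show ?thesis using j by (cases w) (auto simp: vvec_coord)
  qed
  show "T \<in> aug_faces {1..n} r" if "S \<in> aug_faces {1..n} r" "T \<subseteq> S" for S T
    by (rule aug_faces_subset[OF _ that]) simp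
  show "S \<in> aug_faces {1..n} r \<longleftrightarrow> S \<subseteq> fan_vars r n \<and> cone_hull (\<Union>(gcone n ` S)) \<in> ?\<Sigma>" for S
  proof
    have rays: "cone_hull (\<Union>(gcone n ` S)) = cone_hull (?f ` S)" if "S \<subseteq> fan_vars r n"
    proof -
      have "finite S" using that finite_fan_vars by (rule finite_subset)
      from cone_hull_rays[OF this, of ?f] show ?thesis by (simp add: gcone_def[abs_def])
    qed
    show "S \<subseteq> fan_vars r n \<and> cone_hull (\<Union>(gcone n ` S)) \<in> ?\<Sigma>" if S: "S \<in> aug_faces {1..n} r"
      using rays[OF aug_faces_vars[OF S]] aug_faces_vars[OF S] S by (auto simp: aug_bergman_fan_eq)
    assume a: "S \<subseteq> fan_vars r n \<and> cone_hull (\<Union>(gcone n ` S)) \<in> ?\<Sigma>"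
    then obtain S' where S': "S' \<in> aug_faces {1..n} r" "cone_hull (?f ` S) = cone_hull (?f ` S')"
      using rays by (auto simp: aug_bergman_fan_eq)
    have "w \<in> S'" if w: "w \<in> S" for w
    proof (rule ray_in_cone[OF _ rn S'(1)])
      show "w \<in> fan_vars r n" using a w by blast
      show "?f w \<in> cone_hull (?f ` S')" using cone_hull_generator[of "?f w" "?f ` S"] w S'(2) by auto
    qed
    then show "S \<in> aug_faces {1..n} r" using aug_faces_subset[OF _ S'(1), of S] by auto
  qed
qed

subsection \<open>The basis elements\<close>

text \<open>
  The elements of the theorem, indexed as in \<open>aug_index\<close>; the index \<open>Inr ({},
  {})\<close> gives \<open>1\<close>.
\<close>

definition basis_el :: "nat => (nat set list \<times> nat set) + (nat set \<times> nat set) => koszul" where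
  "basis_el n i = (case i of
     Inl (Fs, U) => tensor (x_var n (hd Fs) * x_flag n Fs) (if U = {} then koszul_one else wedge_of n Fs U)
   | Inr (B, J) => tensor (\<Prod>j\<in>B. y_var j) (ell_set J))"

lemma var_gcone: "y_var i = ray_var (gcone n (Yv i))" "x_var n F = ray_var (gcone n (Xv F))"
  by (simp_all add: y_var_def x_var_def gcone_def elem_vec_def flat_vec_def vvec_def)

lemma prod_y_var: "finite B ==> (\<Prod>j\<in>B. y_var j) = Poly_Mapping.single (img (gcone n) (mset_set (Yv ` B))) 1"
proof (induction B rule: finite_induct)
  case (insert b B)
  have "Yv b \<notin> Yv ` B" using insert.hyps(2) by auto
  then have "mset_set (Yv ` insert b B) = add_mset (Yv b) (mset_set (Yv ` B))" using insert.hyps(1) by simp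
  then show ?case using insert by (simp add: var_gcone(1)[of b n] ray_var_def mult_single img_add)
qed simp

lemma prod_x_flag:
  assumes "Fs \<noteq> []"
  shows "x_var n (hd Fs) * x_flag n Fs = Poly_Mapping.single (img (gcone n) (mset (map Xv Fs))) 1"
proof -
  obtain H r where Fs: "Fs = H # r" using assms by (cases Fs) auto
  have "x_flag n Fs = (\<Prod>k<length r. x_var n (r ! k))"
    unfolding x_flag_def Fs by (simp add: prod.atLeast1_atMost_eq)
  also have "\<dots> = prod_list (map (x_var n) r)"
    by (simp add: prod.list_conv_set_nth atLeast0LessThan)
  also have "\<dots> = Poly_Mapping.single (img (gcone n) (mset (map Xv r))) 1"
    by (induction r) (simp_all add: var_gcone(2) ray_var_def mult_single img_add)
  finally show ?thesis by (simp add: Fs var_gcone(2) ray_var_def mult_single img_add)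
qed

lemma ir_nth:
  "ir Gs \<longleftrightarrow> (\<forall>j. Suc (Suc j) < length Gs -->
    covers (Gs ! Suc j) (Gs ! j) --> Gs ! Suc j - Gs ! j = {Max (Gs ! Suc (Suc j) - Gs ! j)})"
proof (induction Gs rule: ir.induct)
  case (1 A B C r)
  let ?Q = "\<lambda>j. covers ((A # B # C # r) ! Suc j) ((A # B # C # r) ! j) -->
    (A # B # C # r) ! Suc j - (A # B # C # r) ! j = {Max ((A # B # C # r) ! Suc (Suc j) - (A # B # C # r) ! j)}"
  have "(\<forall>j. Suc (Suc j) < length (A # B # C # r) --> ?Q j)
      \<longleftrightarrow> ?Q 0 \<and> (\<forall>j. Suc (Suc (Suc j)) < length (A # B # C # r) --> ?Q (Suc j))"
    (is "?L \<longleftrightarrow> ?R")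
  proof
    assume L: ?L
    have "?Q 0" using spec[OF L, of 0] by simp
    moreover have "\<forall>j. Suc (Suc (Suc j)) < length (A # B # C # r) --> ?Q (Suc j)"
      by (rule allI) (rule spec[OF L])
    ultimately show ?R by (rule conjI)
  next
    assume R: ?R
    show ?L
    proof (intro allI)
      fix j show "Suc (Suc j) < length (A # B # C # r) --> ?Q j" using R by (cases j) blast+
    qed
  qed
  then show ?case using 1 by simp
qed simp_all

lemma flag_from_iff:
  assumes "F \<in> FF {1..n} r" shows "flag_from r n F Fs \<longleftrightarrow> Fs \<in> fc F {1..n} (r - 1)"
proof
  have r: "1 \<le> r" using assms by (simp add: FF_def)
  show "Fs \<in> fc F {1..n} (r - 1)" if f: "flag_from r n F Fs"
  proof -
    have "unif_proper_flat r n (last Fs)" using f by (simp add: flag_from_def)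
    then have "last Fs \<subseteq> {1..n}" "card (last Fs) \<le> r - 1" by (auto simp: unif_proper_flat_def)
    then show ?thesis using f by (simp add: flag_from_def fc_def)
  qed
  assume f: "Fs \<in> fc F {1..n} (r - 1)"
  have "unif_proper_flat r n G" if G: "G \<in> set Fs" for G
  proof -
    have "G \<subseteq> last Fs" using sorted_hd_last(2)[of Fs G] f G by (simp add: fc_def)
    moreover have "finite (last Fs)" using f by (auto simp: fc_def intro: finite_subset)
    ultimately have "G \<subseteq> {1..n}" "card G \<le> card (last Fs)" using f card_mono by (auto simp: fc_def)
    then show ?thesis using f r by (auto simp: fc_def unif_proper_flat_def)
  qed
  then show "flag_from r n F Fs" using f by (simp add: flag_from_def fc_def)
qed

lemma all_positive_iff: "(\<forall>k. 1 \<le> k \<and> P k --> Q k) \<longleftrightarrow> (\<forall>j. P (Suc j) --> Q (Suc j))"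
proof
  assume R: "\<forall>j. P (Suc j) --> Q (Suc j)"
  show "\<forall>k. 1 \<le> k \<and> P k --> Q k"
  proof (intro allI impI)
    fix k :: nat assume "1 \<le> k \<and> P k"
    then show "Q k" using R by (cases k) auto
  qed
qed simp

lemma retral_iff: "Fs \<noteq> [] ==> retral n Fs \<longleftrightarrow> ir (Fs @ [{1..n}])"
proof -
  assume ne: "Fs \<noteq> []"
  let ?G = "Fs @ [{1..n}]"
  let ?Q = "\<lambda>j. covers (?G ! Suc j) (?G ! j) --> ?G ! Suc j - ?G ! j = {Max (?G ! Suc (Suc j) - ?G ! j)}"
  have at: "retral_at n Fs (Suc j) \<longleftrightarrow> ?Q j" for j by (simp add: retral_at_def Let_def)
  have len: "Suc j \<le> length Fs - 1 \<longleftrightarrow> Suc (Suc j) < length ?G" for j using ne by (cases Fs) auto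
  have "retral n Fs \<longleftrightarrow> (\<forall>j. Suc j \<le> length Fs - 1 --> retral_at n Fs (Suc j))"
    unfolding retral_def by (rule all_positive_iff)
  then show ?thesis unfolding ir_nth at len .
qed

lemma weakly_retral_iff:
  assumes "1 \<le> r" "Fs \<noteq> []"
  shows "weakly_retral r n Fs \<longleftrightarrow> last Fs \<subseteq> {1..n} \<and> card (last Fs) = r - 1 \<and> ir Fs"
proof -
  let ?Q = "\<lambda>j. covers (Fs ! Suc j) (Fs ! j) --> Fs ! Suc j - Fs ! j = {Max (Fs ! Suc (Suc j) - Fs ! j)}"
  have at: "retral_at n Fs (Suc j) \<longleftrightarrow> ?Q j" if "Suc (Suc j) < length Fs" for j
    using that by (simp add: retral_at_def Let_def nth_append)
  have len: "Suc j < length Fs - 1 \<longleftrightarrow> Suc (Suc j) < length Fs" for j by auto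
  have "(\<forall>k. 1 \<le> k \<and> k < length Fs - 1 --> retral_at n Fs k) \<longleftrightarrow> (\<forall>j. Suc j < length Fs - 1 --> retral_at n Fs (Suc j))"
    by (rule all_positive_iff)
  also have "\<dots> \<longleftrightarrow> (\<forall>j. Suc (Suc j) < length Fs --> ?Q j)" unfolding len using at by blast
  finally have "(\<forall>k. 1 \<le> k \<and> k < length Fs - 1 --> retral_at n Fs k) \<longleftrightarrow> ir Fs" unfolding ir_nth .
  then show ?thesis using assms(1) by (auto simp: weakly_retral_def unif_hyperplane_def)
qed

lemma admissible_set_iff:
  assumes "Fs \<noteq> []"
  shows "admissible_set n Fs U \<longleftrightarrow> U \<noteq> {} \<and> U \<subseteq> {1..n} - last Fs \<and> (\<forall>u\<in>U. \<exists>w\<in>{1..n} - last Fs. u < w) \<and> lc_ok Fs U"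
proof -
  have 1: "1 \<le> length Fs - 1 \<longleftrightarrow> 2 \<le> length Fs" by auto
  have 2: "Fs ! (length Fs - 1) = last Fs" using assms by (simp add: last_conv_nth)
  have 3: "Fs ! (length Fs - 1 - 1) = last (butlast Fs)" if "2 \<le> length Fs"
  proof -
    have "butlast Fs \<noteq> []" using that by (cases Fs; cases "tl Fs") auto
    then have "last (butlast Fs) = butlast Fs ! (length Fs - 1 - 1)" by (simp add: last_conv_nth)
    also have "\<dots> = Fs ! (length Fs - 1 - 1)" by (rule nth_butlast) (use that in simp)
    finally show ?thesis by simp
  qed
  show ?thesis unfolding admissible_set_def lc_ok_def Let_def 1 2 using 3 by auto
qed

lemma B_flat_eq:
  assumes F: "F \<in> FF {1..n} r"
  shows "B_flat r n F = (\<lambda>i. basis_el n (Inl i)) ` BI {1..n} (r - 1) F"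
proof -
  have r: "1 \<le> r" using F by (simp add: FF_def)
  have Fc: "Fs \<noteq> []" "hd Fs = F" "last Fs \<subseteq> {1..n}" if "Fs \<in> fc F {1..n} (r - 1)" for Fs
    using that by (auto simp: fc_def)
  show ?thesis
  proof (intro set_eqI iffI)
    fix x assume "x \<in> B_flat r n F"
    then consider (ret) Fs where "x = tensor (x_var n F * x_flag n Fs) koszul_one" "flag_from r n F Fs" "retral n Fs"
      | (weak) Fs U where "x = tensor (x_var n F * x_flag n Fs) (wedge_of n Fs U)" "flag_from r n F Fs"
          "weakly_retral r n Fs" "admissible_set n Fs U"
      unfolding B_flat_def admissible_wedges_def by blast
    then show "x \<in> (\<lambda>i. basis_el n (Inl i)) ` BI {1..n} (r - 1) F"
    proof cases
      case ret
      have fc: "Fs \<in> fc F {1..n} (r - 1)" using ret(2) flag_from_iff[OF F] by simp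
      have "(Fs, {}) \<in> BI {1..n} (r - 1) F" using fc ret(3) retral_iff[OF Fc(1)[OF fc]] by (simp add: BI_def)
      then show ?thesis using ret(1) Fc(2)[OF fc] by (intro image_eqI[of _ _ "(Fs, {})"]) (simp_all add: basis_el_def)
    next
      case weak
      have fc: "Fs \<in> fc F {1..n} (r - 1)" using weak(2) flag_from_iff[OF F] by simp
      have adm: "U \<noteq> {} \<and> U \<subseteq> {1..n} - last Fs \<and> (\<forall>u\<in>U. \<exists>w\<in>{1..n} - last Fs. u < w) \<and> lc_ok Fs U"
        using weak(4) admissible_set_iff[OF Fc(1)[OF fc]] by metis
      have wr: "card (last Fs) = r - 1 \<and> ir Fs" using weak(3) weakly_retral_iff[OF r Fc(1)[OF fc]] by metis
      have "(Fs, U) \<in> BI {1..n} (r - 1) F" unfolding BI_def using fc adm wr by simp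
      then show ?thesis using weak(1) Fc(2)[OF fc] adm by (intro image_eqI[of _ _ "(Fs, U)"]) (simp_all add: basis_el_def)
    qed
  next
    fix x assume "x \<in> (\<lambda>i. basis_el n (Inl i)) ` BI {1..n} (r - 1) F"
    then obtain Fs U where x: "x = basis_el n (Inl (Fs, U))" "(Fs, U) \<in> BI {1..n} (r - 1) F" by auto
    then have fc: "Fs \<in> fc F {1..n} (r - 1)" by (simp add: BI_def)
    have ff: "flag_from r n F Fs" using fc flag_from_iff[OF F] by simp
    show "x \<in> B_flat r n F"
    proof (cases "U = {}")
      case True
      then have "retral n Fs" using x(2) retral_iff[OF Fc(1)[OF fc]] by (simp add: BI_def)
      then show ?thesis unfolding B_flat_def using x(1) True ff Fc(2)[OF fc] by (auto simp: basis_el_def)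
    next
      case False
      have wr: "weakly_retral r n Fs" using x(2) False weakly_retral_iff[OF r Fc(1)[OF fc]] Fc(3)[OF fc] by (simp add: BI_def)
      have adm: "admissible_set n Fs U" using x(2) False admissible_set_iff[OF Fc(1)[OF fc]] by (simp add: BI_def)
      have "x = tensor (x_var n F * x_flag n Fs) (wedge_of n Fs U)" using x(1) False Fc(2)[OF fc] by (simp add: basis_el_def)
      then show ?thesis unfolding B_flat_def admissible_wedges_def using ff wr adm by blast
    qed
  qed
qed

lemma B_IN_eq: "B_IN r n = (\<lambda>i. basis_el n (Inr i)) ` (SK {1..n} r - {({}, {})})"
proof (intro set_eqI iffI)
  fix x assume "x \<in> B_IN r n"
  then obtain B J where x: "x = tensor (\<Prod>j\<in>B. y_var j) (ell_set J)" "unif_basis r n B" "J \<subseteq> {1..n}" "J \<noteq> {}"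
      "J \<inter> B = {}" "r = 0 \<or> Min J < Min B" unfolding B_IN_def mem_Collect_eq by (elim exE conjE) (rule that; assumption)
  have "J \<subseteq> {1..n} - B" using x(3,5) by blast
  then have "(B, J) \<in> SK {1..n} r - {({}, {})}" using x(2,4,6) by (simp add: SK_def unif_basis_def)
  then show "x \<in> (\<lambda>i. basis_el n (Inr i)) ` (SK {1..n} r - {({}, {})})"
    by (intro image_eqI[of _ _ "(B, J)"]) (simp_all add: basis_el_def x(1))
next
  fix x assume "x \<in> (\<lambda>i. basis_el n (Inr i)) ` (SK {1..n} r - {({}, {})})"
  then obtain B J where x: "x = basis_el n (Inr (B, J))" "(B, J) \<in> SK {1..n} r" "(B, J) \<noteq> ({}, {})" by auto
  then have b: "B \<subseteq> {1..n}" "card B = r" "J \<subseteq> {1..n} - B" "J \<noteq> {}" "r = 0 \<or> Min J < Min B" by (auto simp: SK_def)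
  have "J \<subseteq> {1..n}" "J \<inter> B = {}" using b(3) by auto
  then show "x \<in> B_IN r n" unfolding B_IN_def using b x(1)
    by (intro CollectI exI[of _ B] exI[of _ J]) (simp add: basis_el_def unif_basis_def)
qed

lemma koszul_one_eq: "koszul_one = basis_el n (Inr ({}, {}))"
  by (simp add: basis_el_def ell_set_def wedge_list_def tensor_def)

lemma basis_el_transfer:
  assumes rn: "r \<le> n" and i: "i \<in> aug_index {1..n} r"
  shows "basis_el n i \<in> koszul_lift n (aug_bergman_fan r n)"
    and "fan_transfer.Psi (gcone n) (aug_faces {1..n} r) (basis_el n i) = aug_el {1..n} i"
proof -
  interpret fan_transfer n "aug_bergman_fan r n" "fan_vars r n" "gcone n" "aug_faces {1..n} r" ct
    by (rule fan_transfer_aug[OF rn])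
  have mon_lift: "Poly_Mapping.single (img (gcone n) \<alpha>) 1 \<in> poly_ring (fan_rays n (aug_bergman_fan r n))" if "\<alpha> \<in> X" for \<alpha>
    unfolding rays by (rule poly_ring_single) (use X_V[OF that] in \<open>auto simp: keys_img\<close>)
  have "basis_el n i \<in> koszul_lift n (aug_bergman_fan r n) \<and> Psi (basis_el n i) = aug_el {1..n} i"
  proof (cases i)
    case (Inl p)
    obtain Fs U where p: "p = (Fs, U)" by (cases p)
    obtain F where F: "F \<in> FF {1..n} r" "(Fs, U) \<in> BI {1..n} (r - 1) F" using i unfolding aug_index_def Inl p by auto
    have b: "Fs \<in> fc F {1..n} (r - 1)" "U \<subseteq> {1..n} - last Fs" "\<And>u. u \<in> U ==> \<exists>w\<in>{1..n} - last Fs. u < w"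
      using F(2) by (auto simp: BI_def)
    have fU: "finite U" using b(2) by (rule finite_subset) simp
    have ne: "Fs \<noteq> []" using b(1) by (auto simp: fc_def)
    have flag: "flag_from r n F Fs" using b(1) flag_from_iff[OF F(1)] by simp
    have "Xv ` set Fs \<in> aug_faces {1..n} r" unfolding aug_faces_def
    proof (intro CollectI exI[of _ "{} :: nat set"] exI[of _ "set Fs"] conjI ballI)
      fix A B assume AB: "A \<in> set Fs" "B \<in> set Fs"
      then obtain k l where "k < length Fs" "A = Fs ! k" "l < length Fs" "B = Fs ! l" by (auto simp: in_set_conv_nth)
      moreover have "sorted_wrt (\<subset>) Fs" using b(1) by (simp add: fc_def)
      ultimately show "A \<subseteq> B \<or> B \<subseteq> A"
        by (metis linorder_neqE_nat order_refl psubset_imp_subset sorted_wrt_nth_less)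
    qed (use flag in \<open>auto simp: flag_from_def unif_proper_flat_def\<close>)
    then have \<alpha>: "mset (map Xv Fs) \<in> X" by simp
    note pe = prod_x_flag[OF ne, of n]
    have w: "basis_el n i = tensor (Poly_Mapping.single (img (gcone n) (mset (map Xv Fs))) 1) (wedge_of n Fs U)"
      by (simp add: basis_el_def Inl p pe wedge_of_def wedge_list_def)
    have s: "succ_in ({1..n} - last Fs) u \<in> {1..n}" if "u \<in> U" for u
      using succ_in(1)[OF _ b(3)[OF that]] by simp
    have "wedge_of n Fs U \<in> koszul_lift n (aug_bergman_fan r n)" unfolding wedge_of_def
    proof (rule wedge_list_lift)
      fix m assume "m \<in> set (map (\<lambda>u J. ell u J - ell (succ_in ({1..n} - last Fs) u) J) (sorted_list_of_set U))"
      then obtain u where u: "u \<in> U" "m = (\<lambda>J. ell u J - ell (succ_in ({1..n} - last Fs) u) J)" using fU by auto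
      have "u \<in> {1..n}" using u(1) b(2) by auto
      then show "m \<in> koszul_lift n (aug_bergman_fan r n)" unfolding u(2)
        by (intro lift_diff ell_lift s[OF u(1)])
    qed
    then have 1: "basis_el n i \<in> koszul_lift n (aug_bergman_fan r n)" unfolding w by (rule tensor_lift[OF mon_lift[OF \<alpha>]])
    have "Psi (basis_el n i) = wlist (lf ({1..n} - last Fs)) U (mon (mset (map Xv Fs)))"
      unfolding w wedge_of_def
    proof (rule Psi_tensor_wedge[OF \<alpha> fU])
      fix u and \<eta> :: koszul assume u: "u \<in> U" and \<eta>: "\<And>J. infinite J ==> \<eta> J = 0"
      let ?p = "Poly_Mapping.single (img (gcone n) (mset (map Xv Fs))) 1"
      show "Psi (tensor ?p (koszul_mult (\<lambda>J. ell u J - ell (succ_in ({1..n} - last Fs) u) J) \<eta>))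
          = lf ({1..n} - last Fs) u (Psi (tensor ?p \<eta>))"
      proof -
        have "Psi (tensor ?p (koszul_mult (\<lambda>J. ell u J - ell (succ_in ({1..n} - last Fs) u) J) \<eta>))
            = eps u (Psi (tensor ?p \<eta>)) - eps (succ_in ({1..n} - last Fs) u) (Psi (tensor ?p \<eta>))"
          by (rule Psi_tensor_ell_diff) (rule \<eta>)
        then show ?thesis using b(3)[OF u] by (simp add: lf_def)
      qed
    qed
    also have "\<dots> = aug_el {1..n} i"
      using bel_wlist[OF _ b(1,2)] by (simp add: aug_el_def Inl p)
    finally show ?thesis using 1 by blast
  next
    case (Inr p)
    obtain B J where p: "p = (B, J)" by (cases p)
    have "(B, J) \<in> SK {1..n} r" using i unfolding aug_index_def Inr p by auto
    then have b: "B \<subseteq> {1..n}" "card B \<le> r" "J \<subseteq> {1..n}" by (auto simp: SK_def)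
    have fin: "finite B" "finite J" using b finite_subset by auto
    have "Yv ` B \<in> aug_faces {1..n} r" unfolding aug_faces_def
      using b by (intro CollectI exI[of _ B] exI[of _ "{}"]) simp
    then have \<alpha>: "mset_set (Yv ` B) \<in> X" using fin by simp
    have w: "basis_el n i = tensor (Poly_Mapping.single (img (gcone n) (mset_set (Yv ` B))) 1) (ell_set J)"
      by (simp add: basis_el_def Inr p prod_y_var[OF fin(1), of n])
    have "ell_set J \<in> koszul_lift n (aug_bergman_fan r n)" unfolding ell_set_def
    proof (rule wedge_list_lift)
      fix m assume "m \<in> set (map ell (sorted_list_of_set J))"
      then obtain u where u: "m = ell u" "u \<in> J" using fin(2) by auto
      show "m \<in> koszul_lift n (aug_bergman_fan r n)" unfolding u(1) by (rule ell_lift[OF subsetD[OF b(3) u(2)]])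
    qed
    then have 1: "basis_el n i \<in> koszul_lift n (aug_bergman_fan r n)" unfolding w by (rule tensor_lift[OF mon_lift[OF \<alpha>]])
    have "Psi (basis_el n i) = wlist eps J (mon (mset_set (Yv ` B)))"
      unfolding w ell_set_def by (rule Psi_tensor_wedge[OF \<alpha> fin(2)]) (rule Psi_tensor_ell)
    also have "\<dots> = aug_el {1..n} i" by (simp add: aug_el_def Inr p sk_el_def)
    finally show ?thesis using 1 by blast
  qed
  then show "basis_el n i \<in> koszul_lift n (aug_bergman_fan r n)" "Psi (basis_el n i) = aug_el {1..n} i" by blast+
qed

theorem theorem1p2:
  fixes r n :: nat
  assumes "r \<le> n"
  shows
    "(\<forall>F G. unif_proper_flat r n F \<and> unif_proper_flat r n G \<and> F \<noteq> G
        \<longrightarrow> B_flat r n F \<inter> B_flat r n G = {}) \<and>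
     {koszul_one} \<inter> (\<Union>F\<in>{F. unif_proper_flat r n F}. B_flat r n F) = {} \<and>
     {koszul_one} \<inter> B_IN r n = {} \<and>
     (\<Union>F\<in>{F. unif_proper_flat r n F}. B_flat r n F) \<inter> B_IN r n = {} \<and>
     homology_basis n (aug_bergman_fan r n)
       ({koszul_one} \<union> (\<Union>F\<in>{F. unif_proper_flat r n F}. B_flat r n F) \<union> B_IN r n)"
proof -
  interpret fan_transfer n "aug_bergman_fan r n" "fan_vars r n" "gcone n" "aug_faces {1..n} r" ct
    by (rule fan_transfer_aug[OF assms])
  let ?W = "{1..n}" and ?I = "aug_index {1..n} r" and ?F = "{F. unif_proper_flat r n F}"
  have FF: "?F = FF ?W r" by (auto simp: unif_proper_flat_def FF_def)
  have h: "hom_basis ct X ?W ?I (aug_el ?W)" by (rule hom_basis_augmented) (use assms in auto)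
  have lift: "basis_el n i \<in> koszul_lift n (aug_bergman_fan r n)" "Psi (basis_el n i) = aug_el ?W i" if "i \<in> ?I" for i
    using basis_el_transfer[OF assms that] by auto
  have basis: "homology_basis n (aug_bergman_fan r n) (basis_el n ` ?I)" and inj: "inj_on (basis_el n) ?I"
    using homology_basis_transfer[OF h lift] by auto
  let ?A = "\<lambda>F. Inl ` BI ?W (r - 1) F :: ((nat set list \<times> nat set) + (nat set \<times> nat set)) set"
  let ?O = "{Inr ({}, {})} :: ((nat set list \<times> nat set) + (nat set \<times> nat set)) set"
  let ?N = "Inr ` (SK ?W r - {({}, {})}) :: ((nat set list \<times> nat set) + (nat set \<times> nat set)) set"
  have sub: "(\<Union>F\<in>?F. ?A F) \<subseteq> ?I" "?O \<subseteq> ?I" "?N \<subseteq> ?I"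
    unfolding FF aug_index_def by (auto simp: SK_def)
  have flat: "B_flat r n F = basis_el n ` ?A F" if "F \<in> ?F" for F
    using B_flat_eq[of F n r] that unfolding FF by (simp add: image_image)
  have flats: "(\<Union>F\<in>?F. B_flat r n F) = basis_el n ` (\<Union>F\<in>?F. ?A F)"
    unfolding image_UN by (rule SUP_cong[OF refl flat])
  have one: "{koszul_one} = basis_el n ` ?O" using koszul_one_eq[of n] by simp
  have ind: "B_IN r n = basis_el n ` ?N" by (simp add: B_IN_eq image_image)
  have disj: "basis_el n ` S \<inter> basis_el n ` T = {}" if "S \<subseteq> ?I" "T \<subseteq> ?I" "S \<inter> T = {}" for S T
    using inj_on_image_Int[OF inj that(1,2)] that(3) by simp
  have "B_flat r n F \<inter> B_flat r n G = {}" if FG: "F \<in> ?F" "G \<in> ?F" "F \<noteq> G" for F G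
    unfolding flat[OF FG(1)] flat[OF FG(2)]
  proof (rule disj)
    show "?A F \<subseteq> ?I" "?A G \<subseteq> ?I" using sub(1) FG(1,2) by blast+
    have "hd (fst i) = F" if "i \<in> BI ?W (r - 1) F" for i F using that by (auto simp: BI_def fc_def)
    then show "?A F \<inter> ?A G = {}" using FG(3) by blast
  qed
  moreover have "{koszul_one} \<inter> (\<Union>F\<in>?F. B_flat r n F) = {}"
    unfolding one flats by (rule disj[OF sub(2,1)]) auto
  moreover have "{koszul_one} \<inter> B_IN r n = {}" unfolding one ind by (rule disj[OF sub(2,3)]) auto
  moreover have "(\<Union>F\<in>?F. B_flat r n F) \<inter> B_IN r n = {}" unfolding flats ind by (rule disj[OF sub(1,3)]) auto
  moreover have "{koszul_one} \<union> (\<Union>F\<in>?F. B_flat r n F) \<union> B_IN r n = basis_el n ` ?I"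
  proof -
    have "?O \<union> (\<Union>F\<in>?F. ?A F) \<union> ?N = ?I" unfolding FF aug_index_def by (auto simp: SK_def)
    then show ?thesis unfolding one flats ind image_Un[symmetric] by (simp only:)
  qed
  ultimately show ?thesis using basis by auto
qed

end
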